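(* Under the standing assumptions and with the notation of the context (in particular with $\epsilon$ as in assumption (iii)), the following hold. (i) The integral $$\mathcal T x:=\int_0^\infty B^*e^{A^*t}R^*R\Phi(t)x\,dt$$ defines a bounded linear operator from $\mathcal D(A^\epsilon)$ into $U$. (ii) The operator $B^*P$, formally defined by $B^*Px:=B^*\int_0^\infty e^{A^*t}R^*R\Phi(t)x\,dt$, coincides with $\mathcal T$ on $\mathcal D(A^\epsilon)$, and hence $B^*P\in\mathcal L(\mathcal D(A^\epsilon),U)$.
   Context: Standing assumptions. $Y,U,Z$ are separable complex Hilbert spaces. $A:\mathcal D(A)\subseteq Y\to Y$ is a closed linear operator generating a strongly continuous semigroup $e^{At}$ on $Y$ with $\|e^{At}\|_{\mathcal L(Y)}\le Me^{-\omega t}$ for all $t\ge0$ ($M\ge1$, $\omega>0$); then $A^{-1}\in\mathcal L(Y)$. $A^\alpha$ and ${A^*}^\alpha$ denote the fractional powers $(-A)^\alpha$, $(-A^* )^\alpha$. $[\mathcal D(A^\alpha)]'$ and $[\mathcal D({A^*}^\alpha)]'$ are the duals with respect to the pivot space $Y$; $e^{At}$ extends to $[\mathcal D(A^* )]'$. $B\in\mathcal L(U,[\mathcal D(A^* )]')$, equivalently $A^{-1}B\in\mathcal L(U,Y)$, and $B^*\in\mathcal L(\mathcal D(A^* ),U)$ is its adjoint. $R\in\mathcal L(Y,Z)$. One has $B^*e^{A^*t}x=F(t)x+G(t)x$ for $t\ge0$, $x\in\mathcal D(A^* )$, where $F(t):Y\to U$ and $G(t):\mathcal D(A^* )\to U$,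 $t>0$, are bounded linear operators such that: (i) there are $\gamma\in(0,1)$, $\eta,N>0$ with $\|F(t)\|_{\mathcal L(Y,U)}\le Nt^{-\gamma}e^{-\eta t}$ for all $t>0$; (ii) there is $T>0$ such that $G(\cdot)\in\mathcal L(Y,L^p(0,T;U))$ for all $p\in[1,\infty)$; (iii) there are $T>0$ and $\epsilon\in(0,1)$ such that: (a) $G(\cdot){A^*}^{-\epsilon}\in\mathcal L(Y,C([0,T];U))$, in particular $\sup_{t\in[0,T]}\|G(t){A^*}^{-\epsilon}\|_{\mathcal L(Y,U)}<\infty$; (b) $R^*R\in\mathcal L(\mathcal D(A^\epsilon),\mathcal D({A^*}^\epsilon))$; (c) there is $q\in(1,2)$ such that $B^*e^{A^*\cdot}{A^*}^\epsilon$, defined on $\mathcal D({A^*}^{1+\epsilon})$, has an extension belonging to $\mathcal L(Y,L^q(0,T;U))$. Control problem. $y(t;x,u)=e^{At}x+(Lu)(t)$ with $(Lu)(t)=\int_0^te^{A(t-s)}Bu(s)\,ds$, and $J(u)=\int_0^\infty(\|Ry(t;x,u)\|_Z^2+\|u(t)\|_U^2)dt$. For each $x\in Y$, $\hat u(\cdot;x)$ is the unique minimizer of $J$ over $L^2(0,\infty;U)$, $\Phi(t)x:=y(t;x,\hat u(\cdot;x))$ is the optimal state, and $P\in\mathcal L(Y)$ is $Px=\int_0^\infty e^{A^*t}R^*R\Phi(t)x\,dt$. Meaning of the operators. For $t>0$, $B^*e^{A^*t}$ has a bounded extension from $\mathcal D(A^* )$ to $\mathcal D({A^*}^\epsilon)$,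 namely $F(t)+G(t)=[e^{At}B]^*\in\mathcal L(\mathcal D({A^*}^\epsilon),U)$; this extension is used in the integral defining $\mathcal T$. For $x\in\mathcal D(A^\epsilon)$ one has $Px\in\mathcal D({A^*}^\epsilon)$, and $B^*Px$ is understood as the weak limit in $U$ of $[e^{As}B]^*Px$ as $s\to0^+$. *)

theory Defs
  imports "HOL-Analysis.Analysis"
begin

section \<open>Separable complex Hilbert spaces\<close>

text \<open>
  The inner product is linear in its first argument and conjugate linear in the second; norm and
  topology are those of the underlying real Hilbert space, and separability is second countability.
\<close>

class separable_complex_hilbert = real_inner + banach + second_countable_topology +
  fixes scaleC :: "complex \<Rightarrow> 'a \<Rightarrow> 'a"  (infixr "*\<^sub>C" 75)
    and cinner :: "'a \<Rightarrow> 'a \<Rightarrow> complex"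
  assumes scaleC_add_right: "c *\<^sub>C (x + y) = c *\<^sub>C x + c *\<^sub>C y"
    and scaleC_add_left: "(c + d) *\<^sub>C x = c *\<^sub>C x + d *\<^sub>C x"
    and scaleC_scaleC: "c *\<^sub>C (d *\<^sub>C x) = (c * d) *\<^sub>C x"
    and scaleR_scaleC: "r *\<^sub>R x = complex_of_real r *\<^sub>C x"
    and cinner_commute: "cinner x y = cnj (cinner y x)"
    and cinner_add_left: "cinner (x + y) z = cinner x z + cinner y z"
    and cinner_scaleC_left: "cinner (c *\<^sub>C x) y = c * cinner x y"
    and inner_cinner: "inner x y = Re (cinner x y)"

instantiation complex :: separable_complex_hilbert
begin

definition "scaleC (c::complex) (x::complex) = c * x"
definition "cinner (x::complex) (y::complex) = x * cnj y"

instance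
  by standard (auto simp: scaleC_complex_def cinner_complex_def algebra_simps scaleR_conv_of_real
      inner_complex_def)

end


section \<open>Operators between normed subspaces\<close>

definition csubspace_set :: "'a::separable_complex_hilbert set \<Rightarrow> bool" where
  "csubspace_set D \<longleftrightarrow>
     0 \<in> D \<and> (\<forall>x\<in>D. \<forall>y\<in>D. x + y \<in> D) \<and> (\<forall>c. \<forall>x\<in>D. c *\<^sub>C x \<in> D)"

definition clinear_on ::
  "'a::separable_complex_hilbert set \<Rightarrow> ('a \<Rightarrow> 'b::separable_complex_hilbert) \<Rightarrow> bool" where
  "clinear_on D f \<longleftrightarrow>
     (\<forall>x\<in>D. \<forall>y\<in>D. f (x + y) = f x + f y) \<and> (\<forall>c. \<forall>x\<in>D. f (c *\<^sub>C x) = c *\<^sub>C f x)"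

text \<open>
  The restriction of \<open>f\<close> to \<open>X\<close> belongs to \<open>\<L>(X, V)\<close>, where \<open>X\<close> and \<open>V\<close> are subspaces carrying
  the norms \<open>nX\<close> and \<open>nV\<close>.
\<close>

definition bounded_op ::
  "'a::separable_complex_hilbert set \<Rightarrow> ('a \<Rightarrow> real) \<Rightarrow>
   'b::separable_complex_hilbert set \<Rightarrow> ('b \<Rightarrow> real) \<Rightarrow> ('a \<Rightarrow> 'b) \<Rightarrow> bool" where
  "bounded_op X nX V nV f \<longleftrightarrow>
     (\<forall>x\<in>X. f x \<in> V) \<and> clinear_on X f \<and> (\<exists>K. \<forall>x\<in>X. nV (f x) \<le> K * nX x)"

definition graph_norm ::
  "('a::separable_complex_hilbert \<Rightarrow> 'b::separable_complex_hilbert) \<Rightarrow> 'a \<Rightarrow> real" where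
  "graph_norm T x = norm x + norm (T x)"

text \<open>An unbounded operator is a pair of a domain and a function relevant only on that domain.\<close>

definition closed_operator ::
  "'a::separable_complex_hilbert set \<Rightarrow> ('a \<Rightarrow> 'b::separable_complex_hilbert) \<Rightarrow> bool" where
  "closed_operator D T \<longleftrightarrow> csubspace_set D \<and> clinear_on D T \<and> closed {(x, T x) | x. x \<in> D}"

definition adj_dom ::
  "'a::separable_complex_hilbert set \<Rightarrow> ('a \<Rightarrow> 'b::separable_complex_hilbert) \<Rightarrow> 'b set" where
  "adj_dom D T = {y. \<exists>z. \<forall>x\<in>D. cinner (T x) y = cinner x z}"

definition adj ::
  "'a::separable_complex_hilbert set \<Rightarrow> ('a \<Rightarrow> 'b::separable_complex_hilbert) \<Rightarrow> 'b \<Rightarrow> 'a" where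
  "adj D T y = (THE z. \<forall>x\<in>D. cinner (T x) y = cinner x z)"

abbreviation bounded_adj ::
  "('a::separable_complex_hilbert \<Rightarrow> 'b::separable_complex_hilbert) \<Rightarrow> 'b \<Rightarrow> 'a" where
  "bounded_adj T \<equiv> adj UNIV T"

definition weak_tendsto ::
  "('i \<Rightarrow> 'a::separable_complex_hilbert) \<Rightarrow> 'a \<Rightarrow> 'i filter \<Rightarrow> bool" where
  "weak_tendsto f v Flt \<longleftrightarrow> (\<forall>w. ((\<lambda>s. cinner (f s) w) \<longlongrightarrow> cinner v w) Flt)"

definition weak_lim :: "'i filter \<Rightarrow> ('i \<Rightarrow> 'a::separable_complex_hilbert) \<Rightarrow> 'a" where
  "weak_lim Flt f = (THE v. weak_tendsto f v Flt)"


section \<open>Semigroups and fractional powers\<close>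

definition C0_semigroup :: "(real \<Rightarrow> 'y::separable_complex_hilbert \<Rightarrow> 'y) \<Rightarrow> bool" where
  "C0_semigroup S \<longleftrightarrow>
     (\<forall>t\<ge>0. bounded_op UNIV norm UNIV norm (S t)) \<and>
     (\<forall>x. S 0 x = x) \<and>
     (\<forall>s\<ge>0. \<forall>t\<ge>0. \<forall>x. S (s + t) x = S s (S t x)) \<and>
     (\<forall>x. ((\<lambda>t. S t x) \<longlongrightarrow> x) (at_right 0))"

definition generates ::
  "'y::separable_complex_hilbert set \<Rightarrow> ('y \<Rightarrow> 'y) \<Rightarrow> (real \<Rightarrow> 'y \<Rightarrow> 'y) \<Rightarrow> bool" where
  "generates D A S \<longleftrightarrow>
     C0_semigroup S \<and>
     D = {x. \<exists>y. ((\<lambda>h. (1 / h) *\<^sub>R (S h x - x)) \<longlongrightarrow> y) (at_right 0)} \<and>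
     (\<forall>x\<in>D. ((\<lambda>h. (1 / h) *\<^sub>R (S h x - x)) \<longlongrightarrow> A x) (at_right 0))"

text \<open>The semigroup generated by \<open>A\<^sup>*\<close> consists of the adjoints of the operators \<open>S t\<close>.\<close>

definition adj_sg ::
  "(real \<Rightarrow> 'y::separable_complex_hilbert \<Rightarrow> 'y) \<Rightarrow> real \<Rightarrow> 'y \<Rightarrow> 'y" where
  "adj_sg S t = bounded_adj (S t)"

text \<open>
  Fractional powers of the negative of the generator of an exponentially stable semigroup \<open>S\<close>:
  for \<open>\<alpha> > 0\<close> the operator \<open>(-A)\<^sup>-\<^sup>\<alpha>\<close> is \<open>\<Gamma>(\<alpha>)\<^sup>-\<^sup>1 \<integral>\<^sub>0\<^sup>\<infinity> t\<^sup>\<alpha>\<^sup>-\<^sup>1 S(t) dt\<close>, it is injective, and \<open>(-A)\<^sup>\<alpha>\<close> is its inverse,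
  defined on its range.
\<close>

definition frac_neg_pow ::
  "(real \<Rightarrow> 'y::separable_complex_hilbert \<Rightarrow> 'y) \<Rightarrow> real \<Rightarrow> 'y \<Rightarrow> 'y" where
  "frac_neg_pow S \<alpha> x =
     (1 / Gamma \<alpha>) *\<^sub>R (LINT t:{0<..}|lebesgue. (t powr (\<alpha> - 1)) *\<^sub>R S t x)"

definition frac_dom :: "(real \<Rightarrow> 'y::separable_complex_hilbert \<Rightarrow> 'y) \<Rightarrow> real \<Rightarrow> 'y set" where
  "frac_dom S \<alpha> = range (frac_neg_pow S \<alpha>)"

definition frac_pow ::
  "(real \<Rightarrow> 'y::separable_complex_hilbert \<Rightarrow> 'y) \<Rightarrow> real \<Rightarrow> 'y \<Rightarrow> 'y" where
  "frac_pow S \<alpha> = inv (frac_neg_pow S \<alpha>)"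


section \<open>The control operator\<close>

text \<open>
  Elements of the dual \<open>[\<D>(A\<^sup>*)]'\<close> with respect to the pivot space are represented by
  \<^emph>\<open>conjugate\<close> linear functionals on \<open>D = \<D>(A\<^sup>*)\<close> that are bounded in the norm \<open>n\<close> of \<open>D\<close>, so that
  \<open>y \<mapsto> (\<lambda>\<xi>. cinner y \<xi>)\<close> is the (linear) embedding of the pivot space. Values of such functionals
  off \<open>D\<close> are irrelevant.
\<close>

definition pivot_dual ::
  "'y::separable_complex_hilbert set \<Rightarrow> ('y \<Rightarrow> real) \<Rightarrow> ('y \<Rightarrow> complex) set" where
  "pivot_dual D n =
     {\<phi>. (\<forall>x\<in>D. \<forall>y\<in>D. \<phi> (x + y) = \<phi> x + \<phi> y) \<and>
         (\<forall>c. \<forall>x\<in>D. \<phi> (c *\<^sub>C x) = cnj c * \<phi> x) \<and>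
         (\<exists>K. \<forall>x\<in>D. cmod (\<phi> x) \<le> K * n x)}"

text \<open>\<open>B \<in> \<L>(U, [\<D>(A\<^sup>*)]')\<close>.\<close>

definition bounded_into_dual ::
  "'y::separable_complex_hilbert set \<Rightarrow> ('y \<Rightarrow> real) \<Rightarrow>
   ('u::separable_complex_hilbert \<Rightarrow> 'y \<Rightarrow> complex) \<Rightarrow> bool" where
  "bounded_into_dual D n B \<longleftrightarrow>
     (\<forall>u. B u \<in> pivot_dual D n) \<and>
     (\<forall>u v. \<forall>x\<in>D. B (u + v) x = B u x + B v x) \<and>
     (\<forall>c u. \<forall>x\<in>D. B (c *\<^sub>C u) x = c * B u x) \<and>
     (\<exists>K. \<forall>u. \<forall>x\<in>D. cmod (B u x) \<le> K * norm u * n x)"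

text \<open>The adjoint \<open>B\<^sup>* : \<D>(A\<^sup>*) \<rightarrow> U\<close>.\<close>

definition Bstar ::
  "('u::separable_complex_hilbert \<Rightarrow> 'y::separable_complex_hilbert \<Rightarrow> complex) \<Rightarrow> 'y \<Rightarrow> 'u" where
  "Bstar B x = (THE v. \<forall>u. B u x = cinner u v)"

text \<open>
  The bounded extension of \<open>B\<^sup>* e\<^bsup>A\<^sup>*t\<^esup>\<close> from \<open>D = \<D>(A\<^sup>*)\<close> to \<open>\<D>(A\<^sup>*\<^sup>\<epsilon>)\<close>, i.e. \<open>[e\<^bsup>At\<^esup> B]\<^sup>*\<close>. It is unique on
  \<open>\<D>(A\<^sup>*\<^sup>\<epsilon>)\<close>, because \<open>\<D>(A\<^sup>*)\<close> is dense there in the graph norm; its values elsewhere are unspecified.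
\<close>

definition Bstar_sg_ext ::
  "'y::separable_complex_hilbert set \<Rightarrow> (real \<Rightarrow> 'y \<Rightarrow> 'y) \<Rightarrow>
   ('u::separable_complex_hilbert \<Rightarrow> 'y \<Rightarrow> complex) \<Rightarrow> real \<Rightarrow> real \<Rightarrow> 'y \<Rightarrow> 'u" where
  "Bstar_sg_ext D S B \<epsilon> t =
     (SOME E. bounded_op (frac_dom (adj_sg S) \<epsilon>) (graph_norm (frac_pow (adj_sg S) \<epsilon>)) UNIV norm E \<and>
              (\<forall>\<xi>\<in>D. E \<xi> = Bstar B (adj_sg S t \<xi>)))"


section \<open>Spaces of functions of time\<close>

definition Lp_set :: "real set \<Rightarrow> real \<Rightarrow> (real \<Rightarrow> 'u::separable_complex_hilbert) set" where
  "Lp_set I p = {f. set_borel_measurable lebesgue I f \<and>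
                    set_integrable lebesgue I (\<lambda>t. norm (f t) powr p)}"

definition Lp_norm :: "real set \<Rightarrow> real \<Rightarrow> (real \<Rightarrow> 'u::separable_complex_hilbert) \<Rightarrow> real" where
  "Lp_norm I p f = (LINT t:I|lebesgue. norm (f t) powr p) powr (1 / p)"

text \<open>
  The family \<open>f t : D \<rightarrow> U\<close> extends to an element of \<open>\<L>(Y, L\<^sup>p(0,T;U))\<close>, respectively of
  \<open>\<L>(Y, C([0,T];U))\<close>.
\<close>

definition extends_to_Lp ::
  "'y::separable_complex_hilbert set \<Rightarrow> (real \<Rightarrow> 'y \<Rightarrow> 'u::separable_complex_hilbert) \<Rightarrow>
   real \<Rightarrow> real \<Rightarrow> bool" where
  "extends_to_Lp D f T p \<longleftrightarrow>
     (\<exists>E :: 'y \<Rightarrow> real \<Rightarrow> 'u.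
        (\<forall>x. E x \<in> Lp_set {0<..<T} p) \<and>
        (\<forall>x y. AE t in lebesgue. t \<in> {0<..<T} \<longrightarrow> E (x + y) t = E x t + E y t) \<and>
        (\<forall>c x. AE t in lebesgue. t \<in> {0<..<T} \<longrightarrow> E (c *\<^sub>C x) t = c *\<^sub>C E x t) \<and>
        (\<exists>K. \<forall>x. Lp_norm {0<..<T} p (E x) \<le> K * norm x) \<and>
        (\<forall>x\<in>D. AE t in lebesgue. t \<in> {0<..<T} \<longrightarrow> E x t = f t x))"

definition extends_to_C ::
  "'y::separable_complex_hilbert set \<Rightarrow> (real \<Rightarrow> 'y \<Rightarrow> 'u::separable_complex_hilbert) \<Rightarrow>
   real \<Rightarrow> bool" where
  "extends_to_C D f T \<longleftrightarrow>
     (\<exists>E :: 'y \<Rightarrow> real \<Rightarrow> 'u.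
        (\<forall>x. continuous_on {0..T} (E x)) \<and>
        (\<forall>x y. \<forall>t\<in>{0..T}. E (x + y) t = E x t + E y t) \<and>
        (\<forall>c x. \<forall>t\<in>{0..T}. E (c *\<^sub>C x) t = c *\<^sub>C E x t) \<and>
        (\<exists>K. \<forall>x. \<forall>t\<in>{0..T}. norm (E x t) \<le> K * norm x) \<and>
        (\<forall>x\<in>D. \<forall>t\<in>{0..T}. E x t = f t x))"


section \<open>The optimal control problem\<close>

text \<open>In the remaining definitions \<open>D\<close> stands for \<open>\<D>(A\<^sup>*)\<close>.\<close>

text \<open>The extension of \<open>e\<^bsup>At\<^esup>\<close> to \<open>[\<D>(A\<^sup>*)]'\<close>, by transposition.\<close>

definition sg_dual ::
  "(real \<Rightarrow> 'y::separable_complex_hilbert \<Rightarrow> 'y) \<Rightarrow> real \<Rightarrow> ('y \<Rightarrow> complex) \<Rightarrow> 'y \<Rightarrow> complex" where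
  "sg_dual S t \<phi> = (\<lambda>\<xi>. \<phi> (adj_sg S t \<xi>))"

text \<open>
  \<open>(Lu)(t)\<close> as an element of \<open>[\<D>(A\<^sup>*)]'\<close>: the integral is evaluated by pairing with the elements
  of \<open>\<D>(A\<^sup>*)\<close>.
\<close>

definition control_to_state ::
  "(real \<Rightarrow> 'y::separable_complex_hilbert \<Rightarrow> 'y) \<Rightarrow>
   ('u::separable_complex_hilbert \<Rightarrow> 'y \<Rightarrow> complex) \<Rightarrow> (real \<Rightarrow> 'u) \<Rightarrow> real \<Rightarrow> 'y \<Rightarrow> complex" where
  "control_to_state S B u t = (\<lambda>\<xi>. LINT s:{0..t}|lebesgue. sg_dual S (t - s) (B (u s)) \<xi>)"

text \<open>
  The element of \<open>Y\<close> that a functional in \<open>[\<D>(A\<^sup>*)]'\<close> represents, and \<open>0\<close> if it does not lie in \<open>Y\<close>.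
  For square integrable \<open>u\<close> the functional \<open>(Lu)(t)\<close> lies in \<open>Y\<close> for almost every \<open>t\<close>, so that the
  default value is used on a null set of times only.
\<close>

definition pivot_rep ::
  "'y::separable_complex_hilbert set \<Rightarrow> ('y \<Rightarrow> complex) \<Rightarrow> 'y" where
  "pivot_rep D \<phi> = (if \<exists>z. \<forall>\<xi>\<in>D. \<phi> \<xi> = cinner z \<xi> then THE z. \<forall>\<xi>\<in>D. \<phi> \<xi> = cinner z \<xi> else 0)"

definition state ::
  "'y::separable_complex_hilbert set \<Rightarrow> (real \<Rightarrow> 'y \<Rightarrow> 'y) \<Rightarrow>
   ('u::separable_complex_hilbert \<Rightarrow> 'y \<Rightarrow> complex) \<Rightarrow> 'y \<Rightarrow> (real \<Rightarrow> 'u) \<Rightarrow> real \<Rightarrow> 'y" where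
  "state D S B x u t = S t x + pivot_rep D (control_to_state S B u t)"

definition cost ::
  "'y::separable_complex_hilbert set \<Rightarrow> (real \<Rightarrow> 'y \<Rightarrow> 'y) \<Rightarrow>
   ('u::separable_complex_hilbert \<Rightarrow> 'y \<Rightarrow> complex) \<Rightarrow> ('y \<Rightarrow> 'z::separable_complex_hilbert) \<Rightarrow>
   'y \<Rightarrow> (real \<Rightarrow> 'u) \<Rightarrow> ennreal" where
  "cost D S B R x u =
     (\<integral>\<^sup>+ t\<in>{0<..}. ennreal ((norm (R (state D S B x u t)))\<^sup>2 + (norm (u t))\<^sup>2) \<partial>lebesgue)"

text \<open>Uniqueness is that of elements of \<open>L\<^sup>2(0,\<infinity>;U)\<close>, that is, up to null sets.\<close>

definition unique_minimizer ::
  "'y::separable_complex_hilbert set \<Rightarrow> (real \<Rightarrow> 'y \<Rightarrow> 'y) \<Rightarrow>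
   ('u::separable_complex_hilbert \<Rightarrow> 'y \<Rightarrow> complex) \<Rightarrow> ('y \<Rightarrow> 'z::separable_complex_hilbert) \<Rightarrow>
   'y \<Rightarrow> (real \<Rightarrow> 'u) \<Rightarrow> bool" where
  "unique_minimizer D S B R x u \<longleftrightarrow>
     u \<in> Lp_set {0<..} 2 \<and>
     (\<forall>v\<in>Lp_set {0<..} 2. cost D S B R x u \<le> cost D S B R x v) \<and>
     (\<forall>v\<in>Lp_set {0<..} 2. cost D S B R x v = cost D S B R x u \<longrightarrow>
        (AE t in lebesgue. 0 < t \<longrightarrow> v t = u t))"

text \<open>
  The optimal state \<open>\<Phi>(t)x\<close>, where \<open>uhat x\<close> is the optimal control for the initial state \<open>x\<close>. Its
  value at \<open>t\<close> does not depend on the representative of \<open>uhat x\<close>.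
\<close>

definition opt_state ::
  "'y::separable_complex_hilbert set \<Rightarrow> (real \<Rightarrow> 'y \<Rightarrow> 'y) \<Rightarrow>
   ('u::separable_complex_hilbert \<Rightarrow> 'y \<Rightarrow> complex) \<Rightarrow> ('y \<Rightarrow> real \<Rightarrow> 'u) \<Rightarrow> real \<Rightarrow> 'y \<Rightarrow> 'y" where
  "opt_state D S B uhat t x = state D S B x (uhat x) t"

definition P_op ::
  "'y::separable_complex_hilbert set \<Rightarrow> (real \<Rightarrow> 'y \<Rightarrow> 'y) \<Rightarrow>
   ('u::separable_complex_hilbert \<Rightarrow> 'y \<Rightarrow> complex) \<Rightarrow> ('y \<Rightarrow> 'z::separable_complex_hilbert) \<Rightarrow>
   ('y \<Rightarrow> real \<Rightarrow> 'u) \<Rightarrow> 'y \<Rightarrow> 'y" where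
  "P_op D S B R uhat x =
     (LINT t:{0<..}|lebesgue. adj_sg S t (bounded_adj R (R (opt_state D S B uhat t x))))"

definition T_integrand ::
  "'y::separable_complex_hilbert set \<Rightarrow> (real \<Rightarrow> 'y \<Rightarrow> 'y) \<Rightarrow>
   ('u::separable_complex_hilbert \<Rightarrow> 'y \<Rightarrow> complex) \<Rightarrow> ('y \<Rightarrow> 'z::separable_complex_hilbert) \<Rightarrow>
   real \<Rightarrow> ('y \<Rightarrow> real \<Rightarrow> 'u) \<Rightarrow> 'y \<Rightarrow> real \<Rightarrow> 'u" where
  "T_integrand D S B R \<epsilon> uhat x t =
     Bstar_sg_ext D S B \<epsilon> t (bounded_adj R (R (opt_state D S B uhat t x)))"

definition T_op ::
  "'y::separable_complex_hilbert set \<Rightarrow> (real \<Rightarrow> 'y \<Rightarrow> 'y) \<Rightarrow>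
   ('u::separable_complex_hilbert \<Rightarrow> 'y \<Rightarrow> complex) \<Rightarrow> ('y \<Rightarrow> 'z::separable_complex_hilbert) \<Rightarrow>
   real \<Rightarrow> ('y \<Rightarrow> real \<Rightarrow> 'u) \<Rightarrow> 'y \<Rightarrow> 'u" where
  "T_op D S B R \<epsilon> uhat x = (LINT t:{0<..}|lebesgue. T_integrand D S B R \<epsilon> uhat x t)"

definition BstarP ::
  "'y::separable_complex_hilbert set \<Rightarrow> (real \<Rightarrow> 'y \<Rightarrow> 'y) \<Rightarrow>
   ('u::separable_complex_hilbert \<Rightarrow> 'y \<Rightarrow> complex) \<Rightarrow> ('y \<Rightarrow> 'z::separable_complex_hilbert) \<Rightarrow>
   real \<Rightarrow> ('y \<Rightarrow> real \<Rightarrow> 'u) \<Rightarrow> 'y \<Rightarrow> 'u" where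
  "BstarP D S B R \<epsilon> uhat x =
     weak_lim (at_right 0) (\<lambda>s. Bstar_sg_ext D S B \<epsilon> s (P_op D S B R uhat x))"

end

theory Submission
  imports Defs
begin

text \<open>
  Put \<open>J = (-A)\<^sup>-\<^sup>1\<close>. Every element of \<open>\<D>(A\<^sup>*)\<close> is \<open>J' z\<close> with \<open>J' = J\<^sup>*\<close>, and \<open>B\<^sup>* e\<^bsup>A\<^sup>*t\<^esup> J' z = b\<^sup>* S\<^sup>*(t) z\<close> with
  the bounded operator \<open>b = (-A)\<^sup>-\<^sup>1 B\<close>. Hence \<open>(Lu)(t)\<close> is the \<open>y\<close> that satisfies
  \<open>\<langle>y, J' z\<rangle> = \<integral>\<^sub>0\<^sup>t \<langle>u(s), b\<^sup>* S\<^sup>*(t - s) z\<rangle> ds\<close> for all \<open>z\<close>. By a Riesz argument it exists, with norm at most \<open>c\<close>,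
  as soon as the right-hand side is bounded by \<open>c \<parallel>J' z\<parallel>\<close>; if it is bounded by \<open>c \<parallel>A\<^sup>*\<^sup>-\<^sup>\<epsilon> J' z\<parallel>\<close>, then
  \<open>y = A\<^sup>-\<^sup>\<epsilon> w\<close> with \<open>\<parallel>w\<parallel> \<le> c\<close>. By (iii)(c) the latter holds for controls in \<open>L\<^sup>2 \<inter> L\<^sup>n\<close> with \<open>n\<close> large, so
  the point is to bound the \<open>L\<^sup>n\<close> norm of the optimal control.

  The optimality condition is \<open>\<langle>R y, R L v\<rangle> + \<langle>u, v\<rangle> = 0\<close> for all \<open>v\<close> in \<open>L\<^sup>2\<close>. Split the kernel into a
  singular part, supported on a short time interval and of small \<open>L\<^sup>1\<close> norm, and a remainder that is \<open>L\<^sup>p\<close>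
  in time with an exponential weight, for \<open>p = 2\<close> and \<open>p = n\<close>. The remainder maps \<open>L\<^sup>2\<close> into bounded functions
  and the dual of \<open>L\<^sup>n\<close> into \<open>L\<^sup>2\<close>. Testing the optimality condition with powers of \<open>\<parallel>u\<parallel>\<close> then gives a
  pointwise inequality \<open>\<parallel>u\<parallel> \<le> h + A \<parallel>u\<parallel>\<close> with \<open>h\<close> in \<open>L\<^sup>n\<close> and \<open>A\<close> a positive convolution operator of norm at
  most 1/4 on \<open>L\<^sup>2\<close> and \<open>L\<^sup>n\<close>, and the Neumann series of \<open>A\<close> applied to \<open>h\<close> dominates \<open>\<parallel>u\<parallel>\<close>. Only natural
  exponents \<open>n\<close> are needed.

  Finally \<open>R\<^sup>*R\<Phi>(t)x = A\<^sup>*\<^sup>-\<^sup>\<epsilon> g(t)\<close> with \<open>g\<close> bounded, and \<open>Q(t) = [e\<^bsup>At\<^esup> B]\<^sup>* A\<^sup>*\<^sup>-\<^sup>\<epsilon>\<close> is a bounded operator on \<open>Y\<close> of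
  integrable norm with \<open>Q(s) S\<^sup>*(t) = Q(t) S\<^sup>*(s)\<close>. Therefore \<open>\<T>x = \<integral> Q(t) g(t) dt\<close>, \<open>Px\<close> lies in the range of
  \<open>A\<^sup>*\<^sup>-\<^sup>\<epsilon>\<close>, and \<open>[e\<^bsup>As\<^esup> B]\<^sup>* P x = \<integral> Q(t) S\<^sup>*(s) g(t) dt\<close> tends weakly to \<open>\<T>x\<close>.
\<close>

section \<open>Hilbert space preliminaries\<close>

text \<open>The obstacle is that (iii)(c) controls the kernel only in L^q with q < 2. A control in
  L^2 cannot be paired with it, since the conjugate exponent q/(q - 1) exceeds 2, while the cost
  yields exactly L^2. The missing integrability has to come from the optimality condition. There R
  is bounded but not small, so the contraction is obtained from the kernel instead: the interval
  carrying the singularity t^(-\<gamma>) is shortened, and its L^1 norm tends to 0 because \<gamma>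
  < 1. As the control is not known beforehand to lie in L^n, the test functions are truncated, and
  the bound must not depend on the truncation. The bounds are not homogeneous in the initial state;
  they are proved on the unit ball and extended by scaling, which the linearity of the optimality
  condition and the uniqueness of its solution permit. Estimates use the real inner product
  throughout; complex pairings are recovered by pairing with \<open>\<i> *\<^sub>C z\<close> as
  well.\<close>

lemma closest_point_limit:
  fixes L :: "'c::real_vector \<Rightarrow> 'a::{real_inner,banach}" and \<phi> :: "'c \<Rightarrow> real"
  assumes L: "linear L" and phi: "linear \<phi>" and C: "0 \<le> C"
    and bound: "\<And>z. \<bar>\<phi> z\<bar> \<le> C * norm (L z)"
  obtains y where "norm y \<le> C" "\<And>z. \<phi> z = inner y (L z)" "y \<in> closure (range L)"
proof -
  \<comment> \<open>A quadratic functional whose Euler equation is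
    \<open>\<phi> z = inner y (L z)\<close>. The range of \<open>L\<close> need not be closed, so
    \<open>y\<close> is only the limit of the values of \<open>L\<close> along a minimising
    sequence.\<close>
  define f where "f z = (norm (L z))\<^sup>2 - 2 * \<phi> z" for z
  define m where "m = Inf (range f)"
  have f_lower: "f z \<ge> - C\<^sup>2" for z
  proof -
    have "0 \<le> (norm (L z) - C)\<^sup>2" by simp
    moreover have "\<phi> z \<le> C * norm (L z)" using bound[of z] by linarith
    ultimately show ?thesis unfolding f_def power2_diff by (simp add: algebra_simps)
  qed
  have bdd: "bdd_below (range f)" using f_lower by (auto intro!: bdd_belowI[of _ "- C\<^sup>2"])
  have m_le: "m \<le> f z" for z unfolding m_def by (rule cInf_lower) (use bdd in auto)
  \<comment> \<open>Parallelogram identity for \<open>f\<close>; together with the lower bound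
    \<open>m\<close> at the midpoint it makes the minimising sequence Cauchy in the range.\<close>
  have par: "(norm (L z - L w))\<^sup>2 = 2 * f z + 2 * f w - 4 * f ((1/2) *\<^sub>R (z + w))" for z w
  proof -
    have a: "L ((1/2) *\<^sub>R (z + w)) = (1/2) *\<^sub>R (L z + L w)"
      and b: "\<phi> ((1/2) *\<^sub>R (z + w)) = (\<phi> z + \<phi> w) / 2"
      by (simp_all add: linear_add[OF L] linear_add[OF phi] linear_scale[OF L] linear_scale[OF phi])
    show ?thesis unfolding f_def a b
      by (simp add: power2_norm_eq_inner inner_simps inner_commute algebra_simps)
  qed
  have "\<exists>z. f z < m + 1 / real (Suc k)" for k
  proof (rule ccontr)
    assume "\<not> ?thesis"
    then have "m + 1 / real (Suc k) \<le> m" unfolding m_def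
      by (intro cINF_greatest) (auto simp: not_less m_def)
    then show False by simp
  qed
  then obtain Z where Z: "f (Z k) < m + 1 / real (Suc k)" for k by metis
  have ineq: "(norm (L (Z j) - L (Z k)))\<^sup>2 \<le> 2 / real (Suc j) + 2 / real (Suc k)" for j k
    using par[of "Z j" "Z k"] Z[of j] Z[of k] m_le[of "(1/2) *\<^sub>R (Z j + Z k)"] by simp
  have "Cauchy (\<lambda>k. L (Z k))"
  proof (rule metric_CauchyI)
    fix e :: real assume e: "0 < e"
    then obtain K where K: "4 / e\<^sup>2 < real K" using reals_Archimedean2 by blast
    show "\<exists>K. \<forall>j\<ge>K. \<forall>k\<ge>K. dist (L (Z j)) (L (Z k)) < e"
    proof (intro exI[of _ K] allI impI)
      fix j k assume jk: "K \<le> j" "K \<le> k"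
      have "2 / real (Suc j) \<le> 2 / real (Suc K)" "2 / real (Suc k) \<le> 2 / real (Suc K)"
        using jk by (auto intro!: divide_left_mono)
      then have "(norm (L (Z j) - L (Z k)))\<^sup>2 \<le> 4 / real (Suc K)"
        using ineq[of j k] by linarith
      also have "4 / real (Suc K) < e\<^sup>2"
      proof -
        have "4 < real K * e\<^sup>2" using K e by (simp add: pos_divide_less_eq)
        also have "\<dots> \<le> real (Suc K) * e\<^sup>2" by (intro mult_right_mono) auto
        finally have "4 < real (Suc K) * e\<^sup>2" .
        then show ?thesis by (simp add: pos_divide_less_eq mult.commute)
      qed
      finally show "dist (L (Z j)) (L (Z k)) < e"
        unfolding dist_norm by (rule power2_less_imp_less) (use e in auto)
    qed
  qed
  then obtain y where y: "(\<lambda>k. L (Z k)) \<longlonglongrightarrow> y" using Cauchy_convergent unfolding convergent_def by blast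
  have var: "\<phi> z = inner y (L z)" for z
  proof (cases "L z = 0")
    case True then show ?thesis using bound[of z] by simp
  next
    case False
    then have n0: "norm (L z) > 0" by simp
    \<comment> \<open>Half the derivative of \<open>f\<close> at \<open>Z k\<close> in the direction
      \<open>z\<close>; it must be small near the minimum.\<close>
    define d where "d k = inner (L (Z k)) (L z) - \<phi> z" for k
    have shift: "m \<le> f (Z k) + 2 * h * d k + h\<^sup>2 * (norm (L z))\<^sup>2" for h k
    proof -
      have "f (Z k + h *\<^sub>R z) = f (Z k) + 2 * h * d k + h\<^sup>2 * (norm (L z))\<^sup>2"
        unfolding f_def d_def power2_norm_eq_inner linear_add[OF L] linear_add[OF phi]
          linear_scale[OF L] linear_scale[OF phi]
        by (simp add: inner_simps inner_commute algebra_simps power2_eq_square)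
      then show ?thesis using m_le by metis
    qed
    have "(d k)\<^sup>2 \<le> (norm (L z))\<^sup>2 * (1 / real (Suc k))" for k
    proof -
      \<comment> \<open>The chosen step minimises the quadratic in \<open>h\<close>.\<close>
      have "m \<le> f (Z k) + 2 * (- d k / (norm (L z))\<^sup>2) * d k + (- d k / (norm (L z))\<^sup>2)\<^sup>2 * (norm (L z))\<^sup>2"
        by (rule shift)
      also have "\<dots> = f (Z k) - (d k)\<^sup>2 / (norm (L z))\<^sup>2"
        using n0 by (simp add: power2_eq_square field_simps)
      finally have "(d k)\<^sup>2 / (norm (L z))\<^sup>2 \<le> 1 / real (Suc k)" using Z[of k] by simp
      then show ?thesis using n0 by (simp add: field_simps)
    qed
    moreover have "(\<lambda>k. (norm (L z))\<^sup>2 * (1 / real (Suc k))) \<longlonglongrightarrow> (norm (L z))\<^sup>2 * 0"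
      unfolding inverse_eq_divide[symmetric] by (intro tendsto_intros LIMSEQ_inverse_real_of_nat)
    ultimately have "(\<lambda>k. (d k)\<^sup>2) \<longlonglongrightarrow> 0"
      by (intro tendsto_sandwich[of "\<lambda>_. 0" "\<lambda>k. (d k)\<^sup>2" _ "\<lambda>k. (norm (L z))\<^sup>2 * (1 / real (Suc k))"]) auto
    then have "d \<longlonglongrightarrow> 0" by simp
    moreover have "d \<longlonglongrightarrow> inner y (L z) - \<phi> z" unfolding d_def by (intro tendsto_intros y)
    ultimately show ?thesis using LIMSEQ_unique by fastforce
  qed
  have cl: "y \<in> closure (range L)"
    unfolding closure_sequential by (intro exI[of _ "\<lambda>k. L (Z k)"]) (simp add: y)
  have "norm y \<le> C"
  proof -
    have "inner y (L (Z k)) \<le> C * norm (L (Z k))" for k using bound[of "Z k"] var[of "Z k"] by simp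
    moreover have "(\<lambda>k. inner y (L (Z k))) \<longlonglongrightarrow> inner y y" "(\<lambda>k. C * norm (L (Z k))) \<longlonglongrightarrow> C * norm y"
      by (intro tendsto_intros y)+
    ultimately have "inner y y \<le> C * norm y" by (meson LIMSEQ_le)
    then have "norm y * norm y \<le> C * norm y" by (simp add: dot_square_norm power2_eq_square)
    then show ?thesis using C by (cases "norm y = 0") (auto simp: mult_le_cancel_right)
  qed
  then show thesis using that var cl by blast
qed

text \<open>The representative of \<open>inner x (L z)\<close> given by
  \<open>closest_point_limit\<close> is the orthogonal projection of \<open>x\<close> onto the
  closed range; \<open>x\<close> minus it annihilates the range and vanishes by totality.\<close>

lemma dense_range_if_total:
  fixes L :: "'c::real_vector \<Rightarrow> 'a::{real_inner,banach}"
  assumes L: "linear L" and total: "\<And>y. (\<And>z. inner y (L z) = 0) \<Longrightarrow> y = 0"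
  shows "closure (range L) = UNIV"
proof -
  have "x \<in> closure (range L)" for x
  proof -
    have "linear (\<lambda>z. inner x (L z))"
      by (rule linearI) (simp_all add: linear_add[OF L] linear_scale[OF L] inner_simps)
    then obtain y where y: "\<And>z. inner x (L z) = inner y (L z)" "y \<in> closure (range L)"
      by (rule closest_point_limit[OF L, of "\<lambda>z. inner x (L z)" "norm x"]) (auto intro: Cauchy_Schwarz_ineq2)
    then have "x - y = 0" by (intro total) (simp add: inner_diff_left)
    then show ?thesis using y by simp
  qed
  then show ?thesis by auto
qed

lemma bounded_linear_eq_on_dense:
  assumes "closure X = UNIV" "bounded_linear f" "bounded_linear g" "\<And>x. x \<in> X \<Longrightarrow> f x = g x"
  shows "f x = g x"
proof -
  have "closed {x. f x = g x}"
    using assms(2,3) by (intro closed_Collect_eq linear_continuous_on)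
  then have "closure X \<subseteq> {x. f x = g x}" using assms(4) by (intro closure_minimal) auto
  then show ?thesis using assms(1) by auto
qed

lemma norm_le_on_dense:
  assumes "closure X = UNIV" "bounded_linear f" "\<And>x. x \<in> X \<Longrightarrow> norm (f x) \<le> C * norm x"
  shows "norm (f x) \<le> C * norm x"
proof -
  have "closed {x. norm (f x) \<le> C * norm x}"
    using assms(2) by (intro closed_Collect_le continuous_intros linear_continuous_on)
  then have "closure X \<subseteq> {x. norm (f x) \<le> C * norm x}" using assms(3) by (intro closure_minimal) auto
  then show ?thesis using assms(1) by auto
qed

lemma norm_le_of_inner:
  fixes a :: "'a::real_inner"
  assumes "0 \<le> C" "\<And>y. \<bar>inner a y\<bar> \<le> C * norm y" shows "norm a \<le> C"
proof (cases "a = 0")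
  case False
  have "norm a * norm a \<le> C * norm a"
    using assms(2)[of a] by (simp add: dot_square_norm power2_eq_square)
  then show ?thesis using False by simp
qed (use assms in simp)


lemma dense_tendsto_obtain:
  fixes y :: "'a::metric_space"
  assumes "closure X = UNIV"
  obtains s where "\<And>n::nat. s n \<in> X" "s \<longlonglongrightarrow> y"
  using assms closure_sequential[of y X] by auto

text \<open>Pettis's theorem: a closed ball is cut out by countably many half spaces, one for each
  element of a countable dense set, and an open set is a countable union of closed balls.
  Measurability of vector-valued functions is thereby reduced to scalar pairings with a dense
  set.\<close>

lemma borel_measurable_weak:
  fixes f :: "'b \<Rightarrow> 'a::{real_inner,second_countable_topology}"
  assumes X: "closure X = UNIV" and weak: "\<And>y. y \<in> X \<Longrightarrow> (\<lambda>x. inner (f x) y) \<in> borel_measurable M"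
  shows "f \<in> borel_measurable M"
proof -
  have meas: "(\<lambda>x. inner (f x) y) \<in> borel_measurable M" for y
  proof -
    obtain s where s: "\<And>n::nat. s n \<in> X" "s \<longlonglongrightarrow> y"
      using dense_tendsto_obtain[OF X] by blast
    show ?thesis
      by (rule borel_measurable_LIMSEQ_real[where u = "\<lambda>n x. inner (f x) (s n)"])
        (auto intro!: tendsto_intros s weak)
  qed
  obtain D :: "'a set" where D: "countable D" "\<And>U. open U \<Longrightarrow> U \<noteq> {} \<Longrightarrow> \<exists>d\<in>D. d \<in> U"
    using countable_dense_setE by blast
  have clD: "closure D = UNIV"
    using D(2) by (auto simp: closure_approachable) (metis centre_in_ball mem_ball dist_commute open_ball empty_iff)
  have cball_char: "norm v \<le> r \<longleftrightarrow> (\<forall>d\<in>D. inner v d \<le> r * norm d)" if "0 \<le> r" for v r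
  proof
    assume "norm v \<le> r"
    then show "\<forall>d\<in>D. inner v d \<le> r * norm d"
      using norm_cauchy_schwarz[of v] by (meson mult_right_mono norm_ge_zero order_trans)
  next
    assume h: "\<forall>d\<in>D. inner v d \<le> r * norm d"
    obtain s where s: "\<And>n::nat. s n \<in> D" "s \<longlonglongrightarrow> v" using dense_tendsto_obtain[OF clD] by blast
    have "(\<lambda>n. inner v (s n)) \<longlonglongrightarrow> inner v v" "(\<lambda>n. r * norm (s n)) \<longlonglongrightarrow> r * norm v"
      by (intro tendsto_intros s)+
    then have "inner v v \<le> r * norm v" using LIMSEQ_le h s(1) by blast
    then show "norm v \<le> r" using that
      by (cases "v = 0") (auto simp: dot_square_norm power2_eq_square)
  qed
  have cb: "f -` cball c r \<inter> space M \<in> sets M" for c r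
  proof (cases "0 \<le> r")
    case True
    have "f -` cball c r \<inter> space M = {x\<in>space M. \<forall>d\<in>D. inner (f x - c) d \<le> r * norm d}"
    proof -
      have "f x \<in> cball c r \<longleftrightarrow> (\<forall>d\<in>D. inner (f x - c) d \<le> r * norm d)" for x
        by (simp add: dist_norm norm_minus_commute cball_char[OF True, symmetric])
      then show ?thesis by auto
    qed
    also have "\<dots> \<in> sets M"
    proof -
      have [measurable]: "(\<lambda>x. inner (f x - c) d) \<in> borel_measurable M" for d
        using meas[of d] by (simp add: inner_diff_left)
      show ?thesis by (intro sets.sets_Collect_countable_All'[OF _ D(1)]) measurable
    qed
    finally show ?thesis .
  qed auto
  show ?thesis
  proof (rule borel_measurableI)
    fix U :: "'a set" assume U: "open U"
    define I where "I = {(d, r). d \<in> D \<and> r \<in> \<rat> \<and> cball d r \<subseteq> U}"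
    have "countable (D \<times> \<rat>)" using D(1) countable_rat by auto
    then have cI: "countable I" by (rule countable_subset[rotated]) (auto simp: I_def)
    have "U = (\<Union>(d, r)\<in>I. cball d r)"
    proof
      show "U \<subseteq> (\<Union>(d, r)\<in>I. cball d r)"
      proof
        fix x assume "x \<in> U"
        then obtain e where e: "0 < e" "ball x e \<subseteq> U" using U open_contains_ball by blast
        \<comment> \<open>A centre within e/3 of \<open>x\<close> and a radius between e/3 and e/2
          give a ball that contains \<open>x\<close> and stays in \<open>ball x e\<close>, as e/3 +
          e/2 < e.\<close>
        obtain r where r: "r \<in> \<rat>" "e / 3 < r" "r < e / 2"
          using Rats_dense_in_real[of "e/3" "e/2"] e by auto
        have "ball x (e/3) \<noteq> {}" using e by simp
        then obtain d where d: "d \<in> D" "dist x d < e / 3" using D(2)[of "ball x (e/3)"] by auto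
        have "cball d r \<subseteq> ball x e"
        proof
          fix y assume "y \<in> cball d r"
          then show "y \<in> ball x e" using d r e dist_triangle[of x y d] by simp
        qed
        then have "(d, r) \<in> I" using d r e by (auto simp: I_def)
        moreover have "x \<in> cball d r" using d r by (simp add: dist_commute)
        ultimately show "x \<in> (\<Union>(d, r)\<in>I. cball d r)" by (intro UN_I[of "(d, r)"]) auto
      qed
    qed (auto simp: I_def)
    then have "f -` U \<inter> space M = (\<Union>(d, r)\<in>I. f -` cball d r \<inter> space M)" by auto
    also have "\<dots> \<in> sets M" using cI cb by (intro sets.countable_UN') auto
    finally show "f -` U \<inter> space M \<in> sets M" .
  qed
qed

section \<open>Complex scalars and adjoints of bounded operators\<close>

lemma cinner_scaleC_right: "cinner x (c *\<^sub>C y) = cnj c * cinner x y"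
  by (metis cinner_commute cinner_scaleC_left complex_cnj_mult)

text \<open>Conjugate linearity in the second argument turns the imaginary part into a real pairing.
  This is the bridge from \<open>cinner\<close> to \<open>inner\<close>.\<close>

lemma cinner_eq_Complex: "cinner x y = Complex (inner x y) (inner x (\<i> *\<^sub>C y))"
  by (rule complex_eqI) (simp_all add: inner_cinner cinner_scaleC_right)

lemma cinner_eq_Complex': "cinner x y = Complex (inner x y) (- inner (\<i> *\<^sub>C x) y)"
  by (rule complex_eqI) (simp_all add: inner_cinner cinner_scaleC_left)

lemma inner_scaleC_left: "inner (c *\<^sub>C x) y = inner x (cnj c *\<^sub>C y)"
  by (simp add: inner_cinner cinner_scaleC_left cinner_scaleC_right)

lemma norm_scaleC: "norm (c *\<^sub>C x) = cmod c * norm x"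
proof -
  have "(norm (c *\<^sub>C x))\<^sup>2 = inner ((cnj c * c) *\<^sub>C x) x"
    by (simp add: power2_norm_eq_inner inner_scaleC_left[of c] scaleC_scaleC inner_commute)
  also have "\<dots> = (cmod c * norm x)\<^sup>2"
    by (simp add: mult.commute[of "cnj c"] complex_norm_square[symmetric] power_mult_distrib
        power2_norm_eq_inner[of x] flip: scaleR_scaleC of_real_power)
  finally show ?thesis by simp
qed

lemma bounded_linear_scaleC: "bounded_linear (\<lambda>x. c *\<^sub>C x)"
proof (rule bounded_linear_intro[where K = "cmod c"])
  show "c *\<^sub>C (r *\<^sub>R x) = r *\<^sub>R (c *\<^sub>C x)" for r and x :: 'a
    by (simp add: scaleR_scaleC scaleC_scaleC mult.commute)
qed (simp_all add: scaleC_add_right norm_scaleC)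

lemma csubspace_set_add: "csubspace_set D \<Longrightarrow> x \<in> D \<Longrightarrow> y \<in> D \<Longrightarrow> x + y \<in> D"
  and csubspace_set_scaleC: "csubspace_set D \<Longrightarrow> x \<in> D \<Longrightarrow> c *\<^sub>C x \<in> D"
  by (auto simp: csubspace_set_def)

text \<open>Domain and operator are invariant under multiplication by \<i>, so the real identity at
  \<open>\<i> *\<^sub>C x\<close> supplies the imaginary part. Adjoints can therefore be computed
  with \<open>inner\<close>.\<close>

lemma cinner_pairing_iff_inner:
  assumes "csubspace_set D" "clinear_on D T"
  shows "(\<forall>x\<in>D. cinner (T x) y = cinner x z) \<longleftrightarrow> (\<forall>x\<in>D. inner (T x) y = inner x z)"
proof
  assume "\<forall>x\<in>D. inner (T x) y = inner x z"
  moreover have "\<i> *\<^sub>C x \<in> D" "T (\<i> *\<^sub>C x) = \<i> *\<^sub>C T x" if "x \<in> D" for x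
    using assms that by (auto simp: csubspace_set_def clinear_on_def)
  ultimately show "\<forall>x\<in>D. cinner (T x) y = cinner x z" by (metis cinner_eq_Complex')
qed (simp add: inner_cinner)

text \<open>Complex homogeneity is added to the real \<open>bounded_linear\<close>, so that
  continuity, limits and integrals come from the real theory; \<open>bounded_op_UNIV_iff\<close>
  links it to the notion of the definitions.\<close>

definition bclinear ::
  "('a::separable_complex_hilbert \<Rightarrow> 'b::separable_complex_hilbert) \<Rightarrow> bool" where
  "bclinear f \<longleftrightarrow> bounded_linear f \<and> (\<forall>c x. f (c *\<^sub>C x) = c *\<^sub>C f x)"

lemma bclinearD: "bclinear f \<Longrightarrow> bounded_linear f" "bclinear f \<Longrightarrow> f (c *\<^sub>C x) = c *\<^sub>C f x"
  by (auto simp: bclinear_def)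

lemma bclinearI:
  assumes "\<And>x y. f (x + y) = f x + f y" "\<And>c x. f (c *\<^sub>C x) = c *\<^sub>C f x" "\<And>x. norm (f x) \<le> K * norm x"
  shows "bclinear f"
  unfolding bclinear_def
  using assms(2,3) by (auto intro!: bounded_linear_intro[where K = K] simp: assms(1) scaleR_scaleC mult.commute)

lemma bounded_op_UNIV_iff: "bounded_op UNIV norm UNIV norm f \<longleftrightarrow> bclinear f"
proof
  assume "bounded_op UNIV norm UNIV norm f"
  then show "bclinear f" unfolding bounded_op_def clinear_on_def by (auto intro: bclinearI)
next
  assume "bclinear f"
  then show "bounded_op UNIV norm UNIV norm f"
    unfolding bounded_op_def clinear_on_def bclinear_def
    by (auto simp: linear_add bounded_linear.linear mult.commute dest!: bounded_linear.bounded)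
      (metis mult.commute)
qed

lemma csubspace_set_UNIV: "csubspace_set UNIV" by (simp add: csubspace_set_def)

lemma bclinear_clinear_on: "bclinear f \<Longrightarrow> clinear_on X f"
  by (simp add: bclinear_def clinear_on_def linear_add bounded_linear.linear)

text \<open>Riesz representation, from \<open>closest_point_limit\<close> with the identity in place
  of \<open>L\<close>.\<close>

lemma ex1_inner_representation:
  fixes \<phi> :: "'a::{real_inner,banach} \<Rightarrow> real"
  assumes "bounded_linear \<phi>" shows "\<exists>z. \<forall>x. \<phi> x = inner x z"
proof -
  interpret bounded_linear \<phi> by fact
  obtain K where "K > 0" "\<And>x. norm (\<phi> x) \<le> norm x * K" using pos_bounded by blast
  then have "\<And>x. \<bar>\<phi> x\<bar> \<le> K * norm (id x)" by (simp add: mult.commute)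
  then obtain y where "\<And>x. \<phi> x = inner y (id x)"
    by (rule closest_point_limit[OF linear_id linear_axioms, rotated]) (use \<open>K > 0\<close> in auto)
  then show ?thesis by (metis id_apply inner_commute)
qed

lemma bounded_adj_eqI:
  assumes "bclinear T" "\<And>x. inner (T x) y = inner x z" shows "bounded_adj T y = z"
  unfolding adj_def
proof (rule the_equality)
  note iff = cinner_pairing_iff_inner[OF csubspace_set_UNIV bclinear_clinear_on[OF assms(1)]]
  show "\<forall>x\<in>UNIV. cinner (T x) y = cinner x z" unfolding iff using assms(2) by simp
  fix z' assume "\<forall>x\<in>UNIV. cinner (T x) y = cinner x z'"
  then have "inner x z' = inner x z" for x unfolding iff using assms(2) by simp
  then show "z' = z" by (metis inner_diff_right inner_eq_zero_iff right_minus_eq)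
qed

text \<open>\<open>adj\<close> is a \<open>THE\<close>, so it says nothing until a representative
  exists; Riesz provides one.\<close>

lemma inner_bounded_adj:
  assumes "bclinear T" shows "inner (T x) y = inner x (bounded_adj T y)"
proof -
  have "bounded_linear (\<lambda>x. inner (T x) y)"
    using bclinearD(1)[OF assms] by (rule bounded_linear_inner_left_comp)
  then obtain z where z: "\<And>x. inner (T x) y = inner x z" using ex1_inner_representation by blast
  then show ?thesis using bounded_adj_eqI[OF assms z] by simp
qed

lemma inner_left_eqI: "(\<And>x. inner x y = inner x z) \<Longrightarrow> y = (z::'a::real_inner)"
  by (metis inner_diff_right inner_eq_zero_iff right_minus_eq)

lemma norm_bounded_adj_le:
  assumes T: "bclinear T" and K: "0 \<le> K" "\<And>x. norm (T x) \<le> K * norm x"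
  shows "norm (bounded_adj T y) \<le> K * norm y"
proof (rule norm_le_of_inner)
  fix x
  have "\<bar>inner (bounded_adj T y) x\<bar> = \<bar>inner (T x) y\<bar>"
    by (metis inner_bounded_adj[OF T] inner_commute)
  also have "\<dots> \<le> norm (T x) * norm y" by (rule Cauchy_Schwarz_ineq2)
  also have "\<dots> \<le> K * norm x * norm y" by (intro mult_right_mono K) auto
  finally show "\<bar>inner (bounded_adj T y) x\<bar> \<le> K * norm y * norm x" by (simp add: mult_ac)
qed (use K in simp)

lemma bclinear_bounded_adj:
  assumes T: "bclinear T" shows "bclinear (bounded_adj T)"
proof -
  obtain K where K: "0 \<le> K" "\<And>x. norm (T x) \<le> norm x * K"
    using bounded_linear.nonneg_bounded[OF bclinearD(1)[OF T]] by blast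
  show ?thesis
  proof (rule bclinearI[where K = K])
    show "norm (bounded_adj T x) \<le> K * norm x" for x
      using K by (intro norm_bounded_adj_le[OF T]) (auto simp: mult.commute)
    show "bounded_adj T (x + y) = bounded_adj T x + bounded_adj T y" for x y
      by (rule bounded_adj_eqI[OF T]) (simp add: inner_add_right inner_bounded_adj[OF T])
    show "bounded_adj T (c *\<^sub>C x) = c *\<^sub>C bounded_adj T x" for c x
    proof (rule bounded_adj_eqI[OF T])
      fix w
      have "inner (T w) (c *\<^sub>C x) = inner (T (cnj c *\<^sub>C w)) x"
        using bclinearD(2)[OF T] inner_scaleC_left[of "cnj c" "T w" x] by simp
      also have "\<dots> = inner w (c *\<^sub>C bounded_adj T x)"
        using inner_bounded_adj[OF T] inner_scaleC_left[of "cnj c" w] by simp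
      finally show "inner (T w) (c *\<^sub>C x) = inner w (c *\<^sub>C bounded_adj T x)" .
    qed
  qed
qed

lemma bclinear_compose: "bclinear f \<Longrightarrow> bclinear g \<Longrightarrow> bclinear (\<lambda>x. f (g x))"
  by (auto simp: bclinear_def intro: bounded_linear_compose)

section \<open>Power integrals and convolutions\<close>

text \<open>Young's inequality for the exponents (m + 1)/m and m + 1. In the induction step the
  hypothesis is multiplied by \<open>y\<close> and combined with the nonnegative term (m + 1) x^m (x
  - y)^2.\<close>

lemma power_Suc_mult_le_weighted:
  fixes x y :: real
  assumes "0 \<le> x" "0 \<le> y"
  shows "real (Suc m) * (x ^ m * y) \<le> real m * x ^ Suc m + y ^ Suc m"
proof (induction m)
  case (Suc m)
  have "y * (real (Suc m) * (x ^ m * y)) \<le> y * (real m * x ^ Suc m + y ^ Suc m)"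
    using Suc assms by (intro mult_left_mono)
  moreover have "0 \<le> real (Suc m) * (x ^ m * (x - y)\<^sup>2)" using assms by simp
  ultimately show ?case by (simp add: algebra_simps power2_eq_square)
qed simp

lemma power_Suc_mult_le_weighted_ennreal:
  fixes x y :: ennreal
  shows "of_nat (Suc m) * (x ^ m * y) \<le> of_nat m * x ^ Suc m + y ^ Suc m"
proof (cases x; cases y)
  fix r s assume "x = ennreal r" "0 \<le> r" "y = ennreal s" "0 \<le> s"
  then show ?thesis
    using power_Suc_mult_le_weighted[of r s m]
    by (simp add: ennreal_power ennreal_mult[symmetric] ennreal_plus[symmetric]
        ennreal_of_nat_eq_real_of_nat ennreal_le_iff del: of_nat_Suc ennreal_plus)
next
  fix s assume "x = top"
  then show ?thesis by (cases "m = 0") (auto simp: ennreal_mult_top power_Suc_0)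
next
  fix r assume "y = top" 
  then show ?thesis by simp
qed (cases "m = 0", auto simp: ennreal_mult_top)

text \<open>Hoelder's inequality with exponents (m + 1)/m and m + 1, raised to the power m + 1 so
  that no roots occur. In the main case Young's inequality is integrated for the functions divided
  by their norms \<alpha> and \<beta>.\<close>

lemma nn_integral_power_Holder:
  fixes a b :: "'a \<Rightarrow> ennreal"
  assumes [measurable]: "a \<in> borel_measurable M" "b \<in> borel_measurable M"
  shows "(\<integral>\<^sup>+x. a x ^ m * b x \<partial>M) ^ Suc m \<le> (\<integral>\<^sup>+x. a x ^ Suc m \<partial>M) ^ m * (\<integral>\<^sup>+x. b x ^ Suc m \<partial>M)"
proof (cases "m = 0")
  case m: False
  let ?A = "\<integral>\<^sup>+x. a x ^ Suc m \<partial>M" and ?B = "\<integral>\<^sup>+x. b x ^ Suc m \<partial>M"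
  consider (zero) "?A = 0 \<or> ?B = 0" | (inf) "?A \<noteq> 0" "?B \<noteq> 0" "?A = top \<or> ?B = top"
    | (fin) "?A \<noteq> 0" "?B \<noteq> 0" "?A \<noteq> top" "?B \<noteq> top" by blast
  then show ?thesis
  proof cases
    \<comment> \<open>The right-hand side may be 0 times \<infinity>, which is 0, so the left
      integral itself has to vanish.\<close>
    case zero
    then have "(AE x in M. a x ^ Suc m = 0) \<or> (AE x in M. b x ^ Suc m = 0)"
      by (subst (asm) (1 2) nn_integral_0_iff_AE) auto
    then have "AE x in M. a x ^ m * b x = 0"
      using m by (elim disjE AE_mp) (auto intro!: AE_I2)
    then have "(\<integral>\<^sup>+x. a x ^ m * b x \<partial>M) = (\<integral>\<^sup>+x. 0 \<partial>M)" by (rule nn_integral_cong_AE)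
    then show ?thesis by simp
  next
    case inf
    then have "?A ^ m * ?B = top" using m by (auto simp: ennreal_mult_eq_top_iff power_eq_top_ennreal_iff)
    then show ?thesis by simp
  next
    case fin
    define \<alpha> where "\<alpha> = root (Suc m) (enn2real ?A)"
    define \<beta> where "\<beta> = root (Suc m) (enn2real ?B)"
    have Apos: "0 < enn2real ?A" and Bpos: "0 < enn2real ?B"
      using fin by (auto simp: enn2real_positive_iff less_top zero_less_iff_neq_zero)
    have pos: "0 < \<alpha>" "0 < \<beta>" using Apos Bpos by (auto simp: \<alpha>_def \<beta>_def)
    have AB: "?A = ennreal (\<alpha> ^ Suc m)" "?B = ennreal (\<beta> ^ Suc m)"
      unfolding \<alpha>_def \<beta>_def real_root_pow_pos[OF zero_less_Suc Apos] real_root_pow_pos[OF zero_less_Suc Bpos]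
      using fin by (simp_all only: ennreal_enn2real less_top)
    have inv: "ennreal (inverse \<alpha>) ^ j * ennreal \<alpha> ^ j = 1" "ennreal (inverse \<beta>) ^ j * ennreal \<beta> ^ j = 1" for j
      using pos by (simp_all add: ennreal_power ennreal_mult[symmetric] power_inverse)
    have "of_nat (Suc m) * (\<integral>\<^sup>+x. (ennreal (inverse \<alpha>) * a x) ^ m * (ennreal (inverse \<beta>) * b x) \<partial>M)
        = (\<integral>\<^sup>+x. of_nat (Suc m) * ((ennreal (inverse \<alpha>) * a x) ^ m * (ennreal (inverse \<beta>) * b x)) \<partial>M)"
      by (rule nn_integral_cmult[symmetric]) measurable
    also have "\<dots> \<le> (\<integral>\<^sup>+x. of_nat m * (ennreal (inverse \<alpha>) * a x) ^ Suc m + (ennreal (inverse \<beta>) * b x) ^ Suc m \<partial>M)"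
      by (intro nn_integral_mono power_Suc_mult_le_weighted_ennreal)
    also have "\<dots> = of_nat m * (ennreal (inverse \<alpha>) ^ Suc m * ?A) + ennreal (inverse \<beta>) ^ Suc m * ?B"
      by (simp add: nn_integral_add nn_integral_cmult power_mult_distrib del: power_Suc)
    also have "\<dots> = of_nat (Suc m)"
      unfolding AB ennreal_power[OF less_imp_le[OF pos(1)], symmetric] ennreal_power[OF less_imp_le[OF pos(2)], symmetric] inv by simp
    finally have "of_nat (Suc m) * (\<integral>\<^sup>+x. (ennreal (inverse \<alpha>) * a x) ^ m * (ennreal (inverse \<beta>) * b x) \<partial>M)
        \<le> of_nat (Suc m) * 1" by simp
    then have "(\<integral>\<^sup>+x. (ennreal (inverse \<alpha>) * a x) ^ m * (ennreal (inverse \<beta>) * b x) \<partial>M) \<le> 1"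
      by (subst (asm) ennreal_mult_le_mult_iff) (auto simp: ennreal_of_nat_eq_real_of_nat)
    moreover have "(\<integral>\<^sup>+x. (ennreal (inverse \<alpha>) * a x) ^ m * (ennreal (inverse \<beta>) * b x) \<partial>M)
        = ennreal (inverse \<alpha>) ^ m * ennreal (inverse \<beta>) * (\<integral>\<^sup>+x. a x ^ m * b x \<partial>M)"
      by (simp add: nn_integral_cmult[symmetric] power_mult_distrib mult_ac)
    ultimately have le1: "ennreal (inverse \<alpha>) ^ m * ennreal (inverse \<beta>) * (\<integral>\<^sup>+x. a x ^ m * b x \<partial>M) \<le> 1" by simp
    have "(\<integral>\<^sup>+x. a x ^ m * b x \<partial>M) = (ennreal (inverse \<alpha>) ^ m * ennreal \<alpha> ^ m) * (ennreal (inverse \<beta>) ^ 1 * ennreal \<beta> ^ 1) * (\<integral>\<^sup>+x. a x ^ m * b x \<partial>M)"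
      unfolding inv by simp
    also have "\<dots> = (ennreal \<alpha> ^ m * ennreal \<beta>) * (ennreal (inverse \<alpha>) ^ m * ennreal (inverse \<beta>) * (\<integral>\<^sup>+x. a x ^ m * b x \<partial>M))"
      by (simp add: mult_ac)
    also have "\<dots> \<le> (ennreal \<alpha> ^ m * ennreal \<beta>) * 1" by (intro mult_left_mono le1) simp
    finally have "(\<integral>\<^sup>+x. a x ^ m * b x \<partial>M) ^ Suc m \<le> (ennreal \<alpha> ^ m * ennreal \<beta>) ^ Suc m"
      by (intro power_mono_ennreal) simp
    also have "\<dots> = (ennreal \<alpha> ^ Suc m) ^ m * ennreal \<beta> ^ Suc m"
      by (metis power_mult_distrib power_mult mult.commute)
    finally show ?thesis using pos by (simp add: AB ennreal_power del: power_Suc)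
  qed
qed simp

lemma nn_integral_Cauchy_Schwarz:
  fixes a b :: "'a \<Rightarrow> ennreal"
  assumes [measurable]: "a \<in> borel_measurable M" "b \<in> borel_measurable M"
  shows "(\<integral>\<^sup>+x. a x * b x \<partial>M)\<^sup>2 \<le> (\<integral>\<^sup>+x. a x ^ 2 \<partial>M) * (\<integral>\<^sup>+x. b x ^ 2 \<partial>M)"
  using nn_integral_power_Holder[OF assms, of 1] by (simp add: numeral_2_eq_2)

text \<open>Hoelder's inequality for the measure with density \<open>k\<close>, with first factor 1;
  the mass of \<open>k\<close> is arbitrary and appears to the power \<open>m\<close>.\<close>

lemma nn_integral_power_Jensen:
  fixes a k :: "'a \<Rightarrow> ennreal"
  assumes [measurable]: "a \<in> borel_measurable M" "k \<in> borel_measurable M"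
  shows "(\<integral>\<^sup>+x. k x * a x \<partial>M) ^ Suc m \<le> (\<integral>\<^sup>+x. k x \<partial>M) ^ m * (\<integral>\<^sup>+x. k x * a x ^ Suc m \<partial>M)"
proof -
  have "(\<integral>\<^sup>+x. 1 ^ m * a x \<partial>density M k) ^ Suc m
      \<le> (\<integral>\<^sup>+x. 1 ^ Suc m \<partial>density M k) ^ m * (\<integral>\<^sup>+x. a x ^ Suc m \<partial>density M k)"
    by (rule nn_integral_power_Holder) measurable
  then show ?thesis by (simp add: nn_integral_density emeasure_density del: power_Suc)
qed

lemma add_power_le_ennreal: "(x + y :: ennreal) ^ n \<le> 2 ^ n * (x ^ n + y ^ n)"
proof -
  have "x + y \<le> 2 * max x y" by (metis add_mono max.cobounded1 max.cobounded2 mult_2)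
  then have "(x + y) ^ n \<le> (2 * max x y) ^ n" by (intro power_mono_ennreal)
  also have "\<dots> = 2 ^ n * max x y ^ n" by (simp add: power_mult_distrib)
  also have "\<dots> \<le> 2 ^ n * (x ^ n + y ^ n)" by (intro mult_left_mono) (auto simp: max_def)
  finally show ?thesis .
qed

lemma SUP_power_ennreal:
  fixes f :: "nat \<Rightarrow> ennreal"
  assumes "incseq f" shows "(SUP m. f m) ^ n \<le> (SUP m. f m ^ n)"
proof (induction n)
  case (Suc n)
  have "(SUP m. f m) ^ Suc n \<le> (SUP m. f m) * (SUP m. f m ^ n)"
    using Suc by (simp add: mult_left_mono)
  also have "\<dots> = (SUP i. SUP j. f j * f i ^ n)"
    by (simp add: SUP_mult_left_ennreal SUP_mult_right_ennreal)
  also have "\<dots> \<le> (SUP m. f m ^ Suc n)"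
  proof (intro SUP_least)
    fix i j :: nat
    have "f j * f i ^ n \<le> f (max i j) * f (max i j) ^ n"
      by (intro mult_mono power_mono_ennreal incseqD[OF assms]) auto
    also have "\<dots> \<le> (SUP m. f m ^ Suc n)" by (rule SUP_upper2[of "max i j"]) auto
    finally show "f j * f i ^ n \<le> (SUP m. f m ^ Suc n)" .
  qed
  finally show ?case .
qed simp

text \<open>Convolution over the whole line: causality is expressed by kernels that vanish at
  nonpositive times, and the adjoint is convolution with the reflected kernel.\<close>

definition conv :: "(real \<Rightarrow> ennreal) \<Rightarrow> (real \<Rightarrow> ennreal) \<Rightarrow> real \<Rightarrow> ennreal" where
  "conv k a t = (\<integral>\<^sup>+s. k (t - s) * a s \<partial>lborel)"

lemma conv_measurable [measurable]:
  assumes [measurable]: "k \<in> borel_measurable borel" "a \<in> borel_measurable borel"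
  shows "conv k a \<in> borel_measurable borel"
  unfolding conv_def by measurable

lemma nn_integral_reflect_shift:
  fixes f :: "real \<Rightarrow> ennreal"
  assumes [measurable]: "f \<in> borel_measurable borel"
  shows "(\<integral>\<^sup>+s. f (t - s) \<partial>lborel) = (\<integral>\<^sup>+s. f s \<partial>lborel)"
    "(\<integral>\<^sup>+s. f (s - t) \<partial>lborel) = (\<integral>\<^sup>+s. f s \<partial>lborel)"
  using nn_integral_real_affine[of f "-1" t] nn_integral_real_affine[of f "1" "-t"] by simp_all

lemma conv_add:
  assumes [measurable]: "k \<in> borel_measurable borel" "a \<in> borel_measurable borel" "b \<in> borel_measurable borel"
  shows "conv k (\<lambda>s. a s + b s) t = conv k a t + conv k b t"
  unfolding conv_def by (simp add: distrib_left nn_integral_add)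

lemma conv_cmult:
  assumes [measurable]: "k \<in> borel_measurable borel" "a \<in> borel_measurable borel"
  shows "conv k (\<lambda>s. c * a s) t = c * conv k a t"
  unfolding conv_def by (simp add: mult.left_commute nn_integral_cmult)

lemma conv_mono_AE:
  assumes "AE s in lborel. a s \<le> b s" shows "conv k a t \<le> conv k b t"
  unfolding conv_def by (rule nn_integral_mono_AE) (use assms in eventually_elim, simp add: mult_left_mono)

text \<open>Young's convolution inequality for an L^1 kernel: Jensen with the kernel as weight at
  each \<open>t\<close>, then Tonelli.\<close>

lemma nn_integral_conv_power_le:
  assumes [measurable]: "k \<in> borel_measurable borel" "a \<in> borel_measurable borel"
  shows "(\<integral>\<^sup>+t. conv k a t ^ Suc m \<partial>lborel)
    \<le> (\<integral>\<^sup>+s. k s \<partial>lborel) ^ Suc m * (\<integral>\<^sup>+s. a s ^ Suc m \<partial>lborel)"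
proof -
  let ?K = "\<integral>\<^sup>+s. k s \<partial>lborel"
  have "conv k a t ^ Suc m \<le> ?K ^ m * (\<integral>\<^sup>+s. k (t - s) * a s ^ Suc m \<partial>lborel)" for t
    unfolding conv_def
    using nn_integral_power_Jensen[of a lborel "\<lambda>s. k (t - s)" m]
    by (simp add: nn_integral_reflect_shift[of k] del: power_Suc)
  then have "(\<integral>\<^sup>+t. conv k a t ^ Suc m \<partial>lborel)
      \<le> (\<integral>\<^sup>+t. ?K ^ m * (\<integral>\<^sup>+s. k (t - s) * a s ^ Suc m \<partial>lborel) \<partial>lborel)"
    by (rule nn_integral_mono)
  also have "\<dots> = ?K ^ m * (\<integral>\<^sup>+t. (\<integral>\<^sup>+s. k (t - s) * a s ^ Suc m \<partial>lborel) \<partial>lborel)"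
    by (rule nn_integral_cmult) measurable
  also have "(\<integral>\<^sup>+t. (\<integral>\<^sup>+s. k (t - s) * a s ^ Suc m \<partial>lborel) \<partial>lborel)
      = (\<integral>\<^sup>+s. (\<integral>\<^sup>+t. k (t - s) * a s ^ Suc m \<partial>lborel) \<partial>lborel)"
    by (rule lborel_pair.Fubini'[symmetric]) measurable
  also have "\<dots> = (\<integral>\<^sup>+s. ?K * a s ^ Suc m \<partial>lborel)"
    by (simp add: nn_integral_multc nn_integral_reflect_shift[of k] del: power_Suc)
  also have "\<dots> = ?K * (\<integral>\<^sup>+s. a s ^ Suc m \<partial>lborel)"
    by (rule nn_integral_cmult) measurable
  finally show ?thesis by (simp add: mult_ac)
qed

text \<open>Tonelli. It serves to move the singular part of the kernel from the test control to the
  output.\<close>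

lemma nn_integral_conv_pairing:
  assumes [measurable]: "k \<in> borel_measurable borel" "a \<in> borel_measurable borel" "f \<in> borel_measurable borel"
  shows "(\<integral>\<^sup>+t. f t * conv k a t \<partial>lborel) = (\<integral>\<^sup>+s. a s * conv (\<lambda>\<tau>. k (- \<tau>)) f s \<partial>lborel)"
proof -
  have "(\<integral>\<^sup>+t. f t * conv k a t \<partial>lborel) = (\<integral>\<^sup>+t. \<integral>\<^sup>+s. f t * (k (t - s) * a s) \<partial>lborel \<partial>lborel)"
    unfolding conv_def by (simp add: nn_integral_cmult)
  also have "\<dots> = (\<integral>\<^sup>+s. \<integral>\<^sup>+t. f t * (k (t - s) * a s) \<partial>lborel \<partial>lborel)"
    by (rule lborel_pair.Fubini'[symmetric]) measurable
  also have "\<dots> = (\<integral>\<^sup>+s. \<integral>\<^sup>+t. a s * (k (- (s - t)) * f t) \<partial>lborel \<partial>lborel)"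
    by (simp add: mult_ac)
  also have "\<dots> = (\<integral>\<^sup>+s. a s * conv (\<lambda>\<tau>. k (- \<tau>)) f s \<partial>lborel)"
    unfolding conv_def by (simp add: nn_integral_cmult)
  finally show ?thesis .
qed

text \<open>The Neumann series of \<open>A\<close> applied to \<open>h\<close> dominates \<open>a\<close>; square integrability of \<open>a\<close> is only
  needed to make the remainder vanish.\<close>

lemma power_integral_bound_of_contraction:
  fixes A :: "(real \<Rightarrow> ennreal) \<Rightarrow> real \<Rightarrow> ennreal"
  assumes meas: "\<And>a. a \<in> borel_measurable borel \<Longrightarrow> A a \<in> borel_measurable borel"
    and mono: "\<And>a b t. AE s in lborel. a s \<le> b s \<Longrightarrow> A a t \<le> A b t"
    and add: "\<And>a b t. a \<in> borel_measurable borel \<Longrightarrow> b \<in> borel_measurable borel \<Longrightarrow>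
      A (\<lambda>s. a s + b s) t = A a t + A b t"
    and bound: "\<And>a m. a \<in> borel_measurable borel \<Longrightarrow> m \<in> {2, n} \<Longrightarrow>
      (\<integral>\<^sup>+t. A a t ^ m \<partial>lborel) \<le> ennreal (1/4) ^ m * (\<integral>\<^sup>+s. a s ^ m \<partial>lborel)"
    and n: "1 \<le> n"
    and [measurable]: "a \<in> borel_measurable borel" "h \<in> borel_measurable borel"
    and le: "AE t in lborel. a t \<le> h t + A a t"
    and fin: "\<And>t. a t < top" and L2: "(\<integral>\<^sup>+s. a s ^ 2 \<partial>lborel) < top"
  shows "(\<integral>\<^sup>+s. a s ^ n \<partial>lborel) \<le> 2 ^ (n + 1) * (\<integral>\<^sup>+s. h s ^ n \<partial>lborel)"
proof -
  \<comment> \<open>Partial sums of the Neumann series, in Horner form.\<close>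
  define S where "S = rec_nat (\<lambda>_. 0) (\<lambda>_ f t. h t + A f t)"
  have S_0: "S 0 = (\<lambda>_. 0)" and S_Suc: "S (Suc m) = (\<lambda>t. h t + A (S m) t)" for m
    by (simp_all add: S_def)
  have S_meas [measurable]: "S m \<in> borel_measurable borel" for m
  proof (induction m)
    case (Suc m)
    note [measurable] = meas[OF Suc]
    show ?case unfolding S_Suc by measurable
  qed (simp add: S_0)
  have r_meas [measurable]: "(A ^^ m) a \<in> borel_measurable borel" for m
    by (induction m) (simp_all add: meas)
  have S_mono: "S m t \<le> S (Suc m) t" for m t
  proof (induction m arbitrary: t)
    case (Suc m)
    then show ?case unfolding S_Suc[of "Suc m"] S_Suc[of m] 
      by (intro add_left_mono mono AE_I2) (simp add: S_Suc[symmetric])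
  qed (simp add: S_0)
  have inc: "incseq (\<lambda>m. S m t)" for t by (intro incseq_SucI S_mono)
  \<comment> \<open>Iterating the inequality leaves the remainder \<open>(A ^^ m) a\<close>, whose
    L^2 norm decays like 4^(-m).\<close>
  have rem: "AE t in lborel. a t \<le> S m t + (A ^^ m) a t" for m
  proof (induction m)
    case (Suc m)
    have A_le: "A a t \<le> A (S m) t + A ((A ^^ m) a) t" for t
      using mono[OF Suc] add[of "S m" "(A ^^ m) a"] by simp
    show ?case using le unfolding S_Suc
    proof (eventually_elim)
      case (elim t)
      then have "a t \<le> h t + (A (S m) t + A ((A ^^ m) a) t)" using A_le[of t] by (meson add_left_mono order_trans)
      then show ?case by (simp add: add.assoc)
    qed
  qed (simp add: S_0)
  have r_int: "(\<integral>\<^sup>+s. (A ^^ m) a s ^ 2 \<partial>lborel) \<le> ennreal ((1/16) ^ m) * (\<integral>\<^sup>+s. a s ^ 2 \<partial>lborel)" for m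
  proof (induction m)
    case (Suc m)
    have "(\<integral>\<^sup>+s. (A ^^ Suc m) a s ^ 2 \<partial>lborel) \<le> ennreal (1/4) ^ 2 * (\<integral>\<^sup>+s. (A ^^ m) a s ^ 2 \<partial>lborel)"
      using bound[of "(A ^^ m) a" 2] by simp
    also have "\<dots> \<le> ennreal (1/4) ^ 2 * (ennreal ((1/16) ^ m) * (\<integral>\<^sup>+s. a s ^ 2 \<partial>lborel))"
      by (intro mult_left_mono Suc) simp
    also have "\<dots> = ennreal ((1/16) ^ Suc m) * (\<integral>\<^sup>+s. a s ^ 2 \<partial>lborel)"
      by (simp add: ennreal_power ennreal_mult[symmetric] mult.assoc[symmetric] power2_eq_square)
    finally show ?case .
  qed simp
  define Sup_S where "Sup_S t = (SUP m. S m t)" for t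
  have [measurable]: "Sup_S \<in> borel_measurable borel" unfolding Sup_S_def by measurable
  \<comment> \<open>Subtraction in \<open>ennreal\<close> is truncated at 0, so this integral
    measures only the excess of \<open>a\<close> over the series; letting \<open>m\<close> grow
    shows that it is 0.\<close>
  have "(\<integral>\<^sup>+t. (a t - Sup_S t)\<^sup>2 \<partial>lborel) \<le> ennreal ((1/16) ^ m) * (\<integral>\<^sup>+s. a s ^ 2 \<partial>lborel)" for m
  proof -
    have "AE t in lborel. (a t - Sup_S t)\<^sup>2 \<le> (A ^^ m) a t ^ 2"
      using rem[of m]
    proof (eventually_elim)
      case (elim t)
      have "S m t \<le> Sup_S t" unfolding Sup_S_def by (rule SUP_upper) simp
      then have "a t \<le> Sup_S t + (A ^^ m) a t" using elim by (meson add_right_mono order_trans)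
      then have "a t - Sup_S t \<le> (A ^^ m) a t"
        using fin[of t] by (auto simp: ennreal_minus_le_iff)
      then show ?case by (rule power_mono_ennreal)
    qed
    then show ?thesis by (rule order_trans[OF nn_integral_mono_AE r_int])
  qed
  moreover have "(\<lambda>m. ennreal ((1/16) ^ m) * (\<integral>\<^sup>+s. a s ^ 2 \<partial>lborel)) \<longlonglongrightarrow> ennreal 0 * (\<integral>\<^sup>+s. a s ^ 2 \<partial>lborel)"
    using L2 by (intro tendsto_mult_ennreal tendsto_ennrealI LIMSEQ_power_zero tendsto_const) (auto simp: less_top)
  ultimately have "(\<integral>\<^sup>+t. (a t - Sup_S t)\<^sup>2 \<partial>lborel) \<le> ennreal 0 * (\<integral>\<^sup>+s. a s ^ 2 \<partial>lborel)"
    by (intro LIMSEQ_le_const) auto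
  then have "(\<integral>\<^sup>+t. (a t - Sup_S t)\<^sup>2 \<partial>lborel) = 0" by simp
  then have "AE t in lborel. a t \<le> Sup_S t"
    by (subst (asm) nn_integral_0_iff_AE) (auto dest: ennreal_minus_eq_0)
  then have "(\<integral>\<^sup>+t. a t ^ n \<partial>lborel) \<le> (\<integral>\<^sup>+t. Sup_S t ^ n \<partial>lborel)"
    by (intro nn_integral_mono_AE) (auto intro: power_mono_ennreal)
  also have "\<dots> \<le> (\<integral>\<^sup>+t. (SUP m. S m t ^ n) \<partial>lborel)"
    unfolding Sup_S_def by (intro nn_integral_mono SUP_power_ennreal inc)
  also have "\<dots> = (SUP m. \<integral>\<^sup>+t. S m t ^ n \<partial>lborel)"
    by (intro nn_integral_monotone_convergence_SUP)
      (auto intro!: incseq_SucI le_funI power_mono_ennreal S_mono)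
  also have "\<dots> \<le> 2 ^ (n + 1) * (\<integral>\<^sup>+s. h s ^ n \<partial>lborel)"
  proof (rule SUP_least)
    let ?H = "\<integral>\<^sup>+s. h s ^ n \<partial>lborel"
    fix m show "(\<integral>\<^sup>+t. S m t ^ n \<partial>lborel) \<le> 2 ^ (n + 1) * ?H"
    \<comment> \<open>The constant 2^(n+1) reproduces itself: 2^n (H + 4^(-n) 2^(n+1) H) = 2^n H + 2
      H, and 2 \<le> 2^n because n \<ge> 1.\<close>
    proof (induction m)
      case (Suc m)
      have "(\<integral>\<^sup>+t. S (Suc m) t ^ n \<partial>lborel) \<le> (\<integral>\<^sup>+t. 2 ^ n * (h t ^ n + A (S m) t ^ n) \<partial>lborel)"
        unfolding S_Suc by (intro nn_integral_mono add_power_le_ennreal)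
      also have "\<dots> = 2 ^ n * (?H + (\<integral>\<^sup>+t. A (S m) t ^ n \<partial>lborel))"
        using meas[OF S_meas] by (simp add: nn_integral_cmult nn_integral_add)
      also have "\<dots> \<le> 2 ^ n * (?H + ennreal (1/4) ^ n * (2 ^ (n + 1) * ?H))"
        using bound[OF S_meas, of n m] Suc by (intro mult_left_mono add_left_mono) (auto elim!: order_trans intro: mult_left_mono)
      also have "\<dots> = 2 ^ n * ?H + 2 * ((2 ^ n * ennreal (1/4) ^ n * 2 ^ n) * ?H)"
        by (simp add: algebra_simps)
      also have "2 ^ n * ennreal (1/4) ^ n * 2 ^ n = 1"
      proof -
        have "2 ^ n * ennreal (1/4) ^ n * 2 ^ n = (2 * ennreal (1/4) * 2) ^ n" by (simp add: power_mult_distrib)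
        also have "2 * ennreal (1/4) * 2 = ennreal (2 * (1/4) * 2)"
          by (metis ennreal_mult' ennreal_numeral zero_le_numeral mult.commute)
        finally show ?thesis by simp
      qed
      also have "2 ^ n * ?H + 2 * (1 * ?H) \<le> 2 ^ n * ?H + 2 ^ n * ?H"
      proof -
        have "(2::ennreal) ^ 1 \<le> 2 ^ n" using n by (intro power_increasing) auto
        then show ?thesis by (intro add_left_mono) (simp add: mult_right_mono)
      qed
      also have "\<dots> = 2 ^ (n + 1) * ?H" by (simp add: mult_2 distrib_right)
      finally show ?case .
    qed (use n in \<open>simp add: S_0 power_0_left\<close>)
  qed
  finally show ?thesis .
qed

section \<open>Exponentially stable semigroups and fractional powers\<close>

text \<open>Scaling by \<open>r\<close> reduces the integral to the Beta integral on (0,1). It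
  evaluates the inner integral in the semigroup law of the fractional powers.\<close>

lemma Beta_integral_scaled:
  fixes a b r :: real
  assumes ab: "0 < a" "0 < b" and r: "0 < r"
  shows "has_bochner_integral lborel (\<lambda>t. indicator {0<..<r} t * (t powr (a - 1) * (r - t) powr (b - 1)))
    (r powr (a + b - 1) * Beta a b)"
proof -
  let ?g = "\<lambda>t. indicator {0<..<1} t * (t powr (a - 1) * (1 - t) powr (b - 1)) :: real"
  have eq: "AE t in lborel. indicator {0..1} t *\<^sub>R (t powr (a - 1) * (1 - t) powr (b - 1)) = ?g t"
    using AE_lborel_singleton[of 0] AE_lborel_singleton[of 1] by eventually_elim (auto simp: indicator_def)
  have g: "has_bochner_integral lborel ?g (Beta a b)"
  proof -
    have "(LINT t:{0..1}|lborel. t powr (a - 1) * (1 - t) powr (b - 1)) = Beta a b"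
      using set_borel_integral_eq_integral(2)[OF integrable_Beta[OF ab]] has_integral_Beta_real[OF ab]
      by (simp add: integral_unique)
    then have "has_bochner_integral lborel (\<lambda>t. indicator {0..1} t *\<^sub>R (t powr (a - 1) * (1 - t) powr (b - 1))) (Beta a b)"
      using integrable_Beta[OF ab] unfolding set_integrable_def set_lebesgue_integral_def
      by (simp add: has_bochner_integral_iff)
    then show ?thesis
      by (subst (asm) has_bochner_integral_cong_AE[OF _ _ eq]) auto
  qed
  let ?f = "\<lambda>t. indicator {0<..<r} t * (t powr (a - 1) * (r - t) powr (b - 1)) :: real"
  have f: "?f (0 + r * t) = r powr (a + b - 2) * ?g t" for t
  proof (cases "0 < t \<and> t < 1")
    case True
    have rr: "r powr (a - 1) * r powr (b - 1) = r powr (a + b - 2)"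
      by (simp add: powr_add[symmetric])
    have "r - r * t = r * (1 - t)" by (simp add: algebra_simps)
    then have "(r * t) powr (a - 1) * (r - r * t) powr (b - 1)
        = (r powr (a - 1) * r powr (b - 1)) * (t powr (a - 1) * (1 - t) powr (b - 1))"
      using r True by (simp add: powr_mult)
    then show ?thesis using True r unfolding rr by simp
  next
    case False
    then show ?thesis using r by (auto simp: indicator_def zero_less_mult_iff)
  qed
  have int: "integrable lborel ?f"
    using lborel_integrable_real_affine_iff[of r ?f 0] r g unfolding f
    by (simp add: has_bochner_integral_iff)
  have "integral\<^sup>L lborel ?f = r * (r powr (a + b - 2) * Beta a b)"
    using lborel_integral_real_affine[of r ?f 0] r g unfolding f by (simp add: has_bochner_integral_iff)
  also have "\<dots> = r powr 1 * r powr (a + b - 2) * Beta a b" using r by simp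
  also have "\<dots> = r powr (a + b - 1) * Beta a b" by (simp only: powr_add[symmetric]) simp
  finally show ?thesis using int by (simp add: has_bochner_integral_iff)
qed

text \<open>The norm of the complex Gamma integrand is this real function, so absolute integrability
  carries over.\<close>

lemma integrable_powr_exp:
  assumes "0 < a" "0 < \<omega>"
  shows "set_integrable lborel {0<..} (\<lambda>t::real. t powr (a - 1) * exp (- \<omega> * t))"
proof -
  have "(\<lambda>t. complex_of_real t powr (of_real a - 1) / of_real (exp (\<omega> * t))) absolutely_integrable_on {0<..}"
    using assms by (intro absolutely_integrable_Gamma_integral) auto
  then have "(\<lambda>t. norm (complex_of_real t powr (of_real a - 1) / of_real (exp (\<omega> * t)))) absolutely_integrable_on {0<..}"
    by (rule set_integrable_norm)
  moreover have "(\<lambda>t. indicat_real {0<..} t *\<^sub>R norm (complex_of_real t powr (of_real a - 1) / of_real (exp (\<omega> * t))))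
      = (\<lambda>t. indicat_real {0<..} t *\<^sub>R (t powr (a - 1) * exp (- \<omega> * t)))"
    by (rule ext) (auto simp: norm_divide norm_powr_real_powr exp_minus field_simps indicator_def)
  ultimately have "integrable lebesgue (\<lambda>t. indicat_real {0<..} t *\<^sub>R (t powr (a - 1) * exp (- \<omega> * t)))"
    unfolding set_integrable_def by (simp only:)
  then show ?thesis unfolding set_integrable_def by (subst (asm) integrable_completion) auto
qed

locale stable_semigroup =
  fixes S :: "real \<Rightarrow> 'y::separable_complex_hilbert \<Rightarrow> 'y" and M \<omega> :: real
  assumes semigroup: "C0_semigroup S" and M_ge: "1 \<le> M" and \<omega>_pos: "0 < \<omega>"
    and stable: "\<And>t x. 0 \<le> t \<Longrightarrow> norm (S t x) \<le> M * exp (- \<omega> * t) * norm x"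
begin

lemma bclinear_S: "0 \<le> t \<Longrightarrow> bclinear (S t)"
  and S_zero: "S 0 x = x"
  and S_add: "0 \<le> s \<Longrightarrow> 0 \<le> t \<Longrightarrow> S (s + t) x = S s (S t x)"
  and S_tendsto: "((\<lambda>t. S t x) \<longlongrightarrow> x) (at_right 0)"
  using semigroup by (auto simp: C0_semigroup_def bounded_op_UNIV_iff)

lemma norm_S_le: "0 \<le> t \<Longrightarrow> norm (S t x) \<le> M * norm x"
proof -
  assume t: "0 \<le> t"
  have "M * exp (- \<omega> * t) * norm x \<le> M * 1 * norm x"
    using M_ge \<omega>_pos t by (intro mult_right_mono mult_left_mono) auto
  then show ?thesis using stable[OF t, of x] by simp
qed

text \<open>Only right continuity at 0 is given. Two times are compared through the smaller one, S t
  x - S s x = S s (S (t - s) x - x), and the uniform bound \<open>M\<close> covers both sides of a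
  time at once.\<close>

lemma continuous_on_S: "continuous_on {0..} (\<lambda>t. S t x)"
proof -
  have diff: "norm (S t x - S s x) \<le> M * norm (S (t - s) x - x)" if "0 \<le> s" "s \<le> t" for s t
  proof -
    have "S t x - S s x = S s (S (t - s) x - x)"
      using S_add[of s "t - s" x] that bclinearD(1)[OF bclinear_S[OF that(1)]]
      by (simp add: linear_diff bounded_linear.linear)
    then show ?thesis using norm_S_le[OF that(1)] by simp
  qed
  show ?thesis
    unfolding continuous_on_iff
  proof (intro ballI allI impI)
    fix t e :: real assume t: "t \<in> {0..}" and e: "0 < e"
    have "eventually (\<lambda>h. dist (S h x) x < e / M) (at_right 0)"
      using S_tendsto[of x] M_ge e by (intro tendstoD) auto
    then obtain d where d: "0 < d" "\<And>h. 0 < h \<Longrightarrow> h < d \<Longrightarrow> dist (S h x) x < e / M"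
      unfolding eventually_at_right_field by auto
    have close: "dist (S v x) (S u x) < e" if "0 \<le> u" "u \<le> v" "v - u < d" for u v
    proof (cases "u = v")
      case False
      then have "norm (S (v - u) x - x) < e / M" using d(2)[of "v - u"] that by (simp add: dist_norm)
      then have "M * norm (S (v - u) x - x) < e" using M_ge by (simp add: pos_less_divide_eq mult.commute)
      then show ?thesis using diff[OF that(1,2)] by (simp add: dist_norm)
    qed (use e in simp)
    show "\<exists>d>0. \<forall>t'\<in>{0..}. dist t' t < d \<longrightarrow> dist (S t' x) (S t x) < e"
    proof (intro exI[of _ d] conjI d(1) ballI impI)
      fix t' :: real assume t': "t' \<in> {0..}" "dist t' t < d"
      show "dist (S t' x) (S t x) < e"
        using close[of t t'] close[of t' t] t t' by (cases "t \<le> t'") (auto simp: dist_real_def dist_commute)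
    qed
  qed
qed

lemma borel_measurable_S [measurable]:
  "(\<lambda>t. indicator {0<..} t *\<^sub>R S t x) \<in> borel_measurable borel"
  by (intro borel_measurable_continuous_on_indicator continuous_on_subset[OF continuous_on_S]) auto

lemma set_integrable_weighted:
  assumes "set_integrable lborel {0<..} (\<lambda>t. w t * exp (- \<omega> * t))"
    and [measurable]: "w \<in> borel_measurable borel"
  shows "set_integrable lborel {0<..} (\<lambda>t. w t *\<^sub>R S t x)"
  unfolding set_integrable_def
proof (rule Bochner_Integration.integrable_bound)
  show "integrable lborel (\<lambda>t. (indicator {0<..} t *\<^sub>R (w t * exp (- \<omega> * t))) * (M * norm x))"
    using assms(1) unfolding set_integrable_def by (rule integrable_mult_left)
  have "(\<lambda>t. w t *\<^sub>R (indicator {0<..} t *\<^sub>R S t x)) \<in> borel_measurable lborel" by measurable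
  then show "(\<lambda>t. indicator {0<..} t *\<^sub>R w t *\<^sub>R S t x) \<in> borel_measurable lborel"
    by (simp add: mult.commute)
  show "AE t in lborel. norm (indicator {0<..} t *\<^sub>R w t *\<^sub>R S t x)
      \<le> norm ((indicator {0<..} t *\<^sub>R (w t * exp (- \<omega> * t))) * (M * norm x))"
  proof (rule AE_I2)
    fix t :: real
    show "norm (indicator {0<..} t *\<^sub>R w t *\<^sub>R S t x)
      \<le> norm ((indicator {0<..} t *\<^sub>R (w t * exp (- \<omega> * t))) * (M * norm x))"
    proof (cases "0 < t")
      case True
      then have "\<bar>w t\<bar> * norm (S t x) \<le> \<bar>w t\<bar> * (M * exp (- \<omega> * t) * norm x)"
        by (intro mult_left_mono stable) auto
      then show ?thesis using True M_ge by (simp add: abs_mult mult_ac)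
    qed simp
  qed
qed

lemma set_integrable_frac:
  "0 < a \<Longrightarrow> set_integrable lborel {0<..} (\<lambda>t. t powr (a - 1) *\<^sub>R S t x)"
  by (rule set_integrable_weighted[OF integrable_powr_exp[OF _ \<omega>_pos]]) auto

lemma frac_neg_pow_eq:
  assumes "0 < a"
  shows "frac_neg_pow S a x = (1 / Gamma a) *\<^sub>R (LINT t:{0<..}|lborel. t powr (a - 1) *\<^sub>R S t x)"
  using set_integrable_frac[OF assms, of x]
  unfolding frac_neg_pow_def set_lebesgue_integral_def set_integrable_def
  by (simp add: integral_completion)

lemma inner_frac_neg_pow:
  assumes "0 < a"
  shows "inner (frac_neg_pow S a x) y = (1 / Gamma a) * (LINT t|lborel. indicator {0<..} t * (t powr (a - 1) * inner (S t x) y))"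
proof -
  have "inner (LINT t:{0<..}|lborel. t powr (a - 1) *\<^sub>R S t x) y
      = (LINT t|lborel. inner (indicator {0<..} t *\<^sub>R t powr (a - 1) *\<^sub>R S t x) y)"
    using set_integrable_frac[OF assms] unfolding set_lebesgue_integral_def set_integrable_def
    by (rule integral_inner_left[symmetric])
  then show ?thesis by (simp add: frac_neg_pow_eq[OF assms] mult.assoc)
qed

lemma bclinear_frac_neg_pow:
  assumes a: "0 < a"
  shows "bclinear (frac_neg_pow S a)"
proof -
  note int = set_integrable_frac[OF a, unfolded set_integrable_def]
  note eq = frac_neg_pow_eq[OF a, unfolded set_lebesgue_integral_def]
  have G: "0 < Gamma a" using a by (rule Gamma_real_pos)
  have pos: "t \<in> {0<..} \<Longrightarrow> 0 \<le> t" for t :: real by simp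
  have lin: "S t (x + y) = S t x + S t y" "S t (c *\<^sub>C x) = c *\<^sub>C S t x" if "0 \<le> t" for t x y c
    using bclinear_S[OF that] by (auto simp: bclinear_def linear_add bounded_linear.linear)
  have bl: "bounded_linear (\<lambda>x::'y. c *\<^sub>C x)" for c by (rule bounded_linear_scaleC)
  note scR = linear_scale[OF bounded_linear.linear[OF bl]]
  show ?thesis
  proof (rule bclinearI)
    fix x y
    have "(LINT t|lborel. indicator {0<..} t *\<^sub>R t powr (a - 1) *\<^sub>R S t (x + y))
        = (LINT t|lborel. indicator {0<..} t *\<^sub>R t powr (a - 1) *\<^sub>R S t x + indicator {0<..} t *\<^sub>R t powr (a - 1) *\<^sub>R S t y)"
      by (intro Bochner_Integration.integral_cong refl) (auto simp: indicator_def lin scaleR_add_right)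
    then show "frac_neg_pow S a (x + y) = frac_neg_pow S a x + frac_neg_pow S a y"
      unfolding eq by (simp only: Bochner_Integration.integral_add[OF int int] scaleR_add_right)
  next
    fix c x
    have "(LINT t|lborel. indicator {0<..} t *\<^sub>R t powr (a - 1) *\<^sub>R S t (c *\<^sub>C x))
        = (LINT t|lborel. c *\<^sub>C (indicator {0<..} t *\<^sub>R t powr (a - 1) *\<^sub>R S t x))"
      by (intro Bochner_Integration.integral_cong refl) (auto simp: indicator_def lin scR)
    also have "\<dots> = c *\<^sub>C (LINT t|lborel. (indicator {0<..} t *\<^sub>R t powr (a - 1) *\<^sub>R S t x))"
      by (rule integral_bounded_linear[OF bl int])
    finally show "frac_neg_pow S a (c *\<^sub>C x) = c *\<^sub>C frac_neg_pow S a x"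
      unfolding eq by (simp add: scR)
  next
    fix x
    let ?W = "LINT t|lborel. indicator {0<..} t *\<^sub>R (t powr (a - 1) * exp (- \<omega> * t))"
    have W: "integrable lborel (\<lambda>t. indicator {0<..} t *\<^sub>R (t powr (a - 1) * exp (- \<omega> * t)))"
      using integrable_powr_exp[OF a \<omega>_pos] by (simp add: set_integrable_def)
    have "norm (LINT t|lborel. indicator {0<..} t *\<^sub>R t powr (a - 1) *\<^sub>R S t x)
        \<le> (LINT t|lborel. (indicator {0<..} t *\<^sub>R (t powr (a - 1) * exp (- \<omega> * t))) * (M * norm x))"
    proof (rule Bochner_Integration.integral_norm_bound_integral[OF int integrable_mult_left[OF W]])
      fix t :: real
      show "norm (indicator {0<..} t *\<^sub>R t powr (a - 1) *\<^sub>R S t x)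
          \<le> (indicator {0<..} t *\<^sub>R (t powr (a - 1) * exp (- \<omega> * t))) * (M * norm x)"
      proof (cases "0 < t")
        case True
        then have "t powr (a - 1) * norm (S t x) \<le> t powr (a - 1) * (M * exp (- \<omega> * t) * norm x)"
          by (intro mult_left_mono stable) auto
        then show ?thesis using True by (simp add: mult_ac)
      qed simp
    qed
    also have "\<dots> = ?W * (M * norm x)" by (rule Bochner_Integration.integral_mult_left) (rule W)
    finally show "norm (frac_neg_pow S a x) \<le> (1 / Gamma a) * ?W * M * norm x"
      unfolding eq using G by (simp add: divide_right_mono mult_ac)
  qed
qed

lemma frac_neg_pow_S:
  assumes a: "0 < a" and s: "0 \<le> s"
  shows "frac_neg_pow S a (S s x) = S s (frac_neg_pow S a x)"
proof -
  note int = set_integrable_frac[OF a, unfolded set_integrable_def]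
  note eq = frac_neg_pow_eq[OF a, unfolded set_lebesgue_integral_def]
  have bl: "bounded_linear (S s)" using bclinear_S[OF s] by (rule bclinearD)
  note scR = linear_scale[OF bounded_linear.linear[OF bl]]
  have "(LINT t|lborel. indicator {0<..} t *\<^sub>R t powr (a - 1) *\<^sub>R S t (S s x))
     = (LINT t|lborel. S s (indicator {0<..} t *\<^sub>R t powr (a - 1) *\<^sub>R S t x))"
    using s by (intro Bochner_Integration.integral_cong refl)
      (auto simp: indicator_def scR S_add[symmetric] add.commute linear_0[OF bounded_linear.linear[OF bl]])
  also have "\<dots> = S s (LINT t|lborel. indicator {0<..} t *\<^sub>R t powr (a - 1) *\<^sub>R S t x)"
    by (rule integral_bounded_linear[OF bl int])
  finally show ?thesis unfolding eq by (simp add: scR)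
qed

text \<open>With r = t + s the double integral becomes the integral of S r x against the Beta
  integral of t^(a-1) (r - t)^(b-1), and Beta a b = \<Gamma>(a) \<Gamma>(b) / \<Gamma>(a + b)
  adjusts the constants. Pairing with a fixed \<open>y\<close> leaves scalar integrals for
  Fubini.\<close>

lemma frac_neg_pow_add:
  assumes a: "0 < a" and b: "0 < b"
  shows "frac_neg_pow S a (frac_neg_pow S b x) = frac_neg_pow S (a + b) x"
proof (rule inner_left_eqI)
  fix y
  define f where "f r = indicator {0<..} r * inner (S r x) y" for r :: real
  have f_meas [measurable]: "f \<in> borel_measurable borel"
  proof -
    have "f = (\<lambda>r. inner (indicator {0<..} r *\<^sub>R S r x) y)" by (simp add: f_def fun_eq_iff)
    moreover have "(\<lambda>r. inner (indicator {0<..} r *\<^sub>R S r x) y) \<in> borel_measurable borel" by measurable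
    ultimately show ?thesis by (simp only:)
  qed
  have f_bound: "\<bar>f r\<bar> \<le> exp (- \<omega> * r) * (M * norm x * norm y)" for r
  proof (cases "0 < r")
    case True
    have "\<bar>inner (S r x) y\<bar> \<le> norm (S r x) * norm y" by (rule Cauchy_Schwarz_ineq2)
    also have "\<dots> \<le> (M * exp (- \<omega> * r) * norm x) * norm y"
      using True by (intro mult_right_mono stable) auto
    finally show ?thesis using True by (simp add: f_def mult_ac)
  qed (use M_ge in \<open>simp add: f_def\<close>)
  \<comment> \<open>The integrand in the variables r = t + s and t; the indicator encodes t > 0 and
    s > 0.\<close>
  define h where "h r t = indicator {0<..<r} t * (t powr (a - 1) * (r - t) powr (b - 1)) * f r" for r t :: real
  have h_bochner: "has_bochner_integral lborel (h r) (r powr (a + b - 1) * Beta a b * f r)"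
    "has_bochner_integral lborel (\<lambda>t. norm (h r t)) (r powr (a + b - 1) * Beta a b * \<bar>f r\<bar>)" for r
  proof -
    show "has_bochner_integral lborel (h r) (r powr (a + b - 1) * Beta a b * f r)"
    proof (cases "0 < r")
      case True
      then show ?thesis unfolding h_def
        by (intro has_bochner_integral_mult_left Beta_integral_scaled a b)
    qed (simp add: h_def[abs_def] f_def has_bochner_integral_zero)
    have "(\<lambda>t. norm (h r t)) = (\<lambda>t. indicator {0<..<r} t * (t powr (a - 1) * (r - t) powr (b - 1)) * \<bar>f r\<bar>)"
      by (auto simp: h_def fun_eq_iff abs_mult indicator_def)
    note norm_h = this
    show "has_bochner_integral lborel (\<lambda>t. norm (h r t)) (r powr (a + b - 1) * Beta a b * \<bar>f r\<bar>)"
    proof (cases "0 < r")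
      case True
      then show ?thesis unfolding norm_h
        by (intro has_bochner_integral_mult_left Beta_integral_scaled a b)
    qed (simp add: h_def[abs_def] f_def has_bochner_integral_zero)
  qed
  have h_meas: "case_prod h \<in> borel_measurable (lborel \<Otimes>\<^sub>M lborel)"
  proof -
    have [measurable]: "Measurable.pred (borel \<Otimes>\<^sub>M borel) (\<lambda>z::real\<times>real. snd z \<in> {0<..<fst z})"
      unfolding greaterThanLessThan_iff by measurable
    have "case_prod h = (\<lambda>z. (if snd z \<in> {0<..<fst z} then 1 else 0) * (snd z powr (a - 1) * (fst z - snd z) powr (b - 1)) * f (fst z))"
      by (auto simp: h_def fun_eq_iff indicator_def)
    then show ?thesis by simp
  qed
  have h_int: "integrable (lborel \<Otimes>\<^sub>M lborel) (case_prod h)"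
  proof (rule lborel_pair.Fubini_integrable[OF h_meas])
    show "integrable lborel (\<lambda>r. LINT t|lborel. norm (case_prod h (r, t)))"
    proof (rule Bochner_Integration.integrable_bound)
      show "integrable lborel (\<lambda>r. indicator {0<..} r *\<^sub>R (r powr ((a + b) - 1) * exp (- \<omega> * r)) * (Beta a b * (M * norm x * norm y)))"
        using integrable_powr_exp[of "a + b" \<omega>] a b \<omega>_pos unfolding set_integrable_def by (intro integrable_mult_left) auto
      have "(\<lambda>r. LINT t|lborel. norm (case_prod h (r, t))) = (\<lambda>r. r powr (a + b - 1) * Beta a b * \<bar>f r\<bar>)"
        using h_bochner(2) by (simp add: has_bochner_integral_iff)
      then show "(\<lambda>r. LINT t|lborel. norm (case_prod h (r, t))) \<in> borel_measurable lborel"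
        "AE r in lborel. norm (LINT t|lborel. norm (case_prod h (r, t))) \<le>
          norm (indicator {0<..} r *\<^sub>R (r powr ((a + b) - 1) * exp (- \<omega> * r)) * (Beta a b * (M * norm x * norm y)))"
      proof (simp, intro AE_I2)
        fix r :: real
        have "r powr (a + b - 1) * Beta a b * \<bar>f r\<bar>
            \<le> r powr (a + b - 1) * Beta a b * (exp (- \<omega> * r) * (M * norm x * norm y))" if "0 < r"
          using a b f_bound by (intro mult_left_mono) (auto simp: Beta_def Gamma_real_pos less_imp_le)
        then show "norm (LINT t|lborel. norm (case_prod h (r, t))) \<le>
          norm (indicator {0<..} r *\<^sub>R (r powr ((a + b) - 1) * exp (- \<omega> * r)) * (Beta a b * (M * norm x * norm y)))"
          using h_bochner(2)[of r] a b M_ge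
          by (cases "0 < r") (auto simp: has_bochner_integral_iff f_def abs_mult mult_ac Beta_def Gamma_real_pos less_imp_le)
      qed
    qed
    show "AE r in lborel. integrable lborel (\<lambda>t. case_prod h (r, t))"
      using h_bochner(1) by (auto simp: has_bochner_integral_iff)
  qed
  have inner_b: "indicator {0<..} t * (t powr (a - 1) * inner (S t (frac_neg_pow S b x)) y)
      = (1 / Gamma b) * (LINT r|lborel. h r t)" for t
  proof (cases "0 < t")
    case t: True
    have "inner (S t (frac_neg_pow S b x)) y = (1 / Gamma b) * (LINT s|lborel. indicator {0<..} s * (s powr (b - 1) * inner (S s (S t x)) y))"
      using t by (simp add: frac_neg_pow_S[symmetric] b inner_frac_neg_pow)
    also have "(LINT s|lborel. indicator {0<..} s * (s powr (b - 1) * inner (S s (S t x)) y))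
        = (LINT s|lborel. indicator {0<..} s * (s powr (b - 1) * f (t + s)))"
      using t by (intro Bochner_Integration.integral_cong refl) (auto simp: indicator_def f_def S_add[symmetric] add.commute)
    also have "\<dots> = (LINT r|lborel. indicator {0<..} (- t + r) * ((- t + r) powr (b - 1) * f r))"
      using lborel_integral_real_affine[of 1 "\<lambda>r. indicator {0<..} (- t + r) * ((- t + r) powr (b - 1) * f r)" t] by simp
    finally have "indicator {0<..} t * (t powr (a - 1) * inner (S t (frac_neg_pow S b x)) y)
        = (1 / Gamma b) * (t powr (a - 1) * (LINT r|lborel. indicator {0<..} (- t + r) * ((- t + r) powr (b - 1) * f r)))"
      using t by simp
    also have "t powr (a - 1) * (LINT r|lborel. indicator {0<..} (- t + r) * ((- t + r) powr (b - 1) * f r))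
       = (LINT r|lborel. t powr (a - 1) * (indicator {0<..} (- t + r) * ((- t + r) powr (b - 1) * f r)))"
      by (rule Bochner_Integration.integral_mult_right_zero[symmetric])
    also have "\<dots> = (LINT r|lborel. h r t)"
      using t by (intro Bochner_Integration.integral_cong refl) (auto simp: h_def indicator_def)
    finally show ?thesis .
  next
    case False
    then show ?thesis by (simp add: h_def)
  qed
  have "inner (frac_neg_pow S a (frac_neg_pow S b x)) y = (1 / Gamma a) * (1 / Gamma b) * (LINT t|lborel. LINT r|lborel. h r t)"
    by (simp add: inner_frac_neg_pow[OF a] inner_b)
  also have "(LINT t|lborel. LINT r|lborel. h r t) = (LINT r|lborel. LINT t|lborel. h r t)"
    by (rule lborel_pair.Fubini_integral[OF h_int])
  also have "\<dots> = (LINT r|lborel. Beta a b * (indicator {0<..} r * (r powr (a + b - 1) * inner (S r x) y)))"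
    using h_bochner(1) by (intro Bochner_Integration.integral_cong refl) (auto simp: has_bochner_integral_iff f_def)
  also have "\<dots> = Beta a b * (LINT r|lborel. (indicator {0<..} r * (r powr (a + b - 1) * inner (S r x) y)))"
    by simp
  also have "(1 / Gamma a) * (1 / Gamma b) * (Beta a b * (LINT r|lborel. (indicator {0<..} r * (r powr (a + b - 1) * inner (S r x) y))))
      = inner (frac_neg_pow S (a + b) x) y"
  proof -
    have "Gamma a \<noteq> 0" "Gamma b \<noteq> 0" "Gamma (a + b) \<noteq> 0"
      using Gamma_real_pos[OF a] Gamma_real_pos[OF b] Gamma_real_pos[OF add_pos_pos[OF a b]]
      by (metis less_irrefl)+
    then show ?thesis using a b by (simp add: inner_frac_neg_pow Beta_def)
  qed
  finally show "inner y (frac_neg_pow S a (frac_neg_pow S b x)) = inner y (frac_neg_pow S (a + b) x)"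
    by (simp add: inner_commute)
qed


section \<open>The resolvent at 0 and the generator\<close>

lemma frac_neg_pow_one: "frac_neg_pow S 1 x = (LINT t:{0<..}|lborel. S t x)"
  unfolding frac_neg_pow_eq[OF zero_less_one] set_lebesgue_integral_def
  by (simp, intro Bochner_Integration.integral_cong refl) (auto simp: indicator_def)

lemma set_integrable_S: "set_integrable lborel {0<..} (\<lambda>t. S t x)"
proof -
  have "set_integrable lborel {0<..} (\<lambda>t. t powr (1 - 1) *\<^sub>R S t x)" by (rule set_integrable_frac) simp
  then show ?thesis unfolding set_integrable_def
    by (rule Bochner_Integration.integrable_cong[OF refl, THEN iffD1, rotated]) (auto simp: indicator_def)
qed

lemma set_integrable_S_Ioc: "set_integrable lborel {0<..h} (\<lambda>t. S t x)"
  by (rule set_integrable_subset[OF set_integrable_S]) auto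

text \<open>The exponent 1 gives the integral of the semigroup, which is the inverse of -A; applying
  \<open>S h\<close> shifts the domain of integration to times after \<open>h\<close>. Generator,
  injectivity and density are all derived from this identity.\<close>

lemma resolvent_difference:
  assumes h: "0 < h"
  shows "frac_neg_pow S 1 x - S h (frac_neg_pow S 1 x) = (LINT t:{0<..h}|lborel. S t x)"
proof -
  note int = set_integrable_S[of x]
  have int1: "set_integrable lborel {0<..h} (\<lambda>t. S t x)" "set_integrable lborel {h<..} (\<lambda>t. S t x)"
    using h by (auto intro!: set_integrable_subset[OF int])
  have "S h (frac_neg_pow S 1 x) = (LINT t|lborel. indicator {0<..} t *\<^sub>R S t (S h x))"
    unfolding frac_neg_pow_S[OF zero_less_one less_imp_le[OF h], symmetric] unfolding frac_neg_pow_one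
    by (simp add: set_lebesgue_integral_def)
  also have "\<dots> = (LINT t|lborel. indicator {h<..} (h + 1 * t) *\<^sub>R S (h + 1 * t) x)"
    using h by (intro Bochner_Integration.integral_cong refl) (auto simp: indicator_def S_add[symmetric] add.commute)
  also have "\<dots> = (LINT t:{h<..}|lborel. S t x)"
    using lborel_integral_real_affine[of 1 "\<lambda>t. indicator {h<..} t *\<^sub>R S t x" h] by (simp add: set_lebesgue_integral_def)
  finally have "S h (frac_neg_pow S 1 x) = (LINT t:{h<..}|lborel. S t x)" .
  moreover have "frac_neg_pow S 1 x = (LINT t:{0<..h}|lborel. S t x) + (LINT t:{h<..}|lborel. S t x)"
  proof -
    have "(LINT t:{0<..h} \<union> {h<..}|lborel. S t x) = (LINT t:{0<..h}|lborel. S t x) + (LINT t:{h<..}|lborel. S t x)"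
      by (rule set_integral_Un[OF _ int1]) auto
    moreover have "{0<..h} \<union> {h<..} = {0<..}" using h by auto
    ultimately show ?thesis unfolding frac_neg_pow_one by simp
  qed
  ultimately show ?thesis by simp
qed

lemma average_tendsto: "((\<lambda>h. (1 / h) *\<^sub>R (LINT t:{0<..h}|lborel. S t x)) \<longlongrightarrow> x) (at_right 0)"
proof (rule tendstoI)
  fix e :: real assume e: "0 < e"
  have "eventually (\<lambda>h. dist (S h x) x < e / 2) (at_right 0)"
    using S_tendsto[of x] e by (intro tendstoD) auto
  then obtain d where d: "0 < d" "\<And>h. 0 < h \<Longrightarrow> h < d \<Longrightarrow> dist (S h x) x < e / 2"
    unfolding eventually_at_right_field by auto
  have "dist ((1 / h) *\<^sub>R (LINT t:{0<..h}|lborel. S t x)) x < e" if h: "0 < h" "h < d" for h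
  proof -
    have int: "integrable lborel (\<lambda>t. indicator {0<..h} t *\<^sub>R S t x)"
      using set_integrable_S_Ioc[of h x] unfolding set_integrable_def .
    have int': "integrable lborel (\<lambda>t. indicator {0<..h} t *\<^sub>R x)"
      using h by (intro integrable_indicator) auto
    have int_x: "(LINT t|lborel. indicator {0<..h} t *\<^sub>R x) = h *\<^sub>R x"
      using h by (simp add: integral_indicator)
    have "norm ((LINT t|lborel. indicator {0<..h} t *\<^sub>R S t x) - h *\<^sub>R x)
        = norm (LINT t|lborel. indicator {0<..h} t *\<^sub>R S t x - indicator {0<..h} t *\<^sub>R x)"
      by (simp only: Bochner_Integration.integral_diff[OF int int'] int_x)
    also have "\<dots> \<le> (LINT t|lborel. indicator {0<..h} t * (e / 2))"
    proof (rule Bochner_Integration.integral_norm_bound_integral)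
      show "integrable lborel (\<lambda>t. indicator {0<..h} t *\<^sub>R S t x - indicator {0<..h} t *\<^sub>R x)"
        using int int' by (rule Bochner_Integration.integrable_diff)
      show "integrable lborel (\<lambda>t. indicator {0<..h} t * (e / 2))" using h by simp
      show "norm (indicator {0<..h} t *\<^sub>R S t x - indicator {0<..h} t *\<^sub>R x) \<le> indicator {0<..h} t * (e / 2)" for t
        using d(2)[of t] h by (auto simp: indicator_def dist_norm)
    qed
    also have "\<dots> = h * (e / 2)" using h by simp
    finally have "norm ((LINT t|lborel. indicator {0<..h} t *\<^sub>R S t x) - h *\<^sub>R x) \<le> h * (e / 2)" .
    moreover have "(1 / h) *\<^sub>R (LINT t|lborel. indicator {0<..h} t *\<^sub>R S t x) - x
        = (1 / h) *\<^sub>R ((LINT t|lborel. indicator {0<..h} t *\<^sub>R S t x) - h *\<^sub>R x)"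
      using h by (simp add: scaleR_diff_right)
    ultimately have "dist ((1 / h) *\<^sub>R (LINT t|lborel. indicator {0<..h} t *\<^sub>R S t x)) x \<le> e / 2"
      using h by (simp add: dist_norm pos_divide_le_eq mult.commute)
    then show ?thesis using e by (simp add: set_lebesgue_integral_def)
  qed
  then show "eventually (\<lambda>h. dist ((1 / h) *\<^sub>R (LINT t:{0<..h}|lborel. S t x)) x < e) (at_right 0)"
    unfolding eventually_at_right_field using d(1) by auto
qed

lemma resolvent_generator:
  "((\<lambda>h. (1 / h) *\<^sub>R (S h (frac_neg_pow S 1 x) - frac_neg_pow S 1 x)) \<longlongrightarrow> - x) (at_right 0)"
proof (rule Lim_transform_eventually)
  show "((\<lambda>h. - ((1 / h) *\<^sub>R (LINT t:{0<..h}|lborel. S t x))) \<longlongrightarrow> - x) (at_right 0)"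
    by (intro tendsto_minus average_tendsto)
  show "eventually (\<lambda>h. - ((1 / h) *\<^sub>R (LINT t:{0<..h}|lborel. S t x))
      = (1 / h) *\<^sub>R (S h (frac_neg_pow S 1 x) - frac_neg_pow S 1 x)) (at_right 0)"
    unfolding eventually_at_right_field
    by (intro exI[of _ 1]) (auto simp: resolvent_difference[symmetric] scaleR_diff_right)
qed

text \<open>If the resolvent annihilates \<open>x\<close>, its difference quotients vanish, yet they
  tend to \<open>- x\<close>.\<close>

lemma inj_resolvent: "frac_neg_pow S 1 x = 0 \<Longrightarrow> x = 0"
proof -
  assume 0: "frac_neg_pow S 1 x = 0"
  have "((\<lambda>h. (1 / h) *\<^sub>R (S h 0 - 0)) \<longlongrightarrow> - x) (at_right 0)"
    using resolvent_generator[of x] by (simp add: 0)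
  moreover have "eventually (\<lambda>h. (1 / h) *\<^sub>R (S h 0 - 0) = 0) (at_right 0)"
    unfolding eventually_at_right_field
    using bclinear_S by (intro exI[of _ 1]) (auto simp: bclinear_def linear_0 bounded_linear.linear)
  ultimately have "((\<lambda>h. 0) \<longlongrightarrow> - x) (at_right (0::real))"
    by (rule Lim_transform_eventually)
  then have "0 = - x" by (rule tendsto_unique[OF trivial_limit_at_right_real tendsto_const])
  then show "x = 0" by simp
qed

lemma linear_frac_neg_pow: "0 < a \<Longrightarrow> linear (frac_neg_pow S a)"
  using bclinear_frac_neg_pow by (auto simp: bclinear_def bounded_linear.linear)

text \<open>The resolvent factors through the power \<open>a\<close>, the other factor having
  exponent \<open>1 - a\<close>, so its injectivity passes to the factor applied first.\<close>

lemma frac_neg_pow_eq_0: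
  assumes a: "0 < a" "a \<le> 1" and 0: "frac_neg_pow S a x = 0" shows "x = 0"
proof (cases "a = 1")
  case False
  then have "frac_neg_pow S (1 - a) (frac_neg_pow S a x) = frac_neg_pow S 1 x"
    using a by (simp add: frac_neg_pow_add)
  then show ?thesis using 0 a False by (simp add: linear_0[OF linear_frac_neg_pow] inj_resolvent)
qed (use 0 inj_resolvent in simp)

lemma inj_frac_neg_pow: "0 < a \<Longrightarrow> a \<le> 1 \<Longrightarrow> inj (frac_neg_pow S a)"
  using frac_neg_pow_eq_0 by (auto simp: linear_injective_0[OF linear_frac_neg_pow])

lemma frac_pow_frac_neg_pow: "0 < a \<Longrightarrow> a \<le> 1 \<Longrightarrow> frac_pow S a (frac_neg_pow S a x) = x"
  unfolding frac_pow_def by (intro inv_f_f inj_frac_neg_pow)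

lemma frac_neg_pow_frac_pow: "x \<in> frac_dom S a \<Longrightarrow> frac_neg_pow S a (frac_pow S a x) = x"
  unfolding frac_pow_def frac_dom_def by (rule f_inv_into_f)

text \<open>The means of the orbit of \<open>y\<close> over (0,h] lie in the range of the resolvent
  and tend to \<open>y\<close>, so \<open>y\<close> is orthogonal to itself.\<close>

lemma resolvent_total:
  assumes "\<And>z. inner y (frac_neg_pow S 1 z) = 0" shows "y = 0"
proof -
  have "inner y ((1 / h) *\<^sub>R (LINT t:{0<..h}|lborel. S t y)) = 0" if "0 < h" for h
  proof -
    have "(LINT t:{0<..h}|lborel. S t y) = frac_neg_pow S 1 (y - S h y)"
      using that by (simp add: resolvent_difference[symmetric] frac_neg_pow_S[symmetric]
          linear_diff[OF linear_frac_neg_pow])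
    then show ?thesis using assms by simp
  qed
  then have "eventually (\<lambda>h. inner y ((1 / h) *\<^sub>R (LINT t:{0<..h}|lborel. S t y)) = 0) (at_right 0)"
    unfolding eventually_at_right_field by (intro exI[of _ 1]) auto
  moreover have "((\<lambda>h. inner y ((1 / h) *\<^sub>R (LINT t:{0<..h}|lborel. S t y))) \<longlongrightarrow> inner y y) (at_right 0)"
    by (intro tendsto_intros average_tendsto)
  ultimately have "((\<lambda>h. 0) \<longlongrightarrow> inner y y) (at_right (0::real))"
    by (rule Lim_transform_eventually[rotated])
  then have "0 = inner y y" by (rule tendsto_unique[OF trivial_limit_at_right_real tendsto_const])
  then show ?thesis by simp
qed

lemma dense_range_resolvent: "closure (range (frac_neg_pow S 1)) = UNIV"
  by (intro dense_range_if_total linear_frac_neg_pow resolvent_total) auto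

text \<open>To see that the domain lies in the range, the resolvent is applied to the difference
  quotients of \<open>x\<close>: it commutes with the semigroup, so their limit is both
  \<open>- x\<close> and the resolvent of \<open>A x\<close>.\<close>

lemma generator_resolvent:
  assumes "generates DA A S"
  shows "DA = range (frac_neg_pow S 1)" "A (frac_neg_pow S 1 x) = - x"
proof -
  have DA: "DA = {x. \<exists>y. ((\<lambda>h. (1 / h) *\<^sub>R (S h x - x)) \<longlongrightarrow> y) (at_right 0)}"
    and A: "\<And>x. x \<in> DA \<Longrightarrow> ((\<lambda>h. (1 / h) *\<^sub>R (S h x - x)) \<longlongrightarrow> A x) (at_right 0)"
    using assms by (auto simp: generates_def)
  have in_DA: "frac_neg_pow S 1 x \<in> DA" for x using resolvent_generator[of x] by (auto simp: DA)
  show "A (frac_neg_pow S 1 x) = - x"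
    by (rule tendsto_unique[OF _ A[OF in_DA] resolvent_generator]) simp
  have "x = frac_neg_pow S 1 (- A x)" if x: "x \<in> DA" for x
  proof -
    have bl: "bounded_linear (frac_neg_pow S 1)" using bclinear_frac_neg_pow[of 1] by (simp add: bclinear_def)
    have "((\<lambda>h. frac_neg_pow S 1 ((1 / h) *\<^sub>R (S h x - x))) \<longlongrightarrow> frac_neg_pow S 1 (A x)) (at_right 0)"
      by (rule bounded_linear.tendsto[OF bl A[OF x]])
    moreover have "eventually (\<lambda>h. frac_neg_pow S 1 ((1 / h) *\<^sub>R (S h x - x))
        = (1 / h) *\<^sub>R (S h (frac_neg_pow S 1 x) - frac_neg_pow S 1 x)) (at_right 0)"
      unfolding eventually_at_right_field
      by (intro exI[of _ 1]) (auto simp: linear_diff[OF linear_frac_neg_pow] linear_scale[OF linear_frac_neg_pow] frac_neg_pow_S)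
    ultimately have "((\<lambda>h. (1 / h) *\<^sub>R (S h (frac_neg_pow S 1 x) - frac_neg_pow S 1 x)) \<longlongrightarrow> frac_neg_pow S 1 (A x)) (at_right 0)"
      by (rule Lim_transform_eventually)
    then have "frac_neg_pow S 1 (A x) = - x"
      by (rule tendsto_unique[rotated, OF _ resolvent_generator]) simp
    then show ?thesis by (simp add: linear_neg[OF linear_frac_neg_pow])
  qed
  then show "DA = range (frac_neg_pow S 1)" using in_DA by auto
qed

section \<open>The adjoint semigroup and its generator\<close>

lemma inner_adj_sg: "0 \<le> t \<Longrightarrow> inner (S t x) y = inner x (adj_sg S t y)"
  unfolding adj_sg_def by (rule inner_bounded_adj[OF bclinear_S])

lemma bclinear_adj_sg: "0 \<le> t \<Longrightarrow> bclinear (adj_sg S t)"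
  unfolding adj_sg_def by (rule bclinear_bounded_adj[OF bclinear_S])

lemma adj_sg_stable:
  assumes "0 \<le> t" shows "norm (adj_sg S t x) \<le> M * exp (- \<omega> * t) * norm x"
  unfolding adj_sg_def
  by (rule norm_bounded_adj_le[OF bclinear_S]) (use assms M_ge stable in auto)

lemma inner_bounded_adj_resolvent:
  "inner (frac_neg_pow S 1 x) y = inner x (bounded_adj (frac_neg_pow S 1) y)"
  by (rule inner_bounded_adj[OF bclinear_frac_neg_pow]) simp

text \<open>Totality of the range of an adjoint is injectivity of the operator.\<close>

lemma dense_range_adj_resolvent: "closure (range (bounded_adj (frac_neg_pow S 1))) = UNIV"
proof (rule dense_range_if_total)
  show "linear (bounded_adj (frac_neg_pow S 1))"
    using bclinear_bounded_adj[OF bclinear_frac_neg_pow, of 1] by (simp add: bclinear_def bounded_linear.linear)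
  fix y assume "\<And>z. inner y (bounded_adj (frac_neg_pow S 1) z) = 0"
  then have "frac_neg_pow S 1 y = 0"
    by (metis inner_bounded_adj_resolvent inner_eq_zero_iff)
  then show "y = 0" by (rule inj_resolvent)
qed

text \<open>Duality alone gives only weak continuity of adjoint orbits. On the range of the adjoint
  resolvent the orbit is Lipschitz at 0, by duality from \<open>resolvent_difference\<close>; this
  range is dense and the operators are uniformly bounded.\<close>

lemma adj_sg_tendsto: "((\<lambda>t. adj_sg S t x) \<longlongrightarrow> x) (at_right 0)"
proof (rule tendstoI)
  fix e :: real assume e: "0 < e"
  let ?J = "bounded_adj (frac_neg_pow S 1)"
  have lip: "norm (adj_sg S h (?J z) - ?J z) \<le> h * M * norm z" if h: "0 < h" for h z
  proof (rule norm_le_of_inner)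
    fix w
    have "inner (adj_sg S h (?J z) - ?J z) w = inner w (adj_sg S h (?J z)) - inner w (?J z)"
      by (subst inner_commute) (rule inner_diff_right)
    also have "\<dots> = inner (frac_neg_pow S 1 (S h w) - frac_neg_pow S 1 w) z"
      using h by (simp add: inner_diff_left inner_bounded_adj_resolvent inner_adj_sg)
    also have "\<dots> = - inner (LINT t:{0<..h}|lborel. S t w) z"
      using h by (simp add: frac_neg_pow_S resolvent_difference[symmetric] inner_diff_left)
    finally have "\<bar>inner (adj_sg S h (?J z) - ?J z) w\<bar> \<le> norm (LINT t:{0<..h}|lborel. S t w) * norm z"
      using Cauchy_Schwarz_ineq2[of "LINT t:{0<..h}|lborel. S t w" z] by simp
    also have "norm (LINT t:{0<..h}|lborel. S t w) \<le> (LINT t|lborel. indicator {0<..h} t * (M * norm w))"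
      unfolding set_lebesgue_integral_def
    proof (rule Bochner_Integration.integral_norm_bound_integral)
      show "integrable lborel (\<lambda>t. indicator {0<..h} t *\<^sub>R S t w)"
        using set_integrable_S_Ioc[of h w] unfolding set_integrable_def .
      show "integrable lborel (\<lambda>t. indicator {0<..h} t * (M * norm w))" using h by simp
      show "norm (indicator {0<..h} t *\<^sub>R S t w) \<le> indicator {0<..h} t * (M * norm w)" for t
        using norm_S_le[of t w] by (auto simp: indicator_def)
    qed
    also have "\<dots> = h * (M * norm w)" using h by simp
    finally show "\<bar>inner (adj_sg S h (?J z) - ?J z) w\<bar> \<le> h * M * norm z * norm w"
      by (simp add: mult_ac mult_right_mono)
  qed (use h M_ge in simp)
  have M0: "0 < M" using M_ge by simp
  \<comment> \<open>Three terms of at most e/4 each will be added: the approximation error moved by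
    the semigroup, the Lipschitz term, and the error itself, for which M \<ge> 1 is used.\<close>
  obtain z where z: "norm (x - ?J z) < e / (4 * M)"
  proof -
    have "x \<in> closure (range ?J)" using dense_range_adj_resolvent by simp
    moreover have "0 < e / (4 * M)" using e M0 by simp
    ultimately obtain w where "w \<in> range ?J" "dist w x < e / (4 * M)" unfolding closure_approachable by blast
    then show ?thesis using that by (auto simp: dist_norm norm_minus_commute)
  qed
  \<comment> \<open>The added 1 keeps \<open>K\<close> positive when \<open>z\<close> is 0.\<close>
  define K where "K = norm z + 1"
  have K: "0 < K" "norm z \<le> K" by (simp_all add: K_def add_nonneg_pos)
  define d where "d = e / (4 * M * K)"
  have d0: "0 < d" using e M0 K by (simp add: d_def)
  have "dist (adj_sg S h x) x < e" if h: "0 < h" "h < d" for h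
  proof -
    have bl: "linear (adj_sg S h)" using bclinear_adj_sg[of h] h by (simp add: bclinear_def bounded_linear.linear)
    have eq: "adj_sg S h x - x = adj_sg S h (x - ?J z) + (adj_sg S h (?J z) - ?J z) - (x - ?J z)"
      by (simp add: linear_diff[OF bl])
    have "norm (adj_sg S h x - x) \<le> norm (adj_sg S h (x - ?J z)) + norm (adj_sg S h (?J z) - ?J z) + norm (x - ?J z)"
      unfolding eq
      using norm_triangle_ineq4[of "adj_sg S h (x - ?J z) + (adj_sg S h (?J z) - ?J z)" "x - ?J z"]
        norm_triangle_ineq[of "adj_sg S h (x - ?J z)" "adj_sg S h (?J z) - ?J z"] by linarith
    moreover have "norm (adj_sg S h (x - ?J z)) \<le> M * norm (x - ?J z)"
    proof -
      have "M * exp (- \<omega> * h) * norm (x - ?J z) \<le> M * 1 * norm (x - ?J z)"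
        using M_ge \<omega>_pos h by (intro mult_right_mono mult_left_mono) auto
      then show ?thesis using adj_sg_stable[of h "x - ?J z"] h by simp
    qed
    moreover have "M * norm (x - ?J z) < e / 4"
      using z M0 by (simp add: pos_less_divide_eq mult_ac)
    moreover have "norm (x - ?J z) \<le> M * norm (x - ?J z)"
      using M_ge mult_right_mono[of 1 M "norm (x - ?J z)"] by simp
    moreover have "norm (adj_sg S h (?J z) - ?J z) \<le> e / 4"
    proof -
      have "h * M * norm z \<le> d * M * K"
        using h d0 M0 K by (intro mult_mono) auto
      also have "\<dots> = e / 4" using M0 K by (simp add: d_def)
      finally show ?thesis using lip[OF h(1), of z] by linarith
    qed
    ultimately show ?thesis using e by (simp add: dist_norm)
  qed
  then show "eventually (\<lambda>t. dist (adj_sg S t x) x < e) (at_right 0)"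
    unfolding eventually_at_right_field using d0 by auto
qed

text \<open>By interpretation every statement about \<open>S\<close> becomes available for the
  adjoint semigroup, with the same constants.\<close>

lemma stable_semigroup_adj: "stable_semigroup (adj_sg S) M \<omega>"
proof
  show "C0_semigroup (adj_sg S)"
    unfolding C0_semigroup_def bounded_op_UNIV_iff
  proof (intro conjI allI impI)
    show "bclinear (adj_sg S t)" if "0 \<le> t" for t using that by (rule bclinear_adj_sg)
    show "adj_sg S 0 x = x" for x
      unfolding adj_sg_def by (rule bounded_adj_eqI[OF bclinear_S]) (simp_all add: S_zero)
    show "adj_sg S (s + t) x = adj_sg S s (adj_sg S t x)" if "0 \<le> s" "0 \<le> t" for s t x
    proof (rule inner_left_eqI)
      fix w
      have "inner w (adj_sg S (s + t) x) = inner (S (t + s) w) x" using that by (simp add: inner_adj_sg add.commute)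
      also have "\<dots> = inner w (adj_sg S s (adj_sg S t x))" using that by (simp add: S_add inner_adj_sg)
      finally show "inner w (adj_sg S (s + t) x) = inner w (adj_sg S s (adj_sg S t x))" .
    qed
    show "((\<lambda>t. adj_sg S t x) \<longlongrightarrow> x) (at_right 0)" for x by (rule adj_sg_tendsto)
  qed
qed (use M_ge \<omega>_pos adj_sg_stable in auto)

text \<open>Adjoints pass under the integral: the negative powers of the adjoint semigroup are the
  adjoints of those of \<open>S\<close>.\<close>

lemma inner_frac_neg_pow_adj:
  assumes a: "0 < a"
  shows "inner (frac_neg_pow S a x) y = inner x (frac_neg_pow (adj_sg S) a y)"
proof -
  interpret adj: stable_semigroup "adj_sg S" M \<omega> by (rule stable_semigroup_adj)
  have "inner x (frac_neg_pow (adj_sg S) a y) = inner (frac_neg_pow (adj_sg S) a y) x" by (rule inner_commute)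
  also have "\<dots> = inner (frac_neg_pow S a x) y"
    unfolding inner_frac_neg_pow[OF a] adj.inner_frac_neg_pow[OF a]
    by (intro arg_cong[of _ _ "(*) (1 / Gamma a)"] Bochner_Integration.integral_cong refl)
      (auto simp: indicator_def inner_adj_sg inner_commute[of "adj_sg S _ y" x])
  finally show ?thesis ..
qed

text \<open>\<open>A\<close> acts on the range of the resolvent as minus its inverse. Substituting
  the resolvent of \<open>w\<close> for \<open>x\<close> turns the defining identity of the adjoint
  into an equation for the adjoint resolvent, which is injective.\<close>

lemma adj_generator:
  assumes gen: "generates DA A S"
  shows "adj_dom DA A = range (frac_neg_pow (adj_sg S) 1)"
    "adj DA A (frac_neg_pow (adj_sg S) 1 z) = - z"
proof -
  interpret adj: stable_semigroup "adj_sg S" M \<omega> by (rule stable_semigroup_adj)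
  note DA = generator_resolvent[OF gen]
  let ?J = "frac_neg_pow S 1" and ?J' = "frac_neg_pow (adj_sg S) 1"
  have J: "bclinear ?J" by (rule bclinear_frac_neg_pow) simp
  have sub: "csubspace_set DA"
    unfolding csubspace_set_def DA(1)
  proof (intro conjI ballI allI)
    show "0 \<in> range ?J" using linear_0[OF linear_frac_neg_pow, of 1] by (metis rangeI zero_less_one)
    show "x + y \<in> range ?J" if "x \<in> range ?J" "y \<in> range ?J" for x y
      using that linear_add[OF linear_frac_neg_pow, of 1] by auto (metis rangeI)
    show "c *\<^sub>C x \<in> range ?J" if "x \<in> range ?J" for c x
      using that bclinearD(2)[OF J] by auto (metis rangeI)
  qed
  have A_lin: "clinear_on DA A"
    unfolding clinear_on_def DA(1)
  proof (intro conjI ballI allI)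
    show "A (x + y) = A x + A y" if xy: "x \<in> range ?J" "y \<in> range ?J" for x y
    proof -
      obtain v w where "x = ?J v" "y = ?J w" using xy by auto
      then show ?thesis using linear_add[OF linear_frac_neg_pow, of 1 v w, symmetric] by (simp add: DA(2))
    qed
    show "A (c *\<^sub>C x) = c *\<^sub>C A x" if x: "x \<in> range ?J" for c x
    proof -
      obtain v where "x = ?J v" using x by auto
      then show ?thesis using bclinearD(2)[OF J, of c v, symmetric]
        by (simp add: DA(2) linear_neg[OF bounded_linear.linear[OF bounded_linear_scaleC]])
    qed
  qed
  have iff: "(\<forall>x\<in>DA. cinner (A x) y = cinner x z) \<longleftrightarrow> y = ?J' (- z)" for y z
    unfolding cinner_pairing_iff_inner[OF sub A_lin] unfolding DA(1)
  proof (rule iffI)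
    assume h: "\<forall>x\<in>range ?J. inner (A x) y = inner x z"
    show "y = ?J' (- z)"
    proof (rule inner_left_eqI)
      fix w
      have "inner (A (?J w)) y = inner (?J w) z" by (rule h[rule_format]) (rule rangeI)
      then have "inner w y = inner (?J w) (- z)" unfolding DA(2) inner_minus_left inner_minus_right by simp
      then show "inner w y = inner w (?J' (- z))"
        unfolding inner_frac_neg_pow_adj[OF zero_less_one] .
    qed
  next
    assume y: "y = ?J' (- z)"
    have "inner (A (?J w)) y = inner (?J w) z" for w
      unfolding y DA(2) inner_frac_neg_pow_adj[OF zero_less_one, symmetric]
      by (simp add: linear_neg[OF linear_frac_neg_pow])
    then show "\<forall>x\<in>range ?J. inner (A x) y = inner x z" by blast
  qed
  show "adj_dom DA A = range ?J'"
    unfolding adj_dom_def iff by (auto intro: exI[of _ "- z" for z])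
  show "adj DA A (?J' z) = - z"
    unfolding adj_def iff using adj.inj_frac_neg_pow[of 1]
    by (intro the_equality) (auto dest!: injD)
qed

end

section \<open>The input-to-state map\<close>

text \<open>The exceptional set is first covered by a Borel null set, to which the affine change of
  variables applies.\<close>

lemma AE_lborel_reflect:
  assumes "AE \<tau> in lborel. P (\<tau>::real)" shows "AE s in lborel. P (t - s)"
proof -
  obtain N where N: "N \<in> null_sets lborel" "{\<tau>. \<not> P \<tau>} \<subseteq> N"
    using assms by (auto elim!: AE_E simp: null_sets_def)
  have "AE \<tau> in lborel. \<tau> \<notin> N" using N(1) by (rule AE_not_in)
  moreover have [measurable]: "N \<in> sets borel" using N(1) by auto
  ultimately have "AE s in lborel. t + (-1) * s \<notin> N" by (intro AE_borel_affine) auto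
  then show ?thesis by eventually_elim (use N(2) in auto)
qed

lemma AE_lebesgue_iff: "(AE x in lebesgue. P x) \<longleftrightarrow> (AE x in lborel. P x)"
  by (rule AE_completion_iff)

lemma lebesgue_borel_version:
  fixes f :: "real \<Rightarrow> ennreal"
  assumes "f \<in> borel_measurable lebesgue"
  obtains g where "g \<in> borel_measurable borel" "AE x in lborel. f x = g x"
  using completion_ex_borel_measurable[OF assms] by auto

text \<open>Completeness of Lebesgue measure; it allows functions to be altered on null
  sets.\<close>

lemma borel_measurable_lebesgue_AE:
  fixes f g :: "real \<Rightarrow> 'b::{second_countable_topology,t2_space}"
  assumes "f \<in> borel_measurable lebesgue" "AE x in lborel. f x = g x"
  shows "g \<in> borel_measurable lebesgue"
proof (rule borel_measurableI)
  fix U :: "'b set" assume "open U"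
  then have m: "f -` U \<inter> space lebesgue \<in> sets lebesgue"
    using assms(1) by (intro measurable_sets) auto
  have ae: "AE x in lebesgue. x \<in> f -` U \<inter> space lebesgue \<longleftrightarrow> x \<in> g -` U \<inter> space lebesgue"
    using AE_completion[OF assms(2)] by eventually_elim auto
  show "g -` U \<inter> space lebesgue \<in> sets lebesgue"
    by (rule completion.in_sets_AE[OF ae m]) auto
qed

locale control_system = stable_semigroup S M \<omega>
  for S :: "real \<Rightarrow> 'y::separable_complex_hilbert \<Rightarrow> 'y" and M \<omega> +
  fixes b :: "'u::separable_complex_hilbert \<Rightarrow> 'y"
  assumes bclinear_b: "bclinear b"
begin

sublocale adj: stable_semigroup "adj_sg S" M \<omega> by (rule stable_semigroup_adj)

abbreviation "S' \<equiv> adj_sg S"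
abbreviation "J \<equiv> frac_neg_pow S 1"
abbreviation "J' \<equiv> frac_neg_pow S' 1"

text \<open>\<open>k t z\<close> is \<open>B\<^sup>* e\<^bsup>A\<^sup>*t\<^esup>\<close> evaluated at \<open>J' z = (-A\<^sup>*)\<^sup>-\<^sup>1 z\<close>.\<close>

definition k :: "real \<Rightarrow> 'y \<Rightarrow> 'u" where "k t z = bounded_adj b (S' t z)"

lemma bclinear_J': "bclinear J'"
  by (rule adj.bclinear_frac_neg_pow) simp

lemma linear_J': "linear J'" by (rule adj.linear_frac_neg_pow) simp

lemma J'_S': "0 \<le> t \<Longrightarrow> J' (S' t z) = S' t (J' z)" by (rule adj.frac_neg_pow_S) simp_all

lemma J'_total: "(\<And>z. inner y (J' z) = 0) \<Longrightarrow> y = 0"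
  by (rule adj.resolvent_total)

lemma bclinear_k: "0 \<le> t \<Longrightarrow> bclinear (k t)"
  unfolding k_def[abs_def]
  by (intro bclinear_compose[OF bclinear_bounded_adj[OF bclinear_b]] bclinear_adj_sg)

lemma linear_k: "0 \<le> t \<Longrightarrow> linear (k t)"
  using bclinear_k by (auto simp: bclinear_def bounded_linear.linear)

lemma k_add: "0 \<le> t \<Longrightarrow> 0 \<le> s \<Longrightarrow> k (t + s) z = k t (S' s z)"
  by (simp add: k_def adj.S_add)

lemma continuous_on_k: "continuous_on {0..} (\<lambda>t. k t z)"
  unfolding k_def
  by (intro bounded_linear.continuous_on[OF bclinearD(1)[OF bclinear_bounded_adj[OF bclinear_b]]] adj.continuous_on_S)

lemma k_measurable [measurable]: "(\<lambda>t. indicator {0<..} t *\<^sub>R k t z) \<in> borel_measurable borel"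
  by (intro borel_measurable_continuous_on_indicator continuous_on_subset[OF continuous_on_k]) auto

text \<open>A crude bound in terms of \<open>norm z\<close>, good for integrability. The estimates
  that produce elements of Y are in terms of \<open>norm (J' z)\<close>.\<close>

definition k_bound :: real where
  "k_bound = (SOME K. 0 \<le> K \<and> (\<forall>t\<ge>0. \<forall>z. norm (k t z) \<le> K * norm z))"

lemma k_bound: "0 \<le> k_bound" "0 \<le> t \<Longrightarrow> norm (k t z) \<le> k_bound * norm z"
proof -
  obtain K where K: "0 \<le> K" "\<And>x. norm (bounded_adj b x) \<le> norm x * K"
    using bounded_linear.nonneg_bounded[OF bclinearD(1)[OF bclinear_bounded_adj[OF bclinear_b]]] by blast
  have "norm (k t z) \<le> (K * M) * norm z" if "0 \<le> t" for t z
  proof -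
    have "norm (k t z) \<le> norm (S' t z) * K" unfolding k_def by (rule K)
    also have "\<dots> \<le> (M * norm z) * K" using adj.norm_S_le[OF that] K(1) by (rule mult_right_mono)
    finally show ?thesis by (simp add: mult_ac)
  qed
  then have "\<exists>K. 0 \<le> K \<and> (\<forall>t\<ge>0. \<forall>z. norm (k t z) \<le> K * norm z)"
    using K(1) M_ge by (intro exI[of _ "K * M"]) auto
  then have "0 \<le> k_bound \<and> (\<forall>t\<ge>0. \<forall>z. norm (k t z) \<le> k_bound * norm z)"
    unfolding k_bound_def by (rule someI_ex)
  then show "0 \<le> k_bound" "0 \<le> t \<Longrightarrow> norm (k t z) \<le> k_bound * norm z" by auto
qed

lemma norm_k_measurable [measurable]:
  "(\<lambda>t. indicator {0<..} t * norm (k t z)) \<in> borel_measurable borel"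
proof -
  have "(\<lambda>t. norm (indicator {0<..} t *\<^sub>R k t z)) \<in> borel_measurable borel" by measurable
  then show ?thesis by simp
qed

text \<open>An \<open>L\<^sup>p\<close> bound on one time block spreads to a half line with an exponential weight, because
  \<open>k (\<tau> + j d) z = k \<tau> (S' (j d) z)\<close> and \<open>S'\<close> decays.\<close>

lemma weighted_block_bound:
  fixes \<nu> :: "'y \<Rightarrow> real"
  assumes \<nu>: "\<And>z. 0 \<le> \<nu> z" "\<And>t z. 0 \<le> t \<Longrightarrow> \<nu> (S' t z) \<le> M * exp (- \<omega> * t) * \<nu> z"
    and p: "1 \<le> p" and a: "0 \<le> a" and d: "0 < d" and c: "0 \<le> c"
    and block: "\<And>z. (\<integral>\<^sup>+\<tau>. indicator {a<..a + d} \<tau> * ennreal (norm (k \<tau> z) powr p) \<partial>lborel) \<le> ennreal (c * \<nu> z powr p)"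
  shows "\<exists>C\<ge>0. \<forall>z. (\<integral>\<^sup>+\<tau>. indicator {a<..} \<tau> * ennreal ((exp (\<omega> / 2 * \<tau>) * norm (k \<tau> z)) powr p) \<partial>lborel)
    \<le> ennreal (C * \<nu> z powr p)"
proof -
  \<comment> \<open>Ratio of the geometric series over blocks: a shift by \<open>d\<close> gains
    exp(-\<omega> d) from the semigroup and loses exp(\<omega> d / 2) to the weight.\<close>
  define r where "r = exp (- \<omega> / 2 * d) powr p"
  have r: "0 < r" "r < 1"
  proof -
    have "exp (- \<omega> / 2 * d) < 1" using \<omega>_pos d by simp
    then have "exp (- \<omega> / 2 * d) powr p < 1 powr p" using p by (intro powr_less_mono2) auto
    then show "0 < r" "r < 1" by (auto simp: r_def)
  qed
  \<comment> \<open>Bound for the first block: the weight is at most its value at a + d, and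
    \<open>M\<close> comes from the hypothesis on \<nu>.\<close>
  define C where "C = exp (\<omega> / 2 * (a + d)) powr p * c * M powr p"
  have C: "0 \<le> C" using c by (simp add: C_def)
  let ?I = "\<lambda>j. {a + real j * d<..a + real j * d + d}"
  have kp_meas [measurable]: "(\<lambda>\<tau>. indicator (?I j) \<tau> * ennreal ((exp (\<omega> / 2 * \<tau>) * norm (k \<tau> z)) powr p)) \<in> borel_measurable borel" for j z
  proof -
    define W where "W \<tau> = indicator {0<..} \<tau> * norm (k \<tau> z)" for \<tau>
    have [measurable]: "W \<in> borel_measurable borel" unfolding W_def[abs_def] by (rule norm_k_measurable)
    have pos: "0 < \<tau>" if "\<tau> \<in> ?I j" for \<tau>
    proof -
      have "0 \<le> a + real j * d" using a d by simp
      then show ?thesis using that by simp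
    qed
    have "(\<lambda>\<tau>. indicator (?I j) \<tau> * ennreal ((exp (\<omega> / 2 * \<tau>) * norm (k \<tau> z)) powr p))
        = (\<lambda>\<tau>. indicator (?I j) \<tau> * ennreal ((exp (\<omega> / 2 * \<tau>) * W \<tau>) powr p))"
      using pos by (auto simp: indicator_def W_def fun_eq_iff)
    moreover have "(\<lambda>\<tau>. indicator (?I j) \<tau> * ennreal ((exp (\<omega> / 2 * \<tau>) * W \<tau>) powr p)) \<in> borel_measurable borel"
      by measurable
    ultimately show ?thesis by (simp only:)
  qed
  have term_le: "(\<integral>\<^sup>+\<tau>. indicator (?I j) \<tau> * ennreal ((exp (\<omega> / 2 * \<tau>) * norm (k \<tau> z)) powr p) \<partial>lborel)
      \<le> ennreal (C * \<nu> z powr p * r ^ j)" for j z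
  proof -
    define s where "s = real j * d"
    have s: "0 \<le> s" using d by (simp add: s_def)
    let ?W = "exp (\<omega> / 2 * (s + a + d)) powr p"
    have "(\<integral>\<^sup>+\<tau>. indicator (?I j) \<tau> * ennreal ((exp (\<omega> / 2 * \<tau>) * norm (k \<tau> z)) powr p) \<partial>lborel)
        = (\<integral>\<^sup>+\<tau>. indicator (?I j) (s + 1 * \<tau>) * ennreal ((exp (\<omega> / 2 * (s + 1 * \<tau>)) * norm (k (s + 1 * \<tau>) z)) powr p) \<partial>lborel)"
      by (subst nn_integral_real_affine[OF kp_meas, where c = 1 and t = s]) simp_all
    also have "\<dots> \<le> (\<integral>\<^sup>+\<tau>. ennreal ?W * (indicator {a<..a + d} \<tau> * ennreal (norm (k \<tau> (S' s z)) powr p)) \<partial>lborel)"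
    proof (rule nn_integral_mono)
      fix \<tau> :: real
      show "indicator (?I j) (s + 1 * \<tau>) * ennreal ((exp (\<omega> / 2 * (s + 1 * \<tau>)) * norm (k (s + 1 * \<tau>) z)) powr p)
          \<le> ennreal ?W * (indicator {a<..a + d} \<tau> * ennreal (norm (k \<tau> (S' s z)) powr p))"
      proof (cases "\<tau> \<in> {a<..a + d}")
        case True
        then have "k (s + \<tau>) z = k \<tau> (S' s z)" using k_add[of \<tau> s z] s a by (simp add: add.commute)
        moreover have "exp (\<omega> / 2 * (s + \<tau>)) * norm (k \<tau> (S' s z)) \<le> exp (\<omega> / 2 * (s + a + d)) * norm (k \<tau> (S' s z))"
          using True \<omega>_pos by (intro mult_right_mono) auto
        ultimately show ?thesis using True p
          by (auto simp: s_def ennreal_mult[symmetric] powr_mult[symmetric] intro!: ennreal_leI powr_mono2)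
      qed (auto simp: s_def indicator_def)
    qed
    also have "\<dots> = ennreal ?W * (\<integral>\<^sup>+\<tau>. (indicator {a<..a + d} \<tau> * ennreal (norm (k \<tau> (S' s z)) powr p)) \<partial>lborel)"
    proof (rule nn_integral_cmult)
      have "indicator {a<..a + d} \<tau> * ennreal (norm (k \<tau> (S' s z)) powr p)
          = indicator {a<..a + d} \<tau> * ennreal ((indicator {0<..} \<tau> * norm (k \<tau> (S' s z))) powr p)" for \<tau>
        using a by (auto simp: indicator_def)
      then show "(\<lambda>\<tau>. indicator {a<..a + d} \<tau> * ennreal (norm (k \<tau> (S' s z)) powr p)) \<in> borel_measurable lborel" by simp
    qed
    also have "\<dots> \<le> ennreal ?W * ennreal (c * (M * exp (- \<omega> * s) * \<nu> z) powr p)"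
      using p c \<nu> s by (intro mult_left_mono order_trans[OF block] ennreal_leI powr_mono2) auto
    also have "\<dots> = ennreal (?W * (c * (M * exp (- \<omega> * s) * \<nu> z) powr p))"
      by (rule ennreal_mult[symmetric]) (use c in auto)
    also have "?W * (c * (M * exp (- \<omega> * s) * \<nu> z) powr p) = C * \<nu> z powr p * r ^ j"
    proof -
      have e: "exp (\<omega> / 2 * (s + a + d)) * exp (- \<omega> * s) = exp (\<omega> / 2 * (a + d)) * exp (- \<omega> / 2 * d) ^ j"
        by (simp add: exp_of_nat_mult[symmetric] exp_add[symmetric] s_def) (simp add: algebra_simps)
      have "?W * (M * exp (- \<omega> * s) * \<nu> z) powr p
          = (exp (\<omega> / 2 * (s + a + d)) * exp (- \<omega> * s)) powr p * M powr p * \<nu> z powr p"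
        using M_ge \<nu>(1)[of z] by (simp add: powr_mult mult_ac)
      also have "\<dots> = exp (\<omega> / 2 * (a + d)) powr p * (exp (- \<omega> / 2 * d) ^ j) powr p * M powr p * \<nu> z powr p"
        unfolding e by (simp add: powr_mult)
      also have "(exp (- \<omega> / 2 * d) ^ j) powr p = r ^ j"
        by (simp add: r_def powr_power mult.commute powr_powr flip: powr_realpow)
      finally show ?thesis by (simp add: C_def mult_ac)
    qed
    finally show ?thesis .
  qed
  have "(\<integral>\<^sup>+\<tau>. indicator {a<..} \<tau> * ennreal ((exp (\<omega> / 2 * \<tau>) * norm (k \<tau> z)) powr p) \<partial>lborel)
      \<le> ennreal ((C * (1 / (1 - r))) * \<nu> z powr p)" for z
  proof -
    have "(\<integral>\<^sup>+\<tau>. indicator {a<..} \<tau> * ennreal ((exp (\<omega> / 2 * \<tau>) * norm (k \<tau> z)) powr p) \<partial>lborel)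
        \<le> (\<integral>\<^sup>+\<tau>. (\<Sum>j. indicator (?I j) \<tau> * ennreal ((exp (\<omega> / 2 * \<tau>) * norm (k \<tau> z)) powr p)) \<partial>lborel)"
    proof (rule nn_integral_mono)
      fix \<tau> :: real
      let ?v = "ennreal ((exp (\<omega> / 2 * \<tau>) * norm (k \<tau> z)) powr p)"
      show "indicator {a<..} \<tau> * ?v \<le> (\<Sum>j. indicator (?I j) \<tau> * ?v)"
      proof (cases "a < \<tau>")
        case True
        \<comment> \<open>Index of the block containing \<tau>; the blocks are open on the left and
          closed on the right, hence the ceiling minus 1.\<close>
        define j where "j = nat (\<lceil>(\<tau> - a) / d\<rceil> - 1)"
        have ce: "1 \<le> \<lceil>(\<tau> - a) / d\<rceil>" using True d by (simp add: one_le_ceiling)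
        then have rj: "real j = of_int \<lceil>(\<tau> - a) / d\<rceil> - 1" by (simp add: j_def)
        have "real j < (\<tau> - a) / d" "(\<tau> - a) / d \<le> real j + 1"
          unfolding rj using ceiling_correct[of "(\<tau> - a) / d"] by auto
        then have "\<tau> \<in> ?I j" using d by (auto simp: field_simps)
        then have "?v = (\<Sum>i\<in>{j}. indicator (?I i) \<tau> * ?v)" by simp
        also have "\<dots> \<le> (\<Sum>j. indicator (?I j) \<tau> * ?v)" by (rule sum_le_suminf) auto
        finally show ?thesis using True by simp
      qed simp
    qed
    also have "\<dots> = (\<Sum>j. \<integral>\<^sup>+\<tau>. indicator (?I j) \<tau> * ennreal ((exp (\<omega> / 2 * \<tau>) * norm (k \<tau> z)) powr p) \<partial>lborel)"
      by (rule nn_integral_suminf) measurable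
    also have "\<dots> \<le> (\<Sum>j. ennreal (C * \<nu> z powr p * r ^ j))"
      by (intro suminf_le term_le) auto
    also have "\<dots> = ennreal (\<Sum>j. C * \<nu> z powr p * r ^ j)"
      using C r by (intro suminf_ennreal2 summable_mult summable_geometric) auto
    also have "(\<Sum>j. C * \<nu> z powr p * r ^ j) = C * \<nu> z powr p * (1 / (1 - r))"
      using r by (simp add: suminf_mult suminf_geometric summable_geometric)
    finally show ?thesis by (simp add: mult_ac)
  qed
  moreover have "0 \<le> C * (1 / (1 - r))" using C r by simp
  ultimately show ?thesis by blast
qed

end

lemma ennreal_power_le_cancel:
  fixes x y :: ennreal
  assumes "x ^ n \<le> y ^ n" "0 < n" shows "x \<le> y"
proof (cases x; cases y)
  fix r s assume "x = ennreal r" "0 \<le> r" "y = ennreal s" "0 \<le> s"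
  then show ?thesis using assms power_le_imp_le_base[of r "n - 1" s]
    by (auto simp: ennreal_power ennreal_le_iff)
next
  fix s assume "x = top" "y = ennreal s" "0 \<le> s"
  then show ?thesis using assms by (simp add: ennreal_power top_unique)
qed auto

text \<open>Only Lebesgue measurability is available for the optimal control; the integral over
  \<open>lborel\<close> equals the Lebesgue one and fits the Borel kernels.\<close>

definition sqi :: "(real \<Rightarrow> 'a::{real_inner,banach,second_countable_topology}) \<Rightarrow> bool" where
  "sqi f \<longleftrightarrow> f \<in> borel_measurable lebesgue \<and> (\<integral>\<^sup>+t. ennreal (norm (f t)) ^ 2 \<partial>lborel) < top"

lemma sqi_integrable: "sqi f \<Longrightarrow> integrable lebesgue (\<lambda>s. (norm (f s))\<^sup>2)"
  unfolding sqi_def by (auto intro!: integrableI_bounded simp: nn_integral_completion ennreal_power)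

lemma sqi_inner:
  assumes f: "sqi f" and g: "sqi g" shows "integrable lebesgue (\<lambda>t. inner (f t) (g t))"
proof (rule Bochner_Integration.integrable_bound)
  show "integrable lebesgue (\<lambda>t. (norm (f t))\<^sup>2 + (norm (g t))\<^sup>2)"
    using sqi_integrable[OF f] sqi_integrable[OF g] by (rule Bochner_Integration.integrable_add)
  show "(\<lambda>t. inner (f t) (g t)) \<in> borel_measurable lebesgue"
    using f g unfolding sqi_def by (intro borel_measurable_inner) auto
  show "AE t in lebesgue. norm (inner (f t) (g t)) \<le> norm ((norm (f t))\<^sup>2 + (norm (g t))\<^sup>2)"
  proof (rule AE_I2)
    fix t
    have "0 \<le> (norm (f t) - norm (g t))\<^sup>2" by simp
    then have "2 * (norm (f t) * norm (g t)) \<le> (norm (f t))\<^sup>2 + (norm (g t))\<^sup>2" by (simp add: power2_diff)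
    moreover have "0 \<le> norm (f t) * norm (g t)" by simp
    ultimately show "norm (inner (f t) (g t)) \<le> norm ((norm (f t))\<^sup>2 + (norm (g t))\<^sup>2)"
      using Cauchy_Schwarz_ineq2[of "f t" "g t"] by simp
  qed
qed

lemma sqi_add:
  assumes f: "sqi f" and g: "sqi g" shows "sqi (\<lambda>s. f s + g s)"
  unfolding sqi_def
proof
  have [measurable]: "f \<in> borel_measurable lebesgue" "g \<in> borel_measurable lebesgue"
    using f g by (auto simp: sqi_def)
  show "(\<lambda>s. f s + g s) \<in> borel_measurable lebesgue" by measurable
  have "(\<integral>\<^sup>+s. ennreal (norm (f s + g s)) ^ 2 \<partial>lborel)
      \<le> (\<integral>\<^sup>+s. 2 ^ 2 * (ennreal (norm (f s)) ^ 2 + ennreal (norm (g s)) ^ 2) \<partial>lebesgue)"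
    unfolding nn_integral_completion
  proof (rule nn_integral_mono)
    fix s
    have "ennreal (norm (f s + g s)) ^ 2 \<le> (ennreal (norm (f s)) + ennreal (norm (g s))) ^ 2"
      by (intro power_mono_ennreal) (simp add: norm_triangle_ineq ennreal_plus[symmetric] ennreal_leI del: ennreal_plus)
    also have "\<dots> \<le> 2 ^ 2 * (ennreal (norm (f s)) ^ 2 + ennreal (norm (g s)) ^ 2)" by (rule add_power_le_ennreal)
    finally show "ennreal (norm (f s + g s)) ^ 2 \<le> 2 ^ 2 * (ennreal (norm (f s)) ^ 2 + ennreal (norm (g s)) ^ 2)" .
  qed
  also have "\<dots> = 2 ^ 2 * ((\<integral>\<^sup>+s. ennreal (norm (f s)) ^ 2 \<partial>lebesgue) + (\<integral>\<^sup>+s. ennreal (norm (g s)) ^ 2 \<partial>lebesgue))"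
    by (simp add: nn_integral_add nn_integral_cmult)
  also have "\<dots> < top" using f g by (simp add: sqi_def nn_integral_completion ennreal_mult_less_top)
  finally show "(\<integral>\<^sup>+s. ennreal (norm (f s + g s)) ^ 2 \<partial>lborel) < top" .
qed

lemma sqi_bounded_linear:
  assumes T: "bounded_linear T" and f: "sqi f" shows "sqi (\<lambda>t. T (f t))"
  unfolding sqi_def
proof
  have [measurable]: "f \<in> borel_measurable lebesgue" using f by (simp add: sqi_def)
  show "(\<lambda>t. T (f t)) \<in> borel_measurable lebesgue"
    by (rule measurable_compose[OF _ borel_measurable_continuous_onI[OF linear_continuous_on[OF T]]]) simp
  obtain K where K: "0 \<le> K" "\<And>x. norm (T x) \<le> norm x * K"
    using bounded_linear.nonneg_bounded[OF T] by blast
  have "(\<integral>\<^sup>+t. ennreal (norm (T (f t))) ^ 2 \<partial>lborel) \<le> (\<integral>\<^sup>+t. ennreal K ^ 2 * ennreal (norm (f t)) ^ 2 \<partial>lebesgue)"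
    unfolding nn_integral_completion
  proof (rule nn_integral_mono)
    fix t
    have "ennreal (norm (T (f t))) \<le> ennreal K * ennreal (norm (f t))"
      using K by (simp add: ennreal_mult[symmetric] ennreal_leI mult.commute)
    then show "ennreal (norm (T (f t))) ^ 2 \<le> ennreal K ^ 2 * ennreal (norm (f t)) ^ 2"
      unfolding power_mult_distrib[symmetric] by (rule power_mono_ennreal)
  qed
  also have "\<dots> = ennreal K ^ 2 * (\<integral>\<^sup>+t. ennreal (norm (f t)) ^ 2 \<partial>lebesgue)"
    by (rule nn_integral_cmult) measurable
  also have "\<dots> < top" using f by (simp add: sqi_def nn_integral_completion ennreal_mult_less_top power_less_top_ennreal)
  finally show "(\<integral>\<^sup>+t. ennreal (norm (T (f t))) ^ 2 \<partial>lborel) < top" .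
qed

text \<open>Controls are extended by 0 to nonpositive times, so the lower limit 0 of the state
  integral disappears and convolutions run over the whole line.\<close>

definition ctl :: "(real \<Rightarrow> 'u::separable_complex_hilbert) \<Rightarrow> bool" where
  "ctl u \<longleftrightarrow> u \<in> borel_measurable lebesgue \<and> (\<forall>s\<le>0. u s = 0) \<and>
     (\<integral>\<^sup>+s. ennreal (norm (u s)) ^ 2 \<partial>lborel) < top"

lemma ctl_iff_sqi: "ctl u \<longleftrightarrow> sqi u \<and> (\<forall>s\<le>0. u s = 0)"
  by (auto simp: ctl_def sqi_def)

lemma ctl_sqi: "ctl u \<Longrightarrow> sqi u" by (simp add: ctl_iff_sqi)

lemma ctl_integrable: "ctl u \<Longrightarrow> integrable lebesgue (\<lambda>s. (norm (u s))\<^sup>2)"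
  by (intro sqi_integrable ctl_sqi)

lemma ctl_add: "ctl u \<Longrightarrow> ctl v \<Longrightarrow> ctl (\<lambda>s. u s + v s)"
  by (simp add: ctl_iff_sqi sqi_add)

lemma ctl_scaleC: "ctl u \<Longrightarrow> ctl (\<lambda>s. c *\<^sub>C u s)"
  using linear_0[OF bounded_linear.linear[OF bounded_linear_scaleC]]
  by (auto simp: ctl_iff_sqi intro: sqi_bounded_linear[OF bounded_linear_scaleC])

section \<open>Riesz representation of the controlled part of the state\<close>

context control_system begin

text \<open>The real part of the pairing of (Lu)(t) with \<open>J' z\<close>; the imaginary part is
  \<open>Lam u t (\<i> *\<^sub>C z)\<close>.\<close>

definition Lam :: "(real \<Rightarrow> 'u) \<Rightarrow> real \<Rightarrow> 'y \<Rightarrow> real" where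
  "Lam u t z = (LINT s:{0..t}|lebesgue. inner (u s) (k (t - s) z))"

definition rep :: "(real \<Rightarrow> 'u) \<Rightarrow> real \<Rightarrow> 'y \<Rightarrow> bool" where
  "rep u t y \<longleftrightarrow> (\<forall>z. Lam u t z = inner y (J' z))"

text \<open>The default 0 is that of \<open>pivot_rep\<close>, so the two agree at every time,
  including times without a representative.\<close>

definition Lop :: "(real \<Rightarrow> 'u) \<Rightarrow> real \<Rightarrow> 'y" where
  "Lop u t = (if \<exists>y. rep u t y then THE y. rep u t y else 0)"

lemma rep_unique: "rep u t y \<Longrightarrow> rep u t y' \<Longrightarrow> y = y'"
  using J'_total[of "y - y'"] by (simp add: rep_def inner_diff_left)

lemma Lop_eqI: "rep u t y \<Longrightarrow> Lop u t = y"
  unfolding Lop_def using rep_unique by (auto intro!: the_equality)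

lemma Lam_integrand_measurable:
  assumes "u \<in> borel_measurable lebesgue"
  shows "(\<lambda>s. indicator {..<t} s * inner (u s) (k (t - s) z)) \<in> borel_measurable lebesgue"
proof -
  have "(\<lambda>s. indicator {0<..} (t - s) *\<^sub>R k (t - s) z) \<in> borel_measurable borel"
    by (rule measurable_compose[OF _ k_measurable]) simp
  then have [measurable]: "(\<lambda>s. indicator {0<..} (t - s) *\<^sub>R k (t - s) z) \<in> borel_measurable lebesgue"
    by (intro measurable_completion) simp
  have "(\<lambda>s. inner (u s) (indicator {0<..} (t - s) *\<^sub>R k (t - s) z)) \<in> borel_measurable lebesgue"
    using assms by measurable
  moreover have "(\<lambda>s. inner (u s) (indicator {0<..} (t - s) *\<^sub>R k (t - s) z))
      = (\<lambda>s. indicator {..<t} s * inner (u s) (k (t - s) z))"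
    by (auto simp: fun_eq_iff indicator_def)
  ultimately show ?thesis by simp
qed

lemma Lam_integrand_bound:
  assumes u: "ctl u" and t: "t \<le> T"
  shows "norm (indicator {..<t} s * inner (u s) (k (t - s) z))
    \<le> k_bound * norm z * (indicator {0..T} s + (norm (u s))\<^sup>2)"
proof (cases "0 < s \<and> s < t")
  case True
  have "\<bar>inner (u s) (k (t - s) z)\<bar> \<le> norm (u s) * norm (k (t - s) z)" by (rule Cauchy_Schwarz_ineq2)
  also have "\<dots> \<le> norm (u s) * (k_bound * norm z)"
    using True by (intro mult_left_mono k_bound) auto
  also have "\<dots> \<le> (1 + (norm (u s))\<^sup>2) * (k_bound * norm z)"
  proof (rule mult_right_mono)
    have "0 \<le> (norm (u s) - 1)\<^sup>2 + (norm (u s))\<^sup>2" by simp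
    then show "norm (u s) \<le> 1 + (norm (u s))\<^sup>2"
      by (simp add: power2_diff)
  qed (use k_bound in simp)
  finally show ?thesis using True t by (simp add: mult_ac)
next
  case False
  then show ?thesis using u k_bound(1) by (cases "s \<le> 0") (auto simp: ctl_def)
qed

lemma Lam_integrable:
  assumes u: "ctl u"
  shows "integrable lebesgue (\<lambda>s. indicator {..<t} s * inner (u s) (k (t - s) z))"
proof (rule Bochner_Integration.integrable_bound)
  show "integrable lebesgue (\<lambda>s. k_bound * norm z * (indicator {0..t} s + (norm (u s))\<^sup>2))"
    using ctl_integrable[OF u] by (intro integrable_mult_right Bochner_Integration.integrable_add) (auto intro!: integrable_real_indicator simp: emeasure_lborel_Icc_eq)
  show "(\<lambda>s. indicator {..<t} s * inner (u s) (k (t - s) z)) \<in> borel_measurable lebesgue"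
    using u by (intro Lam_integrand_measurable) (simp add: ctl_def)
  show "AE s in lebesgue. norm (indicator {..<t} s * inner (u s) (k (t - s) z))
    \<le> norm (k_bound * norm z * (indicator {0..t} s + (norm (u s))\<^sup>2))"
    by (intro AE_I2 order_trans[OF Lam_integrand_bound[OF u order_refl]]) simp
qed

text \<open>Endpoints are null and \<open>u\<close> vanishes at nonpositive times, so {0..t} may be
  replaced by {..<t}, where the time argument of \<open>k\<close> is positive.\<close>

lemma Lam_cong:
  assumes u: "ctl u" and eq: "AE s in lborel. 0 < s \<longrightarrow> u s = v s"
  shows "Lam v t z = (LINT s|lebesgue. indicator {..<t} s * inner (u s) (k (t - s) z))"
proof -
  have ae: "AE s in lborel. indicator {..<t} s * inner (u s) (k (t - s) z)
      = indicator {0..t} s *\<^sub>R inner (v s) (k (t - s) z)"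
    using eq AE_lborel_singleton[of 0] AE_lborel_singleton[of t]
    by eventually_elim (use u in \<open>auto simp: indicator_def ctl_def\<close>)
  have m: "(\<lambda>s. indicator {..<t} s * inner (u s) (k (t - s) z)) \<in> borel_measurable lebesgue"
    using u by (intro Lam_integrand_measurable) (simp add: ctl_def)
  show ?thesis
    unfolding Lam_def set_lebesgue_integral_def
    by (rule integral_cong_AE[symmetric, OF m borel_measurable_lebesgue_AE[OF m ae] AE_completion[OF ae]])
qed

lemma Lam_eq: "ctl u \<Longrightarrow> Lam u t z = (LINT s|lebesgue. indicator {..<t} s * inner (u s) (k (t - s) z))"
  by (rule Lam_cong) auto

lemma Lam_AE_cong:
  assumes u: "ctl u" and eq: "AE s in lborel. 0 < s \<longrightarrow> u s = v s"
  shows "Lam v = Lam u" "rep v = rep u" "Lop v = Lop u"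
proof -
  show L: "Lam v = Lam u" by (intro ext) (simp add: Lam_cong[OF u eq] Lam_eq[OF u])
  then show R: "rep v = rep u" by (intro ext) (simp add: rep_def)
  then show "Lop v = Lop u" by (intro ext) (simp add: Lop_def)
qed

lemma linear_Lam:
  assumes u: "ctl u" shows "linear (Lam u t)"
proof (rule linearI)
  fix x y
  have "(\<lambda>s. indicator {..<t} s * inner (u s) (k (t - s) (x + y)))
      = (\<lambda>s. indicator {..<t} s * inner (u s) (k (t - s) x) + indicator {..<t} s * inner (u s) (k (t - s) y))"
    by (auto simp: fun_eq_iff indicator_def linear_add[OF linear_k] inner_add_right)
  then show "Lam u t (x + y) = Lam u t x + Lam u t y"
    unfolding Lam_eq[OF u] by (simp add: Bochner_Integration.integral_add[OF Lam_integrable Lam_integrable, OF u u])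
next
  fix c x
  have "(\<lambda>s. indicator {..<t} s * inner (u s) (k (t - s) (c *\<^sub>R x)))
      = (\<lambda>s. c * (indicator {..<t} s * inner (u s) (k (t - s) x)))"
    by (auto simp: fun_eq_iff indicator_def linear_scale[OF linear_k])
  then show "Lam u t (c *\<^sub>R x) = c *\<^sub>R Lam u t x"
    unfolding Lam_eq[OF u] by simp
qed

lemma Lam_add:
  assumes u: "ctl u" and v: "ctl v"
  shows "Lam (\<lambda>s. u s + v s) t z = Lam u t z + Lam v t z"
proof -
  have "(\<lambda>s. indicator {..<t} s * inner (u s + v s) (k (t - s) z))
      = (\<lambda>s. indicator {..<t} s * inner (u s) (k (t - s) z) + indicator {..<t} s * inner (v s) (k (t - s) z))"
    by (auto simp: fun_eq_iff indicator_def inner_add_left)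
  then show ?thesis
    unfolding Lam_eq[OF u] Lam_eq[OF v] Lam_eq[OF ctl_add[OF u v]]
    by (simp add: Bochner_Integration.integral_add[OF Lam_integrable Lam_integrable, OF u v])
qed

lemma Lam_scaleC:
  assumes u: "ctl u" shows "Lam (\<lambda>s. c *\<^sub>C u s) t z = Lam u t (cnj c *\<^sub>C z)"
  unfolding Lam_eq[OF u] Lam_eq[OF ctl_scaleC[OF u]]
  by (intro Bochner_Integration.integral_cong refl)
    (auto simp: indicator_def inner_scaleC_left bclinearD(2)[OF bclinear_k])

lemma rep_add: "ctl u \<Longrightarrow> ctl v \<Longrightarrow> rep u t y \<Longrightarrow> rep v t y' \<Longrightarrow> rep (\<lambda>s. u s + v s) t (y + y')"
  by (simp add: rep_def Lam_add inner_add_left)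

lemma rep_scaleC: "ctl u \<Longrightarrow> rep u t y \<Longrightarrow> rep (\<lambda>s. c *\<^sub>C u s) t (c *\<^sub>C y)"
  by (simp add: rep_def Lam_scaleC inner_scaleC_left bclinearD(2)[OF bclinear_J'])

text \<open>Dominated convergence, with convergence of the integrand at every s \<noteq> t. This is
  the source of the measurability of \<open>Lop u\<close> in time.\<close>

lemma Lam_continuous:
  assumes u: "ctl u" shows "continuous_on UNIV (\<lambda>t. Lam u t z)"
proof -
  have "(\<lambda>i. Lam u (x i) z) \<longlonglongrightarrow> Lam u t z" if x: "x \<longlonglongrightarrow> t" for x t
  proof -
    obtain T where T: "\<And>i. x i \<le> T"
      using convergent_imp_Bseq[of x] x unfolding convergent_def Bseq_def by (metis abs_le_D1 real_norm_def)
    let ?f = "\<lambda>t s. indicator {..<t} s * inner (u s) (k (t - s) z)"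
    have "(\<lambda>i. LINT s|lebesgue. ?f (x i) s) \<longlonglongrightarrow> (LINT s|lebesgue. ?f t s)"
    proof (rule integral_dominated_convergence)
      show "integrable lebesgue (\<lambda>s. k_bound * norm z * (indicator {0..T} s + (norm (u s))\<^sup>2))"
        using ctl_integrable[OF u] by (intro integrable_mult_right Bochner_Integration.integrable_add) (auto intro!: integrable_real_indicator simp: emeasure_lborel_Icc_eq)
      show "?f (x i) \<in> borel_measurable lebesgue" for i using u by (intro Lam_integrand_measurable) (simp add: ctl_def)
      show "?f t \<in> borel_measurable lebesgue" using u by (intro Lam_integrand_measurable) (simp add: ctl_def)
      show "AE s in lebesgue. norm (?f (x i) s) \<le> k_bound * norm z * (indicator {0..T} s + (norm (u s))\<^sup>2)" for i
        using Lam_integrand_bound[OF u T] by (intro AE_I2)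
      show "AE s in lebesgue. (\<lambda>i. ?f (x i) s) \<longlonglongrightarrow> ?f t s"
        using AE_completion[OF AE_lborel_singleton[of t]]
      proof eventually_elim
        case (elim s)
        show ?case
        proof (cases "s < t")
          case True
          then have ev: "eventually (\<lambda>i. s < x i) sequentially" by (rule order_tendstoD(1)[OF x])
          have "(\<lambda>i. k (x i - s) z) \<longlonglongrightarrow> k (t - s) z"
          proof (rule continuous_on_tendsto_compose[OF continuous_on_k])
            show "(\<lambda>i. x i - s) \<longlonglongrightarrow> t - s" by (intro tendsto_intros x)
            show "\<forall>\<^sub>F i in sequentially. x i - s \<in> {0..}" using ev by eventually_elim auto
          qed (use True in auto)
          then have "(\<lambda>i. inner (u s) (k (x i - s) z)) \<longlonglongrightarrow> inner (u s) (k (t - s) z)" by (intro tendsto_intros)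
          moreover have "eventually (\<lambda>i. inner (u s) (k (x i - s) z) = ?f (x i) s) sequentially"
            using ev by eventually_elim auto
          ultimately have "(\<lambda>i. ?f (x i) s) \<longlonglongrightarrow> inner (u s) (k (t - s) z)" by (rule Lim_transform_eventually)
          then show ?thesis using True by simp
        next
          case False
          then have "t < s" using elim by simp
          with x have "eventually (\<lambda>i. x i < s) sequentially" by (rule order_tendstoD)
          then have "eventually (\<lambda>i. 0 = ?f (x i) s) sequentially" by eventually_elim auto
          then have "(\<lambda>i. ?f (x i) s) \<longlonglongrightarrow> 0" by (rule Lim_transform_eventually[OF tendsto_const])
          then show ?thesis using False by simp
        qed
      qed
    qed
    then show ?thesis by (simp add: Lam_eq[OF u])
  qed
  then show ?thesis by (simp add: continuous_on_sequentially o_def)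
qed

lemma Lam_bound:
  assumes u: "ctl u"
  shows "ennreal \<bar>Lam u t z\<bar> \<le> (\<integral>\<^sup>+s. indicator {..<t} s * (ennreal (norm (u s)) * ennreal (norm (k (t - s) z))) \<partial>lborel)"
proof -
  have "ennreal \<bar>Lam u t z\<bar> \<le> (\<integral>\<^sup>+s. ennreal (norm (indicator {..<t} s * inner (u s) (k (t - s) z))) \<partial>lebesgue)"
    unfolding Lam_eq[OF u] using integral_norm_bound_ennreal[OF Lam_integrable[OF u]] by simp
  also have "\<dots> \<le> (\<integral>\<^sup>+s. indicator {..<t} s * (ennreal (norm (u s)) * ennreal (norm (k (t - s) z))) \<partial>lborel)"
    unfolding nn_integral_completion
    using Cauchy_Schwarz_ineq2
    by (intro nn_integral_mono) (auto simp: indicator_def ennreal_mult[symmetric] intro!: ennreal_leI)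
  finally show ?thesis .
qed

lemma Lam_representation:
  fixes T :: "'y \<Rightarrow> 'y"
  assumes u: "ctl u" and T: "linear T" and E: "0 \<le> E" "\<And>z. \<bar>Lam u t z\<bar> \<le> E * norm (T z)"
  obtains y where "norm y \<le> E" "\<And>z. Lam u t z = inner y (T z)"
  using closest_point_limit[OF T linear_Lam[OF u, of t] E(1) E(2)] by metis

text \<open>The element of the domain of the adjoint is \<open>J' z\<close>. The first part is
  bounded on Y at each time; the remainder \<open>h\<close> is chosen separately for each
  \<open>z\<close>, and only the bound of its weighted L^n norm is uniform.\<close>

definition kernel_split :: "(real \<Rightarrow> ennreal) \<Rightarrow> nat \<Rightarrow> real \<Rightarrow> bool" where
  "kernel_split kd n C \<longleftrightarrow> 0 \<le> C \<and> (\<forall>z. \<exists>h\<in>borel_measurable borel.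
     (AE \<tau> in lborel. 0 < \<tau> \<longrightarrow> ennreal (norm (k \<tau> z)) \<le> kd \<tau> * ennreal (norm (J' z)) + h \<tau>) \<and>
     (\<integral>\<^sup>+\<tau>. indicator {0<..} \<tau> * (ennreal (exp (\<omega> / 2 * \<tau>)) * h \<tau>) ^ n \<partial>lborel) \<le> ennreal (C * norm (J' z)) ^ n)"

text \<open>The Hoelder factor that goes with \<open>kernel_split\<close>: the rate \<omega>/(2 m),
  taken m times, cancels the weight exp(\<omega>/2 \<tau>), and the power m + 1 leaves an integrable
  kernel.\<close>

definition decay :: "nat \<Rightarrow> (real \<Rightarrow> ennreal) \<Rightarrow> real \<Rightarrow> ennreal" where
  "decay m \<psi> = conv (\<lambda>\<tau>. (indicator {0<..} \<tau> * ennreal (exp (- (\<omega> / (2 * real m)) * \<tau>))) ^ Suc m) (\<lambda>s. \<psi> s ^ Suc m)"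

lemma decay_measurable [measurable]: "\<psi> \<in> borel_measurable borel \<Longrightarrow> decay m \<psi> \<in> borel_measurable borel"
  unfolding decay_def by measurable

lemma decay_le:
  assumes "1 \<le> m" shows "decay m \<psi> t \<le> (\<integral>\<^sup>+s. \<psi> s ^ Suc m \<partial>lborel)"
  unfolding decay_def conv_def
proof (rule nn_integral_mono)
  fix s
  have "indicator {0<..} (t - s) * ennreal (exp (- (\<omega> / (2 * real m)) * (t - s))) \<le> 1"
    using \<omega>_pos assms by (auto simp: indicator_def ennreal_le_1)
  then have "(indicator {0<..} (t - s) * ennreal (exp (- (\<omega> / (2 * real m)) * (t - s)))) ^ Suc m \<le> 1 ^ Suc m"
    by (rule power_mono_ennreal)
  then show "(indicator {0<..} (t - s) * ennreal (exp (- (\<omega> / (2 * real m)) * (t - s)))) ^ Suc m * \<psi> s ^ Suc m \<le> \<psi> s ^ Suc m"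
    using mult_right_mono[of _ 1 "\<psi> s ^ Suc m"] by simp
qed

text \<open>The control is given in the dual exponent (m + 1)/m, its norm being \<psi>^m, so that
  Hoelder's inequality for the remainder involves natural powers only. The singular part is
  estimated by a convolution, and Riesz then yields the state.\<close>

lemma Lop_bound:
  assumes split: "kernel_split kd (Suc m) C" and m: "1 \<le> m"
    and kd [measurable]: "kd \<in> borel_measurable borel" and kd0: "\<And>\<tau>. \<tau> \<le> 0 \<Longrightarrow> kd \<tau> = 0"
    and u: "ctl u" and [measurable]: "\<psi> \<in> borel_measurable borel"
    and u\<psi>: "AE s in lborel. ennreal (norm (u s)) = \<psi> s ^ m"
    and fin: "(\<integral>\<^sup>+s. \<psi> s ^ Suc m \<partial>lborel) < top"
    and conv_fin: "conv kd (\<lambda>s. \<psi> s ^ m) t < top"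
  shows "rep u t (Lop u t)"
    "ennreal (norm (Lop u t)) \<le> conv kd (\<lambda>s. \<psi> s ^ m) t
       + ennreal (C * enn2real (decay m \<psi> t) powr (real m / real (Suc m)))"
proof -
  define X where "X = enn2real (decay m \<psi> t)"
  have X: "ennreal X = decay m \<psi> t" "0 \<le> X"
    using le_less_trans[OF decay_le[OF m] fin] by (auto simp: X_def)
  define c where "c = enn2real (conv kd (\<lambda>s. \<psi> s ^ m) t)"
  have c: "ennreal c = conv kd (\<lambda>s. \<psi> s ^ m) t" "0 \<le> c" using conv_fin by (auto simp: c_def less_top[symmetric])
  define E where "E = C * X powr (real m / real (Suc m))"
  have C: "0 \<le> C" using split by (simp add: kernel_split_def)
  have E: "0 \<le> E" using C by (simp add: E_def)
  \<comment> \<open>The exponent m/(m+1) in \<open>E\<close> becomes natural once the power m + 1 is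
    taken.\<close>
  have Epow: "E ^ Suc m = C ^ Suc m * X ^ m"
  proof -
    have "(X powr (real m / real (Suc m))) ^ Suc m = X ^ m"
    proof (cases "X = 0")
      case False
      then have "(X powr (real m / real (Suc m))) ^ Suc m = X powr (real m / real (Suc m) * real (Suc m))"
        using X(2) by (subst powr_realpow[symmetric]) (auto simp: powr_powr)
      also have "real m / real (Suc m) * real (Suc m) = real m" by simp
      finally show ?thesis using X(2) False by (simp add: powr_realpow)
    qed (use m in simp)
    then show ?thesis by (simp only: E_def power_mult_distrib)
  qed
  have "\<bar>Lam u t z\<bar> \<le> (c + E) * norm (J' z)" for z
  proof -
    obtain h where [measurable]: "h \<in> borel_measurable borel"
      and h: "AE \<tau> in lborel. 0 < \<tau> \<longrightarrow> ennreal (norm (k \<tau> z)) \<le> kd \<tau> * ennreal (norm (J' z)) + h \<tau>"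
        "(\<integral>\<^sup>+\<tau>. indicator {0<..} \<tau> * (ennreal (exp (\<omega> / 2 * \<tau>)) * h \<tau>) ^ Suc m \<partial>lborel) \<le> ennreal (C * norm (J' z)) ^ Suc m"
      using split unfolding kernel_split_def by blast
    \<comment> \<open>The weight and its inverse are distributed so that
      \<open>p s ^ m * q (t - s)\<close> is the integrand of the remainder.\<close>
    define p where "p s = \<psi> s * (indicator {0<..} (t - s) * ennreal (exp (- (\<omega> / (2 * real m)) * (t - s))))" for s
    define q where "q \<tau> = indicator {0<..} \<tau> * (ennreal (exp (\<omega> / 2 * \<tau>)) * h \<tau>)" for \<tau>
    have [measurable]: "p \<in> borel_measurable borel" "q \<in> borel_measurable borel"
      unfolding p_def[abs_def] q_def[abs_def] by measurable
    have pq: "p s ^ m * q (t - s) = \<psi> s ^ m * (indicator {0<..} (t - s) * h (t - s))" for s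
    proof (cases "s < t")
      case True
      have "ennreal (exp (- (\<omega> / (2 * real m)) * (t - s))) ^ m * ennreal (exp (\<omega> / 2 * (t - s))) = 1"
        using m by (simp add: ennreal_power ennreal_mult[symmetric] exp_of_nat_mult[symmetric] exp_add[symmetric])
      then show ?thesis using True
        by (simp add: p_def q_def power_mult_distrib) (simp only: mult.assoc[symmetric], simp add: mult.assoc)
    next
      case False
      then show ?thesis using m by (simp add: p_def q_def)
    qed
    let ?I2 = "\<integral>\<^sup>+s. \<psi> s ^ m * (indicator {0<..} (t - s) * h (t - s)) \<partial>lborel"
    have "?I2 ^ Suc m \<le> (\<integral>\<^sup>+s. p s ^ Suc m \<partial>lborel) ^ m * (\<integral>\<^sup>+s. q (t - s) ^ Suc m \<partial>lborel)"
      unfolding pq[symmetric] by (rule nn_integral_power_Holder) measurable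
    also have "(\<integral>\<^sup>+s. p s ^ Suc m \<partial>lborel) = decay m \<psi> t"
      unfolding decay_def conv_def p_def by (simp only: power_mult_distrib mult.commute)
    also have "(\<integral>\<^sup>+s. q (t - s) ^ Suc m \<partial>lborel) = (\<integral>\<^sup>+\<tau>. q \<tau> ^ Suc m \<partial>lborel)"
      by (rule nn_integral_reflect_shift(1)) measurable
    also have "\<dots> = (\<integral>\<^sup>+\<tau>. indicator {0<..} \<tau> * (ennreal (exp (\<omega> / 2 * \<tau>)) * h \<tau>) ^ Suc m \<partial>lborel)"
      by (intro nn_integral_cong) (auto simp: q_def indicator_def)
    also have "decay m \<psi> t ^ m * \<dots> \<le> ennreal X ^ m * ennreal (C * norm (J' z)) ^ Suc m"
      unfolding X(1) by (intro mult_left_mono h(2)) simp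
    also have "\<dots> = ennreal (E * norm (J' z)) ^ Suc m"
      using C X(2) E by (simp add: ennreal_power ennreal_mult[symmetric] power_mult_distrib Epow mult_ac del: power_Suc)
    finally have I2: "?I2 \<le> ennreal (E * norm (J' z))" by (rule ennreal_power_le_cancel) simp
    have "ennreal \<bar>Lam u t z\<bar> \<le> (\<integral>\<^sup>+s. indicator {..<t} s * (ennreal (norm (u s)) * ennreal (norm (k (t - s) z))) \<partial>lborel)"
      by (rule Lam_bound[OF u])
    also have "\<dots> \<le> (\<integral>\<^sup>+s. ennreal (norm (J' z)) * (kd (t - s) * \<psi> s ^ m)
        + \<psi> s ^ m * (indicator {0<..} (t - s) * h (t - s)) \<partial>lborel)"
    proof (rule nn_integral_mono_AE)
      show "AE s in lborel. indicator {..<t} s * (ennreal (norm (u s)) * ennreal (norm (k (t - s) z)))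
          \<le> ennreal (norm (J' z)) * (kd (t - s) * \<psi> s ^ m) + \<psi> s ^ m * (indicator {0<..} (t - s) * h (t - s))"
        using u\<psi> AE_lborel_reflect[OF h(1), of t]
      proof eventually_elim
        case (elim s)
        show ?case
        proof (cases "s < t")
          case True
          then have "\<psi> s ^ m * ennreal (norm (k (t - s) z)) \<le> \<psi> s ^ m * (kd (t - s) * ennreal (norm (J' z)) + h (t - s))"
            using elim by (intro mult_left_mono) auto
          then show ?thesis using True elim by (simp add: distrib_left mult_ac)
        qed simp
      qed
    qed
    also have "\<dots> = ennreal (norm (J' z)) * conv kd (\<lambda>s. \<psi> s ^ m) t + ?I2"
      unfolding conv_def by (simp add: nn_integral_add nn_integral_cmult)
    also have "\<dots> \<le> ennreal (norm (J' z)) * ennreal c + ennreal (E * norm (J' z))"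
      unfolding c(1) by (intro add_left_mono I2)
    also have "\<dots> = ennreal ((c + E) * norm (J' z))"
      using c(2) E by (simp add: ennreal_mult[symmetric] ennreal_plus[symmetric] distrib_right mult.commute del: ennreal_plus)
    finally show ?thesis using c(2) E by (simp add: ennreal_le_iff)
  qed
  then obtain y where y: "norm y \<le> c + E" "\<And>z. Lam u t z = inner y (J' z)"
    using Lam_representation[OF u linear_J', of "c + E" t] c(2) E by (metis add_nonneg_nonneg)
  have ry: "rep u t y" using y(2) by (simp add: rep_def)
  then show "rep u t (Lop u t)" using Lop_eqI by simp
  have "ennreal (norm (Lop u t)) \<le> ennreal (c + E)" using y(1) Lop_eqI[OF ry] by (simp add: ennreal_leI)
  then show "ennreal (norm (Lop u t)) \<le> conv kd (\<lambda>s. \<psi> s ^ m) t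
       + ennreal (C * enn2real (decay m \<psi> t) powr (real m / real (Suc m)))"
    using c E by (simp add: E_def X_def ennreal_plus)
qed

text \<open>The kernel is cut at \<delta>. Before \<delta> the given splitting is kept. After
  \<delta> the factor \<tau>^(-\<gamma>) is bounded, so the whole kernel counts as remainder: it is
  L^n on (\<delta>, 2 \<delta>], inside (0,T), and \<open>weighted_block_bound\<close> spreads this
  to the half line.\<close>

lemma kernel_split_of_block:
  fixes N \<gamma> T \<delta> CG :: real and n :: nat
  assumes N: "0 \<le> N" and \<gamma>: "0 < \<gamma>" and \<delta>: "0 < \<delta>" "2 * \<delta> < T" and n: "1 \<le> n" and CG: "0 \<le> CG"
    and block: "\<And>z. \<exists>g\<in>borel_measurable borel.
      (AE \<tau> in lborel. 0 < \<tau> \<and> \<tau> < T \<longrightarrow>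
        ennreal (norm (k \<tau> z)) \<le> ennreal (N * \<tau> powr (- \<gamma>)) * ennreal (norm (J' z)) + g \<tau>) \<and>
      (\<integral>\<^sup>+\<tau>. indicator {0<..<T} \<tau> * g \<tau> ^ n \<partial>lborel) \<le> ennreal (CG * norm (J' z)) ^ n"
  shows "\<exists>C. kernel_split (\<lambda>\<tau>. indicator {0<..<\<delta>} \<tau> * ennreal (N * \<tau> powr (- \<gamma>))) n C"
proof -
  \<comment> \<open>From (x + y)^n \<le> 2^n (x^n + y^n), the bounded singular part being integrated
    over a block of length \<delta>.\<close>
  define c where "c = 2 ^ n * ((N * \<delta> powr (- \<gamma>)) ^ n * \<delta> + CG ^ n)"
  have c: "0 \<le> c" using N \<delta> CG by (simp add: c_def)
  have blk: "(\<integral>\<^sup>+\<tau>. indicator {\<delta><..\<delta> + \<delta>} \<tau> * ennreal (norm (k \<tau> z) powr real n) \<partial>lborel)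
      \<le> ennreal (c * norm (J' z) powr real n)" for z
  proof -
    obtain g where [measurable]: "g \<in> borel_measurable borel"
      and g: "AE \<tau> in lborel. 0 < \<tau> \<and> \<tau> < T \<longrightarrow>
        ennreal (norm (k \<tau> z)) \<le> ennreal (N * \<tau> powr (- \<gamma>)) * ennreal (norm (J' z)) + g \<tau>"
        "(\<integral>\<^sup>+\<tau>. indicator {0<..<T} \<tau> * g \<tau> ^ n \<partial>lborel) \<le> ennreal (CG * norm (J' z)) ^ n"
      using block by blast
    let ?q = "N * \<delta> powr (- \<gamma>) * norm (J' z)"
    have "(\<integral>\<^sup>+\<tau>. indicator {\<delta><..\<delta> + \<delta>} \<tau> * ennreal (norm (k \<tau> z) powr real n) \<partial>lborel)
        \<le> (\<integral>\<^sup>+\<tau>. 2 ^ n * (ennreal ?q ^ n * indicator {\<delta><..\<delta> + \<delta>} \<tau>  + indicator {0<..<T} \<tau> * g \<tau> ^ n) \<partial>lborel)"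
    proof (rule nn_integral_mono_AE)
      show "AE \<tau> in lborel. indicator {\<delta><..\<delta> + \<delta>} \<tau> * ennreal (norm (k \<tau> z) powr real n)
          \<le> 2 ^ n * (ennreal ?q ^ n * indicator {\<delta><..\<delta> + \<delta>} \<tau> + indicator {0<..<T} \<tau> * g \<tau> ^ n)"
        using g(1)
      proof eventually_elim
        case (elim \<tau>)
        show ?case
        proof (cases "\<delta> < \<tau> \<and> \<tau> \<le> \<delta> + \<delta>")
          case True
          have "\<tau> powr (- \<gamma>) \<le> \<delta> powr (- \<gamma>)" using True \<delta> \<gamma> by (intro powr_mono2') auto
          then have "N * \<tau> powr (- \<gamma>) * norm (J' z) \<le> ?q" using N by (intro mult_right_mono mult_left_mono) auto
          then have "ennreal (N * \<tau> powr (- \<gamma>)) * ennreal (norm (J' z)) \<le> ennreal ?q"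
            using N by (simp add: ennreal_mult[symmetric] ennreal_leI)
          then have "ennreal (norm (k \<tau> z)) \<le> ennreal ?q + g \<tau>"
            using elim True \<delta> by (auto elim!: order_trans intro: add_right_mono)
          then have "ennreal (norm (k \<tau> z)) ^ n \<le> (ennreal ?q + g \<tau>) ^ n" by (rule power_mono_ennreal)
          also have "\<dots> \<le> 2 ^ n * (ennreal ?q ^ n + g \<tau> ^ n)" by (rule add_power_le_ennreal)
          finally show ?thesis using True \<delta> n by (simp add: ennreal_power powr_realpow')
        qed simp
      qed
    qed
    also have "\<dots> = 2 ^ n * (ennreal ?q ^ n * ennreal \<delta> + (\<integral>\<^sup>+\<tau>. indicator {0<..<T} \<tau> * g \<tau> ^ n \<partial>lborel))"
      using \<delta> by (simp add: nn_integral_cmult nn_integral_add)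
    also have "\<dots> \<le> 2 ^ n * (ennreal ?q ^ n * ennreal \<delta> + ennreal (CG * norm (J' z)) ^ n)"
      by (intro mult_left_mono add_left_mono g(2)) simp
    also have "\<dots> = ennreal (2 ^ n * (?q ^ n * \<delta> + (CG * norm (J' z)) ^ n))"
      using N CG \<delta>
      by (simp add: ennreal_power ennreal_mult[symmetric] ennreal_plus[symmetric]
          flip: ennreal_numeral del: ennreal_plus)
    also have "2 ^ n * (?q ^ n * \<delta> + (CG * norm (J' z)) ^ n) = c * norm (J' z) powr real n"
      using n by (simp add: c_def powr_realpow' power_mult_distrib algebra_simps)
    finally show ?thesis .
  qed
  have "\<exists>C\<ge>0. \<forall>z. (\<integral>\<^sup>+\<tau>. indicator {\<delta><..} \<tau> * ennreal ((exp (\<omega> / 2 * \<tau>) * norm (k \<tau> z)) powr real n) \<partial>lborel)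
    \<le> ennreal (C * norm (J' z) powr real n)"
  proof (rule weighted_block_bound[OF _ _ _ _ \<delta>(1) c blk])
    show "norm (J' (S' t z)) \<le> M * exp (- \<omega> * t) * norm (J' z)" if "0 \<le> t" for t z
      unfolding J'_S'[OF that] by (rule adj.stable[OF that])
  qed (use n \<delta> in auto)
  then obtain C where C: "0 \<le> C" "\<And>z. (\<integral>\<^sup>+\<tau>. indicator {\<delta><..} \<tau> * ennreal ((exp (\<omega> / 2 * \<tau>) * norm (k \<tau> z)) powr real n) \<partial>lborel)
    \<le> ennreal (C * norm (J' z) powr real n)" by blast
  \<comment> \<open>The summand 1 gives D \<ge> 1, hence D \<le> D^n, so that the constant can stand
    inside the n-th power.\<close>
  define D where "D = 1 + C + (exp (\<omega> / 2 * \<delta>) * CG) ^ n"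
  have D: "1 \<le> D" using C CG by (simp add: D_def)
  have "kernel_split (\<lambda>\<tau>. indicator {0<..<\<delta>} \<tau> * ennreal (N * \<tau> powr (- \<gamma>))) n D"
    unfolding kernel_split_def
  proof (intro conjI allI)
    fix z
    obtain g where g_meas [measurable]: "g \<in> borel_measurable borel"
      and g: "AE \<tau> in lborel. 0 < \<tau> \<and> \<tau> < T \<longrightarrow>
        ennreal (norm (k \<tau> z)) \<le> ennreal (N * \<tau> powr (- \<gamma>)) * ennreal (norm (J' z)) + g \<tau>"
        "(\<integral>\<^sup>+\<tau>. indicator {0<..<T} \<tau> * g \<tau> ^ n \<partial>lborel) \<le> ennreal (CG * norm (J' z)) ^ n"
      using block by blast
    define W where "W \<tau> = indicator {0<..} \<tau> * norm (k \<tau> z)" for \<tau>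
    have [measurable]: "W \<in> borel_measurable borel" unfolding W_def[abs_def] by (rule norm_k_measurable)
    define h where "h \<tau> = (if \<tau> < \<delta> then g \<tau> else ennreal (W \<tau>))" for \<tau>
    have h_meas: "h \<in> borel_measurable borel" unfolding h_def[abs_def] by measurable
    have 1: "AE \<tau> in lborel. 0 < \<tau> \<longrightarrow> ennreal (norm (k \<tau> z))
        \<le> indicator {0<..<\<delta>} \<tau> * ennreal (N * \<tau> powr (- \<gamma>)) * ennreal (norm (J' z)) + h \<tau>"
      using g(1) by eventually_elim (use \<delta> in \<open>auto simp: h_def W_def\<close>)
    have "(\<integral>\<^sup>+\<tau>. indicator {0<..} \<tau> * (ennreal (exp (\<omega> / 2 * \<tau>)) * h \<tau>) ^ n \<partial>lborel)
        \<le> (\<integral>\<^sup>+\<tau>. ennreal (exp (\<omega> / 2 * \<delta>)) ^ n * (indicator {0<..<T} \<tau> * g \<tau> ^ n)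
            + indicator {\<delta><..} \<tau> * ennreal ((exp (\<omega> / 2 * \<tau>) * W \<tau>) powr real n) \<partial>lborel)"
    proof (rule nn_integral_mono_AE)
      show "AE \<tau> in lborel. indicator {0<..} \<tau> * (ennreal (exp (\<omega> / 2 * \<tau>)) * h \<tau>) ^ n
        \<le> ennreal (exp (\<omega> / 2 * \<delta>)) ^ n * (indicator {0<..<T} \<tau> * g \<tau> ^ n)
            + indicator {\<delta><..} \<tau> * ennreal ((exp (\<omega> / 2 * \<tau>) * W \<tau>) powr real n)"
        using AE_lborel_singleton[of \<delta>]
      proof eventually_elim
        case (elim \<tau>)
        show ?case
        proof (cases "\<tau> < \<delta>")
          case True
          have "indicator {0<..} \<tau> * (ennreal (exp (\<omega> / 2 * \<tau>)) * h \<tau>) ^ n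
              \<le> ennreal (exp (\<omega> / 2 * \<delta>)) ^ n * (indicator {0<..<T} \<tau> * g \<tau> ^ n)"
            using True \<delta> \<omega>_pos
            by (auto simp: h_def indicator_def power_mult_distrib intro!: mult_right_mono power_mono_ennreal ennreal_leI)
          then show ?thesis by (simp add: add_increasing2)
        next
          case False
          then have "\<delta> < \<tau>" using elim by simp
          then show ?thesis using \<delta> n
            by (auto simp: h_def W_def ennreal_mult[symmetric] ennreal_power powr_realpow' add_increasing)
        qed
      qed
    qed
    also have "\<dots> = ennreal (exp (\<omega> / 2 * \<delta>)) ^ n * (\<integral>\<^sup>+\<tau>. indicator {0<..<T} \<tau> * g \<tau> ^ n \<partial>lborel)
        + (\<integral>\<^sup>+\<tau>. indicator {\<delta><..} \<tau> * ennreal ((exp (\<omega> / 2 * \<tau>) * W \<tau>) powr real n) \<partial>lborel)"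
      by (simp add: nn_integral_add nn_integral_cmult)
    also have "(\<integral>\<^sup>+\<tau>. indicator {\<delta><..} \<tau> * ennreal ((exp (\<omega> / 2 * \<tau>) * W \<tau>) powr real n) \<partial>lborel)
        = (\<integral>\<^sup>+\<tau>. indicator {\<delta><..} \<tau> * ennreal ((exp (\<omega> / 2 * \<tau>) * norm (k \<tau> z)) powr real n) \<partial>lborel)"
      using \<delta> by (intro nn_integral_cong) (auto simp: W_def indicator_def)
    also have "ennreal (exp (\<omega> / 2 * \<delta>)) ^ n * (\<integral>\<^sup>+\<tau>. indicator {0<..<T} \<tau> * g \<tau> ^ n \<partial>lborel) + \<dots>
        \<le> ennreal (exp (\<omega> / 2 * \<delta>)) ^ n * ennreal (CG * norm (J' z)) ^ n + ennreal (C * norm (J' z) powr real n)"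
      by (intro add_mono mult_left_mono g(2) C(2)) simp
    also have "\<dots> = ennreal (((exp (\<omega> / 2 * \<delta>) * CG) ^ n + C) * norm (J' z) ^ n)"
      using n CG C(1) by (simp add: ennreal_power powr_realpow' ennreal_mult[symmetric] ennreal_plus[symmetric] power_mult_distrib algebra_simps del: ennreal_plus)
    also have "\<dots> \<le> ennreal ((D * norm (J' z)) ^ n)"
    proof (rule ennreal_leI)
      have "(exp (\<omega> / 2 * \<delta>) * CG) ^ n + C \<le> D" by (simp add: D_def)
      also have "D \<le> D ^ n" using n by (intro self_le_power D) simp
      finally have "((exp (\<omega> / 2 * \<delta>) * CG) ^ n + C) * norm (J' z) ^ n \<le> D ^ n * norm (J' z) ^ n"
        by (rule mult_right_mono) simp
      then show "((exp (\<omega> / 2 * \<delta>) * CG) ^ n + C) * norm (J' z) ^ n \<le> (D * norm (J' z)) ^ n"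
        by (simp only: power_mult_distrib)
    qed
    also have "\<dots> = ennreal (D * norm (J' z)) ^ n" using D by (simp add: ennreal_power)
    finally have 2: "(\<integral>\<^sup>+\<tau>. indicator {0<..} \<tau> * (ennreal (exp (\<omega> / 2 * \<tau>)) * h \<tau>) ^ n \<partial>lborel)
        \<le> ennreal (D * norm (J' z)) ^ n" .
    show "\<exists>h\<in>borel_measurable borel.
      (AE \<tau> in lborel. 0 < \<tau> \<longrightarrow> ennreal (norm (k \<tau> z))
        \<le> indicator {0<..<\<delta>} \<tau> * ennreal (N * \<tau> powr (- \<gamma>)) * ennreal (norm (J' z)) + h \<tau>) \<and>
      (\<integral>\<^sup>+\<tau>. indicator {0<..} \<tau> * (ennreal (exp (\<omega> / 2 * \<tau>)) * h \<tau>) ^ n \<partial>lborel) \<le> ennreal (D * norm (J' z)) ^ n"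
      using h_meas 1 2 by blast
  qed (use D in simp)
  then show ?thesis by blast
qed

end

text \<open>The powers of \<open>x\<close> on the right add up to 2 - 2/(m + 1), which is less than
  2; dividing gives x^(2/(m+1)) \<le> K. This closes an estimate of a quantity by itself.\<close>

lemma powr_root_bound:
  fixes x K :: real
  assumes x: "0 \<le> x" and K: "0 \<le> K" and m: "1 \<le> m"
    and le: "x\<^sup>2 \<le> K * (x powr (real (m - 1) / real (Suc m)) * x)"
  shows "x \<le> K powr (real (Suc m) / 2)"
proof (cases "x = 0")
  case False
  then have x0: "0 < x" using x by simp
  let ?q = "real (m - 1) / real (Suc m)"
  have e: "2 - (?q + 1) = 2 / real (Suc m)" using m by (simp add: field_simps of_nat_diff)
  have "x powr 2 \<le> K * x powr (?q + 1)"
    using le x0 by (simp add: powr_add powr_numeral)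
  then have "x powr 2 * x powr - (?q + 1) \<le> K * x powr (?q + 1) * x powr - (?q + 1)"
    by (rule mult_right_mono) simp
  also have "\<dots> = K" using x0 by (simp add: powr_add[symmetric] mult.assoc)
  also have "x powr 2 * x powr - (?q + 1) = x powr (2 / real (Suc m))"
    by (simp only: powr_add[symmetric] e[symmetric]) simp
  finally have "(x powr (2 / real (Suc m))) powr (real (Suc m) / 2) \<le> K powr (real (Suc m) / 2)"
    by (intro powr_mono2) auto
  moreover have "(x powr (2 / real (Suc m))) powr (real (Suc m) / 2) = x"
  proof -
    have "2 / real (Suc m) * (real (Suc m) / 2) = 1" by simp
    then show ?thesis using x0 by (simp only: powr_powr powr_one)
  qed
  ultimately show ?thesis by simp
qed simp

lemma ennreal_norm_integral_le: "ennreal (norm (integral\<^sup>L M f)) \<le> (\<integral>\<^sup>+x. ennreal (norm (f x)) \<partial>M)"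
proof (cases "integrable M f")
  case False
  then show ?thesis by (simp add: not_integrable_integral_eq)
qed (rule integral_norm_bound_ennreal)

lemma ennreal_diff_add_ge: "a \<le> (a - b) + (b::ennreal)"
  by (cases "b \<le> a") (auto simp: diff_add_cancel_ennreal add_increasing)

lemma nn_integral_powr_kernel:
  fixes N \<gamma> \<delta> :: real
  assumes "0 \<le> N" "\<gamma> < 1" "0 \<le> \<delta>"
  shows "(\<integral>\<^sup>+\<tau>. indicator {0<..<\<delta>} \<tau> * ennreal (N * \<tau> powr (- \<gamma>)) \<partial>lborel)
    = ennreal (N * (\<delta> powr (1 - \<gamma>) / (1 - \<gamma>)))"
proof -
  have "((\<lambda>\<tau>. \<tau> powr (- \<gamma>)) has_integral (\<delta> powr (- \<gamma> + 1) / (- \<gamma> + 1))) {0..\<delta>}"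
    using assms by (intro has_integral_powr_from_0) auto
  then have "((\<lambda>\<tau>. N * \<tau> powr (- \<gamma>)) has_integral (N * (\<delta> powr (1 - \<gamma>) / (1 - \<gamma>)))) {0..\<delta>}"
    by (intro has_integral_mult_right) (simp add: add.commute)
  then have "(\<integral>\<^sup>+\<tau>. indicator {0..\<delta>} \<tau> * ennreal (N * \<tau> powr (- \<gamma>)) \<partial>lborel) = ennreal (N * (\<delta> powr (1 - \<gamma>) / (1 - \<gamma>)))"
    using assms nn_integral_has_integral_lebesgue[of "{0..\<delta>}" "\<lambda>\<tau>. N * \<tau> powr (- \<gamma>)"]
    by (simp add: nn_integral_completion ennreal_mult indicator_mult_ennreal ennreal_indicator mult.commute)
  moreover have "(\<integral>\<^sup>+\<tau>. indicator {0..\<delta>} \<tau> * ennreal (N * \<tau> powr (- \<gamma>)) \<partial>lborel)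
      = (\<integral>\<^sup>+\<tau>. indicator {0<..<\<delta>} \<tau> * ennreal (N * \<tau> powr (- \<gamma>)) \<partial>lborel)"
    by (intro nn_integral_cong_AE)
      (use AE_lborel_singleton[of 0] AE_lborel_singleton[of \<delta>] in \<open>eventually_elim, auto simp: indicator_def\<close>)
  ultimately show ?thesis by simp
qed

text \<open>The integral is a multiple of \<delta>^(1-\<gamma>) and tends to 0 since \<gamma> < 1.
  This is the smallness behind the contraction.\<close>

lemma small_powr_kernel:
  fixes N \<gamma> e T :: real
  assumes "0 \<le> N" "\<gamma> < 1" "0 < e" "0 < T"
  obtains \<delta> where "0 < \<delta>" "2 * \<delta> < T"
    "(\<integral>\<^sup>+\<tau>. indicator {0<..<\<delta>} \<tau> * ennreal (N * \<tau> powr (- \<gamma>)) \<partial>lborel) \<le> ennreal e"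
proof -
  have "((\<lambda>\<delta>. N * (\<delta> powr (1 - \<gamma>) / (1 - \<gamma>))) \<longlongrightarrow> N * (0 powr (1 - \<gamma>) / (1 - \<gamma>))) (at_right 0)"
    using assms(2) by (intro tendsto_intros) (auto intro!: eventually_at_rightI[of 0 1])
  then have "eventually (\<lambda>\<delta>. N * (\<delta> powr (1 - \<gamma>) / (1 - \<gamma>)) < e) (at_right 0)"
    using assms by (intro order_tendstoD(2)) auto
  then obtain d where d: "0 < d" "\<And>\<delta>. 0 < \<delta> \<Longrightarrow> \<delta> < d \<Longrightarrow> N * (\<delta> powr (1 - \<gamma>) / (1 - \<gamma>)) < e"
    unfolding eventually_at_right_field by auto
  define \<delta> where "\<delta> = min (d / 2) (T / 4)"
  have "0 < \<delta>" "2 * \<delta> < T" "\<delta> < d" using d(1) assms(4) by (auto simp: \<delta>_def)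
  then show thesis using that[of \<delta>] nn_integral_powr_kernel[of N \<gamma> \<delta>] d(2)[of \<delta>] assms
    by (simp add: ennreal_leI)
qed

context control_system begin

definition decay_mass :: "nat \<Rightarrow> ennreal" where
  "decay_mass m = (\<integral>\<^sup>+\<tau>. (indicator {0<..} \<tau> * ennreal (exp (- (\<omega> / (2 * real m)) * \<tau>))) ^ Suc m \<partial>lborel)"

lemma nn_integral_exp_finite:
  assumes "0 < c" shows "(\<integral>\<^sup>+\<tau>. indicator {0<..} \<tau> * ennreal (exp (- c * \<tau>)) \<partial>lborel) < top"
proof -
  have "set_integrable lborel {0<..} (\<lambda>t. t powr (1 - 1) * exp (- c * t))"
    using assms by (intro integrable_powr_exp) auto
  then have "(\<integral>\<^sup>+t. ennreal (norm (indicator {0<..} t *\<^sub>R (t powr (1 - 1) * exp (- c * t)))) \<partial>lborel) < top"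
    unfolding set_integrable_def by (simp add: integrable_iff_bounded)
  also have "(\<integral>\<^sup>+t. ennreal (norm (indicator {0<..} t *\<^sub>R (t powr (1 - 1) * exp (- c * t)))) \<partial>lborel)
      = (\<integral>\<^sup>+\<tau>. indicator {0<..} \<tau> * ennreal (exp (- c * \<tau>)) \<partial>lborel)"
    by (intro nn_integral_cong) (auto simp: indicator_def)
  finally show ?thesis .
qed

lemma decay_mass_finite: "1 \<le> m \<Longrightarrow> decay_mass m < top"
proof -
  assume m: "1 \<le> m"
  have "decay_mass m \<le> (\<integral>\<^sup>+\<tau>. indicator {0<..} \<tau> * ennreal (exp (- (\<omega> / (2 * real m)) * \<tau>)) \<partial>lborel)"
    unfolding decay_mass_def
  proof (rule nn_integral_mono)
    fix \<tau> :: real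
    show "(indicator {0<..} \<tau> * ennreal (exp (- (\<omega> / (2 * real m)) * \<tau>))) ^ Suc m
        \<le> indicator {0<..} \<tau> * ennreal (exp (- (\<omega> / (2 * real m)) * \<tau>))"
    proof (cases "0 < \<tau>")
      case True
      have "exp (- (\<omega> / (2 * real m)) * \<tau>) \<le> 1" using True \<omega>_pos m by simp
      then have "exp (- (\<omega> / (2 * real m)) * \<tau>) ^ Suc m \<le> exp (- (\<omega> / (2 * real m)) * \<tau>) ^ 1"
        by (intro power_decreasing) auto
      then show ?thesis using True by (simp add: ennreal_power ennreal_leI del: power_Suc)
    qed simp
  qed
  also have "\<dots> < top" using \<omega>_pos m by (intro nn_integral_exp_finite) auto
  finally show ?thesis .
qed

lemma nn_integral_decay:
  assumes [measurable]: "\<psi> \<in> borel_measurable borel"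
  shows "(\<integral>\<^sup>+t. decay m \<psi> t \<partial>lborel) \<le> decay_mass m * (\<integral>\<^sup>+s. \<psi> s ^ Suc m \<partial>lborel)"
  using nn_integral_conv_power_le[of "\<lambda>\<tau>. (indicator {0<..} \<tau> * ennreal (exp (- (\<omega> / (2 * real m)) * \<tau>))) ^ Suc m"
      "\<lambda>s. \<psi> s ^ Suc m" 0]
  unfolding decay_def decay_mass_def by (simp del: power_Suc)

text \<open>Young's inequality in L^2; finiteness at a given time is what \<open>Lop_bound\<close>
  asks for.\<close>

lemma conv_AE_finite:
  assumes [measurable]: "kd \<in> borel_measurable borel" "a \<in> borel_measurable borel"
    and "(\<integral>\<^sup>+s. kd s \<partial>lborel) < top" "(\<integral>\<^sup>+s. a s ^ 2 \<partial>lborel) < top"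
  shows "AE t in lborel. conv kd a t < top"
proof -
  have "(\<integral>\<^sup>+t. conv kd a t ^ 2 \<partial>lborel) \<le> (\<integral>\<^sup>+s. kd s \<partial>lborel) ^ 2 * (\<integral>\<^sup>+s. a s ^ 2 \<partial>lborel)"
    using nn_integral_conv_power_le[of kd a 1] by (simp add: numeral_2_eq_2)
  also have "\<dots> < top" using assms by (simp add: ennreal_mult_less_top power_less_top_ennreal)
  finally have "AE t in lborel. conv kd a t ^ 2 \<noteq> top" by (intro nn_integral_PInf_AE[unfolded infinity_ennreal_def]) auto
  then show ?thesis by eventually_elim (auto simp: less_top power_eq_top_ennreal)
qed

text \<open>Convolutions take Borel functions. The version is made finite everywhere, so that
  subtraction can be undone, and 0 at nonpositive times.\<close>

lemma norm_ctl_version: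
  assumes u: "ctl u"
  obtains a where "a \<in> borel_measurable borel" "AE s in lborel. ennreal (norm (u s)) = a s"
    "\<And>s. a s < top" "\<And>s. s \<le> 0 \<Longrightarrow> a s = 0"
proof -
  have [measurable]: "u \<in> borel_measurable lebesgue" using u by (simp add: ctl_def)
  have "(\<lambda>s. ennreal (norm (u s))) \<in> borel_measurable lebesgue" by measurable
  then obtain g where [measurable]: "g \<in> borel_measurable borel" and g: "AE s in lborel. ennreal (norm (u s)) = g s"
    by (rule lebesgue_borel_version)
  define a where "a s = (if s \<le> 0 \<or> g s = top then 0 else g s)" for s
  show thesis
  proof (rule that)
    show "a \<in> borel_measurable borel" unfolding a_def[abs_def] by measurable
    show "AE s in lborel. ennreal (norm (u s)) = a s"
      using g by eventually_elim (use u in \<open>auto simp: a_def ctl_def\<close>)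
  qed (auto simp: a_def less_top)
qed

text \<open>The remainder term of \<open>Lop_bound\<close> for m = 1; its square is linear in
  \<open>decay\<close>.\<close>

definition E2 :: "real \<Rightarrow> (real \<Rightarrow> ennreal) \<Rightarrow> real \<Rightarrow> ennreal" where
  "E2 C a t = ennreal (C * enn2real (decay 1 a t) powr (1 / 2))"

lemma E2_measurable [measurable]: "a \<in> borel_measurable borel \<Longrightarrow> E2 C a \<in> borel_measurable borel"
  unfolding E2_def[abs_def] by measurable

lemma E2_power:
  assumes C: "0 \<le> C" and fin: "(\<integral>\<^sup>+s. a s ^ 2 \<partial>lborel) < top"
  shows "E2 C a t ^ 2 = ennreal (C\<^sup>2) * decay 1 a t"
proof -
  have d: "decay 1 a t < top" using le_less_trans[OF decay_le fin[unfolded numeral_2_eq_2]] by simp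
  have "E2 C a t ^ 2 = ennreal (C\<^sup>2 * (enn2real (decay 1 a t) powr (1 / 2)) ^ 2)"
    using C by (simp add: E2_def ennreal_power power_mult_distrib)
  also have "(enn2real (decay 1 a t) powr (1 / 2)) ^ 2 = enn2real (decay 1 a t)"
    by (simp add: powr_half_sqrt)
  also have "ennreal (C\<^sup>2 * enn2real (decay 1 a t)) = ennreal (C\<^sup>2) * decay 1 a t"
    using d by (simp add: ennreal_mult)
  finally show ?thesis .
qed

lemma E2_integral:
  assumes C: "0 \<le> C" and fin: "(\<integral>\<^sup>+s. a s ^ 2 \<partial>lborel) < top" and [measurable]: "a \<in> borel_measurable borel"
  shows "(\<integral>\<^sup>+t. E2 C a t ^ 2 \<partial>lborel) \<le> ennreal (C\<^sup>2) * (decay_mass 1 * (\<integral>\<^sup>+s. a s ^ 2 \<partial>lborel))"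
proof -
  have "(\<integral>\<^sup>+t. E2 C a t ^ 2 \<partial>lborel) = ennreal (C\<^sup>2) * (\<integral>\<^sup>+t. decay 1 a t \<partial>lborel)"
    unfolding E2_power[OF C fin] by (rule nn_integral_cmult) measurable
  also have "\<dots> \<le> ennreal (C\<^sup>2) * (decay_mass 1 * (\<integral>\<^sup>+s. a s ^ 2 \<partial>lborel))"
    using nn_integral_decay[of a 1] by (intro mult_left_mono) (simp_all only: One_nat_def numeral_2_eq_2 assms zero_le)
  finally show ?thesis .
qed

lemma E2_bound:
  assumes C: "0 \<le> C" and fin: "(\<integral>\<^sup>+s. a s ^ 2 \<partial>lborel) \<le> ennreal c" and c: "0 \<le> c"
  shows "E2 C a t \<le> ennreal (C * c powr (1 / 2))"
proof -
  have "decay 1 a t \<le> ennreal c" using order_trans[OF decay_le fin[unfolded numeral_2_eq_2]] by simp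
  then have "enn2real (decay 1 a t) \<le> c" using c by (metis enn2real_leI)
  then show ?thesis unfolding E2_def using C by (intro ennreal_leI mult_left_mono powr_mono2) auto
qed

lemma Lop_bound_L2:
  assumes split: "kernel_split kd 2 C"
    and kd: "kd \<in> borel_measurable borel" "\<And>\<tau>. \<tau> \<le> 0 \<Longrightarrow> kd \<tau> = 0"
    and u: "ctl u" and a: "a \<in> borel_measurable borel" "AE s in lborel. ennreal (norm (u s)) = a s"
    and conv_fin: "conv kd a t < top"
  shows "rep u t (Lop u t)" "ennreal (norm (Lop u t)) \<le> conv kd a t + E2 C a t"
proof -
  have fin: "(\<integral>\<^sup>+s. a s ^ Suc 1 \<partial>lborel) < top"
  proof -
    have "(\<integral>\<^sup>+s. a s ^ Suc 1 \<partial>lborel) = (\<integral>\<^sup>+s. ennreal (norm (u s)) ^ 2 \<partial>lborel)"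
      by (intro nn_integral_cong_AE) (use a(2) in \<open>eventually_elim, simp add: numeral_2_eq_2\<close>)
    then show ?thesis using u by (simp add: ctl_def)
  qed
  have s: "kernel_split kd (Suc 1) C" using split by (simp add: numeral_2_eq_2)
  have c1: "conv kd (\<lambda>s. a s ^ 1) t < top" using conv_fin by simp
  have a1: "AE s in lborel. ennreal (norm (u s)) = a s ^ 1" unfolding power_one_right by (rule a(2))
  note B = Lop_bound[OF s order_refl kd(1) _ u a(1) a1 fin c1]
  show "rep u t (Lop u t)" by (rule B(1)) (rule kd(2))
  have "ennreal (norm (Lop u t)) \<le> conv kd (\<lambda>s. a s ^ 1) t
      + ennreal (C * enn2real (decay 1 a t) powr (real 1 / real (Suc 1)))"
    by (rule B(2)) (rule kd(2))
  then show "ennreal (norm (Lop u t)) \<le> conv kd a t + E2 C a t"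
    by (simp add: E2_def)
qed

text \<open>A state exists wherever the singular convolution is finite. Measurability is tested on
  the dense range of \<open>J'\<close>, where the pairing is \<open>Lam\<close>.\<close>

lemma Lop_L2:
  assumes split: "kernel_split kd 2 C"
    and kd: "kd \<in> borel_measurable borel" "\<And>\<tau>. \<tau> \<le> 0 \<Longrightarrow> kd \<tau> = 0" "(\<integral>\<^sup>+s. kd s \<partial>lborel) < top"
    and u: "ctl u"
  shows "AE t in lborel. rep u t (Lop u t)" "Lop u \<in> borel_measurable lebesgue"
    "(\<integral>\<^sup>+t. ennreal (norm (Lop u t)) ^ 2 \<partial>lborel) < top"
proof -
  obtain a where a [measurable]: "a \<in> borel_measurable borel" and au: "AE s in lborel. ennreal (norm (u s)) = a s"
    by (rule norm_ctl_version[OF u])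
  have C: "0 \<le> C" using split by (simp add: kernel_split_def)
  note [measurable] = kd(1)
  have fin: "(\<integral>\<^sup>+s. a s ^ 2 \<partial>lborel) < top"
  proof -
    have "(\<integral>\<^sup>+s. a s ^ 2 \<partial>lborel) = (\<integral>\<^sup>+s. ennreal (norm (u s)) ^ 2 \<partial>lborel)"
      by (intro nn_integral_cong_AE) (use au in \<open>eventually_elim, simp\<close>)
    then show ?thesis using u by (simp add: ctl_def)
  qed
  have cf: "AE t in lborel. conv kd a t < top" by (rule conv_AE_finite[OF kd(1) a kd(3) fin])
  have B: "rep u t (Lop u t)" "ennreal (norm (Lop u t)) \<le> conv kd a t + E2 C a t" if "conv kd a t < top" for t
    by (rule Lop_bound_L2[OF split kd(1) _ u a au that], rule kd(2), assumption)+
  show rp: "AE t in lborel. rep u t (Lop u t)" using cf by eventually_elim (rule B(1))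
  show "Lop u \<in> borel_measurable lebesgue"
  proof (rule borel_measurable_weak)
    show "closure (range J') = UNIV" by (rule adj.dense_range_resolvent)
    fix y assume "y \<in> range J'"
    then obtain z where y: "y = J' z" by auto
    have "(\<lambda>t. Lam u t z) \<in> borel_measurable borel"
      by (rule borel_measurable_continuous_onI[OF Lam_continuous[OF u]])
    then have "(\<lambda>t. Lam u t z) \<in> borel_measurable lebesgue" by (intro measurable_completion) simp
    moreover have "AE t in lborel. Lam u t z = inner (Lop u t) y"
      using rp by eventually_elim (simp add: rep_def y)
    ultimately show "(\<lambda>t. inner (Lop u t) y) \<in> borel_measurable lebesgue"
      by (rule borel_measurable_lebesgue_AE)
  qed
  have "(\<integral>\<^sup>+t. ennreal (norm (Lop u t)) ^ 2 \<partial>lborel) \<le> (\<integral>\<^sup>+t. 2 ^ 2 * (conv kd a t ^ 2 + E2 C a t ^ 2) \<partial>lborel)"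
  proof (rule nn_integral_mono_AE)
    show "AE t in lborel. ennreal (norm (Lop u t)) ^ 2 \<le> 2 ^ 2 * (conv kd a t ^ 2 + E2 C a t ^ 2)"
      using cf
    proof eventually_elim
      case (elim t)
      show ?case by (rule order_trans[OF power_mono_ennreal[OF B(2)[OF elim]] add_power_le_ennreal])
    qed
  qed
  also have "\<dots> = 2 ^ 2 * ((\<integral>\<^sup>+t. conv kd a t ^ 2 \<partial>lborel) + (\<integral>\<^sup>+t. E2 C a t ^ 2 \<partial>lborel))"
    by (simp add: nn_integral_add nn_integral_cmult)
  also have "\<dots> \<le> 2 ^ 2 * ((\<integral>\<^sup>+s. kd s \<partial>lborel) ^ 2 * (\<integral>\<^sup>+s. a s ^ 2 \<partial>lborel)
      + ennreal (C\<^sup>2) * (decay_mass 1 * (\<integral>\<^sup>+s. a s ^ 2 \<partial>lborel)))"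
    using nn_integral_conv_power_le[of kd a 1]
    by (intro mult_left_mono add_mono E2_integral[OF C fin a]) (auto simp: numeral_2_eq_2)
  also have "\<dots> < top" using fin kd(3) decay_mass_finite[of 1]
    by (simp add: ennreal_mult_less_top power_less_top_ennreal)
  finally show "(\<integral>\<^sup>+t. ennreal (norm (Lop u t)) ^ 2 \<partial>lborel) < top" .
qed

text \<open>Stationarity of the quadratic cost. Real parts suffice because \<open>v\<close> may be
  multiplied by \<i>.\<close>

definition vareq :: "('y \<Rightarrow> 'z::separable_complex_hilbert) \<Rightarrow> 'y \<Rightarrow> (real \<Rightarrow> 'u) \<Rightarrow> bool" where
  "vareq R x u \<longleftrightarrow> (\<forall>v. ctl v \<longrightarrow>
     (LINT t:{0<..}|lebesgue. inner (R (S t x + Lop u t)) (R (Lop v t))) + (LINT t|lebesgue. inner (u t) (v t)) = 0)"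

text \<open>The test control points in the direction of \<open>u\<close> and has length \<psi>^m, so
  its pairing with \<open>u\<close> is \<psi>^m a. By duality the singular part of the kernel
  contributes \<psi>^m times the very convolution that \<psi> subtracts from \<open>a\<close>; it
  cancels, leaving the integral of \<psi>^(m+1) against a pairing of \<rho> with the remainder. The
  latter contains the same integral to a lower power, so the estimate closes. The truncation level
  \<open>L\<close> does not enter the bound.\<close>

lemma vareq_test_bound:
  fixes R :: "'y \<Rightarrow> 'z::separable_complex_hilbert"
  assumes split: "kernel_split kd (Suc m) C" and m: "1 \<le> m"
    and kd [measurable]: "kd \<in> borel_measurable borel" and kd0: "\<And>\<tau>. \<tau> \<le> 0 \<Longrightarrow> kd \<tau> = 0"
    and kdi: "(\<integral>\<^sup>+s. kd s \<partial>lborel) < top"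
    and r: "0 \<le> r" "\<And>y. norm (R y) \<le> r * norm y"
    and u: "ctl u" and var: "vareq R x u"
    and a [measurable]: "a \<in> borel_measurable borel" and au: "AE s in lborel. ennreal (norm (u s)) = a s"
      "\<And>s. a s < top" 
    and \<rho> [measurable]: "\<rho> \<in> borel_measurable borel"
      and \<rho>R: "AE t in lborel. 0 < t \<longrightarrow> ennreal (norm (R (S t x + Lop u t))) = \<rho> t"
    and P: "(\<integral>\<^sup>+t. \<rho> t ^ 2 \<partial>lborel) \<le> ennreal P" "0 \<le> P"
    and \<psi> [measurable]: "\<psi> \<in> borel_measurable borel"
    and \<psi>g: "\<And>s. \<psi> s \<noteq> 0 \<Longrightarrow> 0 < s \<and> s < L \<and> \<psi> s \<le> ennreal L \<and> \<psi> s = a s - ennreal r * conv (\<lambda>\<tau>. kd (- \<tau>)) \<rho> s"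
    and L: "0 \<le> L"
  shows "(\<integral>\<^sup>+s. \<psi> s ^ Suc m \<partial>lborel)
    \<le> ennreal ((r\<^sup>2 * P * C\<^sup>2 * enn2real (decay_mass m)) powr (real (Suc m) / 2))"
proof -
  have C: "0 \<le> C" using split by (simp add: kernel_split_def)
  have \<psi>L: "\<psi> s \<le> ennreal L" for s using \<psi>g[of s] by (cases "\<psi> s = 0") auto
  have \<psi>_ind: "\<psi> s ^ j \<le> ennreal (L ^ j) * indicator {0..L} s" if "1 \<le> j" for j s
  proof (cases "\<psi> s = 0")
    case False
    then have "s \<in> {0..L}" using \<psi>g[of s] by auto
    then show ?thesis using power_mono_ennreal[OF \<psi>L[of s], of j] L by (simp add: ennreal_power)
  qed (use that in \<open>simp add: power_0_left\<close>)
  have \<psi>fin: "(\<integral>\<^sup>+s. \<psi> s ^ j \<partial>lborel) < top" if "1 \<le> j" for j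
  proof -
    have "(\<integral>\<^sup>+s. \<psi> s ^ j \<partial>lborel) \<le> (\<integral>\<^sup>+s. ennreal (L ^ j) * indicator {0..L} s \<partial>lborel)"
      by (intro nn_integral_mono \<psi>_ind that)
    also have "\<dots> < top" using L by (simp add: nn_integral_cmult_indicator ennreal_mult_less_top)
    finally show ?thesis .
  qed
  define X where "X = enn2real (\<integral>\<^sup>+s. \<psi> s ^ Suc m \<partial>lborel)"
  have X: "ennreal X = (\<integral>\<^sup>+s. \<psi> s ^ Suc m \<partial>lborel)" "0 \<le> X" using \<psi>fin[of "Suc m"] by (auto simp: X_def)
  \<comment> \<open>Where \<open>u\<close> vanishes the quotient by 0 is 0; almost everywhere there
    \<psi> vanishes too.\<close>
  define v where "v s = (enn2real (\<psi> s) ^ m / norm (u s)) *\<^sub>R u s" for s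
  have vn: "AE s in lborel. ennreal (norm (v s)) = \<psi> s ^ m \<and> ennreal (inner (u s) (v s)) = \<psi> s ^ m * a s \<and> 0 \<le> inner (u s) (v s)"
    using au(1)
  proof eventually_elim
    case (elim s)
    have p: "ennreal (enn2real (\<psi> s) ^ m) = \<psi> s ^ m" using le_less_trans[OF \<psi>L[of s]] by (simp add: ennreal_power[symmetric])
    show ?case
    proof (cases "u s = 0")
      case True
      then have "a s = 0" using elim by simp
      then have "\<psi> s = 0" using \<psi>g[of s] by (cases "\<psi> s = 0") auto
      then show ?thesis using True m by (simp add: v_def power_0_left)
    next
      case False
      then have "norm (v s) = enn2real (\<psi> s) ^ m" "inner (u s) (v s) = enn2real (\<psi> s) ^ m * norm (u s)"
        by (simp_all add: v_def dot_square_norm power2_eq_square)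
      then show ?thesis using p elim by (simp add: ennreal_mult)
    qed
  qed
  have v: "ctl v"
    unfolding ctl_def
  proof (intro conjI allI impI)
    have [measurable]: "u \<in> borel_measurable lebesgue" using u by (simp add: ctl_def)
    have [measurable]: "(\<lambda>s. enn2real (\<psi> s) ^ m) \<in> borel_measurable lebesgue" by (intro measurable_completion) simp
    show "v \<in> borel_measurable lebesgue" unfolding v_def[abs_def] by measurable
    show "v s = 0" if "s \<le> 0" for s using u that by (simp add: v_def ctl_def)
    have "(\<integral>\<^sup>+s. ennreal (norm (v s)) ^ 2 \<partial>lborel) = (\<integral>\<^sup>+s. \<psi> s ^ (m * 2) \<partial>lborel)"
      by (intro nn_integral_cong_AE) (use vn in \<open>eventually_elim, simp add: power_mult\<close>)
    then show "(\<integral>\<^sup>+s. ennreal (norm (v s)) ^ 2 \<partial>lborel) < top" using \<psi>fin[of "m * 2"] m by simp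
  qed
  have cf: "AE t in lborel. conv kd (\<lambda>s. \<psi> s ^ m) t < top"
    by (rule conv_AE_finite[OF kd _ kdi]) (use \<psi>fin[of "m * 2"] m in \<open>simp_all add: power_mult[symmetric]\<close>)
  define E where "E t = ennreal (C * enn2real (decay m \<psi> t) powr (real m / real (Suc m)))" for t
  have [measurable]: "E \<in> borel_measurable borel" unfolding E_def[abs_def] by measurable
  have vnorm: "AE s in lborel. ennreal (norm (v s)) = \<psi> s ^ m" using vn by eventually_elim simp
  have bd: "AE t in lborel. ennreal (norm (Lop v t)) \<le> conv kd (\<lambda>s. \<psi> s ^ m) t + E t"
    using cf
  proof eventually_elim
    case (elim t)
    show ?case unfolding E_def by (rule Lop_bound(2)[OF split m kd kd0 v \<psi> vnorm \<psi>fin elim]) simp_all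
  qed
  have uv: "(\<integral>\<^sup>+s. \<psi> s ^ m * a s \<partial>lborel) \<le> (\<integral>\<^sup>+t. \<rho> t * (ennreal r * (conv kd (\<lambda>s. \<psi> s ^ m) t + E t)) \<partial>lborel)"
  proof -
    have int: "integrable lebesgue (\<lambda>t. inner (u t) (v t))"
      by (intro sqi_inner ctl_sqi u v)
    have "(\<integral>\<^sup>+s. \<psi> s ^ m * a s \<partial>lborel) = (\<integral>\<^sup>+s. ennreal (inner (u s) (v s)) \<partial>lebesgue)"
      unfolding nn_integral_completion by (intro nn_integral_cong_AE) (use vn in \<open>eventually_elim, simp\<close>)
    also have "\<dots> = ennreal (LINT t|lebesgue. inner (u t) (v t))"
      using vn by (intro nn_integral_eq_integral int AE_completion) (rule eventually_mono, simp_all)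
    \<comment> \<open>The optimality condition enters here; absolute values follow.\<close>
    also have "(LINT t|lebesgue. inner (u t) (v t)) = - (LINT t:{0<..}|lebesgue. inner (R (S t x + Lop u t)) (R (Lop v t)))"
      using var v unfolding vareq_def by (simp add: add_eq_0_iff)
    also have "ennreal \<dots> \<le> ennreal (norm (LINT t:{0<..}|lebesgue. inner (R (S t x + Lop u t)) (R (Lop v t))))"
      by (intro ennreal_leI) simp
    also have "\<dots> \<le> (\<integral>\<^sup>+t. ennreal (norm (indicator {0<..} t *\<^sub>R inner (R (S t x + Lop u t)) (R (Lop v t)))) \<partial>lebesgue)"
      unfolding set_lebesgue_integral_def
      by (rule ennreal_norm_integral_le)
    also have "\<dots> \<le> (\<integral>\<^sup>+t. \<rho> t * (ennreal r * (conv kd (\<lambda>s. \<psi> s ^ m) t + E t)) \<partial>lborel)"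
      unfolding nn_integral_completion
    proof (rule nn_integral_mono_AE)
      show "AE t in lborel. ennreal (norm (indicator {0<..} t *\<^sub>R inner (R (S t x + Lop u t)) (R (Lop v t))))
        \<le> \<rho> t * (ennreal r * (conv kd (\<lambda>s. \<psi> s ^ m) t + E t))"
        using \<rho>R bd
      proof eventually_elim
        case (elim t)
        show ?case
        proof (cases "0 < t")
          case True
          have "\<bar>inner (R (S t x + Lop u t)) (R (Lop v t))\<bar> \<le> norm (R (S t x + Lop u t)) * norm (R (Lop v t))"
            by (rule Cauchy_Schwarz_ineq2)
          also have "\<dots> \<le> norm (R (S t x + Lop u t)) * (r * norm (Lop v t))"
            by (intro mult_left_mono r) simp
          finally have "ennreal \<bar>inner (R (S t x + Lop u t)) (R (Lop v t))\<bar>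
              \<le> ennreal (norm (R (S t x + Lop u t)) * (r * norm (Lop v t)))" by (rule ennreal_leI)
          also have "\<dots> = ennreal (norm (R (S t x + Lop u t))) * (ennreal r * ennreal (norm (Lop v t)))"
            using r(1) by (simp add: ennreal_mult)
          also have "ennreal (norm (R (S t x + Lop u t))) = \<rho> t" using elim(1) True by blast
          also have "\<rho> t * (ennreal r * ennreal (norm (Lop v t))) \<le> \<rho> t * (ennreal r * (conv kd (\<lambda>s. \<psi> s ^ m) t + E t))"
            using elim by (intro mult_left_mono) auto
          finally show ?thesis using True by simp
        qed simp
      qed
    qed
    finally show ?thesis .
  qed
  let ?b = "\<lambda>s. ennreal r * conv (\<lambda>\<tau>. kd (- \<tau>)) \<rho> s"
  \<comment> \<open>On the support of \<psi> one has a = \<psi> + b; elsewhere both sides are 0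
    because m \<ge> 1.\<close>
  have dec: "\<psi> s ^ m * a s = \<psi> s ^ Suc m + \<psi> s ^ m * ?b s" for s
  proof (cases "\<psi> s = 0")
    case False
    then have e: "\<psi> s = a s - ?b s" using \<psi>g by blast
    have "\<not> a s \<le> ?b s" using False diff_eq_0_ennreal[OF au(2)] unfolding e by blast
    then have "a s - ?b s + ?b s = a s" by (intro diff_add_cancel_ennreal) simp
    then have "\<psi> s ^ m * a s = \<psi> s ^ m * (\<psi> s + ?b s)" unfolding e by (simp only:)
    then show ?thesis by (simp only: distrib_left power_Suc mult.commute)
  qed (use m in \<open>simp add: power_0_left\<close>)
  have pair: "(\<integral>\<^sup>+t. \<rho> t * (ennreal r * (conv kd (\<lambda>s. \<psi> s ^ m) t + E t)) \<partial>lborel)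
      = (\<integral>\<^sup>+s. \<psi> s ^ m * ?b s \<partial>lborel) + ennreal r * (\<integral>\<^sup>+t. \<rho> t * E t \<partial>lborel)"
  proof -
    have "(\<integral>\<^sup>+t. \<rho> t * (ennreal r * (conv kd (\<lambda>s. \<psi> s ^ m) t + E t)) \<partial>lborel)
        = (\<integral>\<^sup>+t. ennreal r * (\<rho> t * conv kd (\<lambda>s. \<psi> s ^ m) t) + ennreal r * (\<rho> t * E t) \<partial>lborel)"
      by (intro nn_integral_cong) (simp add: distrib_left mult_ac)
    also have "\<dots> = ennreal r * (\<integral>\<^sup>+t. \<rho> t * conv kd (\<lambda>s. \<psi> s ^ m) t \<partial>lborel) + ennreal r * (\<integral>\<^sup>+t. \<rho> t * E t \<partial>lborel)"
      by (simp add: nn_integral_add nn_integral_cmult)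
    also have "(\<integral>\<^sup>+t. \<rho> t * conv kd (\<lambda>s. \<psi> s ^ m) t \<partial>lborel) = (\<integral>\<^sup>+s. \<psi> s ^ m * conv (\<lambda>\<tau>. kd (- \<tau>)) \<rho> s \<partial>lborel)"
      by (rule nn_integral_conv_pairing) measurable
    also have "ennreal r * \<dots> = (\<integral>\<^sup>+s. \<psi> s ^ m * ?b s \<partial>lborel)"
      by (simp add: nn_integral_cmult[symmetric] mult.left_commute)
    finally show ?thesis .
  qed
  \<comment> \<open>A term can be cancelled in \<open>ennreal\<close> only if it is finite; the
    truncation of \<psi> ensures this.\<close>
  have fin_b: "(\<integral>\<^sup>+s. \<psi> s ^ m * ?b s \<partial>lborel) < top"
  proof -
    have "(\<integral>\<^sup>+s. \<psi> s ^ m * ?b s \<partial>lborel) \<le> (\<integral>\<^sup>+s. \<psi> s ^ m * a s \<partial>lborel)"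
      unfolding dec by (intro nn_integral_mono) simp
    also have "\<dots> \<le> (\<integral>\<^sup>+s. ennreal (L ^ m) * indicator {0..L} s + ennreal (L ^ m) * a s ^ 2 \<partial>lborel)"
    proof (rule nn_integral_mono)
      fix s
      have "a s \<le> 1 + a s ^ 2"
      proof (cases "a s \<le> 1")
        case False
        then have "a s * 1 \<le> a s * a s" by (intro mult_left_mono) auto
        then show ?thesis by (simp add: power2_eq_square add_increasing)
      qed (simp add: add_increasing2)
      then have "\<psi> s ^ m * a s \<le> (ennreal (L ^ m) * indicator {0..L} s) * (1 + a s ^ 2)"
        using \<psi>_ind[OF m] by (intro mult_mono) auto
      also have "\<dots> \<le> ennreal (L ^ m) * indicator {0..L} s + ennreal (L ^ m) * a s ^ 2"
        by (auto simp: distrib_left indicator_def)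
      finally show "\<psi> s ^ m * a s \<le> ennreal (L ^ m) * indicator {0..L} s + ennreal (L ^ m) * a s ^ 2" .
    qed
    also have "\<dots> = ennreal (L ^ m) * ennreal L + ennreal (L ^ m) * (\<integral>\<^sup>+s. a s ^ 2 \<partial>lborel)"
      using L by (simp add: nn_integral_add nn_integral_cmult)
    also have "(\<integral>\<^sup>+s. a s ^ 2 \<partial>lborel) = (\<integral>\<^sup>+s. ennreal (norm (u s)) ^ 2 \<partial>lborel)"
      by (intro nn_integral_cong_AE) (use au(1) in \<open>eventually_elim, simp\<close>)
    also have "ennreal (L ^ m) * ennreal L + ennreal (L ^ m) * \<dots> < top"
      using u by (simp add: ctl_def ennreal_mult_less_top)
    finally show ?thesis .
  qed
  have "(\<integral>\<^sup>+s. \<psi> s ^ Suc m \<partial>lborel) + (\<integral>\<^sup>+s. \<psi> s ^ m * ?b s \<partial>lborel) = (\<integral>\<^sup>+s. \<psi> s ^ m * a s \<partial>lborel)"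
    unfolding dec by (rule nn_integral_add[symmetric]) measurable
  also have "\<dots> \<le> ennreal r * (\<integral>\<^sup>+t. \<rho> t * E t \<partial>lborel) + (\<integral>\<^sup>+s. \<psi> s ^ m * ?b s \<partial>lborel)"
    using uv unfolding pair by (simp add: add.commute)
  finally have XrE: "ennreal X \<le> ennreal r * (\<integral>\<^sup>+t. \<rho> t * E t \<partial>lborel)"
    unfolding X(1) using fin_b by (simp only: add.commute[of _ "\<integral>\<^sup>+s. \<psi> s ^ m * ?b s \<partial>lborel"] ennreal_add_left_cancel_le) auto
  \<comment> \<open>The square of \<open>E\<close> is a multiple of decay^((m-1)/(m+1)) times decay:
    the first factor is replaced by its bound \<open>W\<close>, the second is integrated.\<close>
  define W where "W = X powr (real (m - 1) / real (Suc m))"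
  have E2: "(\<integral>\<^sup>+t. E t ^ 2 \<partial>lborel) \<le> ennreal (C\<^sup>2 * W) * (decay_mass m * ennreal X)"
  proof -
    have "E t ^ 2 \<le> ennreal (C\<^sup>2 * W) * decay m \<psi> t" for t
    proof -
      have dX: "decay m \<psi> t \<le> ennreal X" unfolding X(1) by (rule decay_le[OF m])
      define d where "d = enn2real (decay m \<psi> t)"
      have d: "ennreal d = decay m \<psi> t" "0 \<le> d" "d \<le> X"
        using le_less_trans[OF dX ennreal_less_top] enn2real_leI[OF X(2) dX] by (auto simp: d_def)
      have "(d powr (real m / real (Suc m)))\<^sup>2 = d powr (real m / real (Suc m) + real m / real (Suc m))"
        by (simp only: power2_eq_square powr_add)
      also have "real m / real (Suc m) + real m / real (Suc m) = real (m - 1) / real (Suc m) + 1"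
      proof -
        have "real (m - 1) / real (Suc m) + 1 = (real (m - 1) + real (Suc m)) / real (Suc m)"
          by (simp add: add_divide_distrib)
        also have "real (m - 1) + real (Suc m) = real m + real m" using m by (simp add: of_nat_diff)
        finally show ?thesis by (simp only: add_divide_distrib)
      qed
      also have "d powr (real (m - 1) / real (Suc m) + 1) = d powr (real (m - 1) / real (Suc m)) * d"
        using d(2) by (simp add: powr_add)
      also have "\<dots> \<le> W * d" unfolding W_def using d by (intro mult_right_mono powr_mono2) auto
      finally have "C\<^sup>2 * (d powr (real m / real (Suc m)))\<^sup>2 \<le> C\<^sup>2 * (W * d)" by (rule mult_left_mono) simp
      then have "ennreal (C\<^sup>2 * (d powr (real m / real (Suc m)))\<^sup>2) \<le> ennreal (C\<^sup>2 * W * d)"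
        by (intro ennreal_leI) (simp add: mult.assoc)
      moreover have "E t ^ 2 = ennreal (C\<^sup>2 * (d powr (real m / real (Suc m)))\<^sup>2)"
        using C by (simp add: E_def d_def ennreal_power power_mult_distrib)
      moreover have "ennreal (C\<^sup>2 * W * d) = ennreal (C\<^sup>2 * W) * decay m \<psi> t"
        unfolding d(1)[symmetric] using d(2) by (intro ennreal_mult) (auto simp: W_def)
      ultimately show ?thesis by simp
    qed
    then have "(\<integral>\<^sup>+t. E t ^ 2 \<partial>lborel) \<le> (\<integral>\<^sup>+t. ennreal (C\<^sup>2 * W) * decay m \<psi> t \<partial>lborel)"
      by (intro nn_integral_mono)
    also have "\<dots> = ennreal (C\<^sup>2 * W) * (\<integral>\<^sup>+t. decay m \<psi> t \<partial>lborel)" by (rule nn_integral_cmult) measurable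
    also have "\<dots> \<le> ennreal (C\<^sup>2 * W) * (decay_mass m * ennreal X)"
      unfolding X(1) by (intro mult_left_mono nn_integral_decay) auto
    finally show ?thesis .
  qed
  define D where "D = enn2real (decay_mass m)"
  have D: "ennreal D = decay_mass m" "0 \<le> D" using decay_mass_finite[OF m] by (auto simp: D_def)
  have "ennreal X ^ 2 \<le> (ennreal r * (\<integral>\<^sup>+t. \<rho> t * E t \<partial>lborel)) ^ 2" by (rule power_mono_ennreal[OF XrE])
  also have "\<dots> = ennreal r ^ 2 * (\<integral>\<^sup>+t. \<rho> t * E t \<partial>lborel) ^ 2" by (rule power_mult_distrib)
  also have "\<dots> \<le> ennreal r ^ 2 * ((\<integral>\<^sup>+t. \<rho> t ^ 2 \<partial>lborel) * (\<integral>\<^sup>+t. E t ^ 2 \<partial>lborel))"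
    by (intro mult_left_mono nn_integral_Cauchy_Schwarz) auto
  also have "\<dots> \<le> ennreal r ^ 2 * (ennreal P * (ennreal (C\<^sup>2 * W) * (ennreal D * ennreal X)))"
    unfolding D(1) by (intro mult_left_mono mult_mono P(1) E2) auto
  also have "\<dots> = ennreal ((r\<^sup>2 * P * C\<^sup>2 * D) * (W * X))"
    using r(1) P(2) X(2) D(2) by (simp add: ennreal_power ennreal_mult[symmetric] W_def mult_ac)
  finally have "X\<^sup>2 \<le> (r\<^sup>2 * P * C\<^sup>2 * D) * (W * X)"
    using X(2) r(1) P(2) D(2) by (simp add: ennreal_power ennreal_le_iff W_def)
  then have "X \<le> (r\<^sup>2 * P * C\<^sup>2 * D) powr (real (Suc m) / 2)"
    unfolding W_def using X(2) P(2) D(2) m by (intro powr_root_bound) auto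
  then show ?thesis unfolding X(1)[symmetric] D_def by (rule ennreal_leI)
qed

end

section \<open>Higher integrability of the optimal control\<close>

context control_system begin

text \<open>Let a be the norm of \<open>u\<close> and \<rho> that of the output. The state estimate
  gives \<rho> \<le> r (b' + conv kd a), with b' bounded and square integrable, and
  \<open>vareq_test_bound\<close> puts into L^(m+1) the positive part g of a minus r times the
  reflected convolution of \<rho>. Hence a \<le> h + A a, where A is r^2 times two convolutions of
  mass at most \<theta>, and (r \<theta>)^2 \<le> 1/4. \<open>K\<close> is fixed before
  \<open>x\<close> and \<open>u\<close>.\<close>

lemma vareq_integrability:
  fixes R :: "'y \<Rightarrow> 'z::separable_complex_hilbert"
  assumes split2: "kernel_split kd 2 C" and splitn: "kernel_split kd (Suc m) C'" and m: "1 \<le> m"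
    and kd [measurable]: "kd \<in> borel_measurable borel" and kd0: "\<And>\<tau>. \<tau> \<le> 0 \<Longrightarrow> kd \<tau> = 0"
    and kdi: "(\<integral>\<^sup>+s. kd s \<partial>lborel) \<le> ennreal \<theta>" and \<theta>: "0 \<le> \<theta>" "r * \<theta> \<le> 1 / 2"
    and R: "bounded_linear R" and r: "0 \<le> r" "\<And>y. norm (R y) \<le> r * norm y"
    and c: "0 \<le> c"
  shows "\<exists>K<top. \<forall>x u. norm x \<le> 1 \<longrightarrow> ctl u \<longrightarrow> vareq R x u \<longrightarrow>
    (\<integral>\<^sup>+s. ennreal (norm (u s)) ^ 2 \<partial>lborel) \<le> ennreal c \<longrightarrow>
    (\<integral>\<^sup>+s. ennreal (norm (u s)) ^ Suc m \<partial>lborel) \<le> K"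
proof -
  have C: "0 \<le> C" and C': "0 \<le> C'" using split2 splitn by (auto simp: kernel_split_def)
  have kdf: "(\<integral>\<^sup>+s. kd s \<partial>lborel) < top" by (rule le_less_trans[OF kdi]) simp
  let ?rk = "\<lambda>\<tau>. kd (- \<tau>)"
  have rki: "(\<integral>\<^sup>+s. ?rk s \<partial>lborel) \<le> ennreal \<theta>"
    using nn_integral_reflect_shift(1)[of kd 0] kdi by simp
  define w where "w t = indicator {0<..} t * ennreal (M * exp (- \<omega> * t))" for t :: real
  have [measurable]: "w \<in> borel_measurable borel" unfolding w_def[abs_def] by measurable
  define M1 where "M1 = (\<integral>\<^sup>+t. w t ^ 2 \<partial>lborel)"
  have w_le: "w t \<le> ennreal M" for t
    using M_ge \<omega>_pos by (auto simp: w_def indicator_def intro!: ennreal_leI)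
  have M1: "M1 < top"
  proof -
    have "M1 \<le> (\<integral>\<^sup>+t. ennreal (M\<^sup>2) * (indicator {0<..} t * ennreal (exp (- \<omega> * t))) \<partial>lborel)"
      unfolding M1_def
    proof (rule nn_integral_mono)
      fix t :: real
      have "w t ^ 2 \<le> ennreal M * w t" using w_le[of t] by (simp add: power2_eq_square mult_right_mono)
      also have "\<dots> = ennreal (M\<^sup>2) * (indicator {0<..} t * ennreal (exp (- \<omega> * t)))"
        using M_ge by (simp add: w_def ennreal_mult power2_eq_square mult_ac)
      finally show "w t ^ 2 \<le> ennreal (M\<^sup>2) * (indicator {0<..} t * ennreal (exp (- \<omega> * t)))" .
    qed
    also have "\<dots> = ennreal (M\<^sup>2) * (\<integral>\<^sup>+t. indicator {0<..} t * ennreal (exp (- \<omega> * t)) \<partial>lborel)"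
      by (rule nn_integral_cmult) measurable
    also have "\<dots> < top" using nn_integral_exp_finite[OF \<omega>_pos] by (simp add: ennreal_mult_less_top)
    finally show ?thesis .
  qed
  \<comment> \<open>The constants bound in turn the square integral of b', its supremum, the square
    integral of \<rho>, and the (m+1)-th power integrals of g and h.\<close>
  define IB2 where "IB2 = 2 ^ 2 * (M1 + ennreal (C\<^sup>2) * (decay_mass 1 * ennreal c))"
  have IB2: "IB2 < top" using M1 decay_mass_finite[of 1] by (simp add: IB2_def ennreal_mult_less_top)
  define Bs where "Bs = ennreal M + ennreal (C * c powr (1 / 2))"
  define IP where "IP = ennreal r ^ 2 * (2 ^ 2 * (IB2 + ennreal \<theta> ^ 2 * ennreal c))"
  have IP: "IP < top" using IB2 by (simp add: IP_def ennreal_mult_less_top power_less_top_ennreal)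
  define P where "P = enn2real IP"
  have P: "ennreal P = IP" "0 \<le> P" using IP by (auto simp: P_def)
  define G where "G = ennreal ((r\<^sup>2 * P * C'\<^sup>2 * enn2real (decay_mass m)) powr (real (Suc m) / 2))"
  define IH where "IH = 2 ^ Suc m * (G + ennreal (r\<^sup>2) ^ Suc m * (ennreal \<theta> ^ Suc m * (Bs ^ (m - 1) * IB2)))"
  have IH: "IH < top" using IB2 by (simp add: IH_def G_def Bs_def ennreal_mult_less_top power_less_top_ennreal del: power_Suc)
  define K where "K = 2 ^ (Suc m + 1) * IH"
  have K: "K < top" using IH by (simp add: K_def ennreal_mult_less_top power_less_top_ennreal del: power_Suc)
  have "(\<integral>\<^sup>+s. ennreal (norm (u s)) ^ Suc m \<partial>lborel) \<le> K"
    if x: "norm x \<le> 1" and u: "ctl u" and var: "vareq R x u"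
      and uc: "(\<integral>\<^sup>+s. ennreal (norm (u s)) ^ 2 \<partial>lborel) \<le> ennreal c" for x u
  proof -
    obtain a where a [measurable]: "a \<in> borel_measurable borel" and au: "AE s in lborel. ennreal (norm (u s)) = a s"
      and a_fin: "\<And>s. a s < top" and a0: "\<And>s. s \<le> 0 \<Longrightarrow> a s = 0"
      by (rule norm_ctl_version[OF u]) blast
    have a_pow: "(\<integral>\<^sup>+s. ennreal (norm (u s)) ^ n \<partial>lborel) = (\<integral>\<^sup>+s. a s ^ n \<partial>lborel)" for n
      by (intro nn_integral_cong_AE) (use au in \<open>eventually_elim, simp\<close>)
    have a2: "(\<integral>\<^sup>+s. a s ^ 2 \<partial>lborel) \<le> ennreal c" using uc a_pow by simp
    have a2f: "(\<integral>\<^sup>+s. a s ^ 2 \<partial>lborel) < top" by (rule le_less_trans[OF a2]) simp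
    have cf: "AE t in lborel. conv kd a t < top" by (rule conv_AE_finite[OF kd a kdf a2f])
    define b' where "b' t = w t + E2 C a t" for t
    have [measurable]: "b' \<in> borel_measurable borel" unfolding b'_def[abs_def] by measurable
    have b'2: "(\<integral>\<^sup>+t. b' t ^ 2 \<partial>lborel) \<le> IB2"
    proof -
      have "(\<integral>\<^sup>+t. b' t ^ 2 \<partial>lborel) \<le> (\<integral>\<^sup>+t. 2 ^ 2 * (w t ^ 2 + E2 C a t ^ 2) \<partial>lborel)"
        unfolding b'_def by (intro nn_integral_mono add_power_le_ennreal)
      also have "\<dots> = 2 ^ 2 * (M1 + (\<integral>\<^sup>+t. E2 C a t ^ 2 \<partial>lborel))"
        by (simp add: nn_integral_cmult nn_integral_add M1_def)
      also have "\<dots> \<le> 2 ^ 2 * (M1 + ennreal (C\<^sup>2) * (decay_mass 1 * (\<integral>\<^sup>+s. a s ^ 2 \<partial>lborel)))"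
        by (intro mult_left_mono add_left_mono E2_integral C a2f a) simp
      also have "\<dots> \<le> IB2" unfolding IB2_def by (intro mult_left_mono add_left_mono a2) simp_all
      finally show ?thesis .
    qed
    \<comment> \<open>Bounded and square integrable functions lie in every higher L^p: m - 1 factors
      are estimated by the supremum.\<close>
    have b'n: "(\<integral>\<^sup>+t. b' t ^ Suc m \<partial>lborel) \<le> Bs ^ (m - 1) * IB2"
    proof -
      have b'le: "b' t \<le> Bs" for t
        unfolding b'_def Bs_def by (intro add_mono w_le E2_bound C a2 c)
      have "b' t ^ Suc m \<le> Bs ^ (m - 1) * b' t ^ 2" for t
      proof -
        have "Suc m = (m - 1) + 2" using m by simp
        then have "b' t ^ Suc m = b' t ^ (m - 1) * b' t ^ 2" by (simp only: power_add)
        then show ?thesis using power_mono_ennreal[OF b'le[of t], of "m - 1"] by (simp add: mult_right_mono)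
      qed
      then have "(\<integral>\<^sup>+t. b' t ^ Suc m \<partial>lborel) \<le> (\<integral>\<^sup>+t. Bs ^ (m - 1) * b' t ^ 2 \<partial>lborel)" by (rule nn_integral_mono)
      also have "\<dots> = Bs ^ (m - 1) * (\<integral>\<^sup>+t. b' t ^ 2 \<partial>lborel)" by (rule nn_integral_cmult) measurable
      also have "\<dots> \<le> Bs ^ (m - 1) * IB2" by (intro mult_left_mono b'2) simp
      finally show ?thesis .
    qed
    have Lop_meas: "Lop u \<in> borel_measurable lebesgue" by (rule Lop_L2(2)[OF split2 kd _ kdf u]) (rule kd0)
    obtain \<rho> where \<rho> [measurable]: "\<rho> \<in> borel_measurable borel"
      and \<rho>eq: "AE t in lborel. ennreal (norm (R (indicator {0<..} t *\<^sub>R S t x + indicator {0<..} t *\<^sub>R Lop u t))) = \<rho> t"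
    proof (rule lebesgue_borel_version)
      have [measurable]: "(\<lambda>t. indicator {0<..} t *\<^sub>R S t x) \<in> borel_measurable lebesgue"
        by (intro measurable_completion) simp
      have [measurable]: "Lop u \<in> borel_measurable lebesgue" by (rule Lop_meas)
      have [measurable]: "(\<lambda>t::real. indicator {0<..} t :: real) \<in> borel_measurable lebesgue"
        by (intro measurable_completion borel_measurable_indicator) simp
      have "(\<lambda>t. indicator {0<..} t *\<^sub>R S t x + indicator {0<..} t *\<^sub>R Lop u t) \<in> borel_measurable lebesgue"
        by measurable
      then have [measurable]: "(\<lambda>t. R (indicator {0<..} t *\<^sub>R S t x + indicator {0<..} t *\<^sub>R Lop u t)) \<in> borel_measurable lebesgue"
        by (rule measurable_compose[OF _ borel_measurable_continuous_onI[OF linear_continuous_on[OF R]]])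
      show "(\<lambda>t. ennreal (norm (R (indicator {0<..} t *\<^sub>R S t x + indicator {0<..} t *\<^sub>R Lop u t)))) \<in> borel_measurable lebesgue"
        by measurable
    qed blast
    have \<rho>R: "AE t in lborel. 0 < t \<longrightarrow> ennreal (norm (R (S t x + Lop u t))) = \<rho> t"
      using \<rho>eq by eventually_elim auto
    have \<rho>le: "AE t in lborel. \<rho> t \<le> ennreal r * (b' t + conv kd a t)"
      using \<rho>eq cf
    proof eventually_elim
      case (elim t)
      show ?case
      proof (cases "0 < t")
        case True
        have L: "ennreal (norm (Lop u t)) \<le> conv kd a t + E2 C a t"
          by (rule Lop_bound_L2(2)[OF split2 kd _ u a au elim(2)]) (rule kd0)
        have "norm (S t x) \<le> M * exp (- \<omega> * t) * norm x" using True by (intro stable) simp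
        also have "\<dots> \<le> M * exp (- \<omega> * t) * 1" using x M_ge by (intro mult_left_mono) auto
        finally have s: "ennreal (norm (S t x)) \<le> w t" using True by (simp add: w_def ennreal_leI)
        have "\<rho> t = ennreal (norm (R (S t x + Lop u t)))" using elim(1) True by simp
        also have "\<dots> \<le> ennreal (r * (norm (S t x) + norm (Lop u t)))"
          by (intro ennreal_leI order_trans[OF r(2)] mult_left_mono norm_triangle_ineq r(1))
        also have "\<dots> = ennreal r * (ennreal (norm (S t x)) + ennreal (norm (Lop u t)))"
          using r(1) by (simp add: ennreal_mult)
        also have "\<dots> \<le> ennreal r * (w t + (conv kd a t + E2 C a t))"
          by (intro mult_left_mono add_mono s L) simp
        finally show ?thesis by (simp add: b'_def add_ac)
      next
        case False
        then have "\<rho> t = 0" using elim(1) linear_0[OF bounded_linear.linear[OF R]] by simp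
        then show ?thesis by simp
      qed
    qed
    have P1: "(\<integral>\<^sup>+t. \<rho> t ^ 2 \<partial>lborel) \<le> ennreal P"
    proof -
      have "(\<integral>\<^sup>+t. \<rho> t ^ 2 \<partial>lborel) \<le> (\<integral>\<^sup>+t. ennreal r ^ 2 * (2 ^ 2 * (b' t ^ 2 + conv kd a t ^ 2)) \<partial>lborel)"
      proof (rule nn_integral_mono_AE)
        show "AE t in lborel. \<rho> t ^ 2 \<le> ennreal r ^ 2 * (2 ^ 2 * (b' t ^ 2 + conv kd a t ^ 2))"
          using \<rho>le
        proof eventually_elim
          case (elim t)
          have "\<rho> t ^ 2 \<le> (ennreal r * (b' t + conv kd a t)) ^ 2" by (rule power_mono_ennreal[OF elim])
          also have "\<dots> \<le> ennreal r ^ 2 * (2 ^ 2 * (b' t ^ 2 + conv kd a t ^ 2))"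
            unfolding power_mult_distrib by (intro mult_left_mono add_power_le_ennreal) simp
          finally show ?case .
        qed
      qed
      also have "\<dots> = ennreal r ^ 2 * (2 ^ 2 * ((\<integral>\<^sup>+t. b' t ^ 2 \<partial>lborel) + (\<integral>\<^sup>+t. conv kd a t ^ 2 \<partial>lborel)))"
        by (simp add: nn_integral_cmult nn_integral_add)
      also have "\<dots> \<le> ennreal r ^ 2 * (2 ^ 2 * (IB2 + ennreal \<theta> ^ 2 * ennreal c))"
      proof (intro mult_left_mono add_mono b'2)
        have "(\<integral>\<^sup>+t. conv kd a t ^ 2 \<partial>lborel) \<le> (\<integral>\<^sup>+s. kd s \<partial>lborel) ^ 2 * (\<integral>\<^sup>+s. a s ^ 2 \<partial>lborel)"
          using nn_integral_conv_power_le[of kd a 1] by (simp add: numeral_2_eq_2)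
        also have "\<dots> \<le> ennreal \<theta> ^ 2 * ennreal c" by (intro mult_mono power_mono_ennreal kdi a2) simp_all
        finally show "(\<integral>\<^sup>+t. conv kd a t ^ 2 \<partial>lborel) \<le> ennreal \<theta> ^ 2 * ennreal c" .
      qed simp_all
      finally show ?thesis unfolding P(1) IP_def .
    qed
    \<comment> \<open>Subtraction is truncated, so this is the positive part of the
      difference.\<close>
    define g where "g s = a s - ennreal r * conv ?rk \<rho> s" for s
    have [measurable]: "g \<in> borel_measurable borel" unfolding g_def[abs_def] by measurable
    have g_le: "g s \<le> a s" for s unfolding g_def by (rule diff_le_self_ennreal)
    have gn: "(\<integral>\<^sup>+s. g s ^ Suc m \<partial>lborel) \<le> G"
    proof -
      \<comment> \<open>Truncation in time and size; it increases to g, which is finite and vanishes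
        at nonpositive times.\<close>
      define \<psi> where "\<psi> j s = (if 0 < s \<and> s < real j \<and> g s \<le> ennreal (real j) then g s else 0)" for j s
      have [measurable]: "\<psi> j \<in> borel_measurable borel" for j unfolding \<psi>_def[abs_def] by measurable
      have \<psi>G: "(\<integral>\<^sup>+s. \<psi> j s ^ Suc m \<partial>lborel) \<le> G" for j
        unfolding G_def
      proof (rule vareq_test_bound[OF splitn m kd kd0 kdf r u var a au a_fin \<rho> \<rho>R P1 P(2), where L = "real j"])
        fix s assume "\<psi> j s \<noteq> 0"
        then show "0 < s \<and> s < real j \<and> \<psi> j s \<le> ennreal (real j) \<and> \<psi> j s = a s - ennreal r * conv ?rk \<rho> s"
          by (auto simp: \<psi>_def g_def split: if_splits)
      qed simp_all
      have inc: "\<psi> i s \<le> \<psi> j s" if "i \<le> j" for i j s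
        using that by (auto simp: \<psi>_def intro: order_trans ennreal_leI)
      have "g s ^ Suc m \<le> (SUP j. \<psi> j s ^ Suc m)" for s
      proof (cases "0 < s")
        case True
        have "g s < top" using g_le[of s] a_fin[of s] by (rule le_less_trans)
        then obtain q where q: "g s = ennreal q" "0 \<le> q" by (cases "g s") auto
        obtain j where "max s q < real j" using reals_Archimedean2 by blast
        then have "\<psi> j s = g s" using True q by (auto simp: \<psi>_def intro!: ennreal_leI)
        then show ?thesis by (metis SUP_upper UNIV_I)
      next
        case False
        then have "g s = 0" using g_le[of s] a0[of s] by simp
        then show ?thesis by simp
      qed
      then have "(\<integral>\<^sup>+s. g s ^ Suc m \<partial>lborel) \<le> (\<integral>\<^sup>+s. (SUP j. \<psi> j s ^ Suc m) \<partial>lborel)" by (rule nn_integral_mono)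
      also have "\<dots> = (SUP j. \<integral>\<^sup>+s. \<psi> j s ^ Suc m \<partial>lborel)"
        by (intro nn_integral_monotone_convergence_SUP) (auto simp: incseq_def le_fun_def simp del: power_Suc intro!: power_mono_ennreal inc)
      also have "\<dots> \<le> G" by (intro SUP_least \<psi>G)
      finally show ?thesis .
    qed
    define h where "h s = g s + ennreal (r\<^sup>2) * conv ?rk b' s" for s
    have [measurable]: "h \<in> borel_measurable borel" unfolding h_def[abs_def] by measurable
    \<comment> \<open>The kernel computes the output, its reflection comes from the adjoint in the
      optimality condition.\<close>
    define A where "A f s = ennreal (r\<^sup>2) * conv ?rk (conv kd f) s" for f s
    have hn: "(\<integral>\<^sup>+s. h s ^ Suc m \<partial>lborel) \<le> IH"
    proof -
      have "(\<integral>\<^sup>+s. h s ^ Suc m \<partial>lborel)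
          \<le> (\<integral>\<^sup>+s. 2 ^ Suc m * (g s ^ Suc m + ennreal (r\<^sup>2) ^ Suc m * conv ?rk b' s ^ Suc m) \<partial>lborel)"
        unfolding h_def power_mult_distrib[symmetric] by (intro nn_integral_mono add_power_le_ennreal)
      also have "\<dots> = 2 ^ Suc m * ((\<integral>\<^sup>+s. g s ^ Suc m \<partial>lborel)
          + ennreal (r\<^sup>2) ^ Suc m * (\<integral>\<^sup>+s. conv ?rk b' s ^ Suc m \<partial>lborel))"
        by (simp add: nn_integral_cmult nn_integral_add del: power_Suc)
      also have "\<dots> \<le> IH" unfolding IH_def
      proof (intro mult_left_mono add_mono gn)
        have "(\<integral>\<^sup>+s. conv ?rk b' s ^ Suc m \<partial>lborel) \<le> (\<integral>\<^sup>+s. ?rk s \<partial>lborel) ^ Suc m * (\<integral>\<^sup>+s. b' s ^ Suc m \<partial>lborel)"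
          by (rule nn_integral_conv_power_le) measurable
        also have "\<dots> \<le> ennreal \<theta> ^ Suc m * (Bs ^ (m - 1) * IB2)"
          by (intro mult_mono power_mono_ennreal rki b'n) simp_all
        finally show "(\<integral>\<^sup>+s. conv ?rk b' s ^ Suc m \<partial>lborel) \<le> ennreal \<theta> ^ Suc m * (Bs ^ (m - 1) * IB2)" .
      qed simp_all
      finally show ?thesis .
    qed
    have "(\<integral>\<^sup>+s. a s ^ Suc m \<partial>lborel) \<le> 2 ^ (Suc m + 1) * (\<integral>\<^sup>+s. h s ^ Suc m \<partial>lborel)"
    proof (rule power_integral_bound_of_contraction[of A])
      show "A f \<in> borel_measurable borel" if [measurable]: "f \<in> borel_measurable borel" for f
        unfolding A_def[abs_def] by measurable
      show "A f t \<le> A f' t" if "AE s in lborel. f s \<le> f' s" for f f' t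
        unfolding A_def by (intro mult_left_mono conv_mono_AE AE_I2 that) simp
      show "A (\<lambda>s. f s + f' s) t = A f t + A f' t"
        if [measurable]: "f \<in> borel_measurable borel" "f' \<in> borel_measurable borel" for f f' t
      proof -
        have "conv kd (\<lambda>s. f s + f' s) = (\<lambda>t. conv kd f t + conv kd f' t)"
          by (intro ext conv_add) measurable
        then show ?thesis unfolding A_def by (simp add: conv_add distrib_left)
      qed
      show "(\<integral>\<^sup>+t. A f t ^ p \<partial>lborel) \<le> ennreal (1/4) ^ p * (\<integral>\<^sup>+s. f s ^ p \<partial>lborel)"
        if f [measurable]: "f \<in> borel_measurable borel" and p: "p \<in> {2, Suc m}" for f p
      proof -
        obtain j where j: "p = Suc j" using p by (auto simp: numeral_2_eq_2)
        have "(\<integral>\<^sup>+t. A f t ^ p \<partial>lborel) = ennreal (r\<^sup>2) ^ p * (\<integral>\<^sup>+t. conv ?rk (conv kd f) t ^ p \<partial>lborel)"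
          unfolding A_def power_mult_distrib by (rule nn_integral_cmult) measurable
        also have "\<dots> \<le> ennreal (r\<^sup>2) ^ p * (ennreal \<theta> ^ p * (ennreal \<theta> ^ p * (\<integral>\<^sup>+s. f s ^ p \<partial>lborel)))"
        proof (intro mult_left_mono)
          have "(\<integral>\<^sup>+t. conv ?rk (conv kd f) t ^ p \<partial>lborel) \<le> (\<integral>\<^sup>+s. ?rk s \<partial>lborel) ^ p * (\<integral>\<^sup>+t. conv kd f t ^ p \<partial>lborel)"
            unfolding j by (rule nn_integral_conv_power_le) measurable
          also have "\<dots> \<le> ennreal \<theta> ^ p * ((\<integral>\<^sup>+s. kd s \<partial>lborel) ^ p * (\<integral>\<^sup>+s. f s ^ p \<partial>lborel))"
            unfolding j by (intro mult_mono power_mono_ennreal rki nn_integral_conv_power_le) (simp_all del: power_Suc)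
          also have "\<dots> \<le> ennreal \<theta> ^ p * (ennreal \<theta> ^ p * (\<integral>\<^sup>+s. f s ^ p \<partial>lborel))"
            by (intro mult_left_mono mult_right_mono power_mono_ennreal kdi) simp_all
          finally show "(\<integral>\<^sup>+t. conv ?rk (conv kd f) t ^ p \<partial>lborel) \<le> \<dots>" .
        qed simp
        also have "\<dots> = ennreal ((r * \<theta>)\<^sup>2) ^ p * (\<integral>\<^sup>+s. f s ^ p \<partial>lborel)"
          using \<theta>(1) r(1) by (simp add: power2_eq_square ennreal_mult power_mult_distrib mult_ac)
        also have "\<dots> \<le> ennreal (1/4) ^ p * (\<integral>\<^sup>+s. f s ^ p \<partial>lborel)"
        proof (intro mult_right_mono power_mono_ennreal ennreal_leI)
          have "(r * \<theta>)\<^sup>2 \<le> (1/2)\<^sup>2" using \<theta> r(1) by (intro power_mono) auto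
          then show "(r * \<theta>)\<^sup>2 \<le> 1/4" by (simp add: power2_eq_square)
        qed simp
        finally show ?thesis .
      qed
      show "AE t in lborel. a t \<le> h t + A a t"
      proof (rule AE_I2)
        fix t
        have "conv ?rk \<rho> t \<le> conv ?rk (\<lambda>t. ennreal r * (b' t + conv kd a t)) t" by (rule conv_mono_AE[OF \<rho>le])
        also have "\<dots> = ennreal r * (conv ?rk b' t + conv ?rk (conv kd a) t)"
          by (subst conv_cmult) (simp_all add: conv_add)
        finally have "ennreal r * conv ?rk \<rho> t \<le> ennreal r * (ennreal r * (conv ?rk b' t + conv ?rk (conv kd a) t))"
          by (rule mult_left_mono) simp
        also have "\<dots> = ennreal (r\<^sup>2) * conv ?rk b' t + A a t"
          using r(1) by (simp add: A_def power2_eq_square ennreal_mult distrib_left mult.assoc)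
        finally have "g t + ennreal r * conv ?rk \<rho> t \<le> h t + A a t"
          unfolding h_def by (simp add: add.assoc add_left_mono)
        moreover have "a t \<le> g t + ennreal r * conv ?rk \<rho> t" unfolding g_def by (rule ennreal_diff_add_ge)
        ultimately show "a t \<le> h t + A a t" by (rule order_trans[rotated])
      qed
    qed (use a_fin a2f in simp_all)
    also have "\<dots> \<le> K" unfolding K_def by (intro mult_left_mono hn) simp
    finally show ?thesis unfolding a_pow .
  qed
  then show ?thesis using K by blast
qed

end

section \<open>The optimality condition\<close>

lemma sqi_indicator:
  assumes f: "sqi f" shows "sqi (\<lambda>t. indicator {0<..} t *\<^sub>R f t)"
  unfolding sqi_def
proof
  have [measurable]: "f \<in> borel_measurable lebesgue" using f by (simp add: sqi_def)
  have [measurable]: "(\<lambda>t::real. indicator {0<..} t :: real) \<in> borel_measurable lebesgue"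
    by (intro measurable_completion borel_measurable_indicator) simp
  show "(\<lambda>t. indicator {0<..} t *\<^sub>R f t) \<in> borel_measurable lebesgue" by measurable
  have "(\<integral>\<^sup>+t. ennreal (norm (indicator {0<..} t *\<^sub>R f t)) ^ 2 \<partial>lborel) \<le> (\<integral>\<^sup>+t. ennreal (norm (f t)) ^ 2 \<partial>lborel)"
    by (intro nn_integral_mono) (auto simp: indicator_def)
  also have "\<dots> < top" using f by (simp add: sqi_def)
  finally show "(\<integral>\<^sup>+t. ennreal (norm (indicator {0<..} t *\<^sub>R f t)) ^ 2 \<partial>lborel) < top" .
qed

text \<open>A nonnegative parabola through the origin has slope 0 there; the test value is h = - a /
  (b + 1), the 1 avoiding a division by 0.\<close>

lemma linear_term_zero:
  fixes a b :: real
  assumes b: "0 \<le> b" and le: "\<And>h. 0 \<le> 2 * h * a + h\<^sup>2 * b"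
  shows "a = 0"
proof (rule ccontr)
  assume a: "a \<noteq> 0"
  define B where "B = b + 1"
  have B: "0 < B" using b by (simp add: B_def)
  have "0 \<le> 2 * (- a / B) * a + (- a / B)\<^sup>2 * b" by (rule le)
  also have "2 * (- a / B) * a = (a\<^sup>2 / B\<^sup>2) * (- 2 * B)" using B by (simp add: power2_eq_square)
  also have "(- a / B)\<^sup>2 * b = (a\<^sup>2 / B\<^sup>2) * b" by (simp add: power_divide)
  also have "(a\<^sup>2 / B\<^sup>2) * (- 2 * B) + (a\<^sup>2 / B\<^sup>2) * b = (a\<^sup>2 / B\<^sup>2) * (- 2 * B + b)"
    by (rule distrib_left[symmetric])
  also have "\<dots> < 0" using a b B by (intro mult_pos_neg) (auto simp: B_def)
  finally show False by simp
qed

text \<open>Young's inequality for q and q/(q - 1), the latter enclosed between the integers 2 and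
  n. Either a \<le> b^(q-1) and the product is at most b^q, or b \<le> a^(1/(q-1)) and it is at most
  a^(q/(q-1)).\<close>

lemma mult_le_power_sum:
  fixes a b q :: real
  assumes a: "0 \<le> a" and b: "0 \<le> b" and q: "1 < q" "q \<le> 2" and n: "q / (q - 1) \<le> real n"
  shows "a * b \<le> a ^ 2 + a ^ n + b powr q"
proof (cases "a \<le> b powr (q - 1)")
  case True
  then have "a * b \<le> b powr (q - 1) * b" using b by (rule mult_right_mono)
  also have "\<dots> = b powr q" using b by (cases "b = 0") (simp_all add: powr_mult_base mult.commute)
  also have "\<dots> \<le> a ^ 2 + a ^ n + b powr q" using a by simp
  finally show ?thesis .
next
  case False
  then have a0: "0 < a" using powr_ge_zero[of b "q - 1"] by linarith
  have "b = (b powr (q - 1)) powr (1 / (q - 1))" using q b by (cases "b = 0") (simp_all add: powr_powr)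
  also have "\<dots> \<le> a powr (1 / (q - 1))" using False q by (intro powr_mono2) auto
  finally have "a * b \<le> a powr 1 * a powr (1 / (q - 1))" using a0 by (simp add: mult_left_mono)
  also have "\<dots> = a powr (1 + 1 / (q - 1))" by (simp add: powr_add)
  also have "1 + 1 / (q - 1) = q / (q - 1)" using q by (simp add: field_simps)
  also have "a powr (q / (q - 1)) \<le> a ^ 2 + a ^ n"
  proof (cases "a \<le> 1")
    case True
    have "2 \<le> q / (q - 1)" using q by (simp add: pos_le_divide_eq)
    then have "a powr (q / (q - 1)) \<le> a powr 2" using True a0 by (intro powr_mono') auto
    then show ?thesis using a0 by (simp add: powr_numeral add_increasing2)
  next
    case False
    then have "a powr (q / (q - 1)) \<le> a powr real n" using n by (intro powr_mono) auto
    then show ?thesis using a0 by (simp add: powr_realpow add_increasing)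
  qed
  finally show ?thesis using powr_ge_zero[of b q] by linarith
qed

context control_system begin

lemma sqi_S: "sqi (\<lambda>t. indicator {0<..} t *\<^sub>R S t x)"
  unfolding sqi_def
proof
  show "(\<lambda>t. indicator {0<..} t *\<^sub>R S t x) \<in> borel_measurable lebesgue"
    by (intro measurable_completion) simp
  have "(\<integral>\<^sup>+t. ennreal (norm (indicator {0<..} t *\<^sub>R S t x)) ^ 2 \<partial>lborel)
      \<le> (\<integral>\<^sup>+t. ennreal (M * norm x) ^ 2 * (indicator {0<..} t * ennreal (exp (- \<omega> * t))) \<partial>lborel)"
  proof (rule nn_integral_mono)
    fix t :: real
    show "ennreal (norm (indicator {0<..} t *\<^sub>R S t x)) ^ 2
        \<le> ennreal (M * norm x) ^ 2 * (indicator {0<..} t * ennreal (exp (- \<omega> * t)))"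
    proof (cases "0 < t")
      case True
      have "norm (S t x) * norm (S t x) \<le> (M * norm x) * (M * exp (- \<omega> * t) * norm x)"
        using True M_ge by (intro mult_mono norm_S_le stable) auto
      then have "(norm (S t x))\<^sup>2 \<le> (M * norm x)\<^sup>2 * exp (- \<omega> * t)"
        by (simp add: power2_eq_square mult_ac)
      then show ?thesis using True M_ge
        by (simp add: ennreal_power ennreal_mult[symmetric] ennreal_leI)
    qed simp
  qed
  also have "\<dots> = ennreal (M * norm x) ^ 2 * (\<integral>\<^sup>+t. indicator {0<..} t * ennreal (exp (- \<omega> * t)) \<partial>lborel)"
    by (rule nn_integral_cmult) measurable
  also have "\<dots> < top" using nn_integral_exp_finite[OF \<omega>_pos]
    by (simp add: ennreal_mult_less_top power_less_top_ennreal)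
  finally show "(\<integral>\<^sup>+t. ennreal (norm (indicator {0<..} t *\<^sub>R S t x)) ^ 2 \<partial>lborel) < top" .
qed

definition run_cost :: "('y \<Rightarrow> 'z::separable_complex_hilbert) \<Rightarrow> 'y \<Rightarrow> (real \<Rightarrow> 'u) \<Rightarrow> ennreal" where
  "run_cost R x u = (\<integral>\<^sup>+t. indicator {0<..} t * ennreal ((norm (R (S t x + Lop u t)))\<^sup>2 + (norm (u t))\<^sup>2) \<partial>lborel)"

end

locale control_L2 = control_system S M \<omega> b
  for S :: "real \<Rightarrow> 'y::separable_complex_hilbert \<Rightarrow> 'y" and M \<omega>
    and b :: "'u::separable_complex_hilbert \<Rightarrow> 'y" +
  fixes R :: "'y \<Rightarrow> 'z::separable_complex_hilbert" and kd :: "real \<Rightarrow> ennreal" and C :: real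
  assumes bclinear_R: "bclinear R"
    and split2: "kernel_split kd 2 C"
    and kd_meas: "kd \<in> borel_measurable borel" and kd0: "\<And>\<tau>. \<tau> \<le> 0 \<Longrightarrow> kd \<tau> = 0"
    and kd_fin: "(\<integral>\<^sup>+s. kd s \<partial>lborel) < top"
begin

lemma bounded_linear_R: "bounded_linear R" using bclinear_R by (simp add: bclinear_def)

lemma rep_AE: "ctl u \<Longrightarrow> AE t in lborel. rep u t (Lop u t)"
  by (rule Lop_L2(1)[OF split2 kd_meas _ kd_fin]) (use kd0 in auto)

lemma sqi_Lop: "ctl u \<Longrightarrow> sqi (Lop u)"
  unfolding sqi_def by (intro conjI Lop_L2(2,3)[OF split2 kd_meas _ kd_fin]) (use kd0 in auto)

text \<open>The output is jointly linear in the pair (x, u) up to null sets; \<open>out 0 v\<close>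
  is the response to a variation of the control.\<close>

definition out :: "'y \<Rightarrow> (real \<Rightarrow> 'u) \<Rightarrow> real \<Rightarrow> 'z" where
  "out x u t = indicator {0<..} t *\<^sub>R R (S t x + Lop u t)"

lemma sqi_out:
  assumes u: "ctl u" shows "sqi (out x u)"
proof -
  have "sqi (\<lambda>t. R (indicator {0<..} t *\<^sub>R S t x + indicator {0<..} t *\<^sub>R Lop u t))"
    by (intro sqi_bounded_linear[OF bounded_linear_R] sqi_add sqi_S sqi_indicator sqi_Lop u)
  moreover have "(\<lambda>t. R (indicator {0<..} t *\<^sub>R S t x + indicator {0<..} t *\<^sub>R Lop u t)) = out x u"
    by (auto simp: fun_eq_iff out_def indicator_def linear_0[OF bounded_linear.linear[OF bounded_linear_R]])
  ultimately show ?thesis by simp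
qed

lemma S_0_right: "0 \<le> t \<Longrightarrow> S t 0 = 0"
  using bclinear_S by (auto simp: bclinear_def linear_0 bounded_linear.linear)

lemma out_0: "out 0 v t = indicator {0<..} t *\<^sub>R R (Lop v t)"
  by (auto simp: out_def indicator_def S_0_right)

lemma Lop_add_AE:
  assumes "ctl u" "ctl v"
  shows "AE t in lborel. Lop (\<lambda>s. u s + v s) t = Lop u t + Lop v t"
  using rep_AE[OF assms(1)] rep_AE[OF assms(2)]
  by eventually_elim (rule Lop_eqI[OF rep_add[OF assms]])

lemma Lop_scaleC_AE:
  assumes "ctl u"
  shows "AE t in lborel. Lop (\<lambda>s. c *\<^sub>C u s) t = c *\<^sub>C Lop u t"
  using rep_AE[OF assms(1)] by eventually_elim (rule Lop_eqI[OF rep_scaleC[OF assms]])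

lemma out_add_AE:
  assumes "ctl u" "ctl v"
  shows "AE t in lborel. out (x + y) (\<lambda>s. u s + v s) t = out x u t + out y v t"
  using Lop_add_AE[OF assms]
proof eventually_elim
  case (elim t)
  show ?case
  proof (cases "0 < t")
    case True
    have "linear (S t)" using True bclinear_S[of t] by (simp add: bclinear_def bounded_linear.linear)
    then show ?thesis using elim True
      by (simp add: out_def linear_add linear_add[OF bounded_linear.linear[OF bounded_linear_R], symmetric] add_ac)
  qed (simp add: out_def)
qed

lemma out_scaleC_AE:
  assumes "ctl u"
  shows "AE t in lborel. out (c *\<^sub>C x) (\<lambda>s. c *\<^sub>C u s) t = c *\<^sub>C out x u t"
  using Lop_scaleC_AE[OF assms, of c]
proof eventually_elim
  case (elim t)
  show ?case
  proof (cases "0 < t")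
    case True
    then show ?thesis using elim bclinearD(2)[OF bclinear_S, of t c x]
      by (simp add: out_def scaleC_add_right[symmetric] bclinearD(2)[OF bclinear_R])
  qed (simp add: out_def linear_0[OF bounded_linear.linear[OF bounded_linear_scaleC]])
qed

lemma vareq_iff:
  "vareq R x u \<longleftrightarrow> (\<forall>v. ctl v \<longrightarrow> (LINT t|lebesgue. inner (out x u t) (out 0 v t)) + (LINT t|lebesgue. inner (u t) (v t)) = 0)"
proof -
  have "(LINT t:{0<..}|lebesgue. inner (R (S t x + Lop u t)) (R (Lop v t))) = (LINT t|lebesgue. inner (out x u t) (out 0 v t))" for v
    unfolding set_lebesgue_integral_def
    by (intro Bochner_Integration.integral_cong refl) (auto simp: out_0 indicator_def, auto simp: out_def)
  then show ?thesis by (simp add: vareq_def)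
qed

lemma LINT_cong_AE:
  fixes f g :: "real \<Rightarrow> real"
  assumes "integrable lebesgue f" "AE t in lborel. f t = g t"
  shows "(LINT t|lebesgue. f t) = (LINT t|lebesgue. g t)"
proof (rule integral_cong_AE)
  show "f \<in> borel_measurable lebesgue" using assms(1) by (rule borel_measurable_integrable)
  then show "g \<in> borel_measurable lebesgue" using assms(2) by (rule borel_measurable_lebesgue_AE)
  show "AE t in lebesgue. f t = g t" using assms(2) by (rule AE_completion)
qed

lemma vareq_add:
  assumes u: "ctl u" and w: "ctl w" and "vareq R x u" "vareq R y w"
  shows "vareq R (x + y) (\<lambda>s. u s + w s)"
  unfolding vareq_iff
proof (intro allI impI)
  fix v :: "real \<Rightarrow> 'u" assume v: "ctl v"
  note i = sqi_inner[OF sqi_out[OF u] sqi_out[OF v], of x 0] sqi_inner[OF sqi_out[OF w] sqi_out[OF v], of y 0]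
    sqi_inner[OF ctl_sqi[OF u] ctl_sqi[OF v]] sqi_inner[OF ctl_sqi[OF w] ctl_sqi[OF v]]
  have "(LINT t|lebesgue. inner (out (x + y) (\<lambda>s. u s + w s) t) (out 0 v t))
      = (LINT t|lebesgue. inner (out x u t) (out 0 v t) + inner (out y w t) (out 0 v t))"
    by (intro LINT_cong_AE sqi_inner sqi_out ctl_add u w v)
      (use out_add_AE[OF u w, of x y] in \<open>eventually_elim, simp add: inner_add_left\<close>)
  moreover have "(LINT t|lebesgue. inner (u t + w t) (v t)) = (LINT t|lebesgue. inner (u t) (v t) + inner (w t) (v t))"
    by (simp add: inner_add_left)
  moreover have "(LINT t|lebesgue. inner (out x u t) (out 0 v t)) + (LINT t|lebesgue. inner (u t) (v t)) = 0"
    "(LINT t|lebesgue. inner (out y w t) (out 0 v t)) + (LINT t|lebesgue. inner (w t) (v t)) = 0"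
    using assms(3,4) v by (auto simp: vareq_iff)
  ultimately show "(LINT t|lebesgue. inner (out (x + y) (\<lambda>s. u s + w s) t) (out 0 v t))
      + (LINT t|lebesgue. inner (u t + w t) (v t)) = 0"
    by (simp add: Bochner_Integration.integral_add[OF i(1,2)] Bochner_Integration.integral_add[OF i(3,4)])
qed

text \<open>In the real inner product multiplication by \<open>c\<close> has the adjoint
  \<open>cnj c\<close>, which is absorbed by the test control.\<close>

lemma vareq_scaleC:
  assumes u: "ctl u" and "vareq R x u"
  shows "vareq R (c *\<^sub>C x) (\<lambda>s. c *\<^sub>C u s)"
  unfolding vareq_iff
proof (intro allI impI)
  fix v :: "real \<Rightarrow> 'u" assume v: "ctl v"
  let ?v = "\<lambda>s. cnj c *\<^sub>C v s"
  have cv: "ctl ?v" by (rule ctl_scaleC[OF v])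
  have "(LINT t|lebesgue. inner (out (c *\<^sub>C x) (\<lambda>s. c *\<^sub>C u s) t) (out 0 v t))
      = (LINT t|lebesgue. inner (out x u t) (out 0 ?v t))"
  proof (intro LINT_cong_AE sqi_inner sqi_out ctl_scaleC u v)
    have "(cnj c *\<^sub>C 0 :: 'y) = 0" by (rule linear_0[OF bounded_linear.linear[OF bounded_linear_scaleC]])
    then show "AE t in lborel. inner (out (c *\<^sub>C x) (\<lambda>s. c *\<^sub>C u s) t) (out 0 v t) = inner (out x u t) (out 0 ?v t)"
      using out_scaleC_AE[OF u, of c x] out_scaleC_AE[OF v, of "cnj c" 0]
      by (elim AE_mp) (intro AE_I2, simp add: inner_scaleC_left)
  qed
  moreover have "(LINT t|lebesgue. inner (c *\<^sub>C u t) (v t)) = (LINT t|lebesgue. inner (u t) (?v t))"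
    by (simp add: inner_scaleC_left)
  ultimately show "(LINT t|lebesgue. inner (out (c *\<^sub>C x) (\<lambda>s. c *\<^sub>C u s) t) (out 0 v t))
      + (LINT t|lebesgue. inner (c *\<^sub>C u t) (v t)) = 0"
    using assms(2) cv by (simp add: vareq_iff)
qed

text \<open>The difference of two solutions solves the problem with initial state 0; tested with
  itself, it makes a sum of two squares vanish.\<close>

lemma vareq_unique:
  assumes u: "ctl u" and w: "ctl w" and "vareq R x u" "vareq R x w"
  shows "AE s in lborel. u s = w s"
proof -
  let ?d = "\<lambda>s. u s + (-1) *\<^sub>C w s"
  have m1: "(-1) *\<^sub>C y = - y" for y :: "'a::separable_complex_hilbert"
    using scaleR_scaleC[of "-1" y] by simp
  have d: "ctl ?d" by (intro ctl_add ctl_scaleC u w)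
  have "vareq R (x + (-1) *\<^sub>C x) ?d" by (intro vareq_add vareq_scaleC ctl_scaleC assms)
  then have "(LINT t|lebesgue. inner (out 0 ?d t) (out 0 ?d t)) + (LINT t|lebesgue. inner (?d t) (?d t)) = 0"
    using d by (simp add: vareq_iff m1)
  moreover have "0 \<le> (LINT t|lebesgue. inner (out 0 ?d t) (out 0 ?d t))"
    by (intro Bochner_Integration.integral_nonneg) simp
  moreover have "0 \<le> (LINT t|lebesgue. inner (?d t) (?d t))"
    by (intro Bochner_Integration.integral_nonneg) simp
  ultimately have "(LINT t|lebesgue. inner (?d t) (?d t)) = 0" by linarith
  then have "AE t in lebesgue. inner (?d t) (?d t) = 0"
    using integral_nonneg_eq_0_iff_AE[OF sqi_inner[OF ctl_sqi[OF d] ctl_sqi[OF d]]] by simp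
  then have "AE t in lborel. inner (?d t) (?d t) = 0" by (simp only: AE_lebesgue_iff)
  then show ?thesis by eventually_elim (simp add: m1)
qed

lemma vareq_zero: "vareq R 0 (\<lambda>_. 0)"
proof -
  have c0: "ctl (\<lambda>_. 0)" by (simp add: ctl_def)
  have "Lam (\<lambda>_. 0) t z = 0" for t z by (simp add: Lam_def set_lebesgue_integral_def)
  then have "rep (\<lambda>_. 0) t 0" for t by (simp add: rep_def)
  then have "Lop (\<lambda>_. 0) t = 0" for t by (rule Lop_eqI)
  then show ?thesis
    by (simp add: vareq_iff out_0 linear_0[OF bounded_linear.linear[OF bounded_linear_R]])
qed

lemma run_cost_eq:
  assumes u: "ctl u"
  shows "run_cost R x u = ennreal (LINT t|lebesgue. (norm (out x u t))\<^sup>2 + (norm (u t))\<^sup>2)"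
proof -
  have "run_cost R x u = (\<integral>\<^sup>+t. ennreal ((norm (out x u t))\<^sup>2 + (norm (u t))\<^sup>2) \<partial>lebesgue)"
    unfolding run_cost_def nn_integral_completion
    by (intro nn_integral_cong) (use u in \<open>auto simp: out_def ctl_def indicator_def\<close>)
  also have "\<dots> = ennreal (LINT t|lebesgue. (norm (out x u t))\<^sup>2 + (norm (u t))\<^sup>2)"
    by (intro nn_integral_eq_integral Bochner_Integration.integrable_add sqi_integrable sqi_out ctl_sqi u) auto
  finally show ?thesis .
qed

text \<open>Along u + h v the cost is a quadratic polynomial in h, minimal at h = 0, so its linear
  coefficient vanishes.\<close>

lemma minimizer_vareq:
  assumes u: "ctl u" and min: "\<And>v. ctl v \<Longrightarrow> run_cost R x u \<le> run_cost R x v"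
  shows "vareq R x u"
  unfolding vareq_iff
proof (intro allI impI)
  fix v :: "real \<Rightarrow> 'u" assume v: "ctl v"
  let ?I = "\<lambda>f g. LINT t|lebesgue. inner (f t) (g t) :: real"
  define a where "a = ?I (out x u) (out 0 v) + ?I u v"
  define c where "c = ?I (out 0 v) (out 0 v) + ?I v v"
  have c: "0 \<le> c" unfolding c_def by (intro add_nonneg_nonneg Bochner_Integration.integral_nonneg) auto
  note i = sqi_inner[OF sqi_out[OF u] sqi_out[OF u], of x x] sqi_inner[OF ctl_sqi[OF u] ctl_sqi[OF u]]
    sqi_inner[OF sqi_out[OF u] sqi_out[OF v], of x 0] sqi_inner[OF ctl_sqi[OF u] ctl_sqi[OF v]]
    sqi_inner[OF sqi_out[OF v] sqi_out[OF v], of 0 0] sqi_inner[OF ctl_sqi[OF v] ctl_sqi[OF v]]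
  have "0 \<le> 2 * h * a + h\<^sup>2 * c" for h
  proof -
    let ?w = "\<lambda>s. u s + complex_of_real h *\<^sub>C v s"
    have hv: "ctl (\<lambda>s. complex_of_real h *\<^sub>C v s)" by (rule ctl_scaleC[OF v])
    have w: "ctl ?w" by (rule ctl_add[OF u hv])
    let ?F = "\<lambda>t. inner (out x u t) (out x u t) + inner (u t) (u t)"
    let ?G = "\<lambda>t. 2 * h * inner (out x u t) (out 0 v t) + 2 * h * inner (u t) (v t)"
    let ?H = "\<lambda>t. h\<^sup>2 * inner (out 0 v t) (out 0 v t) + h\<^sup>2 * inner (v t) (v t)"
    have F: "integrable lebesgue ?F" using i(1,2) by simp
    have G: "integrable lebesgue ?G" using i(3,4) by simp
    have H: "integrable lebesgue ?H" using i(5,6) by simp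
    have z: "(complex_of_real h *\<^sub>C 0 :: 'y) = 0" by (rule linear_0[OF bounded_linear.linear[OF bounded_linear_scaleC]])
    have ae: "AE t in lborel. (norm (out x ?w t))\<^sup>2 + (norm (?w t))\<^sup>2 = ?F t + ?G t + ?H t"
      using out_add_AE[OF u hv, of x 0] out_scaleC_AE[OF v, of "complex_of_real h" 0]
    proof eventually_elim
      case (elim t)
      then have "out x ?w t = out x u t + h *\<^sub>R out 0 v t" by (simp add: z scaleR_scaleC)
      then show ?case unfolding power2_norm_eq_inner
        by (simp add: scaleR_scaleC[symmetric] inner_simps inner_commute[of "v t" "u t"]
            inner_commute[of "out 0 v t" "out x u t"] algebra_simps power2_eq_square)
    qed
    have "(LINT t|lebesgue. (norm (out x ?w t))\<^sup>2 + (norm (?w t))\<^sup>2) = (LINT t|lebesgue. ?F t + ?G t + ?H t)"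
      by (intro LINT_cong_AE Bochner_Integration.integrable_add sqi_integrable sqi_out ctl_sqi w ae)
    also have "\<dots> = (LINT t|lebesgue. ?F t) + (LINT t|lebesgue. ?G t) + (LINT t|lebesgue. ?H t)"
      using F G H by simp
    also have "(LINT t|lebesgue. ?G t) = 2 * h * a"
      using i(3,4) by (simp add: a_def distrib_left)
    also have "(LINT t|lebesgue. ?H t) = h\<^sup>2 * c"
      using i(5,6) by (simp add: c_def distrib_left)
    finally have e: "(LINT t|lebesgue. (norm (out x ?w t))\<^sup>2 + (norm (?w t))\<^sup>2)
        = (LINT t|lebesgue. ?F t) + 2 * h * a + h\<^sup>2 * c" .
    have "ennreal (LINT t|lebesgue. ?F t) \<le> ennreal (LINT t|lebesgue. (norm (out x ?w t))\<^sup>2 + (norm (?w t))\<^sup>2)"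
      using min[OF w] unfolding run_cost_eq[OF u] run_cost_eq[OF w] by (simp add: power2_norm_eq_inner)
    moreover have "0 \<le> (LINT t|lebesgue. (norm (out x ?w t))\<^sup>2 + (norm (?w t))\<^sup>2)"
      by (intro Bochner_Integration.integral_nonneg) simp
    ultimately have "(LINT t|lebesgue. ?F t) \<le> (LINT t|lebesgue. (norm (out x ?w t))\<^sup>2 + (norm (?w t))\<^sup>2)"
      by (simp add: ennreal_le_iff)
    then show ?thesis unfolding e by simp
  qed
  then have "a = 0" by (rule linear_term_zero[OF c])
  then show "(LINT t|lebesgue. inner (out x u t) (out 0 v t)) + (LINT t|lebesgue. inner (u t) (v t)) = 0"
    by (simp add: a_def)
qed

end

section \<open>Fractional smoothness of the controlled state\<close>

context control_system begin

text \<open>Riesz with \<open>T\<close> in place of \<open>J'\<close> represents \<open>Lam\<close>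
  by some w, and the fractional power moves to the other side as
  \<open>frac_neg_pow S \<epsilon> w\<close>. The bound adds integrals of different powers and is
  not homogeneous, so it is proved where norm (T z) = 1 and then scaled.\<close>

lemma Lop_frac:
  assumes \<epsilon>: "0 < \<epsilon>" "\<epsilon> < 1"
    and q: "1 < q" "q \<le> 2" "q / (q - 1) \<le> real n"
    and Cq: "0 \<le> Cq" "\<And>z. (\<integral>\<^sup>+\<tau>. indicator {0<..} \<tau> * ennreal (norm (k \<tau> z) powr q) \<partial>lborel)
      \<le> ennreal (Cq * norm (frac_neg_pow S' \<epsilon> (J' z)) powr q)"
    and u: "ctl u" and c2: "(\<integral>\<^sup>+s. ennreal (norm (u s)) ^ 2 \<partial>lborel) \<le> ennreal c2" "0 \<le> c2"
    and c3: "(\<integral>\<^sup>+s. ennreal (norm (u s)) ^ n \<partial>lborel) \<le> ennreal c3" "0 \<le> c3"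
  shows "\<exists>w. norm w \<le> c2 + c3 + Cq \<and> rep u t (frac_neg_pow S \<epsilon> w)"
proof -
  define T where "T z = frac_neg_pow S' \<epsilon> (J' z)" for z
  have lT: "linear T" unfolding T_def[abs_def]
    using linear_compose[OF linear_J' adj.linear_frac_neg_pow[OF \<epsilon>(1)]] by (simp add: o_def)
  have unit: "\<bar>Lam u t z\<bar> \<le> c2 + c3 + Cq" if z: "norm (T z) = 1" for z
  proof -
    have [measurable]: "u \<in> borel_measurable lebesgue" using u by (simp add: ctl_def)
    define W where "W \<tau> = indicator {0<..} \<tau> * norm (k \<tau> z)" for \<tau>
    have W [measurable]: "W \<in> borel_measurable borel" unfolding W_def[abs_def] by (rule norm_k_measurable)
    have WL: "(\<lambda>s. ennreal (W (t - s) powr q)) \<in> borel_measurable lebesgue"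
      by (intro measurable_completion) simp
    have W0: "0 \<le> W \<tau>" for \<tau> by (simp add: W_def)
    have "ennreal \<bar>Lam u t z\<bar> \<le> (\<integral>\<^sup>+s. indicator {..<t} s * (ennreal (norm (u s)) * ennreal (norm (k (t - s) z))) \<partial>lborel)"
      by (rule Lam_bound[OF u])
    also have "\<dots> \<le> (\<integral>\<^sup>+s. (ennreal (norm (u s)) ^ 2 + ennreal (norm (u s)) ^ n) + ennreal (W (t - s) powr q) \<partial>lebesgue)"
      unfolding nn_integral_completion
    proof (rule nn_integral_mono)
      fix s
      show "indicator {..<t} s * (ennreal (norm (u s)) * ennreal (norm (k (t - s) z)))
        \<le> (ennreal (norm (u s)) ^ 2 + ennreal (norm (u s)) ^ n) + ennreal (W (t - s) powr q)"
      proof (cases "s < t")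
        case True
        then have Wk: "W (t - s) = norm (k (t - s) z)" by (simp add: W_def)
        have "norm (u s) * W (t - s) \<le> (norm (u s)) ^ 2 + (norm (u s)) ^ n + W (t - s) powr q"
          by (rule mult_le_power_sum[OF norm_ge_zero W0 q])
        then have "ennreal (norm (u s) * W (t - s)) \<le> ennreal ((norm (u s)) ^ 2 + (norm (u s)) ^ n + W (t - s) powr q)"
          by (rule ennreal_leI)
        then show ?thesis using True by (simp add: Wk ennreal_mult ennreal_plus ennreal_power)
      qed simp
    qed
    also have "\<dots> = ((\<integral>\<^sup>+s. ennreal (norm (u s)) ^ 2 \<partial>lebesgue) + (\<integral>\<^sup>+s. ennreal (norm (u s)) ^ n \<partial>lebesgue))
        + (\<integral>\<^sup>+s. ennreal (W (t - s) powr q) \<partial>lebesgue)"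
      using WL by (simp add: nn_integral_add)
    also have "\<dots> \<le> (ennreal c2 + ennreal c3) + ennreal Cq"
    proof (intro add_mono)
      have "(\<integral>\<^sup>+s. ennreal (W (t - s) powr q) \<partial>lebesgue) = (\<integral>\<^sup>+\<tau>. ennreal (W \<tau> powr q) \<partial>lborel)"
        unfolding nn_integral_completion by (rule nn_integral_reflect_shift(1)) measurable
      also have "\<dots> = (\<integral>\<^sup>+\<tau>. indicator {0<..} \<tau> * ennreal (norm (k \<tau> z) powr q) \<partial>lborel)"
        by (intro nn_integral_cong) (auto simp: W_def indicator_def)
      also have "\<dots> \<le> ennreal Cq" using Cq(2)[of z] z by (simp add: T_def)
      finally show "(\<integral>\<^sup>+s. ennreal (W (t - s) powr q) \<partial>lebesgue) \<le> ennreal Cq" .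
    qed (use c2 c3 in \<open>simp_all add: nn_integral_completion\<close>)
    also have "\<dots> = ennreal (c2 + c3 + Cq)" using c2 c3 Cq by simp
    finally show ?thesis using c2 c3 Cq(1) by (simp add: ennreal_le_iff del: ennreal_plus)
  qed
  have bound: "\<bar>Lam u t z\<bar> \<le> (c2 + c3 + Cq) * norm (T z)" for z
  proof (cases "T z = 0")
    case True
    then have "z = 0" using adj.frac_neg_pow_eq_0[of \<epsilon> "J' z"] adj.inj_resolvent[of z] \<epsilon> by (simp add: T_def)
    then show ?thesis using linear_0[OF linear_Lam[OF u]] by (simp add: linear_0[OF lT])
  next
    case False
    let ?z = "(1 / norm (T z)) *\<^sub>R z"
    have "norm (T ?z) = 1" using False by (simp add: linear_scale[OF lT])
    then have "\<bar>Lam u t ?z\<bar> \<le> c2 + c3 + Cq" by (rule unit)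
    then show ?thesis using False by (simp add: linear_scale[OF linear_Lam[OF u]] abs_mult pos_divide_le_eq)
  qed
  have c: "0 \<le> c2 + c3 + Cq" using c2 c3 Cq(1) by simp
  obtain w where w: "norm w \<le> c2 + c3 + Cq" "\<And>z. Lam u t z = inner w (T z)"
    using Lam_representation[OF u lT c bound] by blast
  have "rep u t (frac_neg_pow S \<epsilon> w)"
    unfolding rep_def using w(2) inner_frac_neg_pow_adj[OF \<epsilon>(1), of w] by (simp add: T_def)
  then show ?thesis using w(1) by blast
qed

end

section \<open>The extended adjoint kernel and the gain operator\<close>

lemma weak_tendsto_unique:
  assumes "weak_tendsto f v F" "weak_tendsto f v' F" "F \<noteq> bot" shows "v = v'"
proof (rule inner_left_eqI)
  fix w
  have "cinner v w = cinner v' w"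
    using assms tendsto_unique unfolding weak_tendsto_def by blast
  then show "inner w v = inner w v'" by (metis inner_cinner inner_commute)
qed

lemma weak_tendstoI:
  assumes "\<And>w. ((\<lambda>s. inner (f s) w) \<longlongrightarrow> inner v w) F" shows "weak_tendsto f v F"
  unfolding weak_tendsto_def cinner_eq_Complex by (intro allI tendsto_Complex assms)

text \<open>Collects what the regularity estimates provide: the controlled state lies in the domain
  of the fractional power at every time, and the kernel has the integrable majorant \<kappa>. What
  remains is linear operator theory and dominated convergence.\<close>

locale lq_opt = control_L2 S M \<omega> b R kd C
  for S :: "real \<Rightarrow> 'y::separable_complex_hilbert \<Rightarrow> 'y" and M \<omega>
    and b :: "'u::separable_complex_hilbert \<Rightarrow> 'y"
    and R :: "'y \<Rightarrow> 'z::separable_complex_hilbert" and kd C +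
  fixes \<epsilon> :: real and uh :: "'y \<Rightarrow> real \<Rightarrow> 'u" and CW :: real
    and E :: "real \<Rightarrow> 'y \<Rightarrow> 'u" and \<kappa> :: "real \<Rightarrow> real"
  assumes \<epsilon>: "0 < \<epsilon>" "\<epsilon> < 1"
    and uh_ctl: "ctl (uh x)" and uh_var: "vareq R x (uh x)"
    and CW: "0 \<le> CW"
    and W_ex: "\<And>x t. \<exists>w. norm w \<le> CW * norm x \<and> rep (uh x) t (frac_neg_pow S \<epsilon> w)"
    and E_op: "\<And>t. 0 < t \<Longrightarrow> bounded_op (frac_dom S' \<epsilon>) (graph_norm (frac_pow S' \<epsilon>)) UNIV norm (E t)"
    and E_k: "\<And>t z. 0 < t \<Longrightarrow> E t (J' z) = k t z"
    and \<kappa>: "\<And>t. 0 \<le> \<kappa> t" "integrable lborel (\<lambda>t. indicator {0<..} t * \<kappa> t)"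
    and k_\<kappa>: "\<And>t z. 0 < t \<Longrightarrow> norm (k t (frac_neg_pow S' \<epsilon> z)) \<le> \<kappa> t * norm (J' z)"
    and RR_op: "bounded_op (frac_dom S \<epsilon>) (graph_norm (frac_pow S \<epsilon>)) (frac_dom S' \<epsilon>)
      (graph_norm (frac_pow S' \<epsilon>)) (\<lambda>x. bounded_adj R (R x))"
begin

abbreviation "N \<equiv> frac_neg_pow S \<epsilon>"
abbreviation "N' \<equiv> frac_neg_pow S' \<epsilon>"

lemma bclinear_N: "bclinear N" and bclinear_N': "bclinear N'"
  using \<epsilon> by (auto intro: bclinear_frac_neg_pow adj.bclinear_frac_neg_pow)

lemma bl_N: "bounded_linear N" and bl_N': "bounded_linear N'"
  using bclinear_N bclinear_N' by (auto simp: bclinear_def)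

lemma lin_N: "linear N" and lin_N': "linear N'"
  using bl_N bl_N' by (auto simp: bounded_linear.linear)

lemma inj_N': "N' x = N' y \<Longrightarrow> x = y"
  using adj.inj_frac_neg_pow[of \<epsilon>] \<epsilon> by (auto dest: injD)

lemma inner_N: "inner (N x) y = inner x (N' y)"
  by (rule inner_frac_neg_pow_adj) (use \<epsilon> in simp)

lemma N'_J': "N' (J' z) = J' (N' z)"
  using \<epsilon> adj.frac_neg_pow_add[of \<epsilon> 1 z] adj.frac_neg_pow_add[of 1 \<epsilon> z] by (simp add: add.commute)

lemma in_dom: "N y \<in> frac_dom S \<epsilon>" "N' y \<in> frac_dom S' \<epsilon>"
  by (simp_all add: frac_dom_def)

lemma frac_pow_N: "frac_pow S \<epsilon> (N y) = y" "frac_pow S' \<epsilon> (N' y) = y"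
  using \<epsilon> by (simp_all add: frac_pow_frac_neg_pow adj.frac_pow_frac_neg_pow)

lemma dense_range_N: "closure (range N) = UNIV"
proof -
  have "frac_neg_pow S 1 z = N (frac_neg_pow S (1 - \<epsilon>) z)" for z
    using \<epsilon> by (simp add: frac_neg_pow_add)
  then have "range J \<subseteq> range N" by auto
  then have "closure (range J) \<subseteq> closure (range N)" by (rule closure_mono)
  then show ?thesis by (simp add: dense_range_resolvent top.extremum_unique)
qed

definition Q :: "real \<Rightarrow> 'y \<Rightarrow> 'u" where "Q t z = E t (N' z)"

text \<open>The graph norm of \<open>N' z\<close> is norm (N' z) + norm z, so composition with
  \<open>N'\<close> turns a graph-norm bound into a bound on all of Y.\<close>

lemma bclinear_Q:
  assumes t: "0 < t" shows "bclinear (Q t)"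
proof -
  obtain K where K: "\<And>x. x \<in> frac_dom S' \<epsilon> \<Longrightarrow> norm (E t x) \<le> K * graph_norm (frac_pow S' \<epsilon>) x"
    and lin: "clinear_on (frac_dom S' \<epsilon>) (E t)"
    using E_op[OF t] by (auto simp: bounded_op_def)
  obtain K' where K': "0 \<le> K'" "\<And>x. norm (N' x) \<le> norm x * K'"
    using bounded_linear.nonneg_bounded[OF bl_N'] by blast
  show ?thesis
  proof (rule bclinearI[where K = "\<bar>K\<bar> * (K' + 1)"])
    show "Q t (x + y) = Q t x + Q t y" for x y
      using lin in_dom(2) unfolding clinear_on_def Q_def linear_add[OF lin_N'] by blast
    show "Q t (c *\<^sub>C x) = c *\<^sub>C Q t x" for c x
      using lin in_dom(2) unfolding clinear_on_def Q_def bclinearD(2)[OF bclinear_N'] by blast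
    show "norm (Q t x) \<le> \<bar>K\<bar> * (K' + 1) * norm x" for x
    proof -
      have "norm (Q t x) \<le> K * (norm (N' x) + norm x)"
        using K[OF in_dom(2)[of x]] by (simp add: Q_def graph_norm_def frac_pow_N)
      also have "\<dots> \<le> \<bar>K\<bar> * (norm x * K' + norm x)" by (intro mult_mono add_right_mono K') auto
      finally show ?thesis by (simp add: algebra_simps)
    qed
  qed
qed

lemma bl_Q: "0 < t \<Longrightarrow> bounded_linear (Q t)" using bclinear_Q by (auto simp: bclinear_def)

lemma Q_J': "0 < t \<Longrightarrow> Q t (J' z) = k t (N' z)"
  by (simp add: Q_def N'_J' E_k)

text \<open>On the dense range of \<open>J'\<close> this is the hypothesis on \<kappa>; the rest is
  continuity.\<close>

lemma norm_Q: assumes t: "0 < t" shows "norm (Q t z) \<le> \<kappa> t * norm z"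
  by (rule norm_le_on_dense[OF adj.dense_range_resolvent bl_Q[OF t]]) (use t Q_J' k_\<kappa> in auto)

text \<open>On the dense range of \<open>J'\<close> both sides equal
  \<open>k (s + t) (N' y)\<close>.\<close>

lemma Q_S':
  assumes s: "0 < s" and t: "0 < t" shows "Q s (S' t z) = Q t (S' s z)"
proof (rule bounded_linear_eq_on_dense[of "range J'" "\<lambda>x. Q s (S' t x)" "\<lambda>x. Q t (S' s x)",
      OF adj.dense_range_resolvent])
  show "bounded_linear (\<lambda>x. Q s (S' t x))" "bounded_linear (\<lambda>x. Q t (S' s x))"
    using s t bclinear_adj_sg by (auto intro!: bounded_linear_compose[OF bl_Q] simp: bclinear_def)
  fix x assume "x \<in> range J'"
  then obtain y where x: "x = J' y" by auto
  have swap: "Q s (S' t x) = k s (S' t (N' y))" if "0 < s" "0 < t" for s t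
    using that \<epsilon> unfolding x J'_S'[OF less_imp_le[OF that(2)], symmetric] Q_J'[OF that(1)]
    by (simp add: adj.frac_neg_pow_S)
  show "Q s (S' t x) = Q t (S' s x)"
    unfolding swap[OF s t] swap[OF t s] using k_add[of s t "N' y"] k_add[of t s "N' y"] s t by (simp add: add.commute)
qed

text \<open>Meant for \<open>Q t (f t)\<close> with a moving argument: its pairing with
  \<open>v\<close> is the inner product of \<open>f t\<close> and
  \<open>bounded_adj (Q t) v\<close>, both measurable in time.\<close>

lemma Q_adj_measurable:
  "(\<lambda>t. indicator {0<..} t *\<^sub>R bounded_adj (Q t) v) \<in> borel_measurable borel"
proof (rule borel_measurable_weak[OF adj.dense_range_resolvent])
  fix y assume "y \<in> range J'"
  then obtain z where y: "y = J' z" by auto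
  have "(\<lambda>t. inner v (indicator {0<..} t *\<^sub>R k t (N' z))) \<in> borel_measurable borel" by measurable
  moreover have "inner (indicator {0<..} t *\<^sub>R bounded_adj (Q t) v) y = inner v (indicator {0<..} t *\<^sub>R k t (N' z))" for t
    using inner_bounded_adj[OF bclinear_Q, of t "J' z" v]
    by (cases "0 < t") (simp_all add: y Q_J' inner_commute)
  ultimately show "(\<lambda>t. inner (indicator {0<..} t *\<^sub>R bounded_adj (Q t) v) y) \<in> borel_measurable borel" by (simp only:)
qed

definition \<Phi> :: "'y \<Rightarrow> real \<Rightarrow> 'y" where "\<Phi> x t = S t x + Lop (uh x) t"

lemma rep_uh: "rep (uh x) t (Lop (uh x) t)"
  using W_ex[of x t] Lop_eqI by metis

text \<open>Optimal controls add up almost everywhere by uniqueness, and \<open>Lop\<close> ignores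
  null sets. Since \<open>rep_uh\<close> holds at each time, the identity does too.\<close>

lemma \<Phi>_add: assumes t: "0 \<le> t" shows "\<Phi> (x + y) t = \<Phi> x t + \<Phi> y t"
proof -
  have "AE s in lborel. uh x s + uh y s = uh (x + y) s"
    by (rule vareq_unique[OF ctl_add[OF uh_ctl uh_ctl] uh_ctl vareq_add[OF uh_ctl uh_ctl uh_var uh_var] uh_var])
  then have "AE s in lborel. 0 < s \<longrightarrow> uh x s + uh y s = uh (x + y) s" by eventually_elim simp
  then have "Lop (uh (x + y)) = Lop (\<lambda>s. uh x s + uh y s)"
    by (rule Lam_AE_cong(3)[OF ctl_add[OF uh_ctl uh_ctl]])
  moreover have "Lop (\<lambda>s. uh x s + uh y s) t = Lop (uh x) t + Lop (uh y) t"
    by (rule Lop_eqI[OF rep_add[OF uh_ctl uh_ctl rep_uh rep_uh]])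
  ultimately show ?thesis
    using bclinear_S[OF t] by (simp add: \<Phi>_def bclinear_def linear_add bounded_linear.linear)
qed

lemma \<Phi>_scaleC: assumes t: "0 \<le> t" shows "\<Phi> (c *\<^sub>C x) t = c *\<^sub>C \<Phi> x t"
proof -
  have "AE s in lborel. c *\<^sub>C uh x s = uh (c *\<^sub>C x) s"
    by (rule vareq_unique[OF ctl_scaleC[OF uh_ctl] uh_ctl vareq_scaleC[OF uh_ctl uh_var] uh_var])
  then have "AE s in lborel. 0 < s \<longrightarrow> c *\<^sub>C uh x s = uh (c *\<^sub>C x) s" by eventually_elim simp
  then have "Lop (uh (c *\<^sub>C x)) = Lop (\<lambda>s. c *\<^sub>C uh x s)"
    by (rule Lam_AE_cong(3)[OF ctl_scaleC[OF uh_ctl]])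
  moreover have "Lop (\<lambda>s. c *\<^sub>C uh x s) t = c *\<^sub>C Lop (uh x) t"
    by (rule Lop_eqI[OF rep_scaleC[OF uh_ctl rep_uh]])
  ultimately show ?thesis
    using bclinearD(2)[OF bclinear_S[OF t]] by (simp add: \<Phi>_def scaleC_add_right)
qed

lemma \<Phi>_frac:
  assumes t: "0 \<le> t"
  obtains w where "\<Phi> (N y) t = N w" "norm w \<le> M * norm y + CW * norm (N y)"
proof -
  obtain w where w: "norm w \<le> CW * norm (N y)" "rep (uh (N y)) t (N w)" using W_ex by blast
  have "\<Phi> (N y) t = N (S t y + w)"
    using Lop_eqI[OF w(2)] t \<epsilon> by (simp add: \<Phi>_def frac_neg_pow_S linear_add[OF lin_N])
  moreover have "norm (S t y + w) \<le> M * norm y + CW * norm (N y)"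
    using norm_triangle_ineq[of "S t y" w] norm_S_le[OF t, of y] w(1) by linarith
  ultimately show thesis by (rule that)
qed

abbreviation RR :: "'y \<Rightarrow> 'y" where "RR x \<equiv> bounded_adj R (R x)"

lemma bclinear_RR: "bclinear RR"
  by (rule bclinear_compose[OF bclinear_bounded_adj[OF bclinear_R] bclinear_R])

lemma lin_RR: "linear RR"
  using bclinearD(1)[OF bclinear_RR] by (rule bounded_linear.linear)

definition g :: "'y \<Rightarrow> real \<Rightarrow> 'y" where "g x t = frac_pow S' \<epsilon> (RR (\<Phi> x t))"

lemma RR_\<Phi>_dom: "0 \<le> t \<Longrightarrow> x \<in> frac_dom S \<epsilon> \<Longrightarrow> RR (\<Phi> x t) \<in> frac_dom S' \<epsilon>"
proof -
  assume t: "0 \<le> t" and "x \<in> frac_dom S \<epsilon>"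
  then obtain y where x: "x = N y" by (auto simp: frac_dom_def)
  obtain w where "\<Phi> x t = N w" using \<Phi>_frac[OF t, of y] x by metis
  then show ?thesis using RR_op in_dom(1)[of w] by (auto simp: bounded_op_def)
qed

lemma N'_g: "0 \<le> t \<Longrightarrow> x \<in> frac_dom S \<epsilon> \<Longrightarrow> N' (g x t) = RR (\<Phi> x t)"
  unfolding g_def by (rule adj.frac_neg_pow_frac_pow[OF RR_\<Phi>_dom])

lemma g_bound: "\<exists>K\<ge>0. \<forall>x\<in>frac_dom S \<epsilon>. \<forall>t\<ge>0. norm (g x t) \<le> K * graph_norm (frac_pow S \<epsilon>) x"
proof -
  obtain K where K: "\<And>x. x \<in> frac_dom S \<epsilon> \<Longrightarrow>
      graph_norm (frac_pow S' \<epsilon>) (RR x) \<le> K * graph_norm (frac_pow S \<epsilon>) x"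
    using RR_op by (auto simp: bounded_op_def)
  obtain K' where K': "0 \<le> K'" "\<And>x. norm (N x) \<le> norm x * K'"
    using bounded_linear.nonneg_bounded[OF bl_N] by blast
  have "norm (g x t) \<le> (\<bar>K\<bar> * (K' + 1) * (M + CW)) * graph_norm (frac_pow S \<epsilon>) x"
    if x: "x \<in> frac_dom S \<epsilon>" and t: "0 \<le> t" for x t
  proof -
    obtain y where y: "x = N y" using x by (auto simp: frac_dom_def)
    obtain w where w: "\<Phi> x t = N w" "norm w \<le> M * norm y + CW * norm x" using \<Phi>_frac[OF t, of y] y by metis
    have "norm (g x t) \<le> graph_norm (frac_pow S' \<epsilon>) (RR (N w))"
      unfolding g_def w(1) by (simp add: graph_norm_def)
    also have "\<dots> \<le> K * graph_norm (frac_pow S \<epsilon>) (N w)" by (rule K[OF in_dom(1)])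
    also have "\<dots> \<le> \<bar>K\<bar> * (norm w * K' + norm w)"
      unfolding graph_norm_def frac_pow_N by (intro mult_mono add_right_mono K') auto
    also have "\<dots> = (\<bar>K\<bar> * (K' + 1)) * norm w" by (simp add: algebra_simps)
    also have "\<dots> \<le> (\<bar>K\<bar> * (K' + 1)) * ((M + CW) * (norm x + norm y))"
    proof (rule mult_left_mono)
      have "0 \<le> M * norm x" "0 \<le> CW * norm y" using M_ge CW by simp_all
      then show "norm w \<le> (M + CW) * (norm x + norm y)"
        using w(2) by (simp only: distrib_left distrib_right)
    qed (use K'(1) in simp)
    finally show ?thesis by (simp add: y graph_norm_def frac_pow_N mult.assoc)
  qed
  moreover have "0 \<le> \<bar>K\<bar> * (K' + 1) * (M + CW)" using K'(1) M_ge CW by simp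
  ultimately show ?thesis by blast
qed

lemma indicator_lebesgue [measurable]: "(\<lambda>t::real. indicator {0<..} t :: real) \<in> borel_measurable lebesgue"
  by (intro measurable_completion borel_measurable_indicator) simp

lemma \<Phi>_measurable: "(\<lambda>t. indicator {0<..} t *\<^sub>R \<Phi> x t) \<in> borel_measurable lebesgue"
proof -
  have [measurable]: "(\<lambda>t. indicator {0<..} t *\<^sub>R S t x) \<in> borel_measurable lebesgue"
    by (intro measurable_completion) simp
  have [measurable]: "Lop (uh x) \<in> borel_measurable lebesgue" using sqi_Lop[OF uh_ctl] by (simp add: sqi_def)
  have "(\<lambda>t. indicator {0<..} t *\<^sub>R S t x + indicator {0<..} t *\<^sub>R Lop (uh x) t) \<in> borel_measurable lebesgue"
    by measurable
  then show ?thesis by (simp add: \<Phi>_def scaleR_add_right)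
qed

text \<open>\<open>g\<close> is defined by an inverse operator; paired with \<open>N z\<close> it
  becomes the pairing of \<open>RR (\<Phi> x t)\<close> with z, and the range of \<open>N\<close> is
  dense.\<close>

lemma g_measurable:
  assumes x: "x \<in> frac_dom S \<epsilon>"
  shows "(\<lambda>t. indicator {0<..} t *\<^sub>R g x t) \<in> borel_measurable lebesgue"
proof (rule borel_measurable_weak[OF dense_range_N])
  fix y assume "y \<in> range N"
  then obtain z where y: "y = N z" by auto
  have "(\<lambda>t. RR (indicator {0<..} t *\<^sub>R \<Phi> x t)) \<in> borel_measurable lebesgue"
    by (rule measurable_compose[OF \<Phi>_measurable borel_measurable_continuous_onI[OF linear_continuous_on]])
      (use bclinear_RR in \<open>simp add: bclinear_def\<close>)
  then have "(\<lambda>t. inner (RR (indicator {0<..} t *\<^sub>R \<Phi> x t)) z) \<in> borel_measurable lebesgue" by measurable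
  moreover have "inner (RR (indicator {0<..} t *\<^sub>R \<Phi> x t)) z = inner (indicator {0<..} t *\<^sub>R g x t) y" for t
  proof (cases "0 < t")
    case True
    then show ?thesis using N'_g[OF _ x, of t] inner_N[of z "g x t"] by (simp add: y inner_commute)
  next
    case False
    then show ?thesis using linear_0[OF lin_RR] by simp
  qed
  ultimately show "(\<lambda>t. inner (indicator {0<..} t *\<^sub>R g x t) y) \<in> borel_measurable lebesgue" by simp
qed

lemma Q_measurable:
  assumes f: "(\<lambda>t. indicator {0<..} t *\<^sub>R f t) \<in> borel_measurable lebesgue"
  shows "(\<lambda>t. indicator {0<..} t *\<^sub>R Q t (f t)) \<in> borel_measurable lebesgue"
proof (rule borel_measurable_weak[of UNIV])
  fix v
  have [measurable]: "(\<lambda>t. indicator {0<..} t *\<^sub>R bounded_adj (Q t) v) \<in> borel_measurable lebesgue"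
    using Q_adj_measurable by (intro measurable_completion) simp
  have "(\<lambda>t. inner (indicator {0<..} t *\<^sub>R f t) (indicator {0<..} t *\<^sub>R bounded_adj (Q t) v)) \<in> borel_measurable lebesgue"
    using f by measurable
  moreover have "inner (indicator {0<..} t *\<^sub>R f t) (indicator {0<..} t *\<^sub>R bounded_adj (Q t) v)
      = inner (indicator {0<..} t *\<^sub>R Q t (f t)) v" for t
    using inner_bounded_adj[OF bclinear_Q, of t "f t" v] by (cases "0 < t") simp_all
  ultimately show "(\<lambda>t. inner (indicator {0<..} t *\<^sub>R Q t (f t)) v) \<in> borel_measurable lebesgue" by (simp only:)
qed simp

lemma S'_measurable:
  assumes f: "(\<lambda>t. indicator {0<..} t *\<^sub>R f t) \<in> borel_measurable lebesgue"
  shows "(\<lambda>t. indicator {0<..} t *\<^sub>R S' t (f t)) \<in> borel_measurable lebesgue"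
proof (rule borel_measurable_weak[of UNIV])
  fix v
  have [measurable]: "(\<lambda>t. indicator {0<..} t *\<^sub>R S t v) \<in> borel_measurable lebesgue"
    by (intro measurable_completion) simp
  have "(\<lambda>t. inner (indicator {0<..} t *\<^sub>R S t v) (indicator {0<..} t *\<^sub>R f t)) \<in> borel_measurable lebesgue"
    using f by measurable
  moreover have "inner (indicator {0<..} t *\<^sub>R S t v) (indicator {0<..} t *\<^sub>R f t)
      = inner (indicator {0<..} t *\<^sub>R S' t (f t)) v" for t
    using inner_adj_sg[of t v "f t"] by (cases "0 < t") (simp_all add: inner_commute)
  ultimately show "(\<lambda>t. inner (indicator {0<..} t *\<^sub>R S' t (f t)) v) \<in> borel_measurable lebesgue" by (simp only:)
qed simp

lemma \<kappa>_lebesgue: "integrable lebesgue (\<lambda>t. indicator {0<..} t * \<kappa> t)"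
  using \<kappa>(2) by (subst integrable_completion) auto

lemma Q_integrable:
  assumes f: "(\<lambda>t. indicator {0<..} t *\<^sub>R f t) \<in> borel_measurable lebesgue"
    and bd: "\<And>t. 0 < t \<Longrightarrow> norm (f t) \<le> c"
  shows "integrable lebesgue (\<lambda>t. indicator {0<..} t *\<^sub>R Q t (f t))"
    "norm (indicator {0<..} t *\<^sub>R Q t (f t)) \<le> indicator {0<..} t * \<kappa> t * c"
    "norm (LINT t:{0<..}|lebesgue. Q t (f t)) \<le> (LINT t|lebesgue. indicator {0<..} t * \<kappa> t) * c"
proof -
  have le: "norm (indicator {0<..} t *\<^sub>R Q t (f t)) \<le> indicator {0<..} t * \<kappa> t * c" for t
    using norm_Q[of t "f t"] mult_left_mono[OF bd[of t] \<kappa>(1)[of t]] by (cases "0 < t") auto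
  then show "norm (indicator {0<..} t *\<^sub>R Q t (f t)) \<le> indicator {0<..} t * \<kappa> t * c" .
  show int: "integrable lebesgue (\<lambda>t. indicator {0<..} t *\<^sub>R Q t (f t))"
    by (rule Bochner_Integration.integrable_bound[OF integrable_mult_left[OF \<kappa>_lebesgue, of c] Q_measurable[OF f]])
      (use le in \<open>auto intro!: AE_I2 intro: order_trans[OF _ abs_ge_self]\<close>)
  have "norm (LINT t|lebesgue. indicator {0<..} t *\<^sub>R Q t (f t)) \<le> (LINT t|lebesgue. indicator {0<..} t * \<kappa> t * c)"
    using le by (intro Bochner_Integration.integral_norm_bound_integral int integrable_mult_left[OF \<kappa>_lebesgue])
  then show "norm (LINT t:{0<..}|lebesgue. Q t (f t)) \<le> (LINT t|lebesgue. indicator {0<..} t * \<kappa> t) * c"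
    unfolding set_lebesgue_integral_def by simp
qed

lemma E_RR: "0 < t \<Longrightarrow> x \<in> frac_dom S \<epsilon> \<Longrightarrow> E t (RR (\<Phi> x t)) = Q t (g x t)"
  by (simp add: Q_def N'_g)

definition Top :: "'y \<Rightarrow> 'u" where "Top x = (LINT t:{0<..}|lebesgue. E t (RR (\<Phi> x t)))"

lemma Top_eq: "x \<in> frac_dom S \<epsilon> \<Longrightarrow> Top x = (LINT t|lebesgue. indicator {0<..} t *\<^sub>R Q t (g x t))"
  unfolding Top_def set_lebesgue_integral_def
  by (intro Bochner_Integration.integral_cong refl) (auto simp: indicator_def E_RR)

lemma g_bd:
  assumes "x \<in> frac_dom S \<epsilon>" obtains c where "0 \<le> c" "\<And>t. 0 < t \<Longrightarrow> norm (g x t) \<le> c"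
proof -
  obtain K where "K \<ge> 0" "\<forall>x\<in>frac_dom S \<epsilon>. \<forall>t\<ge>0. norm (g x t) \<le> K * graph_norm (frac_pow S \<epsilon>) x"
    using g_bound by blast
  then show thesis using that[of "K * graph_norm (frac_pow S \<epsilon>) x"] assms by (simp add: graph_norm_def)
qed

lemma integrand_integrable:
  assumes x: "x \<in> frac_dom S \<epsilon>"
  shows "integrable lebesgue (\<lambda>t. indicator {0<..} t *\<^sub>R Q t (g x t))"
    "set_integrable lebesgue {0<..} (\<lambda>t. E t (RR (\<Phi> x t)))"
proof -
  obtain c where "\<And>t. 0 < t \<Longrightarrow> norm (g x t) \<le> c" using g_bd[OF x] by blast
  then show i: "integrable lebesgue (\<lambda>t. indicator {0<..} t *\<^sub>R Q t (g x t))"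
    by (rule Q_integrable(1)[OF g_measurable[OF x]])
  have "(\<lambda>t. indicator {0<..} t *\<^sub>R Q t (g x t)) = (\<lambda>t. indicator {0<..} t *\<^sub>R E t (RR (\<Phi> x t)))"
    using x by (auto simp: fun_eq_iff indicator_def E_RR)
  then show "set_integrable lebesgue {0<..} (\<lambda>t. E t (RR (\<Phi> x t)))"
    using i by (simp add: set_integrable_def)
qed

lemma csubspace_frac_dom: "csubspace_set (frac_dom S \<epsilon>)"
  unfolding csubspace_set_def frac_dom_def
proof (intro conjI ballI allI)
  show "0 \<in> range N" using rangeI[of N 0] by (simp add: linear_0[OF lin_N])
  show "x + y \<in> range N" if "x \<in> range N" "y \<in> range N" for x y
    using that by (auto simp: linear_add[OF lin_N, symmetric])
  show "c *\<^sub>C x \<in> range N" if "x \<in> range N" for c x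
    using that by (auto simp: bclinearD(2)[OF bclinear_N, symmetric])
qed

lemma g_add:
  assumes t: "0 \<le> t" and x: "x \<in> frac_dom S \<epsilon>" and y: "y \<in> frac_dom S \<epsilon>"
  shows "g (x + y) t = g x t + g y t"
  by (rule inj_N') (simp add: linear_add[OF lin_N'] N'_g csubspace_set_add[OF csubspace_frac_dom] t x y \<Phi>_add linear_add[OF lin_RR])

lemma g_scaleC:
  assumes t: "0 \<le> t" and x: "x \<in> frac_dom S \<epsilon>"
  shows "g (c *\<^sub>C x) t = c *\<^sub>C g x t"
  by (rule inj_N')
    (simp add: bclinearD(2)[OF bclinear_N'] N'_g csubspace_set_scaleC[OF csubspace_frac_dom] t x \<Phi>_scaleC bclinearD(2)[OF bclinear_RR])

lemma Top_bounded_op: "bounded_op (frac_dom S \<epsilon>) (graph_norm (frac_pow S \<epsilon>)) UNIV norm Top"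
  unfolding bounded_op_def clinear_on_def
proof (intro conjI ballI allI UNIV_I)
  fix x y assume x: "x \<in> frac_dom S \<epsilon>" and y: "y \<in> frac_dom S \<epsilon>"
  have "(\<lambda>t. indicator {0<..} t *\<^sub>R Q t (g (x + y) t))
      = (\<lambda>t. indicator {0<..} t *\<^sub>R Q t (g x t) + indicator {0<..} t *\<^sub>R Q t (g y t))"
    using x y by (auto simp: fun_eq_iff indicator_def g_add linear_add[OF bounded_linear.linear[OF bl_Q]])
  then show "Top (x + y) = Top x + Top y"
    using csubspace_set_add[OF csubspace_frac_dom x y]
    by (simp add: Top_eq x y Bochner_Integration.integral_add integrand_integrable(1))
next
  fix c x assume x: "x \<in> frac_dom S \<epsilon>"
  have scR: "c *\<^sub>C (r *\<^sub>R y) = r *\<^sub>R (c *\<^sub>C y)" for r :: real and y :: 'u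
    by (rule linear_scale[OF bounded_linear.linear[OF bounded_linear_scaleC]])
  have "(\<lambda>t. indicator {0<..} t *\<^sub>R Q t (g (c *\<^sub>C x) t)) = (\<lambda>t. c *\<^sub>C (indicator {0<..} t *\<^sub>R Q t (g x t)))"
    using x by (auto simp: fun_eq_iff indicator_def g_scaleC bclinearD(2)[OF bclinear_Q] scR)
  then show "Top (c *\<^sub>C x) = c *\<^sub>C Top x"
    using csubspace_set_scaleC[OF csubspace_frac_dom x]
    by (simp add: Top_eq x integral_bounded_linear[OF bounded_linear_scaleC integrand_integrable(1)[OF x]])
next
  obtain K where K: "K \<ge> 0" "\<forall>x\<in>frac_dom S \<epsilon>. \<forall>t\<ge>0. norm (g x t) \<le> K * graph_norm (frac_pow S \<epsilon>) x"
    using g_bound by blast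
  have "norm (Top x) \<le> ((LINT t|lebesgue. indicator {0<..} t * \<kappa> t) * K) * graph_norm (frac_pow S \<epsilon>) x"
    if x: "x \<in> frac_dom S \<epsilon>" for x
  proof -
    have "norm (LINT t:{0<..}|lebesgue. Q t (g x t))
        \<le> (LINT t|lebesgue. indicator {0<..} t * \<kappa> t) * (K * graph_norm (frac_pow S \<epsilon>) x)"
      by (rule Q_integrable(3)[OF g_measurable[OF x]]) (use K x in auto)
    then show ?thesis by (simp add: Top_eq[OF x] set_lebesgue_integral_def mult.assoc)
  qed
  then show "\<exists>K. \<forall>x\<in>frac_dom S \<epsilon>. norm (Top x) \<le> K * graph_norm (frac_pow S \<epsilon>) x" by blast
qed

definition Pop :: "'y \<Rightarrow> 'y" where "Pop x = (LINT t:{0<..}|lebesgue. S' t (RR (\<Phi> x t)))"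

lemma S'_g_integrable:
  assumes x: "x \<in> frac_dom S \<epsilon>"
  shows "integrable lebesgue (\<lambda>t. indicator {0<..} t *\<^sub>R S' t (g x t))"
proof -
  obtain c where c: "0 \<le> c" "\<And>t. 0 < t \<Longrightarrow> norm (g x t) \<le> c" using g_bd[OF x] by blast
  have "set_integrable lborel {0<..} (\<lambda>t. t powr (1 - 1) * exp (- \<omega> * t))"
    using \<omega>_pos by (intro integrable_powr_exp) auto
  then have "integrable lebesgue (\<lambda>t. indicator {0<..} t *\<^sub>R (t powr (1 - 1) * exp (- \<omega> * t)))"
    unfolding set_integrable_def by (subst integrable_completion) auto
  from integrable_mult_left[OF this, of "M * c"]
  show ?thesis
  proof (rule Bochner_Integration.integrable_bound[OF _ S'_measurable[OF g_measurable[OF x]]], intro AE_I2)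
    fix t :: real
    show "norm (indicator {0<..} t *\<^sub>R S' t (g x t))
      \<le> norm (indicator {0<..} t *\<^sub>R (t powr (1 - 1) * exp (- \<omega> * t)) * (M * c))"
    proof (cases "0 < t")
      case True
      have "norm (S' t (g x t)) \<le> M * exp (- \<omega> * t) * norm (g x t)" using True by (intro adj.stable) simp
      also have "\<dots> \<le> M * exp (- \<omega> * t) * c" using True M_ge by (intro mult_left_mono c) auto
      finally show ?thesis using True M_ge c(1) by (simp add: abs_mult mult_ac)
    qed simp
  qed
qed

lemma Pop_eq:
  assumes x: "x \<in> frac_dom S \<epsilon>"
  shows "Pop x = N' (LINT t|lebesgue. indicator {0<..} t *\<^sub>R S' t (g x t))"
proof -
  have "Pop x = (LINT t|lebesgue. N' (indicator {0<..} t *\<^sub>R S' t (g x t)))"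
    unfolding Pop_def set_lebesgue_integral_def
    using x \<epsilon> by (intro Bochner_Integration.integral_cong refl)
      (auto simp: indicator_def N'_g[symmetric] adj.frac_neg_pow_S linear_0[OF lin_N'])
  also have "\<dots> = N' (LINT t|lebesgue. indicator {0<..} t *\<^sub>R S' t (g x t))"
    by (rule integral_bounded_linear[OF bl_N' S'_g_integrable[OF x]])
  finally show ?thesis .
qed

lemma Pop_dom: "x \<in> frac_dom S \<epsilon> \<Longrightarrow> Pop x \<in> frac_dom S' \<epsilon>"
  by (simp add: Pop_eq frac_dom_def)

text \<open>Since \<open>Q s (S' t z) = Q t (S' s z)\<close>, the operator \<open>E s\<close> acting on \<open>Pop x\<close> only perturbs the integrand
  of \<open>Top x\<close> by the factor \<open>S' s\<close>, which tends to the identity.\<close>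

lemma E_Pop:
  assumes x: "x \<in> frac_dom S \<epsilon>" and s: "0 < s"
  shows "E s (Pop x) = (LINT t|lebesgue. indicator {0<..} t *\<^sub>R Q t (S' s (g x t)))"
proof -
  have "E s (Pop x) = Q s (LINT t|lebesgue. indicator {0<..} t *\<^sub>R S' t (g x t))" by (simp add: Pop_eq[OF x] Q_def)
  also have "\<dots> = (LINT t|lebesgue. Q s (indicator {0<..} t *\<^sub>R S' t (g x t)))"
    by (rule integral_bounded_linear[OF bl_Q[OF s] S'_g_integrable[OF x], symmetric])
  also have "\<dots> = (LINT t|lebesgue. indicator {0<..} t *\<^sub>R Q t (S' s (g x t)))"
    using s by (intro Bochner_Integration.integral_cong refl)
      (auto simp: indicator_def Q_S' linear_0[OF bounded_linear.linear[OF bl_Q]])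
  finally show ?thesis .
qed

text \<open>Dominated convergence: the integrand is majorised by M c \<kappa> uniformly in s, and
  \<open>S' s\<close> tends strongly to the identity.\<close>

lemma E_Pop_tendsto:
  assumes x: "x \<in> frac_dom S \<epsilon>"
  shows "weak_tendsto (\<lambda>s. E s (Pop x)) (Top x) (at_right 0)"
proof (rule weak_tendstoI)
  fix w
  obtain c where c: "0 \<le> c" "\<And>t. 0 < t \<Longrightarrow> norm (g x t) \<le> c" using g_bd[OF x] by blast
  have gs: "norm (S' s (g x t)) \<le> M * c" if "0 < s" "0 < t" for s t
    using M_ge that by (intro order_trans[OF adj.norm_S_le mult_left_mono[OF c(2)]]) auto
  have meas: "(\<lambda>t. indicator {0<..} t *\<^sub>R S' s (g x t)) \<in> borel_measurable lebesgue" if "0 < s" for s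
  proof -
    have bl: "bounded_linear (S' s)" using bclinear_adj_sg[of s] that by (simp add: bclinear_def)
    have "(\<lambda>t. S' s (indicator {0<..} t *\<^sub>R g x t)) \<in> borel_measurable lebesgue"
      by (rule measurable_compose[OF g_measurable[OF x] borel_measurable_continuous_onI[OF linear_continuous_on[OF bl]]])
    then show ?thesis by (simp add: linear_scale[OF bounded_linear.linear[OF bl]])
  qed
  have seq: "(\<lambda>i. inner (E (X i) (Pop x)) w) \<longlonglongrightarrow> inner (Top x) w"
    if X: "\<And>i. 0 < X i" "X \<longlonglongrightarrow> 0" for X :: "nat \<Rightarrow> real"
  proof -
    let ?f = "\<lambda>i t. inner (indicator {0<..} t *\<^sub>R Q t (S' (X i) (g x t))) w"
    let ?g = "\<lambda>t. inner (indicator {0<..} t *\<^sub>R Q t (g x t)) w"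
    have "(\<lambda>i. LINT t|lebesgue. ?f i t) \<longlonglongrightarrow> (LINT t|lebesgue. ?g t)"
    proof (rule integral_dominated_convergence)
      show "integrable lebesgue (\<lambda>t. indicator {0<..} t * \<kappa> t * (M * c) * norm w)"
        by (intro integrable_mult_left \<kappa>_lebesgue)
      show "?g \<in> borel_measurable lebesgue"
        using Q_measurable[OF g_measurable[OF x]] by measurable
      show "?f i \<in> borel_measurable lebesgue" for i
        using Q_measurable[OF meas[OF X(1)[of i]]] by measurable
      show "AE t in lebesgue. norm (?f i t) \<le> indicator {0<..} t * \<kappa> t * (M * c) * norm w" for i
      proof (rule AE_I2)
        fix t
        have "norm (?f i t) \<le> norm (indicator {0<..} t *\<^sub>R Q t (S' (X i) (g x t))) * norm w"
          unfolding real_norm_def by (rule Cauchy_Schwarz_ineq2)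
        also have "\<dots> \<le> indicator {0<..} t * \<kappa> t * (M * c) * norm w"
          by (intro mult_right_mono Q_integrable(2)[OF meas[OF X(1)]] gs X(1)) auto
        finally show "norm (?f i t) \<le> indicator {0<..} t * \<kappa> t * (M * c) * norm w" .
      qed
      show "AE t in lebesgue. (\<lambda>i. ?f i t) \<longlonglongrightarrow> ?g t"
      proof (rule AE_I2)
        fix t :: real
        show "(\<lambda>i. ?f i t) \<longlonglongrightarrow> ?g t"
        proof (cases "0 < t")
          case True
          have "(\<lambda>i. S' (X i) (g x t)) \<longlonglongrightarrow> S' 0 (g x t)"
            by (rule continuous_on_tendsto_compose[OF adj.continuous_on_S X(2)])
              (use X(1) in \<open>auto simp: less_imp_le\<close>)
          then have "(\<lambda>i. Q t (S' (X i) (g x t))) \<longlonglongrightarrow> Q t (g x t)"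
            using bounded_linear.tendsto[OF bl_Q[OF True]] by (simp add: adj.S_zero)
          then show ?thesis by (intro tendsto_intros)
        qed simp
      qed
    qed
    moreover have "(LINT t|lebesgue. ?f i t) = inner (E (X i) (Pop x)) w" for i
      unfolding E_Pop[OF x X(1)]
      by (rule integral_inner_left) (rule Q_integrable(1)[OF meas[OF X(1)] gs[OF X(1)]])
    moreover have "(LINT t|lebesgue. ?g t) = inner (Top x) w"
      unfolding Top_eq[OF x] by (rule integral_inner_left) (rule integrand_integrable(1)[OF x])
    ultimately show ?thesis by simp
  qed
  show "((\<lambda>s. inner (E s (Pop x)) w) \<longlongrightarrow> inner (Top x) w) (at_right 0)"
    unfolding tendsto_at_iff_sequentially
  proof (intro allI impI)
    fix X :: "nat \<Rightarrow> real" assume "\<forall>i. X i \<in> {0<..} - {0}" "X \<longlonglongrightarrow> 0"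
    then show "((\<lambda>s. inner (E s (Pop x)) w) \<circ> X) \<longlonglongrightarrow> inner (Top x) w"
      using seq[of X] by (auto simp: o_def)
  qed
qed

lemma weak_lim_E_Pop:
  assumes x: "x \<in> frac_dom S \<epsilon>"
  shows "weak_lim (at_right 0) (\<lambda>s. E s (Pop x)) = Top x"
  unfolding weak_lim_def
proof (rule the_equality)
  show "weak_tendsto (\<lambda>s. E s (Pop x)) (Top x) (at_right 0)" by (rule E_Pop_tendsto[OF x])
  fix v assume "weak_tendsto (\<lambda>s. E s (Pop x)) v (at_right 0)"
  then show "v = Top x"
    by (rule weak_tendsto_unique[OF _ E_Pop_tendsto[OF x] trivial_limit_at_right_real])
qed

end

section \<open>Identification with the control problem\<close>

lemma Lp_norm_bound:
  assumes f: "f \<in> Lp_set I p" and p: "1 \<le> p" and c: "0 \<le> c" "Lp_norm I p f \<le> c"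
  shows "(\<integral>\<^sup>+t. indicator I t * ennreal (norm (f t) powr p) \<partial>lborel) \<le> ennreal (c powr p)"
proof -
  let ?I = "LINT t|lebesgue. indicator I t *\<^sub>R (norm (f t) powr p)"
  have int: "integrable lebesgue (\<lambda>t. indicator I t *\<^sub>R (norm (f t) powr p))"
    using f by (simp add: Lp_set_def set_integrable_def)
  have I0: "0 \<le> ?I" by (intro Bochner_Integration.integral_nonneg) simp
  have "(\<integral>\<^sup>+t. indicator I t * ennreal (norm (f t) powr p) \<partial>lborel)
      = (\<integral>\<^sup>+t. ennreal (indicator I t *\<^sub>R (norm (f t) powr p)) \<partial>lebesgue)"
    unfolding nn_integral_completion by (intro nn_integral_cong) (auto simp: indicator_def)
  also have "\<dots> = ennreal ?I" by (rule nn_integral_eq_integral[OF int]) simp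
  also have "?I \<le> c powr p"
  proof -
    have "?I = (?I powr (1 / p)) powr p" using I0 p by (simp add: powr_powr)
    also have "\<dots> \<le> c powr p"
      using c p by (intro powr_mono2) (auto simp: Lp_norm_def set_lebesgue_integral_def)
    finally show ?thesis .
  qed
  finally show ?thesis by (simp add: ennreal_leI)
qed

text \<open>Members of \<open>Lp_set {0<..} 2\<close> are arbitrary at nonpositive times; cutting
  makes them \<open>ctl\<close> without changing state or cost.\<close>

definition cut :: "(real \<Rightarrow> 'u::real_vector) \<Rightarrow> real \<Rightarrow> 'u" where
  "cut v s = indicator {0<..} s *\<^sub>R v s"

lemma ctl_cut:
  assumes v: "v \<in> Lp_set {0<..} 2" shows "ctl (cut v)"
  unfolding ctl_def
proof (intro conjI allI impI)
  show "cut v \<in> borel_measurable lebesgue"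
    using v by (simp add: Lp_set_def set_borel_measurable_def cut_def[abs_def])
  have "(\<integral>\<^sup>+s. ennreal (norm (cut v s)) ^ 2 \<partial>lborel)
      = (\<integral>\<^sup>+s. ennreal (norm (indicator {0<..} s *\<^sub>R (norm (v s) powr 2))) \<partial>lebesgue)"
    unfolding nn_integral_completion
    by (intro nn_integral_cong) (auto simp: cut_def indicator_def ennreal_power powr_numeral)
  also have "\<dots> < top" using v by (simp add: Lp_set_def set_integrable_def integrable_iff_bounded)
  finally show "(\<integral>\<^sup>+s. ennreal (norm (cut v s)) ^ 2 \<partial>lborel) < top" .
qed (simp add: cut_def)

lemma cut_ctl: "ctl v \<Longrightarrow> cut v = v"
  by (auto simp: fun_eq_iff cut_def ctl_def indicator_def)

lemma ctl_Lp_set: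
  assumes v: "ctl v" shows "v \<in> Lp_set {0<..} 2"
proof -
  have c: "(\<lambda>s. indicator {0<..} s *\<^sub>R v s) = v" using cut_ctl[OF v] by (simp add: cut_def[abs_def])
  have "integrable lebesgue (\<lambda>s. (norm (v s))\<^sup>2)" by (rule ctl_integrable[OF v])
  also have "(\<lambda>s. (norm (v s))\<^sup>2) = (\<lambda>s. indicator {0<..} s *\<^sub>R (norm (v s) powr 2))"
    using v by (auto simp: fun_eq_iff indicator_def ctl_def powr_numeral)
  finally show ?thesis using v by (simp add: Lp_set_def set_borel_measurable_def c set_integrable_def ctl_def)
qed

lemma integral_Complex:
  assumes "integrable M f" "integrable M g"
  shows "integral\<^sup>L M (\<lambda>x. Complex (f x) (g x)) = Complex (integral\<^sup>L M f) (integral\<^sup>L M g)"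
  using assms by (simp add: Complex_eq)

text \<open>The graph norm of \<open>?J' z\<close> is at most a multiple of norm z, so evaluating
  \<open>B u\<close> there is a bounded functional of z on Y. Riesz applies to its real
  part.\<close>

lemma (in stable_semigroup) ex_bounded_representation:
  assumes gen: "generates DA A S"
    and B: "bounded_into_dual (adj_dom DA A) (graph_norm (adj DA A)) B"
  obtains b :: "'u::separable_complex_hilbert \<Rightarrow> 'y"
  where "bclinear b" "\<And>u z. B u (frac_neg_pow (adj_sg S) 1 z) = cinner (b u) z"
proof -
  interpret adj: stable_semigroup "adj_sg S" M \<omega> by (rule stable_semigroup_adj)
  let ?J' = "frac_neg_pow (adj_sg S) 1"
  note gen' = adj_generator[OF gen]
  have J': "bclinear ?J'" by (rule adj.bclinear_frac_neg_pow) simp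
  have lJ': "linear ?J'" by (rule adj.linear_frac_neg_pow) simp
  have in_dom: "?J' z \<in> adj_dom DA A" for z by (simp add: gen')
  obtain KJ where KJ: "0 \<le> KJ" "\<And>z. norm (?J' z) \<le> norm z * KJ"
    using bounded_linear.nonneg_bounded[OF bclinearD(1)[OF J']] by blast
  obtain K where K: "\<And>u x. x \<in> adj_dom DA A \<Longrightarrow> cmod (B u x) \<le> K * norm u * graph_norm (adj DA A) x"
    using B unfolding bounded_into_dual_def by blast
  define L where "L = \<bar>K\<bar> * (KJ + 1)"
  have L: "0 \<le> L" using KJ by (simp add: L_def)
  have bound: "cmod (B u (?J' z)) \<le> L * norm u * norm z" for u z
  proof -
    have "graph_norm (adj DA A) (?J' z) = norm (?J' z) + norm z" by (simp add: graph_norm_def gen')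
    also have "\<dots> \<le> (KJ + 1) * norm z" using KJ(2)[of z] by (simp add: algebra_simps)
    finally have "\<bar>K\<bar> * norm u * graph_norm (adj DA A) (?J' z) \<le> \<bar>K\<bar> * norm u * ((KJ + 1) * norm z)"
      by (intro mult_left_mono) auto
    moreover have "K * norm u * graph_norm (adj DA A) (?J' z) \<le> \<bar>K\<bar> * norm u * graph_norm (adj DA A) (?J' z)"
      by (intro mult_right_mono) (auto simp: graph_norm_def)
    ultimately show ?thesis using K[OF in_dom, of u z] by (simp add: L_def mult_ac)
  qed
  have B_add: "B u (?J' (x + y)) = B u (?J' x) + B u (?J' y)"
    and B_scale: "B u (?J' (c *\<^sub>C x)) = cnj c * B u (?J' x)" for u x y c
    using B in_dom unfolding bounded_into_dual_def pivot_dual_def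
    by (auto simp: linear_add[OF lJ'] bclinearD(2)[OF J'])
  have Re_lin: "bounded_linear (\<lambda>z. Re (B u (?J' z)))" for u
  proof (rule bounded_linear_intro[where K = "L * norm u"])
    show "Re (B u (?J' (r *\<^sub>R x))) = r *\<^sub>R Re (B u (?J' x))" for r x
      unfolding scaleR_scaleC[of r x] B_scale by simp
    show "norm (Re (B u (?J' x))) \<le> norm x * (L * norm u)" for x
      using abs_Re_le_cmod[of "B u (?J' x)"] bound[of u x] by (simp add: mult_ac)
  qed (simp add: B_add)
  then have "\<exists>w. \<forall>z. Re (B u (?J' z)) = inner z w" for u by (rule ex1_inner_representation)
  then obtain b where b: "Re (B u (?J' z)) = inner z (b u)" for u z by metis
  have Bb: "B u (?J' z) = cinner (b u) z" for u z
  proof (rule complex_eqI)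
    show "Re (B u (?J' z)) = Re (cinner (b u) z)" by (simp add: b inner_commute flip: inner_cinner)
    \<comment> \<open>By conjugate linearity, replacing z by \<i> z multiplies the value by -
      \<i>.\<close>
    have "Im (B u (?J' z)) = Re (B u (?J' (\<i> *\<^sub>C z)))" by (simp add: B_scale)
    also have "\<dots> = Im (cinner (b u) z)" by (simp add: b inner_commute cinner_eq_Complex)
    finally show "Im (B u (?J' z)) = Im (cinner (b u) z)" .
  qed
  have "bclinear b"
  proof (rule bclinearI[where K = L])
    show "b (u + v) = b u + b v" for u v
    proof (rule inner_left_eqI)
      fix z
      have "B (u + v) (?J' z) = B u (?J' z) + B v (?J' z)" using B in_dom unfolding bounded_into_dual_def by blast
      then show "inner z (b (u + v)) = inner z (b u + b v)" by (simp add: b[symmetric] inner_add_right)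
    qed
    show "b (c *\<^sub>C u) = c *\<^sub>C b u" for c u
    proof (rule inner_left_eqI)
      fix z
      have "B (c *\<^sub>C u) (?J' z) = c * B u (?J' z)" using B in_dom unfolding bounded_into_dual_def by blast
      then have "inner z (b (c *\<^sub>C u)) = Re (cinner (c *\<^sub>C b u) z)"
        unfolding b[symmetric] by (simp add: Bb cinner_scaleC_left)
      then show "inner z (b (c *\<^sub>C u)) = inner z (c *\<^sub>C b u)" by (simp add: inner_commute flip: inner_cinner)
    qed
    show "norm (b u) \<le> L * norm u" for u
    proof (rule norm_le_of_inner)
      fix z
      show "\<bar>inner (b u) z\<bar> \<le> L * norm u * norm z"
        using abs_Re_le_cmod[of "B u (?J' z)"] bound[of u z] by (simp add: b inner_commute)
    qed (use L in simp)
  qed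
  then show thesis using Bb by (rule that)
qed

section \<open>The control problem expressed by \<open>k\<close> and \<open>Lop\<close>\<close>

context control_system begin

lemma cinner_b: "cinner (b u) z = cinner u (bounded_adj b z)"
  using bclinearD(2)[OF bclinear_bounded_adj[OF bclinear_b]]
  by (simp add: cinner_eq_Complex inner_bounded_adj[OF bclinear_b])

lemma Bstar_eq_k:
  assumes Bb: "\<And>u z. B u (J' z) = cinner (b u) z" and t: "0 \<le> t"
  shows "Bstar B (S' t (J' z)) = k t z"
  unfolding Bstar_def J'_S'[OF t, symmetric] Bb cinner_b
proof (rule the_equality)
  fix v assume "\<forall>u. cinner u (bounded_adj b (S' t z)) = cinner u v"
  then have "inner u v = inner u (k t z)" for u by (simp add: inner_cinner k_def)
  then show "v = k t z" by (rule inner_left_eqI)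
qed (simp add: k_def)

lemma control_to_state_eq:
  assumes Bb: "\<And>u z. B u (J' z) = cinner (b u) z"
    and u: "ctl u" and eq: "AE s in lborel. 0 < s \<longrightarrow> u s = v s"
  shows "control_to_state S B v t (J' z) = Complex (Lam u t z) (Lam u t (\<i> *\<^sub>C z))"
proof -
  let ?f = "\<lambda>z s. indicator {..<t} s * inner (u s) (k (t - s) z)"
  have int: "integrable lebesgue (?f z)" for z by (rule Lam_integrable[OF u])
  have ae: "AE s in lborel. Complex (?f z s) (?f (\<i> *\<^sub>C z) s)
      = indicator {0..t} s *\<^sub>R sg_dual S (t - s) (B (v s)) (J' z)"
    using eq AE_lborel_singleton[of 0] AE_lborel_singleton[of t]
  proof eventually_elim
    case (elim s)
    show ?case
    proof (cases "0 < s \<and> s < t")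
      case True
      then have st: "0 \<le> t - s" by simp
      have "sg_dual S (t - s) (B (v s)) (J' z) = cinner (v s) (k (t - s) z)"
        unfolding sg_dual_def J'_S'[OF st, symmetric] Bb cinner_b by (simp add: k_def)
      also have "\<dots> = Complex (?f z s) (?f (\<i> *\<^sub>C z) s)"
        using True elim by (simp add: cinner_eq_Complex bclinearD(2)[OF bclinear_k[OF st]])
      finally show ?thesis using True by simp
    next
      case False
      then have "s \<le> 0 \<or> t < s" using elim by auto
      then show ?thesis using u elim by (auto simp: ctl_def indicator_def Complex_eq)
    qed
  qed
  have "(\<lambda>s. complex_of_real (?f z s) + \<i> * complex_of_real (?f (\<i> *\<^sub>C z) s)) \<in> borel_measurable lebesgue"
    using borel_measurable_integrable[OF int[of z]] borel_measurable_integrable[OF int[of "\<i> *\<^sub>C z"]] by measurable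
  then have m: "(\<lambda>s. Complex (?f z s) (?f (\<i> *\<^sub>C z) s)) \<in> borel_measurable lebesgue" by (simp only: Complex_eq)
  have "control_to_state S B v t (J' z) = (LINT s|lebesgue. Complex (?f z s) (?f (\<i> *\<^sub>C z) s))"
    unfolding control_to_state_def set_lebesgue_integral_def
    by (rule integral_cong_AE[symmetric, OF m borel_measurable_lebesgue_AE[OF m ae] AE_completion[OF ae]])
  also have "\<dots> = Complex (Lam u t z) (Lam u t (\<i> *\<^sub>C z))"
    unfolding Lam_eq[OF u] by (rule integral_Complex[OF int int])
  finally show ?thesis .
qed

text \<open>Both sides search for the same representatives and share the default 0, so no existence
  question arises.\<close>

lemma pivot_rep_eq:
  assumes Bb: "\<And>u z. B u (J' z) = cinner (b u) z"
    and u: "ctl u" and eq: "AE s in lborel. 0 < s \<longrightarrow> u s = v s"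
  shows "pivot_rep (range J') (control_to_state S B v t) = Lop u t"
proof -
  have "(\<forall>\<xi>\<in>range J'. control_to_state S B v t \<xi> = cinner y \<xi>) \<longleftrightarrow> rep u t y" for y
    unfolding rep_def
    by (auto simp: control_to_state_eq[OF Bb u eq] cinner_eq_Complex bclinearD(2)[OF bclinear_J', symmetric])
  then show ?thesis unfolding pivot_rep_def Lop_def by simp
qed

lemma AE_cut: "AE s in lborel. 0 < s \<longrightarrow> cut v s = v s"
  by (simp add: cut_def)

lemma state_eq:
  assumes Bb: "\<And>u z. B u (J' z) = cinner (b u) z" and v: "v \<in> Lp_set {0<..} 2"
  shows "state (range J') S B x v t = S t x + Lop (cut v) t"
  unfolding state_def by (simp add: pivot_rep_eq[OF Bb ctl_cut[OF v] AE_cut])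

lemma cost_eq:
  assumes Bb: "\<And>u z. B u (J' z) = cinner (b u) z" and v: "v \<in> Lp_set {0<..} 2"
  shows "cost (range J') S B R x v = run_cost R x (cut v)"
  unfolding cost_def run_cost_def nn_integral_completion
  by (intro nn_integral_cong) (auto simp: state_eq[OF Bb v] cut_def indicator_def)

text \<open>The singular part is the estimate of F; g is a Borel version of the norm of the L^n
  extension of G, which agrees with G almost everywhere for arguments in the range of
  \<open>J'\<close>.\<close>

lemma block_of_extends_to_Lp:
  fixes F G :: "real \<Rightarrow> 'y \<Rightarrow> 'u"
  assumes kFG: "\<And>t z. 0 \<le> t \<Longrightarrow> k t z = F t (J' z) + G t (J' z)"
    and F: "\<And>t x. 0 < t \<Longrightarrow> norm (F t x) \<le> N * t powr (- \<gamma>) * norm x"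
    and N: "0 \<le> N" and n: "1 \<le> n"
    and ext: "extends_to_Lp (range J') G T (real n)"
  shows "\<exists>CG\<ge>0. \<forall>z. \<exists>g\<in>borel_measurable borel.
      (AE \<tau> in lborel. 0 < \<tau> \<and> \<tau> < T \<longrightarrow>
        ennreal (norm (k \<tau> z)) \<le> ennreal (N * \<tau> powr (- \<gamma>)) * ennreal (norm (J' z)) + g \<tau>) \<and>
      (\<integral>\<^sup>+\<tau>. indicator {0<..<T} \<tau> * g \<tau> ^ n \<partial>lborel) \<le> ennreal (CG * norm (J' z)) ^ n"
proof -
  obtain E K where E: "\<And>x. E x \<in> Lp_set {0<..<T} (real n)"
    and K: "\<And>x. Lp_norm {0<..<T} (real n) (E x) \<le> K * norm x"
    and EG: "\<And>x. x \<in> range J' \<Longrightarrow> AE t in lebesgue. t \<in> {0<..<T} \<longrightarrow> E x t = G t x"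
    using ext unfolding extends_to_Lp_def by blast
  have "\<exists>g\<in>borel_measurable borel.
      (AE \<tau> in lborel. 0 < \<tau> \<and> \<tau> < T \<longrightarrow>
        ennreal (norm (k \<tau> z)) \<le> ennreal (N * \<tau> powr (- \<gamma>)) * ennreal (norm (J' z)) + g \<tau>) \<and>
      (\<integral>\<^sup>+\<tau>. indicator {0<..<T} \<tau> * g \<tau> ^ n \<partial>lborel) \<le> ennreal (\<bar>K\<bar> * norm (J' z)) ^ n" for z
  proof -
    let ?x = "J' z"
    have [measurable]: "(\<lambda>t. indicator {0<..<T} t *\<^sub>R E ?x t) \<in> borel_measurable lebesgue"
      using E[of ?x] by (simp add: Lp_set_def set_borel_measurable_def)
    have "(\<lambda>t. ennreal (norm (indicator {0<..<T} t *\<^sub>R E ?x t))) \<in> borel_measurable lebesgue" by measurable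
    then obtain g where g: "g \<in> borel_measurable borel"
      and ge: "AE t in lborel. ennreal (norm (indicator {0<..<T} t *\<^sub>R E ?x t)) = g t"
      by (rule lebesgue_borel_version)
    have EG': "AE t in lborel. t \<in> {0<..<T} \<longrightarrow> E ?x t = G t ?x"
      using EG[of ?x] by (simp add: AE_lebesgue_iff)
    have "AE \<tau> in lborel. 0 < \<tau> \<and> \<tau> < T \<longrightarrow>
        ennreal (norm (k \<tau> z)) \<le> ennreal (N * \<tau> powr (- \<gamma>)) * ennreal (norm (J' z)) + g \<tau>"
      using ge EG'
    proof eventually_elim
      case (elim \<tau>)
      show ?case
      proof
        assume \<tau>: "0 < \<tau> \<and> \<tau> < T"
        then have gt: "g \<tau> = ennreal (norm (G \<tau> ?x))" using elim by auto
        have "norm (k \<tau> z) \<le> norm (F \<tau> ?x) + norm (G \<tau> ?x)"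
          using kFG[of \<tau> z] \<tau> by (simp add: norm_triangle_ineq)
        also have "\<dots> \<le> N * \<tau> powr (- \<gamma>) * norm ?x + norm (G \<tau> ?x)" using F[of \<tau> ?x] \<tau> by simp
        finally have "ennreal (norm (k \<tau> z)) \<le> ennreal (N * \<tau> powr (- \<gamma>) * norm ?x + norm (G \<tau> ?x))" by (rule ennreal_leI)
        also have "\<dots> = ennreal (N * \<tau> powr (- \<gamma>)) * ennreal (norm ?x) + g \<tau>"
          using N by (simp add: gt ennreal_mult ennreal_plus)
        finally show "ennreal (norm (k \<tau> z)) \<le> ennreal (N * \<tau> powr (- \<gamma>)) * ennreal (norm ?x) + g \<tau>" .
      qed
    qed
    moreover have "(\<integral>\<^sup>+\<tau>. indicator {0<..<T} \<tau> * g \<tau> ^ n \<partial>lborel) \<le> ennreal (\<bar>K\<bar> * norm ?x) ^ n"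
    proof -
      have "(\<integral>\<^sup>+\<tau>. indicator {0<..<T} \<tau> * g \<tau> ^ n \<partial>lborel)
          = (\<integral>\<^sup>+t. indicator {0<..<T} t * ennreal (norm (E ?x t) powr real n) \<partial>lborel)"
        by (intro nn_integral_cong_AE eventually_mono[OF ge])
          (use n in \<open>auto simp: indicator_def powr_realpow' simp flip: ennreal_power\<close>)
      also have "\<dots> \<le> ennreal ((\<bar>K\<bar> * norm ?x) powr real n)"
        using n by (intro Lp_norm_bound E order_trans[OF K] mult_right_mono) auto
      also have "\<dots> = ennreal (\<bar>K\<bar> * norm ?x) ^ n"
        using n by (simp add: ennreal_power powr_realpow')
      finally show ?thesis .
    qed
    ultimately show ?thesis using g by blast
  qed
  then show ?thesis by (intro exI[of _ "\<bar>K\<bar>"]) auto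
qed

text \<open>The element \<open>frac_neg_pow S' \<epsilon> (J' z)\<close> lies in the domain of the
  power 1 + \<epsilon>, and the power \<epsilon> sends it to \<open>J' z\<close>, so (iii)(c) bounds
  \<open>k\<close> on a block by its norm. \<open>weighted_block_bound\<close> extends this to the
  half line, and the weight, at least 1, is dropped.\<close>

lemma frac_kernel_bound:
  assumes Bb: "\<And>u z. B u (J' z) = cinner (b u) z" and \<epsilon>: "0 < \<epsilon>" "\<epsilon> < 1" and T: "0 < T" and q: "1 \<le> q"
    and ext: "extends_to_Lp (frac_dom S' (1 + \<epsilon>)) (\<lambda>t x. Bstar B (S' t (frac_pow S' \<epsilon> x))) T q"
  shows "\<exists>Cq\<ge>0. \<forall>z. (\<integral>\<^sup>+\<tau>. indicator {0<..} \<tau> * ennreal (norm (k \<tau> z) powr q) \<partial>lborel)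
      \<le> ennreal (Cq * norm (frac_neg_pow S' \<epsilon> (J' z)) powr q)"
proof -
  let ?N' = "frac_neg_pow S' \<epsilon>"
  obtain E K where E: "\<And>x. E x \<in> Lp_set {0<..<T} q"
    and K: "\<And>x. Lp_norm {0<..<T} q (E x) \<le> K * norm x"
    and EB: "\<And>x. x \<in> frac_dom S' (1 + \<epsilon>) \<Longrightarrow>
      AE t in lebesgue. t \<in> {0<..<T} \<longrightarrow> E x t = Bstar B (S' t (frac_pow S' \<epsilon> x))"
    using ext unfolding extends_to_Lp_def by blast
  \<comment> \<open>The length T/2 keeps a block that is closed on the right inside the open
    interval (0,T).\<close>
  have blk: "(\<integral>\<^sup>+\<tau>. indicator {0<..0 + T / 2} \<tau> * ennreal (norm (k \<tau> z) powr q) \<partial>lborel)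
      \<le> ennreal (\<bar>K\<bar> powr q * norm (?N' (J' z)) powr q)" for z
  proof -
    let ?x = "?N' (J' z)"
    have "?x \<in> frac_dom S' (1 + \<epsilon>)"
      using adj.frac_neg_pow_add[OF \<epsilon>(1) zero_less_one, of z] by (simp add: frac_dom_def add.commute)
    then have "AE t in lborel. t \<in> {0<..<T} \<longrightarrow> E ?x t = Bstar B (S' t (frac_pow S' \<epsilon> ?x))"
      using EB by (simp add: AE_lebesgue_iff)
    moreover have "frac_pow S' \<epsilon> ?x = J' z" using \<epsilon> by (simp add: adj.frac_pow_frac_neg_pow)
    ultimately have e: "AE t in lborel. t \<in> {0<..<T} \<longrightarrow> E ?x t = k t z"
      by (auto simp: Bstar_eq_k[OF Bb])
    have "(\<integral>\<^sup>+\<tau>. indicator {0<..0 + T / 2} \<tau> * ennreal (norm (k \<tau> z) powr q) \<partial>lborel)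
        \<le> (\<integral>\<^sup>+t. indicator {0<..<T} t * ennreal (norm (E ?x t) powr q) \<partial>lborel)"
      by (intro nn_integral_mono_AE eventually_mono[OF e]) (use T in \<open>auto simp: indicator_def\<close>)
    also have "\<dots> \<le> ennreal ((\<bar>K\<bar> * norm ?x) powr q)"
      using q by (intro Lp_norm_bound E order_trans[OF K] mult_right_mono) auto
    finally show ?thesis by (simp add: powr_mult)
  qed
  have "\<exists>C\<ge>0. \<forall>z. (\<integral>\<^sup>+\<tau>. indicator {0<..} \<tau> * ennreal ((exp (\<omega> / 2 * \<tau>) * norm (k \<tau> z)) powr q) \<partial>lborel)
    \<le> ennreal (C * norm (?N' (J' z)) powr q)"
  proof (rule weighted_block_bound[OF _ _ q order_refl _ _ blk])
    show "norm (?N' (J' (S' t z))) \<le> M * exp (- \<omega> * t) * norm (?N' (J' z))" if "0 \<le> t" for t z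
      unfolding J'_S'[OF that] adj.frac_neg_pow_S[OF \<epsilon>(1) that] by (rule adj.stable[OF that])
  qed (use T in auto)
  then obtain C where C: "C \<ge> 0" "\<And>z. (\<integral>\<^sup>+\<tau>. indicator {0<..} \<tau> * ennreal ((exp (\<omega> / 2 * \<tau>) * norm (k \<tau> z)) powr q) \<partial>lborel)
    \<le> ennreal (C * norm (?N' (J' z)) powr q)" by blast
  have "(\<integral>\<^sup>+\<tau>. indicator {0<..} \<tau> * ennreal (norm (k \<tau> z) powr q) \<partial>lborel)
      \<le> (\<integral>\<^sup>+\<tau>. indicator {0<..} \<tau> * ennreal ((exp (\<omega> / 2 * \<tau>) * norm (k \<tau> z)) powr q) \<partial>lborel)" for z
  proof (rule nn_integral_mono)
    fix \<tau> :: real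
    have "1 * norm (k \<tau> z) \<le> exp (\<omega> / 2 * \<tau>) * norm (k \<tau> z)" if "0 < \<tau>"
      using that \<omega>_pos by (intro mult_right_mono) auto
    then show "indicator {0<..} \<tau> * ennreal (norm (k \<tau> z) powr q)
      \<le> indicator {0<..} \<tau> * ennreal ((exp (\<omega> / 2 * \<tau>) * norm (k \<tau> z)) powr q)"
      using q by (cases "0 < \<tau>") (auto intro!: ennreal_leI powr_mono2)
  qed
  then show ?thesis using C order_trans by blast
qed

text \<open>Up to T the extension is F plus the extension from (iii)(a) evaluated at the fractional
  power; beyond T the extension at T is composed with the adjoint semigroup for the time t - T. The
  same split gives \<kappa>: an integrable singularity, then exponential decay.\<close>

lemma Bstar_sg_ext_exists:
  fixes F G :: "real \<Rightarrow> 'y \<Rightarrow> 'u"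
  assumes Bb: "\<And>u z. B u (J' z) = cinner (b u) z" and \<epsilon>: "0 < \<epsilon>" "\<epsilon> < 1" and T: "0 < T"
    and kFG: "\<And>t z. 0 \<le> t \<Longrightarrow> k t z = F t (J' z) + G t (J' z)"
    and Fb: "\<And>t. 0 < t \<Longrightarrow> bclinear (F t)"
    and F: "\<And>t x. 0 < t \<Longrightarrow> norm (F t x) \<le> N * t powr (- \<gamma>) * norm x"
    and N: "0 \<le> N" and \<gamma>: "0 < \<gamma>" "\<gamma> < 1"
    and ext: "extends_to_C {x. frac_neg_pow S' \<epsilon> x \<in> range J'} (\<lambda>t x. G t (frac_neg_pow S' \<epsilon> x)) T"
  shows "0 < t \<Longrightarrow> \<exists>E. bounded_op (frac_dom S' \<epsilon>) (graph_norm (frac_pow S' \<epsilon>)) UNIV norm E \<and>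
      (\<forall>\<xi>\<in>range J'. E \<xi> = Bstar B (S' t \<xi>))"
    and "\<exists>\<kappa>. (\<forall>t. 0 \<le> \<kappa> t) \<and> integrable lborel (\<lambda>t. indicator {0<..} t * \<kappa> t) \<and>
      (\<forall>t>0. \<forall>z. norm (k t (frac_neg_pow S' \<epsilon> z)) \<le> \<kappa> t * norm (J' z))"
proof -
  let ?N' = "frac_neg_pow S' \<epsilon>"
  obtain H where H: "(\<forall>x y. \<forall>t\<in>{0..T}. H (x + y) t = H x t + H y t) \<and>
      (\<forall>c x. \<forall>t\<in>{0..T}. H (c *\<^sub>C x) t = c *\<^sub>C H x t) \<and>
      (\<exists>K. \<forall>x. \<forall>t\<in>{0..T}. norm (H x t) \<le> K * norm x) \<and>
      (\<forall>x\<in>{x. ?N' x \<in> range J'}. \<forall>t\<in>{0..T}. H x t = G t (?N' x))"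
    using ext unfolding extends_to_C_def by blast
  obtain K where H_bound: "\<And>x t. t \<in> {0..T} \<Longrightarrow> norm (H x t) \<le> K * norm x" using H by blast
  have H_add: "\<And>x y t. t \<in> {0..T} \<Longrightarrow> H (x + y) t = H x t + H y t"
    and H_scale: "\<And>c x t. t \<in> {0..T} \<Longrightarrow> H (c *\<^sub>C x) t = c *\<^sub>C H x t"
    and H_G: "\<And>x t. ?N' x \<in> range J' \<Longrightarrow> t \<in> {0..T} \<Longrightarrow> H x t = G t (?N' x)"
    using H by auto
  have bN': "bclinear ?N'" using \<epsilon> by (intro adj.bclinear_frac_neg_pow)
  have lN': "linear ?N'" using \<epsilon> by (intro adj.linear_frac_neg_pow)
  have J'N': "J' z = ?N' (frac_neg_pow S' (1 - \<epsilon>) z)" for z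
    using \<epsilon> by (simp add: adj.frac_neg_pow_add)
  have comm: "J' (?N' z) = ?N' (J' z)" for z
    using \<epsilon> adj.frac_neg_pow_add[of \<epsilon> 1 z] adj.frac_neg_pow_add[of 1 \<epsilon> z] by (simp add: add.commute)
  have pow: "frac_pow S' \<epsilon> (?N' y) = y" for y using \<epsilon> by (simp add: adj.frac_pow_frac_neg_pow)
  obtain KN where KN: "0 \<le> KN" "\<And>z. norm (?N' z) \<le> norm z * KN"
    using bounded_linear.nonneg_bounded[OF bclinearD(1)[OF bN']] by blast
  have early: "\<exists>E. bounded_op (frac_dom S' \<epsilon>) (graph_norm (frac_pow S' \<epsilon>)) UNIV norm E \<and>
      (\<forall>\<xi>\<in>range J'. E \<xi> = Bstar B (S' t \<xi>))" if t: "0 < t" "t \<le> T" for t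
  proof (intro exI conjI ballI)
    let ?E = "\<lambda>\<xi>. F t \<xi> + H (frac_pow S' \<epsilon> \<xi>) t"
    have tT: "t \<in> {0..T}" using t by simp
    have lF: "linear (F t)" using Fb[OF t(1)] by (simp add: bclinear_def bounded_linear.linear)
    show "bounded_op (frac_dom S' \<epsilon>) (graph_norm (frac_pow S' \<epsilon>)) UNIV norm ?E"
      unfolding bounded_op_def clinear_on_def
    proof (intro conjI ballI allI UNIV_I)
      fix x y assume "x \<in> frac_dom S' \<epsilon>" "y \<in> frac_dom S' \<epsilon>"
      then obtain x' y' where xy: "x = ?N' x'" "y = ?N' y'" by (auto simp: frac_dom_def)
      have s: "?N' x' + ?N' y' = ?N' (x' + y')" by (simp add: linear_add[OF lN'])
      show "?E (x + y) = ?E x + ?E y"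
        unfolding xy s pow H_add[OF tT] by (simp add: linear_add[OF lN'] linear_add[OF lF])
    next
      fix c x assume "x \<in> frac_dom S' \<epsilon>"
      then obtain x' where x: "x = ?N' x'" by (auto simp: frac_dom_def)
      show "?E (c *\<^sub>C x) = c *\<^sub>C ?E x"
        unfolding x bclinearD(2)[OF bN', symmetric] pow H_scale[OF tT] scaleC_add_right
        by (simp add: bclinearD(2)[OF bN'] bclinearD(2)[OF Fb[OF t(1)]])
    next
      have "norm (?E x) \<le> (N * t powr (- \<gamma>) + \<bar>K\<bar>) * graph_norm (frac_pow S' \<epsilon>) x" for x
      proof -
        have "norm (?E x) \<le> N * t powr (- \<gamma>) * norm x + K * norm (frac_pow S' \<epsilon> x)"
          by (intro order_trans[OF norm_triangle_ineq] add_mono F H_bound tT t)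
        also have "\<dots> \<le> (N * t powr (- \<gamma>) + \<bar>K\<bar>) * norm x + (N * t powr (- \<gamma>) + \<bar>K\<bar>) * norm (frac_pow S' \<epsilon> x)"
          using N by (intro add_mono mult_right_mono) (auto intro: add_increasing)
        finally show ?thesis by (simp add: graph_norm_def distrib_left)
      qed
      then show "\<exists>K. \<forall>x\<in>frac_dom S' \<epsilon>. norm (?E x) \<le> K * graph_norm (frac_pow S' \<epsilon>) x" by blast
    qed
    fix \<xi> assume "\<xi> \<in> range J'"
    then obtain z where z: "\<xi> = J' z" by auto
    have "frac_pow S' \<epsilon> (J' z) = frac_neg_pow S' (1 - \<epsilon>) z" unfolding J'N' by (rule pow)
    moreover have "H (frac_neg_pow S' (1 - \<epsilon>) z) t = G t (J' z)"
      using H_G[of "frac_neg_pow S' (1 - \<epsilon>) z" t] tT J'N'[of z] by (metis rangeI)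
    ultimately show "?E \<xi> = Bstar B (S' t \<xi>)"
      using t by (simp add: z Bstar_eq_k[OF Bb] kFG)
  qed
  show "\<exists>E. bounded_op (frac_dom S' \<epsilon>) (graph_norm (frac_pow S' \<epsilon>)) UNIV norm E \<and>
      (\<forall>\<xi>\<in>range J'. E \<xi> = Bstar B (S' t \<xi>))" if t: "0 < t" for t
  proof (cases "t \<le> T")
    case False
    then have s: "0 \<le> t - T" by simp
    obtain E where E: "bounded_op (frac_dom S' \<epsilon>) (graph_norm (frac_pow S' \<epsilon>)) UNIV norm E"
      "\<And>\<xi>. \<xi> \<in> range J' \<Longrightarrow> E \<xi> = Bstar B (S' T \<xi>)" using early[OF T order_refl] by blast
    obtain KE where KE: "\<And>x. x \<in> frac_dom S' \<epsilon> \<Longrightarrow> norm (E x) \<le> KE * graph_norm (frac_pow S' \<epsilon>) x"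
      using E(1) by (auto simp: bounded_op_def)
    have bS: "bclinear (S' (t - T))" by (rule bclinear_adj_sg[OF s])
    have S'N: "S' (t - T) (?N' y) = ?N' (S' (t - T) y)" for y
      using adj.frac_neg_pow_S[OF \<epsilon>(1) s] by simp
    have dom: "S' (t - T) x \<in> frac_dom S' \<epsilon>" if "x \<in> frac_dom S' \<epsilon>" for x
      using that by (auto simp: frac_dom_def S'N)
    show ?thesis
    proof (intro exI conjI ballI)
      show "bounded_op (frac_dom S' \<epsilon>) (graph_norm (frac_pow S' \<epsilon>)) UNIV norm (\<lambda>\<xi>. E (S' (t - T) \<xi>))"
        unfolding bounded_op_def clinear_on_def
      proof (intro conjI ballI allI UNIV_I)
        show "E (S' (t - T) (x + y)) = E (S' (t - T) x) + E (S' (t - T) y)"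
          if "x \<in> frac_dom S' \<epsilon>" "y \<in> frac_dom S' \<epsilon>" for x y
          using E(1) dom[OF that(1)] dom[OF that(2)] linear_add[OF bounded_linear.linear[OF bclinearD(1)[OF bS]], of x y]
          unfolding bounded_op_def clinear_on_def by simp
        show "E (S' (t - T) (c *\<^sub>C x)) = c *\<^sub>C E (S' (t - T) x)" if "x \<in> frac_dom S' \<epsilon>" for c x
          using E(1) dom[OF that] bclinearD(2)[OF bS, of c x]
          unfolding bounded_op_def clinear_on_def by simp
        have "norm (E (S' (t - T) x)) \<le> (\<bar>KE\<bar> * M) * graph_norm (frac_pow S' \<epsilon>) x"
          if "x \<in> frac_dom S' \<epsilon>" for x
        proof -
          obtain y where y: "x = ?N' y" using \<open>x \<in> frac_dom S' \<epsilon>\<close> by (auto simp: frac_dom_def)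
          have "norm (E (S' (t - T) x)) \<le> KE * graph_norm (frac_pow S' \<epsilon>) (S' (t - T) x)" by (rule KE[OF dom[OF that]])
          also have "graph_norm (frac_pow S' \<epsilon>) (S' (t - T) x) = norm (S' (t - T) x) + norm (S' (t - T) y)"
            by (simp add: graph_norm_def y S'N pow)
          also have "KE * \<dots> \<le> \<bar>KE\<bar> * (M * norm x + M * norm y)"
            using adj.norm_S_le[OF s] by (intro mult_mono add_mono) auto
          also have "\<dots> = (\<bar>KE\<bar> * M) * graph_norm (frac_pow S' \<epsilon>) x"
            by (simp add: graph_norm_def y pow algebra_simps)
          finally show ?thesis .
        qed
        then show "\<exists>K. \<forall>x\<in>frac_dom S' \<epsilon>. norm (E (S' (t - T) x)) \<le> K * graph_norm (frac_pow S' \<epsilon>) x" by blast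
      qed
      fix \<xi> assume "\<xi> \<in> range J'"
      then obtain z where z: "\<xi> = J' z" by auto
      have "E (S' (t - T) \<xi>) = Bstar B (S' T (S' (t - T) \<xi>))"
        unfolding z J'_S'[OF s, symmetric] by (rule E(2)) simp
      also have "S' T (S' (t - T) \<xi>) = S' t \<xi>" using adj.S_add[of T "t - T" \<xi>] T s by simp
      finally show "E (S' (t - T) \<xi>) = Bstar B (S' t \<xi>)" .
    qed
  qed (rule early[OF t])
  define c1 where "c1 = N * KN"
  have c1: "0 \<le> c1" using N KN by (simp add: c1_def)
  \<comment> \<open>The factor exp(\<omega> T) compensates for decay that starts only at T; it also
    lets the exponential term absorb the constant bound before T.\<close>
  define c2 where "c2 = (c1 * T powr (- \<gamma>) + \<bar>K\<bar>) * M * exp (\<omega> * T)"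
  have c2: "0 \<le> c2" using c1 M_ge by (simp add: c2_def)
  \<comment> \<open>The open interval reaches to T + 1 so as to contain T itself.\<close>
  define \<kappa> where "\<kappa> t = indicator {0<..<T + 1} t * (c1 * t powr (- \<gamma>)) + c2 * exp (- \<omega> * t)" for t
  have \<kappa>0: "0 \<le> \<kappa> t" for t using c1 c2 by (simp add: \<kappa>_def)
  have early_bound: "norm (k t (?N' z)) \<le> (c1 * t powr (- \<gamma>) + \<bar>K\<bar>) * norm (J' z)" if t: "0 < t" "t \<le> T" for t z
  proof -
    have tT: "t \<in> {0..T}" using t by simp
    have k: "k t (?N' z) = F t (?N' (J' z)) + H (J' z) t"
      using t H_G[OF _ tT, of "J' z"] by (simp add: kFG comm[symmetric])
    have "norm (k t (?N' z)) \<le> N * t powr (- \<gamma>) * norm (?N' (J' z)) + K * norm (J' z)"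
      unfolding k by (intro order_trans[OF norm_triangle_ineq] add_mono F H_bound tT t)
    also have "\<dots> \<le> N * t powr (- \<gamma>) * (norm (J' z) * KN) + \<bar>K\<bar> * norm (J' z)"
      using N by (intro add_mono mult_left_mono mult_right_mono KN) auto
    finally show ?thesis by (simp add: c1_def algebra_simps)
  qed
  have \<kappa>_bound: "norm (k t (?N' z)) \<le> \<kappa> t * norm (J' z)" if t: "0 < t" for t z
  proof (cases "t \<le> T")
    case True
    have e1: "1 \<le> exp (\<omega> * T) * exp (- \<omega> * t)"
      using True \<omega>_pos by (simp add: exp_add[symmetric] mult_left_mono flip: right_diff_distrib)
    have "\<bar>K\<bar> * 1 \<le> (c1 * T powr (- \<gamma>) + \<bar>K\<bar>) * M * (exp (\<omega> * T) * exp (- \<omega> * t))"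
    proof (intro mult_mono e1)
      have "\<bar>K\<bar> * 1 \<le> (c1 * T powr (- \<gamma>) + \<bar>K\<bar>) * M" using c1 M_ge by (intro mult_mono) auto
      then show "\<bar>K\<bar> \<le> (c1 * T powr (- \<gamma>) + \<bar>K\<bar>) * M" by simp
    qed (use c1 M_ge in auto)
    then have "\<bar>K\<bar> \<le> c2 * exp (- \<omega> * t)" by (simp add: c2_def mult_ac)
    then have "c1 * t powr (- \<gamma>) + \<bar>K\<bar> \<le> \<kappa> t" using True t by (simp add: \<kappa>_def)
    then show ?thesis using early_bound[OF t True, of z] by (meson mult_right_mono norm_ge_zero order_trans)
  next
    case False
    then have s: "0 \<le> t - T" by simp
    have "k t (?N' z) = k T (?N' (S' (t - T) z))"
      using k_add[of T "t - T" "?N' z"] T s adj.frac_neg_pow_S[OF \<epsilon>(1) s, of z] by simp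
    then have "norm (k t (?N' z)) \<le> (c1 * T powr (- \<gamma>) + \<bar>K\<bar>) * norm (J' (S' (t - T) z))"
      using early_bound[OF T order_refl] by simp
    also have "\<dots> \<le> (c1 * T powr (- \<gamma>) + \<bar>K\<bar>) * (M * exp (- \<omega> * (t - T)) * norm (J' z))"
      unfolding J'_S'[OF s] using c1 by (intro mult_left_mono adj.stable s) auto
    also have "\<dots> = c2 * exp (- \<omega> * t) * norm (J' z)"
      by (simp add: c2_def mult_ac right_diff_distrib exp_diff exp_minus divide_inverse)
    also have "\<dots> \<le> \<kappa> t * norm (J' z)" using c1 by (intro mult_right_mono) (auto simp: \<kappa>_def)
    finally show ?thesis .
  qed
  have \<kappa>_int: "integrable lborel (\<lambda>t. indicator {0<..} t * \<kappa> t)"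
  proof -
    have "(\<integral>\<^sup>+t. ennreal (norm (indicator {0<..<T + 1} t * (c1 * t powr (- \<gamma>)))) \<partial>lborel)
        = (\<integral>\<^sup>+t. indicator {0<..<T + 1} t * ennreal (c1 * t powr (- \<gamma>)) \<partial>lborel)"
      using c1 by (intro nn_integral_cong) (auto simp: indicator_def)
    also have "\<dots> < top" using nn_integral_powr_kernel[OF c1 \<gamma>(2), of "T + 1"] T by simp
    finally have i1: "integrable lborel (\<lambda>t. indicator {0<..<T + 1} t * (c1 * t powr (- \<gamma>)))"
      by (intro integrableI_bounded) auto
    have "set_integrable lborel {0<..} (\<lambda>t. t powr (1 - 1) * exp (- \<omega> * t))"
      using \<omega>_pos by (intro integrable_powr_exp) auto
    then have i2: "integrable lborel (\<lambda>t. indicator {0<..} t *\<^sub>R (t powr (1 - 1) * exp (- \<omega> * t)) * c2)"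
      unfolding set_integrable_def by (rule integrable_mult_left)
    have "(\<lambda>t. indicator {0<..} t * \<kappa> t) = (\<lambda>t. indicator {0<..<T + 1} t * (c1 * t powr (- \<gamma>))
        + indicator {0<..} t *\<^sub>R (t powr (1 - 1) * exp (- \<omega> * t)) * c2)"
      by (auto simp: fun_eq_iff \<kappa>_def indicator_def)
    then show ?thesis using Bochner_Integration.integrable_add[OF i1 i2] by (simp only:)
  qed
  show "\<exists>\<kappa>. (\<forall>t. 0 \<le> \<kappa> t) \<and> integrable lborel (\<lambda>t. indicator {0<..} t * \<kappa> t) \<and>
      (\<forall>t>0. \<forall>z. norm (k t (?N' z)) \<le> \<kappa> t * norm (J' z))"
    using \<kappa>0 \<kappa>_int \<kappa>_bound by blast
qed

end

text \<open>The defining terms are total, so the conclusion also rules out default values: the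
  argument of \<open>Bstar_sg_ext\<close> lies where that choice is determined, the integrand is
  integrable, and the weak limit is stated to exist.\<close>

theorem theorem3p5:
  fixes DA :: "'y::separable_complex_hilbert set" and A :: "'y \<Rightarrow> 'y"
    and S :: "real \<Rightarrow> 'y \<Rightarrow> 'y"
    and B :: "'u::separable_complex_hilbert \<Rightarrow> 'y \<Rightarrow> complex"
    and R :: "'y \<Rightarrow> 'z::separable_complex_hilbert"
    and F G :: "real \<Rightarrow> 'y \<Rightarrow> 'u"
    and \<epsilon> :: real
    and uhat :: "'y \<Rightarrow> real \<Rightarrow> 'u"
  assumes closed_A: "closed_operator DA A"
    and generates: "generates DA A S"
    and stable: "\<exists>M \<omega>. 1 \<le> M \<and> 0 < \<omega> \<and> (\<forall>t\<ge>0. \<forall>x. norm (S t x) \<le> M * exp (- \<omega> * t) * norm x)"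
    and B: "bounded_into_dual (adj_dom DA A) (graph_norm (adj DA A)) B"
    and R: "bounded_op UNIV norm UNIV norm R"
    and decomposition: "\<forall>t\<ge>0. \<forall>x\<in>adj_dom DA A. Bstar B (adj_sg S t x) = F t x + G t x"
    and F_bounded: "\<forall>t>0. bounded_op UNIV norm UNIV norm (F t)"
    and G_bounded: "\<forall>t>0. bounded_op (adj_dom DA A) (graph_norm (adj DA A)) UNIV norm (G t)"
    and F_estimate: "\<exists>\<gamma> \<eta> N. 0 < \<gamma> \<and> \<gamma> < 1 \<and> 0 < \<eta> \<and> 0 < N \<and>
           (\<forall>t>0. \<forall>x. norm (F t x) \<le> N * t powr (- \<gamma>) * exp (- \<eta> * t) * norm x)"
    and G_Lp: "\<exists>T>0. \<forall>p\<ge>1. extends_to_Lp (adj_dom DA A) G T p"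
    and eps: "0 < \<epsilon>" "\<epsilon> < 1"
    and smoothing: "\<exists>T>0.
           extends_to_C {x. frac_neg_pow (adj_sg S) \<epsilon> x \<in> adj_dom DA A}
             (\<lambda>t x. G t (frac_neg_pow (adj_sg S) \<epsilon> x)) T \<and>
           (\<exists>q. 1 < q \<and> q < 2 \<and>
             extends_to_Lp (frac_dom (adj_sg S) (1 + \<epsilon>))
               (\<lambda>t x. Bstar B (adj_sg S t (frac_pow (adj_sg S) \<epsilon> x))) T q)"
    and RstarR: "bounded_op (frac_dom S \<epsilon>) (graph_norm (frac_pow S \<epsilon>))
           (frac_dom (adj_sg S) \<epsilon>) (graph_norm (frac_pow (adj_sg S) \<epsilon>))
           (\<lambda>x. bounded_adj R (R x))"
    and optimal: "\<forall>x. unique_minimizer (adj_dom DA A) S B R x (uhat x)"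
  shows
    "((\<forall>x\<in>frac_dom S \<epsilon>.
        (AE t in lebesgue. 0 < t \<longrightarrow>
           bounded_adj R (R (opt_state (adj_dom DA A) S B uhat t x)) \<in> frac_dom (adj_sg S) \<epsilon>) \<and>
        set_integrable lebesgue {0<..} (T_integrand (adj_dom DA A) S B R \<epsilon> uhat x)) \<and>
     bounded_op (frac_dom S \<epsilon>) (graph_norm (frac_pow S \<epsilon>)) UNIV norm
       (T_op (adj_dom DA A) S B R \<epsilon> uhat))
     \<and>
     ((\<forall>x\<in>frac_dom S \<epsilon>.
        P_op (adj_dom DA A) S B R uhat x \<in> frac_dom (adj_sg S) \<epsilon> \<and>
        weak_tendsto
          (\<lambda>s. Bstar_sg_ext (adj_dom DA A) S B \<epsilon> s (P_op (adj_dom DA A) S B R uhat x))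
          (BstarP (adj_dom DA A) S B R \<epsilon> uhat x) (at_right 0) \<and>
        BstarP (adj_dom DA A) S B R \<epsilon> uhat x = T_op (adj_dom DA A) S B R \<epsilon> uhat x) \<and>
     bounded_op (frac_dom S \<epsilon>) (graph_norm (frac_pow S \<epsilon>)) UNIV norm
       (BstarP (adj_dom DA A) S B R \<epsilon> uhat))"
proof -
  obtain M \<omega> where M: "1 \<le> M" "0 < \<omega>" "\<And>t x. 0 \<le> t \<Longrightarrow> norm (S t x) \<le> M * exp (- \<omega> * t) * norm x"
    using stable by blast
  interpret stable_semigroup S M \<omega>
    using generates M by unfold_locales (auto simp: generates_def)
  obtain b :: "'u \<Rightarrow> 'y" where b: "bclinear b" and Bb: "\<And>u z. B u (frac_neg_pow (adj_sg S) 1 z) = cinner (b u) z"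
    using ex_bounded_representation[OF generates B] by blast
  interpret control_system S M \<omega> b by unfold_locales (rule b)
  define D where "D = adj_dom DA A"
  have D: "D = range J'" unfolding D_def by (rule adj_generator(1)[OF generates])
  have kFG: "k t z = F t (J' z) + G t (J' z)" if "0 \<le> t" for t z
    using decomposition that Bstar_eq_k[OF Bb that, of z] by (simp add: D_def[symmetric] D)
  obtain \<gamma> \<eta> N where N: "0 < \<gamma>" "\<gamma> < 1" "0 < \<eta>" "0 < N"
    and F: "\<And>t x. 0 < t \<Longrightarrow> norm (F t x) \<le> N * t powr (- \<gamma>) * exp (- \<eta> * t) * norm x"
    using F_estimate by blast
  have F': "norm (F t x) \<le> N * t powr (- \<gamma>) * norm x" if "0 < t" for t x
  proof -
    have "N * t powr (- \<gamma>) * exp (- \<eta> * t) * norm x \<le> N * t powr (- \<gamma>) * 1 * norm x"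
      using N that by (intro mult_right_mono mult_left_mono) auto
    then show ?thesis using F[OF that, of x] by simp
  qed
  have N0: "0 \<le> N" using N by simp
  have Fb: "bclinear (F t)" if "0 < t" for t using F_bounded that by (simp add: bounded_op_UNIV_iff)
  obtain T1 where T1: "0 < T1" "\<And>p. 1 \<le> p \<Longrightarrow> extends_to_Lp (range J') G T1 p"
    using G_Lp unfolding D_def[symmetric] D by blast
  obtain T2 q where T2: "0 < T2"
    and extC: "extends_to_C {x. frac_neg_pow S' \<epsilon> x \<in> range J'} (\<lambda>t x. G t (frac_neg_pow S' \<epsilon> x)) T2"
    and q: "1 < q" "q < 2"
    and extq: "extends_to_Lp (frac_dom S' (1 + \<epsilon>)) (\<lambda>t x. Bstar B (S' t (frac_pow S' \<epsilon> x))) T2 q"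
    using smoothing unfolding D_def[symmetric] D by blast
  have bR: "bclinear R" using R by (simp add: bounded_op_UNIV_iff)
  obtain r where r: "0 \<le> r" "\<And>y. norm (R y) \<le> norm y * r"
    using bounded_linear.nonneg_bounded[OF bclinearD(1)[OF bR]] by blast
  have r': "norm (R y) \<le> r * norm y" for y using r(2)[of y] by (simp add: mult.commute)
  \<comment> \<open>Chosen so that r \<theta> \<le> 1/2, which makes the contraction constant at
    most 1/4; r + 1 avoids a division by 0.\<close>
  define \<theta> where "\<theta> = 1 / (2 * (r + 1))"
  have \<theta>: "0 < \<theta>" "r * \<theta> \<le> 1 / 2" using r(1) by (auto simp: \<theta>_def field_simps)
  obtain \<delta> where \<delta>: "0 < \<delta>" "2 * \<delta> < T1"
    "(\<integral>\<^sup>+\<tau>. indicator {0<..<\<delta>} \<tau> * ennreal (N * \<tau> powr (- \<gamma>)) \<partial>lborel) \<le> ennreal \<theta>"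
    using small_powr_kernel[OF N0 N(2) \<theta>(1) T1(1)] by blast
  define kd where "kd \<tau> = indicator {0<..<\<delta>} \<tau> * ennreal (N * \<tau> powr (- \<gamma>))" for \<tau>
  have kd_meas: "kd \<in> borel_measurable borel" unfolding kd_def[abs_def] by measurable
  have kd0: "kd \<tau> = 0" if "\<tau> \<le> 0" for \<tau> using that by (simp add: kd_def)
  have kdi: "(\<integral>\<^sup>+\<tau>. kd \<tau> \<partial>lborel) \<le> ennreal \<theta>" using \<delta>(3) by (simp add: kd_def)
  have kd_fin: "(\<integral>\<^sup>+\<tau>. kd \<tau> \<partial>lborel) < top" by (rule le_less_trans[OF kdi]) simp
  have split: "\<exists>C. kernel_split kd n C" if n: "1 \<le> n" for n
  proof -
    have "extends_to_Lp (range J') G T1 (real n)" using n by (intro T1(2)) simp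
    from block_of_extends_to_Lp[where F = F, OF kFG F' N0 n this]
    show ?thesis
      unfolding kd_def[abs_def] using kernel_split_of_block[OF N0 N(1) \<delta>(1,2) n] by blast
  qed
  obtain C where split2: "kernel_split kd 2 C" using split[of 2] by auto
  \<comment> \<open>An integer not below the conjugate exponent of q; the control will be estimated
    in L^(m+1).\<close>
  define m where "m = nat \<lceil>q / (q - 1)\<rceil>"
  have m: "q / (q - 1) \<le> real m" "1 \<le> m"
  proof -
    have "0 < q / (q - 1)" using q by simp
    then show "q / (q - 1) \<le> real m" "1 \<le> m" unfolding m_def by linarith+
  qed
  then have m': "q / (q - 1) \<le> real (Suc m)" by simp
  obtain C' where splitn: "kernel_split kd (Suc m) C'" using split[of "Suc m"] by auto
  interpret control_L2 S M \<omega> b R kd C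
    by unfold_locales (use bR split2 kd_meas kd0 kd_fin in auto)
  define uh where "uh x = cut (uhat x)" for x
  have min: "uhat x \<in> Lp_set {0<..} 2" "\<And>v. v \<in> Lp_set {0<..} 2 \<Longrightarrow> cost (range J') S B R x (uhat x) \<le> cost (range J') S B R x v" for x
    using optimal unfolding unique_minimizer_def D_def[symmetric] D by blast+
  have uh_ctl: "ctl (uh x)" for x unfolding uh_def by (rule ctl_cut[OF min(1)])
  have uh_min: "run_cost R x (uh x) \<le> run_cost R x v" if v: "ctl v" for x v
    using min(2)[OF ctl_Lp_set[OF v], of x]
    by (simp add: cost_eq[OF Bb min(1)] cost_eq[OF Bb ctl_Lp_set[OF v]] cut_ctl[OF v] uh_def)
  have uh_var: "vareq R x (uh x)" for x by (rule minimizer_vareq[OF uh_ctl uh_min])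
  \<comment> \<open>Bounds the cost of the control 0 for initial states in the unit ball, hence by
    minimality the square integral of the optimal control.\<close>
  define c where "c = enn2real (ennreal ((r * M)\<^sup>2) * (\<integral>\<^sup>+t. indicator {0<..} t * ennreal (exp (- \<omega> * t)) \<partial>lborel))"
  have c: "0 \<le> c" "ennreal c = ennreal ((r * M)\<^sup>2) * (\<integral>\<^sup>+t. indicator {0<..} t * ennreal (exp (- \<omega> * t)) \<partial>lborel)"
    using nn_integral_exp_finite[OF \<omega>_pos] by (auto simp: c_def ennreal_mult_less_top)
  have rep0: "rep (\<lambda>_. 0) t 0" for t by (simp add: rep_def Lam_def set_lebesgue_integral_def)
  have ctl0: "ctl (\<lambda>_. 0)" by (simp add: ctl_def)
  have uh2: "(\<integral>\<^sup>+s. ennreal (norm (uh x s)) ^ 2 \<partial>lborel) \<le> ennreal c" if x: "norm x \<le> 1" for x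
  proof -
    have "(\<integral>\<^sup>+s. ennreal (norm (uh x s)) ^ 2 \<partial>lborel) \<le> run_cost R x (uh x)"
      unfolding run_cost_def
      by (intro nn_integral_mono) (use uh_ctl[of x] in \<open>auto simp: ctl_def indicator_def not_less ennreal_power intro!: ennreal_leI\<close>)
    also have "\<dots> \<le> run_cost R x (\<lambda>_. 0)" by (rule uh_min[OF ctl0])
    also have "\<dots> \<le> (\<integral>\<^sup>+t. ennreal ((r * M)\<^sup>2) * (indicator {0<..} t * ennreal (exp (- \<omega> * t))) \<partial>lborel)"
      unfolding run_cost_def
    proof (rule nn_integral_mono)
      fix t :: real
      show "indicator {0<..} t * ennreal ((norm (R (S t x + Lop (\<lambda>_. 0) t)))\<^sup>2 + (norm (0::'u))\<^sup>2)
        \<le> ennreal ((r * M)\<^sup>2) * (indicator {0<..} t * ennreal (exp (- \<omega> * t)))"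
      proof (cases "0 < t")
        case True
        have s1: "norm (S t x) \<le> M * exp (- \<omega> * t)"
        proof -
          have "M * exp (- \<omega> * t) * norm x \<le> M * exp (- \<omega> * t) * 1" using x M by (intro mult_left_mono) auto
          then show ?thesis using stable[of t x] True by simp
        qed
        have s2: "norm (S t x) \<le> M"
        proof -
          have "M * norm x \<le> M * 1" using x M by (intro mult_left_mono) auto
          then show ?thesis using norm_S_le[of t x] True by simp
        qed
        have "(norm (R (S t x)))\<^sup>2 \<le> (r * norm (S t x))\<^sup>2" by (intro power_mono r') simp
        also have "\<dots> = r\<^sup>2 * (norm (S t x) * norm (S t x))" by (simp add: power2_eq_square mult_ac)
        also have "\<dots> \<le> r\<^sup>2 * (M * (M * exp (- \<omega> * t)))"
          using M by (intro mult_left_mono mult_mono s1 s2) auto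
        also have "\<dots> = (r * M)\<^sup>2 * exp (- \<omega> * t)" by (simp add: power2_eq_square mult_ac)
        finally have "ennreal ((norm (R (S t x)))\<^sup>2) \<le> ennreal ((r * M)\<^sup>2 * exp (- \<omega> * t))" by (rule ennreal_leI)
        then show ?thesis using True Lop_eqI[OF rep0] by (simp add: ennreal_mult)
      qed simp
    qed
    also have "\<dots> = ennreal c" unfolding c(2) by (rule nn_integral_cmult) measurable
    finally show ?thesis .
  qed
  obtain K where K: "K < top" "\<And>x u. norm x \<le> 1 \<Longrightarrow> ctl u \<Longrightarrow> vareq R x u \<Longrightarrow>
    (\<integral>\<^sup>+s. ennreal (norm (u s)) ^ 2 \<partial>lborel) \<le> ennreal c \<Longrightarrow> (\<integral>\<^sup>+s. ennreal (norm (u s)) ^ Suc m \<partial>lborel) \<le> K"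
    using vareq_integrability[OF split2 splitn m(2) kd_meas kd0 kdi less_imp_le[OF \<theta>(1)] \<theta>(2)
        bclinearD(1)[OF bR] r(1) r' c(1)] by blast
  define c3 where "c3 = enn2real K"
  have c3: "0 \<le> c3" "ennreal c3 = K" using K(1) by (auto simp: c3_def)
  obtain Cq where Cq: "0 \<le> Cq" "\<And>z. (\<integral>\<^sup>+\<tau>. indicator {0<..} \<tau> * ennreal (norm (k \<tau> z) powr q) \<partial>lborel)
      \<le> ennreal (Cq * norm (frac_neg_pow S' \<epsilon> (J' z)) powr q)"
    using frac_kernel_bound[OF Bb eps T2 less_imp_le[OF q(1)] extq] by blast
  define CW where "CW = c + c3 + Cq"
  have CW: "0 \<le> CW" using c(1) c3(1) Cq(1) by (simp add: CW_def)
  \<comment> \<open>Restricted to the unit ball because \<open>CW\<close> comes from estimates that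
    are not homogeneous.\<close>
  have W_unit: "\<exists>w. norm w \<le> CW \<and> rep (uh x) t (frac_neg_pow S \<epsilon> w)" if x: "norm x \<le> 1" for x t
    unfolding CW_def
  proof (rule Lop_frac[OF eps q(1) less_imp_le[OF q(2)] m' Cq uh_ctl uh2[OF x] c(1) _ c3(1)])
    show "(\<integral>\<^sup>+s. ennreal (norm (uh x s)) ^ Suc m \<partial>lborel) \<le> ennreal c3"
      unfolding c3(2) by (rule K(2)[OF x uh_ctl uh_var uh2[OF x]])
  qed
  have bN: "bclinear (frac_neg_pow S \<epsilon>)" by (rule bclinear_frac_neg_pow[OF eps(1)])
  have W_ex: "\<exists>w. norm w \<le> CW * norm x \<and> rep (uh x) t (frac_neg_pow S \<epsilon> w)" for x t
  proof (cases "x = 0")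
    case True
    have "AE s in lborel. (\<lambda>_. 0) s = uh 0 s" by (rule vareq_unique[OF ctl0 uh_ctl vareq_zero uh_var])
    then have "AE s in lborel. 0 < s \<longrightarrow> 0 = uh 0 s" by eventually_elim simp
    from Lam_AE_cong(2)[OF ctl0 this] have "rep (uh 0) t 0" using rep0 by simp
    then show ?thesis using True by (intro exI[of _ 0]) (simp add: linear_0[OF linear_frac_neg_pow] eps)
  next
    case False
    \<comment> \<open>By uniqueness, norm x times the optimal control of the normalised state is the
      optimal control of x, up to a null set.\<close>
    let ?x = "(1 / norm x) *\<^sub>R x" and ?c = "complex_of_real (norm x)"
    have x: "?c *\<^sub>C ?x = x" using False by (simp add: scaleR_scaleC[symmetric])
    have "norm ?x \<le> 1" using False by simp
    then obtain w where w: "norm w \<le> CW" "rep (uh ?x) t (frac_neg_pow S \<epsilon> w)" using W_unit by blast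
    have "vareq R x (\<lambda>s. ?c *\<^sub>C uh ?x s)" using vareq_scaleC[OF uh_ctl uh_var, of ?c ?x] by (simp add: x)
    then have "AE s in lborel. ?c *\<^sub>C uh ?x s = uh x s"
      by (rule vareq_unique[OF ctl_scaleC[OF uh_ctl] uh_ctl _ uh_var])
    then have ae: "AE s in lborel. 0 < s \<longrightarrow> ?c *\<^sub>C uh ?x s = uh x s" by eventually_elim simp
    have "rep (\<lambda>s. ?c *\<^sub>C uh ?x s) t (?c *\<^sub>C frac_neg_pow S \<epsilon> w)" by (rule rep_scaleC[OF uh_ctl w(2)])
    then have "rep (uh x) t (frac_neg_pow S \<epsilon> (?c *\<^sub>C w))"
      unfolding Lam_AE_cong(2)[OF ctl_scaleC[OF uh_ctl] ae] bclinearD(2)[OF bN] .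
    moreover have "norm (?c *\<^sub>C w) \<le> CW * norm x"
      using w(1) by (simp add: norm_scaleC mult.commute mult_right_mono)
    ultimately show ?thesis by blast
  qed
  \<comment> \<open>The choice in \<open>Bstar_sg_ext\<close> is used directly; existence at every t
    > 0 gives it the defining properties.\<close>
  define E where "E = Bstar_sg_ext D S B \<epsilon>"
  have E: "bounded_op (frac_dom S' \<epsilon>) (graph_norm (frac_pow S' \<epsilon>)) UNIV norm (E t) \<and>
      (\<forall>\<xi>\<in>range J'. E t \<xi> = Bstar B (S' t \<xi>))" if t: "0 < t" for t
    unfolding E_def Bstar_sg_ext_def D
    by (rule someI_ex[OF Bstar_sg_ext_exists(1)[where F = F, OF Bb eps T2 kFG Fb F' N0 N(1,2) extC t]])
  obtain \<kappa> where \<kappa>: "\<And>t. 0 \<le> \<kappa> t" "integrable lborel (\<lambda>t. indicator {0<..} t * \<kappa> t)"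
    "\<And>t z. 0 < t \<Longrightarrow> norm (k t (frac_neg_pow S' \<epsilon> z)) \<le> \<kappa> t * norm (J' z)"
    using Bstar_sg_ext_exists(2)[where F = F, OF Bb eps T2 kFG Fb F' N0 N(1,2) extC] by blast
  interpret lq_opt S M \<omega> b R kd C \<epsilon> uh CW E \<kappa>
  proof unfold_locales
    show "E t (J' z) = k t z" if "0 < t" for t z
      using E[OF that] Bstar_eq_k[OF Bb, of t z] that by simp
  qed (use eps uh_ctl uh_var CW W_ex E \<kappa> RstarR in auto)
  have \<Phi>_eq: "opt_state D S B uhat t x = \<Phi> x t" for t x
    unfolding opt_state_def D \<Phi>_def uh_def by (rule state_eq[OF Bb min(1)])
  have T_int: "T_integrand D S B R \<epsilon> uhat x = (\<lambda>t. E t (RR (\<Phi> x t)))" for x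
    by (simp add: fun_eq_iff T_integrand_def \<Phi>_eq E_def)
  have T_eq: "T_op D S B R \<epsilon> uhat = Top" by (simp add: fun_eq_iff T_op_def T_int Top_def)
  have P_eq: "P_op D S B R uhat = Pop" by (simp add: fun_eq_iff P_op_def \<Phi>_eq Pop_def)
  have BP_weak: "BstarP D S B R \<epsilon> uhat x = Top x" if "x \<in> frac_dom S \<epsilon>" for x
    using weak_lim_E_Pop[OF that] by (simp add: BstarP_def P_eq E_def)
  \<comment> \<open>Sums and multiples stay in the domain, where \<open>BstarP\<close> agrees with
    \<open>Top\<close>, so linearity and the bound carry over.\<close>
  have BP_bounded: "bounded_op (frac_dom S \<epsilon>) (graph_norm (frac_pow S \<epsilon>)) UNIV norm (BstarP D S B R \<epsilon> uhat)"
    using Top_bounded_op unfolding bounded_op_def clinear_on_def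
    by (simp add: BP_weak csubspace_set_add[OF csubspace_frac_dom] csubspace_set_scaleC[OF csubspace_frac_dom])
  show ?thesis
    unfolding D_def[symmetric] \<Phi>_eq T_int T_eq P_eq
    using integrand_integrable(2) Top_bounded_op Pop_dom E_Pop_tendsto BP_weak BP_bounded RR_\<Phi>_dom
    by (simp add: E_def)
qed

end
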